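(* Let $R$ be a complete discrete valuation ring with valuation $v$, fraction field $K$, and perfect residue field $k$ of characteristic $p>0$. Let $E/K$ be an elliptic curve with potentially good reduction and with a $K$-rational isogeny of prime degree $\ell>3$, where $\ell\neq p$. Let $\Delta_{E/K}$ be the discriminant of a minimal Weierstrass equation for $E/K$. Then $12$ divides $(\ell-1)\,v(\Delta_{E/K})$. *)

theory Defs
  imports
    "HOL-Algebra.Algebraic_Closure_Type"
    "HOL-Algebra.Embedded_Algebras"
    "HOL-Algebra.Generated_Fields"
    "HOL-Algebra.QuotRing"
    "HOL-Computational_Algebra.Fraction_Field"
    "HOL-Computational_Algebra.Polynomial"
    "HOL-Computational_Algebra.Primes"
begin

section \<open>Discrete valuation rings\<close>

text \<open>
  Valuations live on a subfield \<open>F\<close> of an ambient field type, so that the same notions apply to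
  \<open>K\<close> (with \<open>F = UNIV\<close>) and to finite extensions of \<open>K\<close> inside its algebraic closure.  The value
  \<open>v 0\<close>, which ought to be infinite, is left unspecified and is never used.
\<close>

definition discrete_valuation :: "'a::field set \<Rightarrow> ('a \<Rightarrow> int) \<Rightarrow> bool" where
  "discrete_valuation F v \<longleftrightarrow>
     subfield F ring_of_type_algebra \<and>
     (\<forall>x\<in>F - {0}. \<forall>y\<in>F - {0}. v (x * y) = v x + v y) \<and>
     (\<forall>x\<in>F - {0}. \<forall>y\<in>F - {0}. x + y \<noteq> 0 \<longrightarrow> min (v x) (v y) \<le> v (x + y)) \<and>
     v ` (F - {0}) = UNIV"

definition valuation_ring :: "'a::field set \<Rightarrow> ('a \<Rightarrow> int) \<Rightarrow> 'a set" where
  "valuation_ring F v = {x \<in> F. x = 0 \<or> 0 \<le> v x}"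

definition valuation_ideal :: "'a::field set \<Rightarrow> ('a \<Rightarrow> int) \<Rightarrow> 'a set" where
  "valuation_ideal F v = {x \<in> F. x = 0 \<or> 0 < v x}"

text \<open>\<open>R\<close> is a discrete valuation ring with normalised valuation \<open>v\<close> and fraction field \<open>F\<close>.\<close>

definition is_dvr :: "'a::field set \<Rightarrow> 'a set \<Rightarrow> ('a \<Rightarrow> int) \<Rightarrow> bool" where
  "is_dvr F R v \<longleftrightarrow> discrete_valuation F v \<and> R = valuation_ring F v"

text \<open>\<open>x\<close> and \<open>y\<close> are congruent modulo the \<open>N\<close>-th power of the maximal ideal.\<close>

definition val_close :: "('a::field \<Rightarrow> int) \<Rightarrow> nat \<Rightarrow> 'a \<Rightarrow> 'a \<Rightarrow> bool" where
  "val_close v N x y \<longleftrightarrow> x = y \<or> int N \<le> v (x - y)"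

definition is_complete :: "'a::field set \<Rightarrow> ('a \<Rightarrow> int) \<Rightarrow> bool" where
  "is_complete R v \<longleftrightarrow>
     (\<forall>s :: nat \<Rightarrow> 'a. range s \<subseteq> R \<and> (\<forall>N. \<exists>M. \<forall>m\<ge>M. \<forall>n\<ge>M. val_close v N (s m) (s n)) \<longrightarrow>
        (\<exists>x\<in>R. \<forall>N. \<exists>M. \<forall>n\<ge>M. val_close v N (s n) x))"

definition residue_field :: "'a::field set \<Rightarrow> ('a \<Rightarrow> int) \<Rightarrow> 'a set ring" where
  "residue_field R v = (ring_of_type_algebra\<lparr>carrier := R\<rparr>) Quot valuation_ideal R v"

definition has_characteristic :: "('a, 'b) ring_scheme \<Rightarrow> nat \<Rightarrow> bool" where
  "has_characteristic k p \<longleftrightarrow> (\<forall>n::nat. add_pow k n \<one>\<^bsub>k\<^esub> = \<zero>\<^bsub>k\<^esub> \<longleftrightarrow> p dvd n)"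

definition perfect_field :: "('a, 'b) ring_scheme \<Rightarrow> bool" where
  "perfect_field k \<longleftrightarrow>
     field k \<and>
     (\<forall>p. has_characteristic k p \<and> 0 < p \<longrightarrow> (\<forall>a\<in>carrier k. \<exists>b\<in>carrier k. b [^]\<^bsub>k\<^esub> p = a))"


section \<open>Weierstrass equations\<close>

text \<open>The equation \<open>y\<^sup>2 + a1 x y + a3 y = x\<^sup>3 + a2 x\<^sup>2 + a4 x + a6\<close>.\<close>

datatype 'a weierstrass = Weierstrass (a1: 'a) (a2: 'a) (a3: 'a) (a4: 'a) (a6: 'a)

definition discriminant :: "'a::field weierstrass \<Rightarrow> 'a" where
  "discriminant W =
    (let b2 = a1 W ^ 2 + 4 * a2 W;
         b4 = a1 W * a3 W + 2 * a4 W;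
         b6 = a3 W ^ 2 + 4 * a6 W;
         b8 = a1 W ^ 2 * a6 W + 4 * a2 W * a6 W - a1 W * a3 W * a4 W + a2 W * a3 W ^ 2 - a4 W ^ 2
     in - (b2 ^ 2 * b8) - 8 * b4 ^ 3 - 27 * b6 ^ 2 + 9 * b2 * b4 * b6)"

text \<open>Every elliptic curve over a field is given by a nonsingular Weierstrass equation.\<close>

definition elliptic_curve :: "'a::field weierstrass \<Rightarrow> bool" where
  "elliptic_curve E \<longleftrightarrow> discriminant E \<noteq> 0"

text \<open>The homogenised equation, in projective coordinates; the origin is \<open>(0, 1, 0)\<close>.\<close>

definition on_curve :: "'a::field weierstrass \<Rightarrow> 'a \<times> 'a \<times> 'a \<Rightarrow> bool" where
  "on_curve W = (\<lambda>(x, y, z).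
     y ^ 2 * z + a1 W * x * y * z + a3 W * y * z ^ 2 =
     x ^ 3 + a2 W * x ^ 2 * z + a4 W * x * z ^ 2 + a6 W * z ^ 3)"

text \<open>
  \<open>W'\<close> arises from \<open>W\<close> by the substitution \<open>x = u\<^sup>2 x' + r\<close>, \<open>y = u\<^sup>3 y' + u\<^sup>2 s x' + t\<close>
  (and division by \<open>u\<^sup>6\<close>); these are the isomorphisms over \<open>F\<close> of elliptic curves in Weierstrass form.
\<close>

definition weierstrass_change ::
    "'a::field \<Rightarrow> 'a \<Rightarrow> 'a \<Rightarrow> 'a \<Rightarrow> 'a weierstrass \<Rightarrow> 'a weierstrass \<Rightarrow> bool" where
  "weierstrass_change u r s t W W' \<longleftrightarrow>
     u \<noteq> 0 \<and>
     u * a1 W' = a1 W + 2 * s \<and>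
     u ^ 2 * a2 W' = a2 W - s * a1 W + 3 * r - s ^ 2 \<and>
     u ^ 3 * a3 W' = a3 W + r * a1 W + 2 * t \<and>
     u ^ 4 * a4 W' = a4 W - s * a3 W + 2 * r * a2 W - (t + r * s) * a1 W + 3 * r ^ 2 - 2 * s * t \<and>
     u ^ 6 * a6 W' = a6 W + r * a4 W + r ^ 2 * a2 W + r ^ 3 - t * a3 W - t ^ 2 - r * t * a1 W"

definition isomorphic_over :: "'a::field set \<Rightarrow> 'a weierstrass \<Rightarrow> 'a weierstrass \<Rightarrow> bool" where
  "isomorphic_over F W W' \<longleftrightarrow> (\<exists>u\<in>F. \<exists>r\<in>F. \<exists>s\<in>F. \<exists>t\<in>F. weierstrass_change u r s t W W')"

definition integral_equation ::
    "'a::field set \<Rightarrow> ('a \<Rightarrow> int) \<Rightarrow> 'a weierstrass \<Rightarrow> 'a weierstrass \<Rightarrow> bool" where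
  "integral_equation F v E W \<longleftrightarrow> isomorphic_over F E W \<and> set_weierstrass W \<subseteq> valuation_ring F v"

definition minimal_equation ::
    "'a::field set \<Rightarrow> ('a \<Rightarrow> int) \<Rightarrow> 'a weierstrass \<Rightarrow> 'a weierstrass \<Rightarrow> bool" where
  "minimal_equation F v E W \<longleftrightarrow>
     integral_equation F v E W \<and>
     (\<forall>W'. integral_equation F v E W' \<longrightarrow> v (discriminant W) \<le> v (discriminant W'))"


section \<open>Good and potentially good reduction\<close>

text \<open>
  The reduction of a minimal equation is an elliptic curve over the residue field iff the residue
  class of its discriminant is nonzero.
\<close>

definition good_reduction :: "'a::field set \<Rightarrow> ('a \<Rightarrow> int) \<Rightarrow> 'a weierstrass \<Rightarrow> bool" where
  "good_reduction F v E \<longleftrightarrow>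
     (\<exists>W. minimal_equation F v E W \<and> discriminant W \<notin> valuation_ideal F v)"

text \<open>
  \<open>L\<close> runs over the finite extensions of \<open>K\<close> inside the algebraic closure, and \<open>w\<close> is the normalised
  valuation of \<open>L\<close> that extends \<open>v\<close>, with ramification index \<open>e\<close>.
\<close>

definition potentially_good_reduction :: "('a::field \<Rightarrow> int) \<Rightarrow> 'a weierstrass \<Rightarrow> bool" where
  "potentially_good_reduction v E \<longleftrightarrow>
     (\<exists>(L :: 'a alg_closure set) w n e.
        subfield L ring_of_type_algebra \<and>
        range to_ac \<subseteq> L \<and>
        ring.dimension ring_of_type_algebra n (range to_ac) L \<and>
        discrete_valuation L w \<and>
        0 < e \<and> (\<forall>x. x \<noteq> 0 \<longrightarrow> w (to_ac x) = e * v x) \<and>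
        good_reduction L w (map_weierstrass to_ac E))"


section \<open>Isogenies\<close>

text \<open>
  The function field \<open>K(E)\<close> is realised inside the algebraic closure of the rational function field
  \<open>K(x)\<close>, as \<open>K(x, y)\<close> for a root \<open>y\<close> of the Weierstrass equation; thus \<open>(x, y)\<close> is the generic point
  of \<open>E\<close>.  The two possible choices of \<open>y\<close> are conjugate over \<open>K(x)\<close>.
\<close>

type_synonym 'a func = "'a poly fract alg_closure"

definition const_func :: "'a::field \<Rightarrow> 'a func" where
  "const_func c = to_ac (Fract [:c:] 1)"

definition x_func :: "'a::field func" where
  "x_func = to_ac (Fract [:0, 1:] 1)"

definition generic_y :: "'a::field weierstrass \<Rightarrow> 'a func \<Rightarrow> bool" where
  "generic_y E y \<longleftrightarrow> on_curve (map_weierstrass const_func E) (x_func, y, 1)"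

definition adjoin_consts :: "'a::field func set \<Rightarrow> 'a func set" where
  "adjoin_consts S = generate_field ring_of_type_algebra (range const_func \<union> S)"

text \<open>
  The value at \<open>(x, y, z)\<close> of the form of degree \<open>d\<close> with coefficient \<open>c i j\<close> at
  \<open>x\<^sup>i y\<^sup>j z\<^sup>d\<^sup>-\<^sup>i\<^sup>-\<^sup>j\<close>, the coefficients being mapped by the embedding \<open>h\<close>.
\<close>

definition form_value ::
    "('a \<Rightarrow> 'b::field) \<Rightarrow> nat \<Rightarrow> (nat \<Rightarrow> nat \<Rightarrow> 'a) \<Rightarrow> 'b \<times> 'b \<times> 'b \<Rightarrow> 'b" where
  "form_value h d c = (\<lambda>(x, y, z). \<Sum>i\<le>d. \<Sum>j\<le>d - i. h (c i j) * x ^ i * y ^ j * z ^ (d - i - j))"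

text \<open>
  A rational map over \<open>K\<close> from \<open>E\<close> into an affine Weierstrass curve is a pair \<open>(f, g)\<close> of elements of
  \<open>K(E)\<close>, that is \<open>[f : g : 1]\<close> in homogeneous coordinates.  It is regular at a geometric point \<open>P\<close>,
  with value \<open>Q\<close>, if \<open>[f : g : 1] = [F0 : F1 : F2]\<close> on \<open>E\<close> for forms \<open>F0\<close>, \<open>F1\<close>, \<open>F2\<close> of the same
  degree that do not all vanish at \<open>P\<close>, and \<open>Q = (F0 P, F1 P, F2 P)\<close>.
\<close>

definition regular_value ::
    "'a::field func \<Rightarrow> 'a func \<Rightarrow> 'a func \<Rightarrow>
      'a alg_closure \<times> 'a alg_closure \<times> 'a alg_closure \<Rightarrow>
      'a alg_closure \<times> 'a alg_closure \<times> 'a alg_closure \<Rightarrow> bool" where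
  "regular_value y f g P Q \<longleftrightarrow>
     (\<exists>d F0 F1 F2.
        form_value const_func d F2 (x_func, y, 1) \<noteq> 0 \<and>
        form_value const_func d F0 (x_func, y, 1) = form_value const_func d F2 (x_func, y, 1) * f \<and>
        form_value const_func d F1 (x_func, y, 1) = form_value const_func d F2 (x_func, y, 1) * g \<and>
        Q = (form_value to_ac d F0 P, form_value to_ac d F1 P, form_value to_ac d F2 P) \<and>
        Q \<noteq> (0, 0, 0))"

text \<open>
  An isogeny over \<open>K\<close> is a nonconstant morphism over \<open>K\<close> taking the origin to the origin.  Being
  nonconstant, it maps the generic point of \<open>E\<close> to an affine point \<open>(f, g)\<close> of \<open>E'\<close>.
\<close>

definition isogeny ::
    "'a::field weierstrass \<Rightarrow> 'a weierstrass \<Rightarrow> 'a func \<Rightarrow> 'a func \<Rightarrow> 'a func \<Rightarrow> bool" where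
  "isogeny E E' y f g \<longleftrightarrow>
     elliptic_curve E \<and> elliptic_curve E' \<and> generic_y E y \<and>
     f \<in> adjoin_consts {x_func, y} \<and> g \<in> adjoin_consts {x_func, y} \<and>
     on_curve (map_weierstrass const_func E') (f, g, 1) \<and>
     \<not> (f \<in> range const_func \<and> g \<in> range const_func) \<and>
     (\<forall>P. P \<noteq> (0, 0, 0) \<and> on_curve (map_weierstrass to_ac E) P \<longrightarrow> (\<exists>Q. regular_value y f g P Q)) \<and>
     (\<exists>q. regular_value y f g (0, 1, 0) (0, q, 0))"

text \<open>The degree is that of \<open>K(E)\<close> over the pullback \<open>K(f, g)\<close> of \<open>K(E')\<close>.\<close>

definition has_rational_isogeny :: "'a::field weierstrass \<Rightarrow> nat \<Rightarrow> bool" where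
  "has_rational_isogeny E n \<longleftrightarrow>
     (\<exists>E' y f g. isogeny E E' y f g \<and>
        ring.dimension ring_of_type_algebra n (adjoin_consts {f, g}) (adjoin_consts {x_func, y}))"

end

(*
  Write the isogeny phi as (x, y) |-> (f, g), f = N / D with deg N = l and g = (A + B y) / H.  Over the extension L a
  change of coordinates with scaling factor u turns E into a curve with good reduction, on which the points of the
  kernel have order prime to the residue characteristic.  Hence the values of the 2- and 3-division polynomials of that
  curve at the roots of D are units, and for E itself they are u^6 and u^8 times units.  The product of the 3-division
  polynomial over the l - 1 roots of D and that of the 2-division polynomial over the 3 (l - 1) / 2 roots of H are
  symmetric, hence in K, and their valuations, compared with that of the discriminant, u^12 times a unit, show that 3
  and 4 divide (l - 1) v(Delta).

  The kernel is not available as a group.  Translation by a point P over a root of D is studied on the generic fibre of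
  f: the chord through P and a point of the fibre meets the fibre again, because the norm of the line to the functions
  on E' is a square.  All orbits of this translation on the fibre have the same length, so it has order l, and reducing
  it modulo the maximal ideal of a Gauss extension rules out that P reduces to the origin or to a point of order 2 or 3.
  That f is a function of x alone follows from the fact that a curve of genus 1 has no nonconstant points over K(x).
*)
theory Submission
  imports Defs
begin

section \<open>Valuation rings\<close>

text \<open>The constants come out as follows. A value \<open>u ^ 8\<close> times a unit at
  \<open>l - 1\<close> roots gives 3 v(r3) = 2 (l - 1) v(Delta), hence the factor 3; a value
  \<open>u ^ 6\<close> times a unit at 3 (l - 1) / 2 roots gives 4 v(r2) = 3 (l - 1) v(Delta), hence
  the factor 4. The roots of D would give only a factor 2 here. H does better because D and H are,
  up to constants, the square and the cube of one polynomial j. The roots of D may lie outside L, in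
  an extension with unknown ramification. So all comparisons take place in a valuation ring V of the
  whole algebraic closure that lies above that of w; only units and non-units of V are
  distinguished, and resultants bring the products back to K. The residue characteristic may be 2 or
  3, so squares are never completed: the curve stays in the form y^2 + psi y = cubic, and
  nonsingularity enters through the partial derivatives. A fibre point over the generic point is
  transcendental over the constants. Hence its chords with a constant point P are never degenerate,
  all fibre points satisfy the same equations, and the closed orbit of one of them stands in for the
  relation that l P is the origin.\<close>

definition coeffs_in :: "'f::comm_ring_1 set \<Rightarrow> 'f poly \<Rightarrow> bool" where
  "coeffs_in A p \<longleftrightarrow> (\<forall>i. coeff p i \<in> A)"

text \<open>Subrings are plain subsets of a type: valuation rings, fields of constants and function
  fields have to live inside one algebraically closed field and be compared there.\<close>

locale subring_set =
  fixes A :: "'f::comm_ring_1 set"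
  assumes one_in: "1 \<in> A"
    and diff_in: "x \<in> A \<Longrightarrow> y \<in> A \<Longrightarrow> x - y \<in> A"
    and mult_in: "x \<in> A \<Longrightarrow> y \<in> A \<Longrightarrow> x * y \<in> A"
begin

lemma zero_in: "0 \<in> A" using diff_in[OF one_in one_in] by simp

lemma uminus_in: "x \<in> A \<Longrightarrow> - x \<in> A" using diff_in[OF zero_in, of x] by simp

lemma add_in: "x \<in> A \<Longrightarrow> y \<in> A \<Longrightarrow> x + y \<in> A"
  using diff_in[OF _ uminus_in, of x y] by simp

lemma power_in: "x \<in> A \<Longrightarrow> x ^ n \<in> A"
  by (induction n) (auto intro: one_in mult_in)

lemma of_nat_in: "of_nat n \<in> A"
  by (induction n) (auto intro: one_in zero_in add_in)

lemma numeral_in: "numeral n \<in> A"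
  using of_nat_in[of "numeral n"] by simp

lemma sum_in: "(\<And>i. i \<in> S \<Longrightarrow> f i \<in> A) \<Longrightarrow> sum f S \<in> A"
  by (induction S rule: infinite_finite_induct) (auto intro: zero_in add_in)

lemma prod_mset_in: "(\<And>i. i \<in># S \<Longrightarrow> f i \<in> A) \<Longrightarrow> prod_mset (image_mset f S) \<in> A"
  by (induction S) (auto intro: one_in mult_in)

lemmas closed = zero_in one_in uminus_in add_in diff_in mult_in power_in numeral_in of_nat_in

lemma poly_in: "coeffs_in A p \<Longrightarrow> x \<in> A \<Longrightarrow> poly p x \<in> A"
  unfolding poly_altdef coeffs_in_def by (auto intro: sum_in mult_in power_in)

end

locale ideal_set = subring_set A for A :: "'f::comm_ring_1 set" +
  fixes I :: "'f set"
  assumes I_sub: "I \<subseteq> A"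
    and I_zero: "0 \<in> I"
    and I_add: "x \<in> I \<Longrightarrow> y \<in> I \<Longrightarrow> x + y \<in> I"
    and I_mult: "x \<in> A \<Longrightarrow> y \<in> I \<Longrightarrow> x * y \<in> I"
begin

lemma I_sum: "(\<And>i. i \<in> S \<Longrightarrow> f i \<in> I) \<Longrightarrow> sum f S \<in> I"
  by (induction S rule: infinite_finite_induct) (auto intro: I_zero I_add)

lemma I_uminus: "x \<in> I \<Longrightarrow> - x \<in> I"
  using I_mult[OF uminus_in[OF one_in], of x] by simp

lemma I_diff: "x \<in> I \<Longrightarrow> y \<in> I \<Longrightarrow> x - y \<in> I"
  using I_add[OF _ I_uminus, of x y] by simp

lemma I_mult': "y \<in> I \<Longrightarrow> x \<in> A \<Longrightarrow> y * x \<in> I"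
  using I_mult[of x y] by (simp add: mult.commute)

lemma I_power: "x \<in> I \<Longrightarrow> n > 0 \<Longrightarrow> x ^ n \<in> I"
  by (cases n) (auto intro!: I_mult' power_in dest: subsetD[OF I_sub])

lemma coeffs_in_mult_I: "coeffs_in A p \<Longrightarrow> coeffs_in I q \<Longrightarrow> coeffs_in I (p * q)"
  unfolding coeffs_in_def coeff_mult by (auto intro!: I_sum I_mult)

end

text \<open>The ideal need not be proper, so closure of \<open>coeffs_in A\<close> under products is
  the case \<open>I = A\<close> of the statement for ideals.\<close>

lemma (in subring_set) ideal_set_self: "ideal_set A A"
  by unfold_locales (auto intro: closed)

lemma (in subring_set) coeffs_in_mult: "coeffs_in A p \<Longrightarrow> coeffs_in A q \<Longrightarrow> coeffs_in A (p * q)"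
  by (rule ideal_set.coeffs_in_mult_I[OF ideal_set_self])

lemma (in subring_set) coeffs_in_diff: "coeffs_in A p \<Longrightarrow> coeffs_in A q \<Longrightarrow> coeffs_in A (p - q)"
  unfolding coeffs_in_def by (auto intro: diff_in)

lemma (in subring_set) coeffs_in_add: "coeffs_in A p \<Longrightarrow> coeffs_in A q \<Longrightarrow> coeffs_in A (p + q)"
  unfolding coeffs_in_def by (auto intro: add_in)

lemma (in subring_set) coeffs_in_smult: "a \<in> A \<Longrightarrow> coeffs_in A q \<Longrightarrow> coeffs_in A (smult a q)"
  unfolding coeffs_in_def by (auto intro: mult_in)

lemma (in subring_set) coeffs_in_const: "a \<in> A \<Longrightarrow> coeffs_in A [:a:]"
  unfolding coeffs_in_def by (auto simp: coeff_pCons intro: zero_in split: nat.split)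

text \<open>No value group is carried along: the arguments only ask whether an element is integral,
  a unit or in \<open>mx\<close>, and the dichotomy between \<open>x\<close> and
  \<open>inverse x\<close> answers that.\<close>

locale valuation_ring_set = subring_set V for V :: "'f::field set" +
  assumes total: "x \<in> V \<or> inverse x \<in> V"
begin

text \<open>The clause \<open>x = 0\<close> stands apart because \<open>inverse 0 = 0\<close> lies
  in \<open>V\<close>.\<close>

definition "mx = {x \<in> V. x = 0 \<or> inverse x \<notin> V}"

lemma mx_sub: "mx \<subseteq> V" by (auto simp: mx_def)

lemma mx_one: "1 \<notin> mx" using one_in by (auto simp: mx_def)

lemma mx_mult: assumes "x \<in> V" "y \<in> mx" shows "x * y \<in> mx"
proof (cases "x * y = 0")
  case True then show ?thesis by (auto simp: mx_def zero_in)
next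
  case False
  then have eq: "x * inverse (x * y) = inverse y" by simp
  have "inverse (x * y) \<notin> V"
    using mult_in[OF assms(1), of "inverse (x * y)", unfolded eq] assms(2) False by (auto simp: mx_def)
  then show ?thesis using assms by (auto simp: mx_def intro: mult_in)
qed

lemma mx_add: assumes "x \<in> mx" "y \<in> mx" shows "x + y \<in> mx"
proof -
  have *: "x + y \<in> mx" if "x \<in> mx" "y \<in> mx" "x / y \<in> V" "y \<noteq> 0" for x y
  proof -
    have "x + y = (x / y + 1) * y" using that by (simp add: field_simps)
    then show ?thesis using that mx_mult[of "x/y+1" y] by (auto intro: closed)
  qed
  show ?thesis
  proof (cases "x = 0 \<or> y = 0")
    case True then show ?thesis using assms by auto
  next
    case False
    then show ?thesis using *[of x y] *[of y x] total[of "x/y"] assms by (auto simp: add.commute)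
  qed
qed

sublocale mx: ideal_set V mx
  by unfold_locales (simp_all add: mx_sub mx_add mx_mult, simp add: mx_def zero_in)

lemma not_in_imp: "x \<notin> V \<Longrightarrow> inverse x \<in> mx"
  using total[of x] by (auto simp: mx_def zero_in)

lemma unit_iff: "x \<in> V \<Longrightarrow> x \<notin> mx \<longleftrightarrow> x \<noteq> 0 \<and> inverse x \<in> V"
  by (auto simp: mx_def)

lemma mx_prime: assumes "x \<in> V" "y \<in> V" "x * y \<in> mx" shows "x \<in> mx \<or> y \<in> mx"
proof (rule ccontr)
  assume "\<not> ?thesis"
  then have "x \<noteq> 0" "y \<noteq> 0" "inverse x \<in> V" "inverse y \<in> V" using assms by (auto simp: unit_iff)
  then have "inverse (x * y) \<in> V" "x * y \<noteq> 0" by (auto intro: mult_in)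
  then show False using assms by (auto simp: mx_def)
qed

lemma mx_power: assumes "x \<in> V" "x ^ n \<in> mx" shows "x \<in> mx"
  using assms(2) by (induction n) (use assms(1) mx_one mx_prime in \<open>auto intro: power_in\<close>)

text \<open>Otherwise \<open>inverse x\<close> lies in \<open>mx\<close>, and dividing the monic
  equation by the top power of \<open>x\<close> writes \<open>- 1\<close> as an element of
  \<open>mx\<close>.\<close>

lemma integrally_closed:
  assumes p: "coeffs_in V p" "lead_coeff p = 1" "poly p x = 0"
  shows "x \<in> V"
proof (rule ccontr)
  assume x: "x \<notin> V"
  define n where "n = degree p"
  have x0: "x \<noteq> 0" using x zero_in by auto
  have ix: "inverse x \<in> mx" using x by (rule not_in_imp)
  have "0 = poly p x" using p by simp
  also have "poly p x = (\<Sum>i<n. coeff p i * x ^ i) + x ^ n"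
    using p(2) unfolding poly_altdef n_def by (subst lessThan_Suc_atMost[symmetric], subst sum.lessThan_Suc) simp
  finally have "(\<Sum>i<n. coeff p i * x ^ i) * inverse x ^ n = - 1"
    using x0 by (simp add: eq_neg_iff_add_eq_0 add.commute field_simps)
  moreover have "(\<Sum>i<n. coeff p i * x ^ i) * inverse x ^ n = (\<Sum>i<n. coeff p i * inverse x ^ (n - i))"
    unfolding sum_distrib_right
    by (rule sum.cong) (auto simp: x0 power_diff field_simps)
  moreover have "(\<Sum>i<n. coeff p i * inverse x ^ (n - i)) \<in> mx"
    using p(1) ix by (intro mx.I_sum mx.I_mult mx.I_power) (auto simp: coeffs_in_def)
  ultimately show False using mx.I_uminus mx_one by force
qed

end

text \<open>The degree reduction behind Chevalley's theorem. The relation for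
  \<open>inverse x\<close>, turned into one for \<open>x\<close>, has top coefficient
  \<open>1 - k\<close> with \<open>k\<close> in \<open>J\<close>, and cancels the top term of
  \<open>(1 - k) p\<close>. Adding \<open>k\<close> restores the value 1, so \<open>1 - k\<close>
  never has to be inverted.\<close>

lemma chevalley_step:
  fixes x :: "'f::field"
  assumes "ideal_set B J" "m \<le> n" "0 < n"
    and p: "degree p \<le> n" "coeffs_in J p" "poly p x = 1"
    and q: "degree q \<le> m" "coeffs_in J q" "poly q (inverse x) = 1" "x \<noteq> 0"
  shows "\<exists>p. degree p \<le> n - 1 \<and> coeffs_in J p \<and> poly p x = 1"
proof -
  interpret ideal_set B J by fact
  define k where "k = coeff q 0"
  \<comment> \<open>This is \<open>x ^ m * (1 - q (1 / x))\<close> written as a polynomial in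
    \<open>x\<close>.\<close>
  define Q where "Q = monom 1 m - (\<Sum>i\<le>m. monom (coeff q i) (m - i))"
  have Jc: "coeff q i \<in> J" "coeff p i \<in> J" for i using p q by (auto simp: coeffs_in_def)
  then have Bc: "coeff q i \<in> B" "coeff p i \<in> B" for i using I_sub by blast+
  have cQ: "coeff (\<Sum>i\<le>m. monom (coeff q i) (m - i)) j = (if j \<le> m then coeff q (m - j) else 0)" for j
  proof -
    have "coeff (\<Sum>i\<le>m. monom (coeff q i) (m - i)) j = (\<Sum>i\<le>m. if m - i = j then coeff q i else 0)"
      by (simp add: coeff_sum)
    also have "\<dots> = (\<Sum>i\<in>(if j \<le> m then {m - j} else {}). coeff q i)"
      by (rule sum.mono_neutral_cong_right) (auto split: if_splits)
    finally show ?thesis by (simp split: if_splits)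
  qed
  have "poly Q x = x ^ m - (\<Sum>i\<le>m. coeff q i * x ^ (m - i))"
    by (simp add: Q_def poly_monom poly_sum)
  also have "(\<Sum>i\<le>m. coeff q i * x ^ (m - i)) = x ^ m * (\<Sum>i\<le>m. coeff q i * inverse x ^ i)"
    unfolding sum_distrib_left by (rule sum.cong) (auto simp: q(4) power_diff field_simps)
  also have "(\<Sum>i\<le>m. coeff q i * inverse x ^ i) = poly q (inverse x)"
    unfolding poly_altdef by (rule sum.mono_neutral_right) (use q(1) in \<open>auto simp: coeff_eq_0\<close>)
  finally have Qx: "poly Q x = 0" by (simp add: q)
  define r where "r = smult (1 - k) p - monom (coeff p n) (n - m) * Q + [:k:]"
  have cr: "coeff r j = (1 - k) * coeff p j - (if n - m \<le> j then coeff p n * coeff Q (j - (n - m)) else 0) + (if j = 0 then k else 0)" for j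
    by (auto simp: r_def coeff_monom_mult coeff_pCons split: nat.split)
  have cQ': "coeff Q j = (if j = m then 1 - k else if j \<le> m then - coeff q (m - j) else 0)" for j
    by (auto simp: Q_def cQ k_def)
  have QB: "coeff Q j \<in> B" for j
    unfolding cQ' by (auto intro!: closed Bc simp: k_def)
  have "poly r x = 1" by (simp add: r_def p Qx)
  moreover have "coeffs_in J r"
    unfolding coeffs_in_def cr
    by (intro allI I_add I_diff, intro I_mult diff_in one_in Jc)
       (auto intro: I_zero I_mult' Jc QB Bc simp: k_def)
  moreover have "degree r \<le> n - 1"
  proof (rule degree_le, intro allI impI)
    fix j assume j: "n - 1 < j"
    show "coeff r j = 0"
    proof (cases "j = n")
      case True then show ?thesis using assms(2,3) unfolding cr by (auto simp: cQ')
    next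
      case False
      then have "j > n" using j assms(3) by auto
      then show ?thesis using assms(2,3) p(1) unfolding cr by (auto simp: cQ' coeff_eq_0)
    qed
  qed
  ultimately show ?thesis by blast
qed

text \<open>The pair \<open>(B[x], J B[x])\<close> is the enlargement that the maximality of
  \<open>(B, J)\<close> has to exclude.\<close>

lemma adjoin_ideal_set:
  assumes "ideal_set B J"
  shows "ideal_set {poly p x | p. coeffs_in B p} {poly p (x::'f::field) | p. coeffs_in J p}"
proof -
  interpret ideal_set B J by fact
  show ?thesis
  proof
    show "1 \<in> {poly p x | p. coeffs_in B p}"
      by (rule CollectI, rule exI[of _ 1]) (auto simp: coeffs_in_def coeff_1 intro: closed)
    show "0 \<in> {poly p x | p. coeffs_in J p}"
      by (rule CollectI, rule exI[of _ 0]) (auto simp: coeffs_in_def I_zero)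
    show "{poly p x | p. coeffs_in J p} \<subseteq> {poly p x | p. coeffs_in B p}"
      using I_sub by (auto simp: coeffs_in_def)
  next
    fix a b assume "a \<in> {poly p x | p. coeffs_in B p}" "b \<in> {poly p x | p. coeffs_in B p}"
    then obtain p q where *: "a = poly p x" "b = poly q x" "coeffs_in B p" "coeffs_in B q" by auto
    show "a - b \<in> {poly p x | p. coeffs_in B p}"
      by (rule CollectI, rule exI[of _ "p - q"]) (use * coeffs_in_diff in auto)
    show "a * b \<in> {poly p x | p. coeffs_in B p}"
      by (rule CollectI, rule exI[of _ "p * q"]) (use * coeffs_in_mult in auto)
  next
    fix a b assume "a \<in> {poly p x | p. coeffs_in J p}" "b \<in> {poly p x | p. coeffs_in J p}"
    then obtain p q where *: "a = poly p x" "b = poly q x" "coeffs_in J p" "coeffs_in J q" by auto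
    show "a + b \<in> {poly p x | p. coeffs_in J p}"
      by (rule CollectI, rule exI[of _ "p + q"]) (use * in \<open>auto simp: coeffs_in_def intro: I_add\<close>)
  next
    fix a b assume "a \<in> {poly p x | p. coeffs_in B p}" "b \<in> {poly p x | p. coeffs_in J p}"
    then obtain p q where *: "a = poly p x" "b = poly q x" "coeffs_in B p" "coeffs_in J q" by auto
    show "a * b \<in> {poly p x | p. coeffs_in J p}"
      by (rule CollectI, rule exI[of _ "p * q"]) (use * coeffs_in_mult_I in auto)
  qed
qed

text \<open>Chevalley's extension theorem; a pair \<open>(B, J)\<close> is encoded as the set \<open>B \<times> {True} \<union> J \<times> {False}\<close>.\<close>

lemma chevalley:
  fixes A :: "'f::field set"
  assumes AI: "ideal_set A I" and one: "1 \<notin> I"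
  obtains V where "valuation_ring_set V" "A \<subseteq> V" "I \<subseteq> valuation_ring_set.mx V"
proof -
  define ring_part where "ring_part = (\<lambda>S :: ('f \<times> bool) set. {b. (b, True) \<in> S})"
  define ideal_part where "ideal_part = (\<lambda>S :: ('f \<times> bool) set. {b. (b, False) \<in> S})"
  define Z where "Z = {S. ideal_set (ring_part S) (ideal_part S) \<and> A \<subseteq> ring_part S \<and> I \<subseteq> ideal_part S \<and> 1 \<notin> ideal_part S}"
  define mk where "mk = (\<lambda>B J. (B \<times> {True} \<union> J \<times> {False}) :: ('f \<times> bool) set)"
  have mk: "ring_part (mk B J) = B" "ideal_part (mk B J) = J" for B J
    by (auto simp: mk_def ring_part_def ideal_part_def)
  have start: "mk A I \<in> Z" using AI one by (auto simp: Z_def mk)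
  have "\<exists>M\<in>Z. \<forall>S\<in>Z. M \<subseteq> S \<longrightarrow> S = M"
  proof (rule subset_Zorn)
    fix C assume C: "subset.chain Z C"
    show "\<exists>U\<in>Z. \<forall>S\<in>C. S \<subseteq> U"
    proof (cases "C = {}")
      case True then show ?thesis using start by auto
    next
      case False
      have CA: "S \<in> Z" if "S \<in> C" for S using C that by (auto simp: subset.chain_def)
      have lin: "S \<subseteq> S' \<or> S' \<subseteq> S" if "S \<in> C" "S' \<in> C" for S S'
        using C that by (auto simp: subset_chain_def)
      have two: "\<exists>S\<in>C. u \<in> S \<and> v \<in> S" if "u \<in> \<Union>C" "v \<in> \<Union>C" for u v
        using that lin by (meson UnionE subsetD)
      have ids: "ideal_set (ring_part S) (ideal_part S)" if "S \<in> C" for S using CA[OF that] by (simp add: Z_def)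
      have "ideal_set (ring_part (\<Union>C)) (ideal_part (\<Union>C))"
      proof
        obtain S where S: "S \<in> C" using False by auto
        interpret ideal_set "ring_part S" "ideal_part S" by (rule ids[OF S])
        show "1 \<in> ring_part (\<Union>C)" "0 \<in> ideal_part (\<Union>C)"
          using one_in I_zero S by (auto simp: ring_part_def ideal_part_def)
      next
        show "ideal_part (\<Union>C) \<subseteq> ring_part (\<Union>C)"
          using ideal_set.I_sub[OF ids] by (fastforce simp: ring_part_def ideal_part_def)
      next
        fix x y assume "x \<in> ring_part (\<Union>C)" "y \<in> ring_part (\<Union>C)"
        then obtain S where S: "S \<in> C" "x \<in> ring_part S" "y \<in> ring_part S"
          using two[of "(x,True)" "(y,True)"] by (auto simp: ring_part_def)
        interpret ideal_set "ring_part S" "ideal_part S" by (rule ids[OF S(1)])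
        show "x - y \<in> ring_part (\<Union>C)" "x * y \<in> ring_part (\<Union>C)"
          using S diff_in[of x y] mult_in[of x y] by (auto simp: ring_part_def)
      next
        fix x y assume "x \<in> ideal_part (\<Union>C)" "y \<in> ideal_part (\<Union>C)"
        then obtain S where S: "S \<in> C" "x \<in> ideal_part S" "y \<in> ideal_part S"
          using two[of "(x,False)" "(y,False)"] by (auto simp: ideal_part_def)
        interpret ideal_set "ring_part S" "ideal_part S" by (rule ids[OF S(1)])
        show "x + y \<in> ideal_part (\<Union>C)"
          using S I_add[of x y] by (auto simp: ideal_part_def)
      next
        fix x y assume "x \<in> ring_part (\<Union>C)" "y \<in> ideal_part (\<Union>C)"
        then obtain S where S: "S \<in> C" "x \<in> ring_part S" "y \<in> ideal_part S"
          using two[of "(x,True)" "(y,False)"] by (auto simp: ideal_part_def ring_part_def)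
        interpret ideal_set "ring_part S" "ideal_part S" by (rule ids[OF S(1)])
        show "x * y \<in> ideal_part (\<Union>C)"
          using S I_mult[of x y] by (auto simp: ideal_part_def)
      qed
      moreover have "A \<subseteq> ring_part (\<Union>C)" "I \<subseteq> ideal_part (\<Union>C)"
        using False CA by (auto simp: Z_def ring_part_def ideal_part_def subset_eq)
      moreover have "1 \<notin> ideal_part (\<Union>C)"
        using CA by (auto simp: Z_def ideal_part_def)
      ultimately have "\<Union>C \<in> Z" by (simp add: Z_def)
      then show ?thesis by auto
    qed
  qed
  then obtain M where M: "M \<in> Z" "\<And>S. S \<in> Z \<Longrightarrow> M \<subseteq> S \<Longrightarrow> S = M" by auto
  define B J where "B = ring_part M" and "J = ideal_part M"
  have BJ: "ideal_set B J" "A \<subseteq> B" "I \<subseteq> J" "1 \<notin> J"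
    using M(1) by (auto simp: Z_def B_def J_def)
  interpret ideal_set B J by (rule BJ)
  have max: "B' = B \<and> J' = J" if "ideal_set B' J'" "B \<subseteq> B'" "J \<subseteq> J'" "1 \<notin> J'" for B' J'
  proof -
    have "mk B' J' \<in> Z" using that BJ by (auto simp: Z_def mk)
    moreover have "M \<subseteq> mk B' J'"
    proof
      fix u assume u: "u \<in> M"
      obtain b t where [simp]: "u = (b, t)" by force
      show "u \<in> mk B' J'" using that(2,3) u
        by (cases t) (auto simp: mk_def B_def J_def ring_part_def ideal_part_def)
    qed
    ultimately have "mk B' J' = M" by (rule M(2))
    then show ?thesis by (metis mk B_def J_def)
  qed
  \<comment> \<open>Otherwise \<open>(B[x], J B[x])\<close> would be an admissible pair, and
    maximality would put \<open>x\<close> into \<open>B\<close>.\<close>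
  have ext: "\<exists>p. coeffs_in J p \<and> poly p x = 1" if "x \<notin> B" for x
  proof (rule ccontr)
    assume no: "\<not> ?thesis"
    let ?B = "{poly p x | p. coeffs_in B p}" and ?J = "{poly p x | p. coeffs_in J p}"
    have c: "b \<in> B \<Longrightarrow> coeffs_in B [:b:]" "b \<in> J \<Longrightarrow> coeffs_in J [:b:]" for b
      by (auto simp: coeffs_in_def coeff_pCons zero_in I_zero split: nat.split)
    have "?B = B \<and> ?J = J"
    proof (rule max)
      show "ideal_set ?B ?J" by (rule adjoin_ideal_set) fact
      show "B \<subseteq> ?B" "J \<subseteq> ?J"
        using c by (force intro: exI[of _ "[:_:]"])+
      show "1 \<notin> ?J" using no by force
    qed
    moreover have "coeffs_in B [:0,1:]"
      by (auto simp: coeffs_in_def coeff_pCons zero_in one_in split: nat.split)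
    then have "x \<in> ?B" by (auto intro!: exI[of _ "[:0,1:]"])
    ultimately show False using that by auto
  qed
  have total: "x \<in> B \<or> inverse x \<in> B" for x
  proof (rule ccontr)
    assume "\<not> ?thesis"
    then have nx: "x \<notin> B" "inverse x \<notin> B" by auto
    then have x0: "x \<noteq> 0" using zero_in by auto
    \<comment> \<open>Relations of least degree for \<open>x\<close> and for
      \<open>inverse x\<close>: the step lemma lowers the larger of the two degrees, which is
      absurd.\<close>
    define P where "P = (\<lambda>x n. \<exists>p. degree p \<le> n \<and> coeffs_in J p \<and> poly p x = (1::'f))"
    have exP: "\<exists>n. P y n" if "y \<notin> B" for y using ext[OF that] by (auto simp: P_def)
    define n m where "n = (LEAST n. P x n)" and "m = (LEAST n. P (inverse x) n)"
    have nm: "P x n" "P (inverse x) m"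
      unfolding n_def m_def using exP nx by (meson LeastI_ex)+
    have pos: "\<not> P y 0" for y
      using BJ(4) by (auto simp: P_def coeffs_in_def elim!: degree_eq_zeroE) (metis coeff_pCons_0)
    have n0: "n > 0" "m > 0" using nm pos by (metis neq0_conv)+
    obtain p where p: "degree p \<le> n" "coeffs_in J p" "poly p x = 1" using nm by (auto simp: P_def)
    obtain q where q: "degree q \<le> m" "coeffs_in J q" "poly q (inverse x) = 1" using nm by (auto simp: P_def)
    show False
    proof (cases "m \<le> n")
      case True
      have "P x (n - 1)" unfolding P_def
        by (rule chevalley_step[OF BJ(1) True n0(1) p q x0])
      then have "n \<le> n - 1" unfolding n_def by (rule Least_le)
      then show False using n0 by simp
    next
      case False
      have "P (inverse x) (m - 1)" unfolding P_def
        by (rule chevalley_step[OF BJ(1) _ n0(2) q p(1,2)]) (use False p x0 in auto)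
      then have "m \<le> m - 1" unfolding m_def by (rule Least_le)
      then show False using n0 by simp
    qed
  qed
  interpret V: valuation_ring_set B by unfold_locales (rule total)
  have "j \<in> V.mx" if "j \<in> J" for j
  proof -
    have "j \<noteq> 0 \<Longrightarrow> inverse j \<in> B \<Longrightarrow> False"
      using I_mult[of "inverse j" j] that BJ(4) by simp
    then show ?thesis using that I_sub by (auto simp: V.mx_def)
  qed
  then show ?thesis using that[of B] BJ V.valuation_ring_set_axioms by blast
qed

section \<open>Weierstrass equations\<close>

definition b2 :: "'f::comm_ring_1 weierstrass \<Rightarrow> 'f" where "b2 W = a1 W ^ 2 + 4 * a2 W"
definition b4 :: "'f::comm_ring_1 weierstrass \<Rightarrow> 'f" where "b4 W = a1 W * a3 W + 2 * a4 W"
definition b6 :: "'f::comm_ring_1 weierstrass \<Rightarrow> 'f" where "b6 W = a3 W ^ 2 + 4 * a6 W"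
definition b8 :: "'f::comm_ring_1 weierstrass \<Rightarrow> 'f" where
  "b8 W = a1 W ^ 2 * a6 W + 4 * a2 W * a6 W - a1 W * a3 W * a4 W + a2 W * a3 W ^ 2 - a4 W ^ 2"

definition psi :: "'f::comm_ring_1 weierstrass \<Rightarrow> 'f poly" where "psi W = [:a3 W, a1 W:]"
definition cubic :: "'f::comm_ring_1 weierstrass \<Rightarrow> 'f poly" where "cubic W = [:a6 W, a4 W, a2 W, 1:]"
definition on_affine :: "'f::comm_ring_1 weierstrass \<Rightarrow> 'f \<Rightarrow> 'f \<Rightarrow> bool" where
  "on_affine W x y \<longleftrightarrow> y^2 + poly (psi W) x * y = poly (cubic W) x"

text \<open>The 2- and 3-division polynomials.\<close>

definition div2 :: "'f::comm_ring_1 weierstrass \<Rightarrow> 'f poly" where "div2 W = [:b6 W, 2 * b4 W, b2 W, 4:]"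
definition div3 :: "'f::comm_ring_1 weierstrass \<Rightarrow> 'f poly" where
  "div3 W = [:b8 W, 3 * b6 W, 3 * b4 W, b2 W, 3:]"

lemma poly_psi: "poly (psi W) x = a1 W * x + a3 W"
  by (simp add: psi_def)

lemma poly_cubic: "poly (cubic W) x = x^3 + a2 W * x^2 + a4 W * x + a6 W"
  by (simp add: cubic_def algebra_simps power2_eq_square power3_eq_cube)

lemma poly_div2: "poly (div2 W) x = 4 * x^3 + b2 W * x^2 + 2 * b4 W * x + b6 W"
  by (simp add: div2_def algebra_simps power2_eq_square power3_eq_cube)

lemma poly_div3: "poly (div3 W) x = 3 * x^4 + b2 W * x^3 + 3 * b4 W * x^2 + 3 * b6 W * x + b8 W"
  by (simp add: div3_def algebra_simps power2_eq_square power3_eq_cube power4_eq_xxxx)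

lemma div2_psi: "div2 W = psi W ^ 2 + 4 * cubic (W :: 'f::field weierstrass)"
  by (simp add: div2_def psi_def cubic_def b2_def b4_def b6_def power2_eq_square algebra_simps numeral_poly)

lemma div2_square:
  fixes W :: "'f::field weierstrass"
  assumes "on_affine W x y"
  shows "(2 * y + poly (psi W) x)^2 = poly (div2 W) x"
proof -
  have "(2 * y + poly (psi W) x)^2 = poly (psi W) x ^ 2 + 4 * (y^2 + poly (psi W) x * y)"
    by Groebner_Basis.algebra
  then show ?thesis unfolding assms[unfolded on_affine_def] div2_psi by simp
qed

lemma discriminant_b:
  "discriminant W = - (b2 W ^ 2 * b8 W) - 8 * b4 W ^ 3 - 27 * b6 W ^ 2 + 9 * b2 W * b4 W * b6 W"
  by (simp add: discriminant_def Let_def b2_def b4_def b6_def b8_def)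

text \<open>The equation and its two partial derivatives are solved for \<open>a3\<close>,
  \<open>a4\<close>, \<open>a6\<close>. Then \<open>b4\<close>, \<open>b6\<close>, \<open>b8\<close>
  depend only on \<open>x\<close> and \<open>b2\<close>, and the discriminant cancels identically,
  in every characteristic.\<close>

lemma singular_imp_discriminant_0:
  fixes W :: "'f::field weierstrass"
  assumes "on_affine W x y" "2 * y + poly (psi W) x = 0" "a1 W * y - 3 * x^2 - 2 * a2 W * x - a4 W = 0"
  shows "discriminant W = 0"
proof -
  have e3: "a3 W = - 2 * y - a1 W * x" using assms(2) unfolding poly_psi by Groebner_Basis.algebra
  have e4: "a4 W = a1 W * y - 3 * x^2 - 2 * a2 W * x" using assms(3) by Groebner_Basis.algebra
  have e6: "a6 W = y^2 + a1 W * x * y + (- 2 * y - a1 W * x) * y - x^3 - a2 W * x^2 - (a1 W * y - 3 * x^2 - 2 * a2 W * x) * x"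
    using assms(1) unfolding on_affine_def poly_psi poly_cubic e3 e4 by Groebner_Basis.algebra
  have 4: "b4 W = - (x * b2 W) - 6 * x^2" unfolding b4_def b2_def e3 e4 by Groebner_Basis.algebra
  have 6: "b6 W = x^2 * b2 W + 8 * x^3" unfolding b6_def b2_def e3 e6 by Groebner_Basis.algebra
  have 8: "b8 W = - (x^3 * b2 W) - 9 * x^4" unfolding b8_def b2_def e3 e4 e6 by Groebner_Basis.algebra
  show ?thesis unfolding discriminant_b 4 6 8 by Groebner_Basis.algebra
qed

text \<open>The weighted form with \<open>x = n / h^2\<close> and \<open>y = a / h^3\<close>, meant
  for the numerators and denominators of an isogeny; it includes the point at infinity
  \<open>h = 0\<close>.\<close>

lemma singular_imp_discriminant_0_homogeneous:
  fixes W :: "'f::field weierstrass"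
  assumes W: "discriminant W \<noteq> 0"
    and eq: "a^2 + h * (a1 W * n + a3 W * h^2) * a = n^3 + a2 W * n^2 * h^2 + a4 W * n * h^4 + a6 W * h^6"
    and dy: "2 * a + a1 W * n * h + a3 W * h^3 = 0"
    and dx: "a1 W * a * h - 3 * n^2 - 2 * a2 W * n * h^2 - a4 W * h^4 = 0"
  shows "n = 0" "a = 0" "h = 0"
proof -
  show h: "h = 0"
  proof (rule ccontr)
    assume h: "h \<noteq> 0"
    define x y where "x = n / h^2" and "y = a / h^3"
    have n: "n = x * h^2" and a: "a = y * h^3" using h by (auto simp: x_def y_def)
    have "h^6 * (y^2 + poly (psi W) x * y - poly (cubic W) x) = 0"
      using eq unfolding n a poly_psi poly_cubic by Groebner_Basis.algebra
    then have 1: "on_affine W x y" using h by (simp add: on_affine_def)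
    have "h^3 * (2 * y + poly (psi W) x) = 0" using dy unfolding n a poly_psi by Groebner_Basis.algebra
    then have 2: "2 * y + poly (psi W) x = 0" using h by simp
    have "h^4 * (a1 W * y - 3 * x^2 - 2 * a2 W * x - a4 W) = 0" using dx unfolding n a by Groebner_Basis.algebra
    then have 3: "a1 W * y - 3 * x^2 - 2 * a2 W * x - a4 W = 0" using h by simp
    show False using singular_imp_discriminant_0[OF 1 2 3] W by simp
  qed
  \<comment> \<open>At infinity nonsingularity comes down to 2 and 3 not both being zero in a
    field.\<close>
  have e: "a^2 = n^3" "2 * a = 0" "3 * n^2 = 0" using eq dy dx unfolding h by auto
  show a: "a = 0"
  proof (rule ccontr)
    assume a: "a \<noteq> 0"
    then have "n \<noteq> 0" using e by auto
    then have "(3::'f) = 0" "(2::'f) = 0" using e a by auto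
    then have "(3::'f) - 2 = 0" by (simp only:) simp
    then show False by simp
  qed
  show "n = 0" using e(1) unfolding a by simp
qed

lemma change_b:
  fixes W :: "'f::field weierstrass"
  assumes "weierstrass_change u r s t W W'"
  shows "u^2 * b2 W' = b2 W + 12 * r"
   "u^4 * b4 W' = b4 W + r * b2 W + 6 * r^2"
   "u^6 * b6 W' = b6 W + 2 * r * b4 W + r^2 * b2 W + 4 * r^3"
   "u^8 * b8 W' = b8 W + 3 * r * b6 W + 3 * r^2 * b4 W + r^3 * b2 W + 3 * r^4"
proof -
  note c = assms[unfolded weierstrass_change_def]
  have "u^2 * b2 W' = (u * a1 W')^2 + 4 * (u^2 * a2 W')" unfolding b2_def by Groebner_Basis.algebra
  also have "\<dots> = b2 W + 12 * r" by (simp only: c b2_def) Groebner_Basis.algebra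
  finally show "u^2 * b2 W' = b2 W + 12 * r" .
  have "u^4 * b4 W' = (u * a1 W') * (u^3 * a3 W') + 2 * (u^4 * a4 W')" unfolding b4_def by Groebner_Basis.algebra
  also have "\<dots> = b4 W + r * b2 W + 6 * r^2" by (simp only: c b4_def b2_def) Groebner_Basis.algebra
  finally show "u^4 * b4 W' = b4 W + r * b2 W + 6 * r^2" .
  have "u^6 * b6 W' = (u^3 * a3 W')^2 + 4 * (u^6 * a6 W')" unfolding b6_def by Groebner_Basis.algebra
  also have "\<dots> = b6 W + 2 * r * b4 W + r^2 * b2 W + 4 * r^3" by (simp only: c b6_def b4_def b2_def) Groebner_Basis.algebra
  finally show "u^6 * b6 W' = b6 W + 2 * r * b4 W + r^2 * b2 W + 4 * r^3" .
  have "u^8 * b8 W' = (u * a1 W')^2 * (u^6 * a6 W') + 4 * (u^2 * a2 W') * (u^6 * a6 W')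
     - (u * a1 W') * (u^3 * a3 W') * (u^4 * a4 W') + (u^2 * a2 W') * (u^3 * a3 W') ^ 2 - (u^4 * a4 W')^2"
    unfolding b8_def by Groebner_Basis.algebra
  also have "\<dots> = b8 W + 3 * r * b6 W + 3 * r^2 * b4 W + r^3 * b2 W + 3 * r^4"
    by (simp only: c b8_def b6_def b4_def b2_def) Groebner_Basis.algebra
  finally show "u^8 * b8 W' = b8 W + 3 * r * b6 W + 3 * r^2 * b4 W + r^3 * b2 W + 3 * r^4" .
qed

lemma change_discriminant:
  fixes W :: "'f::field weierstrass"
  assumes "weierstrass_change u r s t W W'"
  shows "u^12 * discriminant W' = discriminant W"
proof -
  \<comment> \<open>The relation between the \<open>b\<close> coefficients, without which the two
    sides of the discriminant formula do not match.\<close>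
  have q: "4 * b8 W = b2 W * b6 W - b4 W ^ 2" unfolding b8_def b6_def b4_def b2_def by Groebner_Basis.algebra
  have "u^12 * discriminant W' = - ((u^2 * b2 W') ^ 2 * (u^8 * b8 W')) - 8 * (u^4 * b4 W') ^ 3 - 27 * (u^6 * b6 W') ^ 2 + 9 * (u^2 * b2 W') * (u^4 * b4 W') * (u^6 * b6 W')"
    unfolding discriminant_b by Groebner_Basis.algebra
  also have "\<dots> = discriminant W" unfolding change_b[OF assms] discriminant_b using q by Groebner_Basis.algebra
  finally show ?thesis .
qed

text \<open>\<open>div2\<close> has weight 6 and \<open>div3\<close> weight 8; the final count sets
  these exponents of \<open>u\<close> against the 12 of the discriminant.\<close>

lemma change_div2:
  fixes W :: "'f::field weierstrass"
  assumes "weierstrass_change u r s t W W'"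
  shows "poly (div2 W) (u^2 * x + r) = u^6 * poly (div2 W') x"
proof -
  have "u^6 * poly (div2 W') x = 4 * (u^2*x)^3 + (u^2 * b2 W') * (u^2*x)^2 + 2 * (u^4 * b4 W') * (u^2*x) + u^6 * b6 W'"
    unfolding poly_div2 by Groebner_Basis.algebra
  also have "\<dots> = poly (div2 W) (u^2 * x + r)"
    unfolding change_b[OF assms] poly_div2 by Groebner_Basis.algebra
  finally show ?thesis by simp
qed

lemma change_div3:
  fixes W :: "'f::field weierstrass"
  assumes "weierstrass_change u r s t W W'"
  shows "poly (div3 W) (u^2 * x + r) = u^8 * poly (div3 W') x"
proof -
  have "u^8 * poly (div3 W') x = 3 * (u^2*x)^4 + (u^2 * b2 W') * (u^2*x)^3 + 3 * (u^4 * b4 W') * (u^2*x)^2 + 3 * (u^6 * b6 W') * (u^2 * x) + u^8 * b8 W'"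
    unfolding poly_div3 by Groebner_Basis.algebra
  also have "\<dots> = poly (div3 W) (u^2 * x + r)"
    unfolding change_b[OF assms] poly_div3 by Groebner_Basis.algebra
  finally show ?thesis by simp
qed

section \<open>Symmetric functions of the roots of a polynomial\<close>

lemma proots_split:
  fixes p :: "'f::alg_closed_field poly"
  assumes "p \<noteq> 0"
  shows "p = smult (lead_coeff p) (\<Prod>x\<in>#proots p. [:-x, 1:])" "size (proots p) = degree p"
proof -
  obtain A where A: "size A = degree p" "p = smult (lead_coeff p) (\<Prod>x\<in>#A. [:-x, 1:])"
    using alg_closed_imp_factorization[OF assms] by blast
  have nz: "0 \<notin># {#[:-x, 1:]. x \<in># B#}" for B :: "'f multiset" by auto
  have "proots (\<Prod>x\<in>#B. [:-x, 1:]) = B" for B :: "'f multiset"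
  proof (induction B)
    case (add x B)
    have "(\<Prod>x\<in>#B. [:-x, 1:]) \<noteq> 0" using nz by (simp add: prod_mset_zero_iff)
    then show ?case using add by (simp add: proots_mult del: mult_pCons_left)
  qed auto
  then have "proots p = A" using assms by (subst A(2)) simp
  then show "p = smult (lead_coeff p) (\<Prod>x\<in>#proots p. [:-x, 1:])" "size (proots p) = degree p" using A by auto
qed

lemma poly_split:
  fixes p :: "'f::alg_closed_field poly"
  assumes "p \<noteq> 0"
  shows "poly p z = lead_coeff p * (\<Prod>x\<in>#proots p. z - x)"
proof -
  have "poly (\<Prod>x\<in>#A. [:-x, 1:]) z = (\<Prod>x\<in>#A. z - x)" for A
    by (induction A) (auto simp: algebra_simps)
  then show ?thesis by (subst proots_split(1)[OF assms]) simp
qed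

text \<open>Up to a power of the leading coefficient of \<open>p\<close>, this is the resultant of
  \<open>p\<close> and \<open>R\<close>.\<close>

definition rootprod :: "'f::field poly \<Rightarrow> 'f poly \<Rightarrow> 'f" where
  "rootprod p R = (\<Prod>z\<in>#proots p. poly R z)"

lemma double_prod_swap:
  fixes A B :: "'f::comm_ring_1 multiset"
  shows "(\<Prod>z\<in>#A. \<Prod>w\<in>#B. (z - w)) = (-1)^(size A * size B) * (\<Prod>w\<in>#B. \<Prod>z\<in>#A. (w - z))"
proof (induction A)
  case (add a A)
  have *: "(\<Prod>w\<in>#B. a - w) = (-1)^size B * (\<Prod>w\<in>#B. w - a)"
    by (induction B) (auto simp: algebra_simps)
  show ?case by (simp add: add * prod_mset.distrib power_add mult_ac)
qed simp

text \<open>Reciprocity of the resultant: both sides are, up to sign, the same double product of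
  differences of roots.\<close>

lemma rootprod_swap:
  fixes p R :: "'f::alg_closed_field poly"
  assumes "p \<noteq> 0" "R \<noteq> 0"
  shows "lead_coeff p ^ degree R * rootprod p R =
    (-1)^(degree p * degree R) * lead_coeff R ^ degree p * rootprod R p"
proof -
  have c: "(\<Prod>z\<in>#A. c * f z) = c ^ size A * (\<Prod>z\<in>#A. f z)" for c and f :: "'f \<Rightarrow> 'f" and A
    by (induction A) (auto simp: mult_ac)
  have 1: "rootprod p R = lead_coeff R ^ degree p * (\<Prod>z\<in>#proots p. \<Prod>w\<in>#proots R. z - w)" 
    unfolding rootprod_def poly_split[OF assms(2)] c proots_split(2)[OF assms(1)] ..
  have 2: "rootprod R p = lead_coeff p ^ degree R * (\<Prod>w\<in>#proots R. \<Prod>z\<in>#proots p. w - z)" 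
    unfolding rootprod_def poly_split[OF assms(1)] c proots_split(2)[OF assms(2)] ..
  have 3: "(\<Prod>z\<in>#proots p. \<Prod>w\<in>#proots R. z - w) =
      (-1)^(degree p * degree R) * (\<Prod>w\<in>#proots R. \<Prod>z\<in>#proots p. w - z)"
    using double_prod_swap[where A = "proots p" and B = "proots R"]
    unfolding proots_split(2)[OF assms(1)] proots_split(2)[OF assms(2)] .
  show ?thesis unfolding 1 2 3 by (simp only: mult_ac)
qed

text \<open>Two instances matter: with \<open>\<theta> = id\<close> symmetric functions of roots are
  shown to lie in \<open>K\<close>, and with the conjugation of a function field their conjugates
  are computed. The map only has to be a homomorphism on \<open>K\<close>.\<close>

locale subfield_hom = subring_set K for K :: "'f::alg_closed_field set" +
  fixes \<theta> :: "'f \<Rightarrow> 'f"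
  assumes inv_in: "x \<in> K \<Longrightarrow> inverse x \<in> K"
    and hom_diff: "x \<in> K \<Longrightarrow> y \<in> K \<Longrightarrow> \<theta> (x - y) = \<theta> x - \<theta> y"
    and hom_mult: "x \<in> K \<Longrightarrow> y \<in> K \<Longrightarrow> \<theta> (x * y) = \<theta> x * \<theta> y"
    and hom_one: "\<theta> 1 = 1"
begin

lemma hom_zero: "\<theta> 0 = 0" using hom_diff[OF one_in one_in] by simp

lemma hom_uminus: "x \<in> K \<Longrightarrow> \<theta> (- x) = - \<theta> x"
  using hom_diff[OF zero_in, of x] by (simp add: hom_zero)

lemma hom_power: "x \<in> K \<Longrightarrow> \<theta> (x ^ n) = \<theta> x ^ n"
  by (induction n) (auto simp: hom_one hom_mult power_in)

lemma hom_eq_0: "x \<in> K \<Longrightarrow> \<theta> x = 0 \<longleftrightarrow> x = 0"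
  using hom_mult[of x "inverse x"] inv_in[of x] by (cases "x = 0") (auto simp: hom_zero hom_one)

lemma coeff_map: "coeff (map_poly \<theta> p) i = \<theta> (coeff p i)"
  by (simp add: coeff_map_poly hom_zero)

lemma degree_map: "coeffs_in K p \<Longrightarrow> degree (map_poly \<theta> p) = degree p"
  by (cases "p = 0") (auto intro!: map_poly_degree_eq simp: hom_eq_0 coeffs_in_def)

lemma map_eq_0: "coeffs_in K p \<Longrightarrow> map_poly \<theta> p = 0 \<longleftrightarrow> p = 0"
  by (auto simp: poly_eq_iff coeff_map hom_eq_0 coeffs_in_def)

text \<open>The Euclidean algorithm takes the place of the theorem on symmetric functions:
  \<open>R\<close> may be reduced modulo \<open>p\<close> without changing the product, and
  reciprocity exchanges the two. Each operation stays in \<open>K\<close> and commutes with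
  \<open>\<theta>\<close>.\<close>

lemma rootprod_hom:
  assumes "p \<noteq> 0" "coeffs_in K p" "coeffs_in K R"
  shows "rootprod p R \<in> K \<and> \<theta> (rootprod p R) = rootprod (map_poly \<theta> p) (map_poly \<theta> R)"
  using assms
\<comment> \<open>The weight 2 makes the measure drop also when \<open>p\<close> and
  \<open>R\<close> are exchanged, which happens for \<open>degree R < degree p\<close>.\<close>
proof (induction "2 * degree p + degree R" arbitrary: p R rule: less_induct)
  case less
  have Kp: "coeff p i \<in> K" and KR: "coeff R i \<in> K" for i using less.prems by (auto simp: coeffs_in_def)
  have mp: "map_poly \<theta> p \<noteq> 0" using less.prems map_eq_0 by auto
  have dp: "degree (map_poly \<theta> p) = degree p" "degree (map_poly \<theta> R) = degree R"
    using less.prems degree_map by auto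
  show ?case
  proof (cases "degree p = 0")
    case True
    then have "proots p = {#}" "proots (map_poly \<theta> p) = {#}"
      using proots_split(2)[OF less.prems(1)] proots_split(2)[OF mp] dp by auto
    then show ?thesis by (simp add: rootprod_def one_in hom_one)
  next
    case False
    show ?thesis
    proof (cases "R = 0")
      case True
      have "rootprod p 0 = 0" "rootprod (map_poly \<theta> p) 0 = 0"
        using False proots_split(2)[OF less.prems(1)] proots_split(2)[OF mp] dp
        by (auto simp: rootprod_def)
      then show ?thesis by (simp add: True zero_in hom_zero)
    next
      case R: False
      show ?thesis
      proof (cases "degree p \<le> degree R")
        case True
        define k where "k = degree R - degree p"
        define c where "c = lead_coeff R * inverse (lead_coeff p)"
        define R' where "R' = R - monom c k * p"
        have cK: "c \<in> K" unfolding c_def by (intro mult_in inv_in Kp KR)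
        have cR': "coeff R' i = coeff R i - (if k \<le> i then c * coeff p (i - k) else 0)" for i
          by (auto simp: R'_def coeff_monom_mult)
        have R'K: "coeffs_in K R'" unfolding coeffs_in_def cR' by (auto intro!: diff_in mult_in KR Kp cK zero_in)
        have "degree R' < degree R"
        proof (rule degree_lessI)
          show "R' \<noteq> 0 \<or> 0 < degree R" using True False by auto
          show "\<forall>i\<ge>degree R. coeff R' i = 0"
          proof (intro allI impI)
            fix i assume i: "degree R \<le> i"
            show "coeff R' i = 0"
            proof (cases "i = degree R")
              case True
              have "i - k = degree p" "k \<le> i" using True \<open>degree p \<le> degree R\<close> by (auto simp: k_def)
              then show ?thesis using less.prems(1) by (simp add: cR' c_def True)
            next
              case False
              then have "i - k > degree p" using i \<open>degree p \<le> degree R\<close> by (auto simp: k_def)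
              then show ?thesis using False i by (simp add: cR' coeff_eq_0)
            qed
          qed
        qed
        then have IH: "rootprod p R' \<in> K \<and> \<theta> (rootprod p R') = rootprod (map_poly \<theta> p) (map_poly \<theta> R')"
          by (intro less.hyps less.prems R'K) auto
        have "poly R' z = poly R z" if "z \<in># proots p" for z
          using that less.prems(1) by (simp add: R'_def)
        then have 1: "rootprod p R' = rootprod p R" unfolding rootprod_def
          by (intro arg_cong[of _ _ prod_mset] image_mset_cong) auto
        have m: "map_poly \<theta> R' = map_poly \<theta> R - monom (\<theta> c) k * map_poly \<theta> p"
          by (rule poly_eqI) (auto simp: coeff_map cR' coeff_monom_mult hom_diff hom_mult KR Kp cK zero_in mult_in hom_zero)
        have "poly (map_poly \<theta> R') z = poly (map_poly \<theta> R) z" if "z \<in># proots (map_poly \<theta> p)" for z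
          using that mp by (simp add: m)
        then have 2: "rootprod (map_poly \<theta> p) (map_poly \<theta> R') = rootprod (map_poly \<theta> p) (map_poly \<theta> R)"
          unfolding rootprod_def by (intro arg_cong[of _ _ prod_mset] image_mset_cong) auto
        show ?thesis using IH unfolding 1 2 .
      next
        case lt: False
        have IH: "rootprod R p \<in> K \<and> \<theta> (rootprod R p) = rootprod (map_poly \<theta> R) (map_poly \<theta> p)"
          by (intro less.hyps less.prems R) (use lt in auto)
        define s where "s = (-1 :: 'f) ^ (degree p * degree R)"
        define u where "u = s * lead_coeff R ^ degree p * inverse (lead_coeff p ^ degree R)"
        have uK: "u \<in> K" unfolding u_def s_def by (intro mult_in inv_in power_in KR Kp uminus_in one_in)
        have lp: "lead_coeff p \<noteq> 0" using less.prems by simp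
        have mR: "map_poly \<theta> R \<noteq> 0" using R less.prems map_eq_0 by auto
        have 1: "rootprod p R = u * rootprod R p"
          using rootprod_swap[OF less.prems(1) R] lp by (simp add: u_def s_def field_simps)
        have ulp: "u * lead_coeff p ^ degree R = s * lead_coeff R ^ degree p" 
          using lp by (simp add: u_def)
        have "\<theta> u * \<theta> (lead_coeff p) ^ degree R = \<theta> (u * lead_coeff p ^ degree R)"
          by (simp add: hom_mult hom_power uK Kp power_in)
        also have "\<dots> = s * \<theta> (lead_coeff R) ^ degree p" unfolding ulp s_def
          by (simp add: hom_mult hom_power KR power_in uminus_in one_in hom_uminus hom_one)
        finally have u: "\<theta> u * \<theta> (lead_coeff p) ^ degree R = s * \<theta> (lead_coeff R) ^ degree p" .
        have "\<theta> (lead_coeff p) ^ degree R * rootprod (map_poly \<theta> p) (map_poly \<theta> R) =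
           s * \<theta> (lead_coeff R) ^ degree p * rootprod (map_poly \<theta> R) (map_poly \<theta> p)"
          using rootprod_swap[OF mp mR] by (simp add: dp coeff_map s_def)
        also have "\<dots> = \<theta> (lead_coeff p) ^ degree R * (\<theta> u * rootprod (map_poly \<theta> R) (map_poly \<theta> p))"
          using u by (simp add: mult_ac)
        finally have "rootprod (map_poly \<theta> p) (map_poly \<theta> R) = \<theta> u * rootprod (map_poly \<theta> R) (map_poly \<theta> p)"
          using lp hom_eq_0[OF Kp] by simp
        then show ?thesis using IH unfolding 1 by (simp add: mult_in uK hom_mult)
      qed
    qed
  qed
qed

end

section \<open>Normality of the coordinate ring of a nonsingular curve\<close>

text \<open>
  An element \<open>(p + q y) / b\<close> of the function field with integral trace and norm is integral; the
  denominator is removed root by root.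
\<close>

lemma normality:
  fixes W :: "'f::alg_closed_field weierstrass"
  assumes W: "discriminant W \<noteq> 0" and b: "b \<noteq> 0"
    and tr: "b dvd 2 * p - q * psi W" and nm: "b^2 dvd p^2 - p * q * psi W - q^2 * cubic W"
  shows "b dvd p \<and> b dvd q"
  using b tr nm
proof (induction "degree b" arbitrary: b p q rule: less_induct)
  case less
  show ?case
  proof (cases "degree b = 0")
    case True
    then have "is_unit b" using less.prems(1) is_unit_iff_degree by blast
    then show ?thesis by (simp add: unit_imp_dvd)
  next
    case False
    then obtain t where t: "poly b t = 0" using alg_closed_imp_poly_has_root[of b] by auto
    define l where "l = [:-t, 1:]"
    have l: "l dvd r \<longleftrightarrow> poly r t = 0" for r unfolding l_def by (simp add: poly_eq_0_iff_dvd)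
    have l0: "l \<noteq> 0" by (simp add: l_def)
    obtain b' where b': "b = l * b'" using t l by (metis dvdE)
    have b'0: "b' \<noteq> 0" using b' less.prems(1) by auto
    \<comment> \<open>A point of the curve above the root \<open>t\<close>; if \<open>q\<close> did
      not vanish at \<open>t\<close>, this point would be singular.\<close>
    obtain y where y: "y^2 + poly (psi W) t * y - poly (cubic W) t = 0"
      using alg_closed_imp_poly_has_root[of "[:- poly (cubic W) t, poly (psi W) t, 1:]"]
      by (auto simp: algebra_simps power2_eq_square)
    define N where "N = p^2 - p * q * psi W - q^2 * cubic W"
    define P where "P = p + smult y q"
    define A where "A = psi W + [:2 * y:]"
    define C where "C = [:y^2:] + smult y (psi W) - cubic W"
    have P_alt: "P = p + [:y:] * q" by (simp add: P_def)
    have C_alt: "C = [:y:]^2 + [:y:] * psi W - cubic W" by (simp add: C_def power2_eq_square)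
    have A_alt: "A = psi W + 2 * [:y:]" by (simp add: A_def numeral_poly)
    \<comment> \<open>The norm expanded at this point: \<open>P\<close> is the numerator with
      \<open>y\<close> frozen to its constant value, \<open>C\<close> the equation on the horizontal
      line through the point, \<open>A\<close> its derivative in \<open>y\<close>.\<close>
    have NP: "N = P^2 - P * q * A + q^2 * C"
      unfolding N_def P_alt C_alt A_alt by Groebner_Basis.algebra
    have TP: "2 * p - q * psi W = 2 * P - q * A"
      unfolding P_alt A_alt by Groebner_Basis.algebra
    have "l dvd 2 * P - q * A" using less.prems(2) unfolding TP b' by (rule dvd_mult_left)
    then have e1: "2 * poly P t = poly q t * poly A t" unfolding l by simp
    have "l^2 * b'^2 dvd N" using less.prems(3) unfolding N_def b' by (simp add: power_mult_distrib)
    then obtain N' where N': "N = l^2 * N'" by (metis dvd_mult_left dvdE)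
    have C0: "poly C t = 0" using y by (simp add: C_def algebra_simps)
    have "poly N t = 0" unfolding N' by (simp add: l_def)
    then have "poly P t ^ 2 - poly P t * (poly q t * poly A t) = 0" unfolding NP by (simp add: C0 algebra_simps)
    then have "- (poly P t ^ 2) = 0" unfolding e1[symmetric] by (simp add: power2_eq_square)
    then have P0: "poly P t = 0" by simp
    have qA: "poly q t * poly A t = 0" using e1 P0 by simp
    \<comment> \<open>The norm vanishes doubly at \<open>t\<close> because \<open>b^2\<close>
      divides it. With \<open>P\<close>, \<open>q * A\<close> and \<open>C\<close> zero there, its
      derivative reduces to \<open>q^2 * pderiv C\<close>.\<close>
    have "pderiv N = l * (2 * (pderiv l * N') + l * pderiv N')"
      unfolding N' power2_eq_square pderiv_mult by (simp add: algebra_simps)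
    then have "poly (pderiv N) t = 0" by (simp add: l_def)
    then have dN: "poly (pderiv (P^2 - P * q * A + q^2 * C)) t = 0" unfolding NP .
    have qC: "poly q t = 0 \<or> poly (pderiv C) t = 0"
    proof (cases "poly q t = 0")
      case False
      then have "poly A t = 0" using qA by simp
      then show ?thesis using dN P0 C0
        by (simp add: pderiv_mult pderiv_add pderiv_diff power2_eq_square)
    qed simp
    have "poly q t = 0"
    proof (rule ccontr)
      assume q: "poly q t \<noteq> 0"
      have "discriminant W = 0"
      proof (rule singular_imp_discriminant_0)
        show "on_affine W t y" using y by (simp add: on_affine_def)
        show "2 * y + poly (psi W) t = 0" using q qA by (simp add: A_def add.commute)
        have "poly (pderiv C) t = a1 W * y - 3 * t^2 - 2 * a2 W * t - a4 W"
          by (simp add: C_def psi_def cubic_def pderiv_pCons algebra_simps power2_eq_square)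
        then show "a1 W * y - 3 * t^2 - 2 * a2 W * t - a4 W = 0" using q qC by simp
      qed
      then show False using W by simp
    qed
    moreover from this have "poly p t = 0" using P0 by (simp add: P_def)
    ultimately obtain p' q' where pq: "p = l * p'" "q = l * q'" using l by (metis dvdE)
    have "b' dvd p' \<and> b' dvd q'"
    proof (rule less.hyps[OF _ b'0])
      show "degree b' < degree b" using b'0 l0 unfolding b' by (subst degree_mult_eq) (auto simp: l_def)
      have "l * b' dvd l * (2 * p' - q' * psi W)" using less.prems(2) unfolding b' pq by (simp add: algebra_simps)
      then show "b' dvd 2 * p' - q' * psi W" using l0 by simp
      have "l^2 * b'^2 dvd l^2 * (p'^2 - p' * q' * psi W - q'^2 * cubic W)"
        using less.prems(3) unfolding b' pq by (simp add: algebra_simps power2_eq_square)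
      then show "b'^2 dvd p'^2 - p' * q' * psi W - q'^2 * cubic W" using l0 by simp
    qed
    then show ?thesis unfolding b' pq by (auto intro: mult_dvd_mono)
  qed
qed

section \<open>Function fields\<close>

locale field_hom_map =
  fixes h :: "'a::field \<Rightarrow> 'b::field"
  assumes h_add: "h (x + y) = h x + h y" and h_mult: "h (x * y) = h x * h y" and h_1: "h 1 = 1"
begin

lemma h_0: "h 0 = 0"
proof -
  have "h 0 = h 0 + h 0" using h_add[of 0 0] by (simp only: add_0_left)
  then show ?thesis by (simp only: add_cancel_right_right)
qed
lemma h_uminus: "h (- x) = - h x" using h_add[of x "- x"] h_0 by (simp add: eq_neg_iff_add_eq_0 add.commute)
lemma h_diff: "h (x - y) = h x - h y" using h_add[of x "- y"] by (simp add: h_uminus)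
lemma h_eq_0: "h x = 0 \<longleftrightarrow> x = 0" using h_mult[of x "inverse x"] h_0 h_1 by (cases "x = 0") auto
lemma h_power: "h (x ^ n) = h x ^ n" by (induction n) (auto simp: h_1 h_mult)
lemma h_of_nat: "h (of_nat n) = of_nat n" by (induction n) (auto simp: h_0 h_1 h_add)
lemma h_numeral: "h (numeral n) = numeral n" using h_of_nat[of "numeral n"] by simp
lemma h_inverse: "h (inverse x) = inverse (h x)"
  using h_mult[of x "inverse x"] h_0 h_1 by (cases "x = 0") (auto intro: inverse_unique[symmetric])
lemma h_divide: "h (x / y) = h x / h y" by (simp add: divide_inverse h_mult h_inverse)
lemma h_sum: "h (sum f S) = (\<Sum>i\<in>S. h (f i))"
  by (induction S rule: infinite_finite_induct) (auto simp: h_0 h_add)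

lemmas hs = h_0 h_1 h_add h_mult h_uminus h_diff h_power h_numeral h_inverse h_divide

lemma coeff_mp: "coeff (map_poly h p) i = h (coeff p i)" by (simp add: coeff_map_poly h_0)

lemma mp_0: "map_poly h 0 = 0" by simp
lemma mp_1: "map_poly h 1 = 1" by (simp add: h_1)
lemma mp_add: "map_poly h (p + q) = map_poly h p + map_poly h q" by (rule poly_eqI) (simp add: coeff_mp h_add)
lemma mp_diff: "map_poly h (p - q) = map_poly h p - map_poly h q" by (rule poly_eqI) (simp add: coeff_mp h_diff)
lemma mp_uminus: "map_poly h (- p) = - map_poly h p" by (rule poly_eqI) (simp add: coeff_mp h_uminus)
lemma mp_smult: "map_poly h (smult c p) = smult (h c) (map_poly h p)" by (rule poly_eqI) (simp add: coeff_mp h_mult)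
lemma mp_mult: "map_poly h (p * q) = map_poly h p * map_poly h q"
  by (rule poly_eqI) (simp add: coeff_mp coeff_mult h_sum h_mult)
lemma mp_power: "map_poly h (p ^ n) = map_poly h p ^ n" by (induction n) (auto simp: mp_1 mp_mult h_1)
lemma mp_pCons: "map_poly h (pCons a p) = pCons (h a) (map_poly h p)"
  by (rule poly_eqI) (simp add: coeff_mp coeff_pCons split: nat.split)
lemma mp_numeral: "map_poly h (numeral n) = numeral n"
  by (simp add: numeral_poly mp_pCons h_numeral)

lemmas mps = mp_0 mp_1 mp_add mp_diff mp_uminus mp_smult mp_mult mp_power mp_pCons mp_numeral

lemma mp_eq_0: "map_poly h p = 0 \<longleftrightarrow> p = 0" by (simp add: poly_eq_iff coeff_mp h_eq_0)
lemma mp_eq: "map_poly h p = map_poly h q \<longleftrightarrow> p = q" using mp_eq_0[of "p - q"] by (simp add: mp_diff)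
lemma mp_degree: "degree (map_poly h p) = degree p"
  by (cases "p = 0") (auto intro!: map_poly_degree_eq simp: h_eq_0)
lemma poly_mp: "poly (map_poly h p) (h x) = h (poly p x)"
  by (induction p) (auto simp: mp_pCons h_add h_mult h_0)

lemma poly_mp': "poly (map_poly h p) x = (\<Sum>i\<le>degree p. h (coeff p i) * x ^ i)"
  by (simp add: poly_altdef mp_degree coeff_mp)

lemma mp_psi: "psi (map_weierstrass h W) = map_poly h (psi W)"
  by (cases W) (simp add: psi_def mp_pCons)
lemma mp_cubic: "cubic (map_weierstrass h W) = map_poly h (cubic W)"
  by (cases W) (simp add: cubic_def mp_pCons h_1)
lemma mp_b: "b2 (map_weierstrass h W) = h (b2 W)" "b4 (map_weierstrass h W) = h (b4 W)"
  "b6 (map_weierstrass h W) = h (b6 W)" "b8 (map_weierstrass h W) = h (b8 W)"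
  by (cases W; simp add: b2_def b4_def b6_def b8_def hs)+
lemma mp_div2: "div2 (map_weierstrass h W) = map_poly h (div2 W)"
  by (simp add: div2_def mp_pCons mp_b hs)
lemma mp_div3: "div3 (map_weierstrass h W) = map_poly h (div3 W)"
  by (simp add: div3_def mp_pCons mp_b hs)
lemma mp_discriminant: "discriminant (map_weierstrass h W) = h (discriminant W)"
  unfolding discriminant_b mp_b by (simp add: hs)
lemma map_on_affine: "on_affine W x y \<Longrightarrow> on_affine (map_weierstrass h W) (h x) (h y)"
  unfolding on_affine_def mp_psi mp_cubic poly_mp by (simp flip: hs)
lemma map_weierstrass_sel: "a1 (map_weierstrass h W) = h (a1 W)" "a2 (map_weierstrass h W) = h (a2 W)"
  "a3 (map_weierstrass h W) = h (a3 W)" "a4 (map_weierstrass h W) = h (a4 W)" "a6 (map_weierstrass h W) = h (a6 W)"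
  by (cases W; simp)+

end

text \<open>Polynomials as elements of the algebraic closure of \<open>K(x)\<close>: identities
  between polynomials are pulled back along \<open>ev\<close> after computing with
  divisions.\<close>

definition ev :: "'a::field poly \<Rightarrow> 'a func" where "ev p = to_ac (Fract p 1)"

lemma ev_add: "ev (p + q) = ev p + ev q" by (simp add: ev_def flip: to_ac_add)
lemma ev_mult: "ev (p * q) = ev p * ev q" by (simp add: ev_def flip: to_ac_mult)
lemma ev_uminus: "ev (- p) = - ev p" by (simp add: ev_def flip: to_ac_minus)
lemma ev_diff: "ev (p - q) = ev p - ev q" by (simp add: ev_def flip: to_ac_diff)
lemma ev_0: "ev 0 = 0" by (simp add: ev_def flip: Zero_fract_def)
lemma ev_1: "ev 1 = 1" by (simp add: ev_def flip: One_fract_def)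
lemma ev_power: "ev (p ^ n) = ev p ^ n" by (induction n) (auto simp: ev_1 ev_mult)
lemma ev_eq_0: "ev p = 0 \<longleftrightarrow> p = 0" by (simp add: ev_def Zero_fract_def eq_fract)
lemma ev_eq: "ev p = ev q \<longleftrightarrow> p = q" by (simp add: ev_def eq_fract)
lemma ev_const: "ev [:c:] = const_func c" by (simp add: ev_def const_func_def)
lemma ev_numeral: "ev (numeral n) = numeral n"
proof -
  have "ev (of_nat k) = of_nat k" for k by (induction k) (auto simp: ev_0 ev_1 ev_add)
  from this[of "numeral n"] show ?thesis by simp
qed

lemmas evs = ev_add ev_mult ev_uminus ev_diff ev_0 ev_1 ev_power ev_numeral

interpretation cf: field_hom_map "const_func :: 'a::field \<Rightarrow> 'a func"
proof
  fix x y :: 'a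
  have "[:x + y:] = [:x:] + [:y:]" "[:x * y:] = [:x:] * [:y:]" by auto
  then show "const_func (x + y) = const_func x + const_func y" "const_func (x * y) = const_func x * const_func y"
    by (simp_all only: ev_const[symmetric] evs)
  show "const_func (1 :: 'a) = 1" by (simp add: ev_const[symmetric] pCons_one ev_1)
qed

interpretation ac: field_hom_map "to_ac :: 'a::field \<Rightarrow> 'a alg_closure"
  by unfold_locales auto

abbreviation lift :: "'a::field poly \<Rightarrow> 'a func poly" where "lift p \<equiv> map_poly const_func p"

lemma poly_lift_x: "poly (lift p) x_func = ev p"
proof (induction p)
  case (pCons a p)
  have "pCons a p = [:a:] + [:0, 1:] * p" by simp
  then have "ev (pCons a p) = const_func a + x_func * ev p"
    by (simp only: evs ev_const x_func_def) (simp add: ev_def)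
  then show ?case using pCons by (simp add: cf.mp_pCons)
qed (simp add: ev_0)

text \<open>The field \<open>K(x)\<close> inside its algebraic closure.\<close>

definition RF :: "'a::field func set" where "RF = range to_ac"

lemma RF_cases: assumes "u \<in> RF" obtains p q where "q \<noteq> 0" "u = ev p / ev q"
proof -
  obtain f :: "'a poly fract" where "u = to_ac f" using assms by (auto simp: RF_def)
  then show ?thesis using that by (cases f) (auto simp: ev_def simp flip: to_ac_divide)
qed

lemma RF_common:
  assumes "u \<in> RF" "v \<in> RF" obtains p q b where "b \<noteq> 0" "u = ev p / ev b" "v = ev q / ev b"
proof -
  obtain p b where 1: "b \<noteq> 0" "u = ev p / ev b" using RF_cases[OF assms(1)] .
  obtain q d where 2: "d \<noteq> 0" "v = ev q / ev d" using RF_cases[OF assms(2)] .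
  show ?thesis by (rule that[of "b * d" "p * d" "q * b"]) (use 1 2 in \<open>auto simp: evs ev_eq_0\<close>)
qed

lemma RF_quot: "ev p / ev q \<in> RF"
  unfolding RF_def ev_def to_ac_divide[symmetric] by (rule rangeI)

lemma RF_ev: "ev p \<in> RF"
  unfolding RF_def ev_def by (rule rangeI)

lemma RF_inverse: "u \<in> RF \<Longrightarrow> inverse u \<in> RF"
  by (auto simp: RF_def simp flip: to_ac_inverse)

lemma RF_const: "const_func c \<in> RF"
  using RF_ev[of "[:c:]"] by (simp add: ev_const)

lemma x_func_ev: "x_func = ev [:0, 1:]"
  by (simp add: x_func_def ev_def)

lemma RF_x: "x_func \<in> RF"
  unfolding x_func_ev by (rule RF_ev)

interpretation RF: subring_set RF
  by unfold_locales (auto simp: RF_def simp flip: to_ac_diff to_ac_mult to_ac_1)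

lemma RF_divide: "u \<in> RF \<Longrightarrow> v \<in> RF \<Longrightarrow> u / v \<in> RF"
  by (simp add: divide_inverse RF.mult_in RF_inverse)

text \<open>On the curve, \<open>2 deg p\<close> and \<open>2 deg q + 3\<close> are the pole orders at infinity of \<open>p\<close> and \<open>q y\<close>.\<close>

lemma degree_psi: "degree (psi W) \<le> 1" by (simp add: psi_def)
lemma degree_cubic: "degree (cubic W) = 3" "lead_coeff (cubic W) = 1" "cubic (W :: 'f::field weierstrass) \<noteq> 0"
  by (simp_all add: cubic_def)

lemma norm_degree:
  fixes W :: "'f::field weierstrass"
  defines "n \<equiv> \<lambda>p q. p^2 - p * q * psi W - q^2 * cubic W"
  shows "q \<noteq> 0 \<Longrightarrow> degree (n p q) = max (2 * degree p) (2 * degree q + 3)" "n p q = 0 \<Longrightarrow> p = 0 \<and> q = 0"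
proof -
  have *: "degree (n p q) = max (2 * degree p) (2 * degree q + 3) \<and> n p q \<noteq> 0" if q: "q \<noteq> 0" for p q
  proof -
    have dc: "degree (q^2 * cubic W) = 2 * degree q + 3"
      using q degree_cubic(3)[of W] by (simp add: degree_mult_eq degree_power_eq degree_cubic(1))
    have dm: "degree (p * q * psi W) \<le> degree p + degree q + 1"
      using degree_psi[of W] degree_mult_le[of "p * q" "psi W"] degree_mult_le[of p q] by linarith
    have dp: "degree (p^2) = 2 * degree p" by (cases "p = 0") (simp_all add: degree_power_eq)
    have "degree (n p q) = max (2 * degree p) (2 * degree q + 3)"
    \<comment> \<open>The two degrees have different parity, so the leading terms cannot cancel; the
      mixed term lies below the larger of them.\<close>
    proof (cases "2 * degree p > 2 * degree q + 3")
      case True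
      have "degree (p * q * psi W + q^2 * cubic W) < degree (p^2)"
        by (rule degree_add_less) (use dc dm dp True in auto)
      then have "degree (p^2 + - (p * q * psi W + q^2 * cubic W)) = degree (p^2)"
        by (intro degree_add_eq_left) (simp only: degree_minus)
      moreover have "p^2 + - (p * q * psi W + q^2 * cubic W) = n p q" by (simp add: n_def)
      ultimately show ?thesis using True dp by simp
    next
      case False
      have lt: "2 * degree p < 2 * degree q + 3" using False by presburger
      have "degree (p * q * psi W - p^2) < degree (q^2 * cubic W)"
        by (rule degree_diff_less) (use dc dm dp lt in auto)
      then have "degree (- (p * q * psi W - p^2) + - (q^2 * cubic W)) = degree (- (q^2 * cubic W))"
        by (intro degree_add_eq_right) (simp only: degree_minus)
      moreover have "- (p * q * psi W - p^2) + - (q^2 * cubic W) = n p q" by (simp add: n_def)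
      ultimately show ?thesis using False dc by simp
    qed
    moreover from this have "degree (n p q) > 0" by simp
    then have "n p q \<noteq> 0" by auto
    ultimately show ?thesis by simp
  qed
  show "q \<noteq> 0 \<Longrightarrow> degree (n p q) = max (2 * degree p) (2 * degree q + 3)" using * by blast
  show "n p q = 0 \<Longrightarrow> p = 0 \<and> q = 0" using *[of q p] by (cases "q = 0") (auto simp: n_def)
qed

locale func_curve =
  fixes W :: "'a::field weierstrass" and y :: "'a func"
  assumes on: "on_affine (map_weierstrass const_func W) x_func y"
begin

definition "yc = - y - ev (psi W)"

text \<open>The function field of the curve, given by its basis \<open>1, y\<close> over
  \<open>K(x)\<close>.\<close>

definition "FF = {p + q * y | p q. p \<in> RF \<and> q \<in> RF}"

lemma eq: "y^2 = ev (cubic W) - ev (psi W) * y"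
  using on by (simp add: on_affine_def cf.mp_psi cf.mp_cubic poly_lift_x algebra_simps)

lemma trace: "(p + q * y) + (p + q * yc) = 2 * p - q * ev (psi W)"
  by (simp add: yc_def algebra_simps)

lemma norm: "(p + q * y) * (p + q * yc) = p^2 - p * q * ev (psi W) - q^2 * ev (cubic W)"
proof -
  have "(p + q * y) * (p + q * yc) = p^2 - p * q * ev (psi W) - q^2 * (y^2 + ev (psi W) * y)"
    unfolding yc_def by Groebner_Basis.algebra
  then show ?thesis unfolding eq by simp
qed

text \<open>After clearing denominators this is the parity of degrees in \<open>norm_degree\<close>.
  It makes \<open>1, y\<close> independent over \<open>K(x)\<close>, so irreducibility of the
  equation never has to be discussed.\<close>

lemma norm_nz: assumes "p \<in> RF" "q \<in> RF" "p^2 - p * q * ev (psi W) - q^2 * ev (cubic W) = 0"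
  shows "p = 0 \<and> q = 0"
proof -
  obtain P Q b where *: "b \<noteq> 0" "p = ev P / ev b" "q = ev Q / ev b" using RF_common[OF assms(1,2)] .
  have b: "ev b \<noteq> 0" using * by (simp add: ev_eq_0)
  then have PQ: "ev P = p * ev b" "ev Q = q * ev b" using * by auto
  have "ev (P^2 - P * Q * psi W - Q^2 * cubic W) = ev b ^ 2 * (p^2 - p * q * ev (psi W) - q^2 * ev (cubic W))"
    unfolding evs PQ by Groebner_Basis.algebra
  then have "P^2 - P * Q * psi W - Q^2 * cubic W = 0" using assms(3) by (simp add: ev_eq_0)
  then have "P = 0 \<and> Q = 0" using norm_degree(2) by blast
  then show ?thesis using * by (simp add: ev_0)
qed

lemma unique0: assumes "p \<in> RF" "q \<in> RF" "p + q * y = 0" shows "p = 0 \<and> q = 0"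
  using norm[of p q] assms norm_nz by simp

lemma unique: assumes "p \<in> RF" "q \<in> RF" "p' \<in> RF" "q' \<in> RF" "p + q * y = p' + q' * y" shows "p = p' \<and> q = q'"
proof -
  have "(p - p') + (q - q') * y = 0" using assms(5) by (simp add: algebra_simps)
  then show ?thesis using unique0[of "p - p'" "q - q'"] assms by (simp add: RF.diff_in)
qed

text \<open>The automorphism of the function field induced by negation on the curve. It is
  meaningful on \<open>FF\<close> only, where \<open>unique\<close> makes the description
  definite.\<close>

definition "conjg u = (THE v. \<exists>p\<in>RF. \<exists>q\<in>RF. u = p + q * y \<and> v = p + q * yc)"

lemma conjg: assumes "p \<in> RF" "q \<in> RF" shows "conjg (p + q * y) = p + q * yc"
  unfolding conjg_def
proof (rule the_equality)
  show "\<exists>p'\<in>RF. \<exists>q'\<in>RF. p + q * y = p' + q' * y \<and> p + q * yc = p' + q' * yc" using assms by blast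
  fix v assume "\<exists>p'\<in>RF. \<exists>q'\<in>RF. p + q * y = p' + q' * y \<and> v = p' + q' * yc"
  then show "v = p + q * yc" using unique[OF assms] by blast
qed

lemma FF_I: "p \<in> RF \<Longrightarrow> q \<in> RF \<Longrightarrow> p + q * y \<in> FF" by (auto simp: FF_def)

lemma FF_RF: "p \<in> RF \<Longrightarrow> p \<in> FF" using FF_I[of p 0] by (simp add: RF.zero_in)

lemma FF_y: "y \<in> FF" using FF_I[of 0 1] by (simp add: RF.closed)

lemma conjg_RF: "p \<in> RF \<Longrightarrow> conjg p = p" using conjg[of p 0] by (simp add: RF.zero_in)

lemma conjg_y: "conjg y = yc" using conjg[of 0 1] by (simp add: RF.closed)

lemma mult_rep: "(p + q * y) * (p' + q' * y) = (p * p' + q * q' * ev (cubic W)) + (p * q' + q * p' - q * q' * ev (psi W)) * y"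
proof -
  have "(p + q * y) * (p' + q' * y) = p * p' + (p * q' + q * p') * y + q * q' * y^2" by Groebner_Basis.algebra
  then show ?thesis unfolding eq by (simp add: algebra_simps)
qed

sublocale FF: subfield_hom FF conjg
proof
  show "1 \<in> FF" "conjg 1 = 1" using FF_RF conjg_RF RF.one_in by auto
next
  fix u v assume "u \<in> FF" "v \<in> FF"
  then obtain p q p' q' where *: "u = p + q * y" "v = p' + q' * y" "p \<in> RF" "q \<in> RF" "p' \<in> RF" "q' \<in> RF"
    by (auto simp: FF_def)
  have 1: "u - v = (p - p') + (q - q') * y" using * by (simp add: algebra_simps)
  show "u - v \<in> FF" unfolding 1 by (intro FF_I RF.diff_in *)
  show "conjg (u - v) = conjg u - conjg v" unfolding 1 unfolding *(1,2)
    by (simp add: conjg * RF.diff_in) (simp add: algebra_simps)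
  have r: "p * p' + q * q' * ev (cubic W) \<in> RF" "p * q' + q * p' - q * q' * ev (psi W) \<in> RF"
    by (intro RF.closed * RF_ev)+
  show "u * v \<in> FF" unfolding *(1,2) mult_rep by (intro FF_I r)
  have "yc^2 = ev (cubic W) - ev (psi W) * yc"
    unfolding yc_def using eq by (simp add: power2_eq_square algebra_simps)
  moreover have "(p + q * yc) * (p' + q' * yc) = p * p' + (p * q' + q * p') * yc + q * q' * yc^2" by Groebner_Basis.algebra
  ultimately have "(p + q * yc) * (p' + q' * yc) = p * p' + (p * q' + q * p') * yc + q * q' * (ev (cubic W) - ev (psi W) * yc)"
    by simp
  then have "(p + q * yc) * (p' + q' * yc) = (p * p' + q * q' * ev (cubic W)) + (p * q' + q * p' - q * q' * ev (psi W)) * yc"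
    by (simp add: algebra_simps)
  then show "conjg (u * v) = conjg u * conjg v" unfolding *(1,2) mult_rep by (simp add: conjg r *)
next
  fix u assume "u \<in> FF"
  then obtain p q where *: "u = p + q * y" "p \<in> RF" "q \<in> RF" by (auto simp: FF_def)
  show "inverse u \<in> FF"
  proof (cases "u = 0")
    case True then show ?thesis using FF_RF RF.zero_in by auto
  next
    case False
    define n where "n = p^2 - p * q * ev (psi W) - q^2 * ev (cubic W)"
    have n: "n \<noteq> 0" using norm_nz[of p q] * False by (auto simp: n_def)
    have nR: "inverse n \<in> RF" unfolding n_def by (intro RF_inverse RF.closed * RF_ev)
    have "u * ((p + q * yc) * inverse n) = ((p + q * y) * (p + q * yc)) * inverse n" using * by simp
    also have "\<dots> = 1" unfolding norm n_def[symmetric] using n by simp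
    finally have "u * ((p + q * yc) * inverse n) = 1" .
    then have "inverse u = (p + q * yc) * inverse n" by (rule inverse_unique)
    also have "\<dots> = (p - q * ev (psi W)) * inverse n + (- q * inverse n) * y" by (simp add: yc_def algebra_simps)
    finally show ?thesis by (simp only:) (intro FF_I RF.closed * nR RF_ev)
  qed
qed

end

section \<open>Rational functions integral over the polynomials\<close>

text \<open>A nonconstant denominator of least degree has a root \<open>t\<close> that the numerator
  does not share. At a place above \<open>t\<close> the denominator lies in the maximal ideal, so
  integrality would force the numerator into it too.\<close>

lemma RF_integral_imp_poly:
  fixes e :: "'f::alg_closed_field func"
  assumes e: "e \<in> RF"
    and int: "\<And>V. valuation_ring_set V \<Longrightarrow> range ev \<subseteq> V \<Longrightarrow> e \<in> V"
  shows "e \<in> range ev"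
proof -
  obtain p0 q0 where "q0 \<noteq> 0" "e = ev p0 / ev q0" using RF_cases[OF e] .
  then have ex: "\<exists>b. b \<noteq> 0 \<and> (\<exists>u. e = ev u / ev b)" by blast
  define b where "b = arg_min degree (\<lambda>b. b \<noteq> 0 \<and> (\<exists>u. e = ev u / ev b))"
  have b: "b \<noteq> 0" "\<exists>u. e = ev u / ev b" and min: "\<And>b' u. b' \<noteq> 0 \<Longrightarrow> e = ev u / ev b' \<Longrightarrow> degree b \<le> degree b'"
    unfolding b_def using arg_min_natI[of "\<lambda>b. b \<noteq> 0 \<and> (\<exists>u. e = ev u / ev b)"] ex
      arg_min_nat_le[of "\<lambda>b. b \<noteq> 0 \<and> (\<exists>u. e = ev u / ev b)" _ degree] by auto
  obtain u where u: "e = ev u / ev b" using b by auto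
  have "degree b = 0"
  proof (rule ccontr)
    assume "degree b \<noteq> 0"
    then obtain t where t: "poly b t = 0" using alg_closed_imp_poly_has_root by auto
    then obtain b' where b': "b = [:-t,1:] * b'" by (metis poly_eq_0_iff_dvd dvdE)
    have ut: "poly u t \<noteq> 0"
    proof
      assume "poly u t = 0"
      then obtain u' where u': "u = [:-t,1:] * u'" by (metis poly_eq_0_iff_dvd dvdE)
      have "ev [:-t,1:] \<noteq> 0" by (simp add: ev_eq_0)
      then have "e = ev u' / ev b'" unfolding u u' b' evs by simp
      moreover have "b' \<noteq> 0" "degree b' < degree b" using b(1) unfolding b'
        by (auto simp: degree_mult_eq simp del: mult_pCons_left)
      ultimately show False using min[of b' u'] by auto
    qed
    \<comment> \<open>Chevalley's theorem for the polynomials and those vanishing at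
      \<open>t\<close> provides the place.\<close>
    have "ideal_set (range ev) {ev p | p. poly p t = 0}"
    proof
      show "1 \<in> range ev" by (metis ev_1 rangeI)
      show "0 \<in> {ev p | p. poly p t = 0}" by (rule CollectI, rule exI[of _ 0]) (simp add: ev_0)
    next
      fix x y :: "'f func" assume "x \<in> range ev" "y \<in> range ev"
      then show "x - y \<in> range ev" "x * y \<in> range ev" by (auto simp flip: evs)
    next
      fix x y :: "'f func" assume "x \<in> {ev p | p. poly p t = 0}" "y \<in> {ev p | p. poly p t = 0}"
      then obtain p q where "x = ev p" "y = ev q" "poly p t = 0" "poly q t = 0" by auto
      then show "x + y \<in> {ev p | p. poly p t = 0}" by (auto intro!: exI[of _ "p + q"] simp: ev_add)
    next
      fix x y :: "'f func" assume "x \<in> range ev" "y \<in> {ev p | p. poly p t = 0}"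
      then obtain p q where "x = ev p" "y = ev q" "poly q t = 0" by auto
      then show "x * y \<in> {ev p | p. poly p t = 0}" by (auto intro!: exI[of _ "p * q"] simp: ev_mult)
    qed auto
    moreover have "1 \<notin> {ev p | p. poly p t = 0}"
    proof
      assume "1 \<in> {ev p | p. poly p t = 0}"
      then obtain p where "ev p = ev 1" "poly p t = 0" by (auto simp: ev_1)
      then show False unfolding ev_eq by simp
    qed
    ultimately obtain V where V: "valuation_ring_set V" "range ev \<subseteq> V" "{ev p | p. poly p t = 0} \<subseteq> valuation_ring_set.mx V"
      by (rule chevalley)
    interpret V: valuation_ring_set V by fact
    have "e * ev b \<in> V.mx" using V int[OF V(1,2)] t by (intro V.mx_mult) auto
    then have eu: "ev u \<in> V.mx" using u b by (simp add: ev_eq_0)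
    have "ev (u - [:poly u t:]) \<in> V.mx"
      by (rule subsetD[OF V(3)], rule CollectI, rule exI[of _ "u - [:poly u t:]"]) simp
    then have "ev u - ev (u - [:poly u t:]) \<in> V.mx" by (rule V.mx.I_diff[OF eu])
    then have c: "ev [:poly u t:] \<in> V.mx" by (simp add: ev_diff)
    have "ev [:inverse (poly u t):] * ev [:poly u t:] \<in> V.mx" using V(2) c by (intro V.mx_mult) auto
    moreover have "ev [:inverse (poly u t):] * ev [:poly u t:] = ev ([:inverse (poly u t):] * [:poly u t:])"
      by (simp only: ev_mult)
    moreover have "[:inverse (poly u t):] * [:poly u t:] = 1" using ut by simp
    ultimately show False using V.mx_one by (simp add: ev_1)
  qed
  then obtain c where c: "b = [:c:]" "c \<noteq> 0" using b(1) by (metis degree_eq_zeroE pCons_0_0)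
  have "e = ev (smult (inverse c) u)"
  proof -
    have "u = b * smult (inverse c) u" using c by simp
    then have "ev u = ev b * ev (smult (inverse c) u)" by (metis ev_mult)
    then show ?thesis using u b by (simp add: ev_eq_0)
  qed
  then show ?thesis by simp
qed

section \<open>Isogenies in coordinates\<close>

text \<open>
  The isogeny \<open>(x, y) \<mapsto> (N / D, (A + B y) / H)\<close>: the two identities express that the conjugate of
  \<open>g = (A + B y) / H\<close> over the field of even functions is \<open>- g - a1' f - a3'\<close>.
\<close>

definition isogeny_data ::
    "'a::field weierstrass \<Rightarrow> 'a weierstrass \<Rightarrow> 'a poly \<Rightarrow> 'a poly \<Rightarrow> 'a poly \<Rightarrow> 'a poly \<Rightarrow> 'a poly \<Rightarrow> bool" where
  "isogeny_data W W' N D A B H \<longleftrightarrow>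
     discriminant W \<noteq> 0 \<and> discriminant W' \<noteq> 0 \<and> B \<noteq> 0 \<and> H \<noteq> 0 \<and> D \<noteq> 0 \<and> degree D < degree N \<and>
     (\<exists>u v. u * N + v * D = 1) \<and>
     D * (2 * A - B * psi W) = - ((smult (a1 W') N + smult (a3 W') D) * H) \<and>
     D^3 * (A^2 - A * B * psi W - B^2 * cubic W) =
       - (H^2 * (N^3 + smult (a2 W') (N^2 * D) + smult (a4 W') (N * D^2) + smult (a6 W') (D^3)))"

lemma (in field_hom_map) isogeny_data_map:
  assumes "isogeny_data W W' N D A B H"
  shows "isogeny_data (map_weierstrass h W) (map_weierstrass h W') (map_poly h N) (map_poly h D)
    (map_poly h A) (map_poly h B) (map_poly h H)"
proof -
  have *: "D * (2 * A - B * psi W) = - ((smult (a1 W') N + smult (a3 W') D) * H)"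
     "D^3 * (A^2 - A * B * psi W - B^2 * cubic W) =
       - (H^2 * (N^3 + smult (a2 W') (N^2 * D) + smult (a4 W') (N * D^2) + smult (a6 W') (D^3)))"
    using assms unfolding isogeny_data_def by blast+
  obtain u v where "u * N + v * D = 1" using assms unfolding isogeny_data_def by blast
  then have "map_poly h u * map_poly h N + map_poly h v * map_poly h D = 1" by (metis mp_add mp_mult mp_1)
  then show ?thesis
    using assms arg_cong[OF *(1), of "map_poly h"] arg_cong[OF *(2), of "map_poly h"]
    unfolding isogeny_data_def mps mp_psi mp_cubic mp_discriminant map_weierstrass_sel mp_eq_0 h_eq_0 mp_degree
    by blast
qed

section \<open>Translation by a point of the kernel\<close>

text \<open>Over algebraically closed constants a polynomial splits, so all its roots are
  constant.\<close>

lemma transcendental: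
  fixes z :: "'f::alg_closed_field func"
  assumes "z \<notin> range const_func" "p \<noteq> 0"
  shows "poly (lift p) z \<noteq> 0"
proof
  assume 0: "poly (lift p) z = 0"
  have "poly (lift (\<Prod>x\<in>#A. [:-x, 1:])) z = (\<Prod>x\<in>#A. z - const_func x)" for A
    by (induction A) (auto simp: cf.mps cf.hs algebra_simps)
  then have "const_func (lead_coeff p) * (\<Prod>x\<in>#proots p. z - const_func x) = 0"
    using 0 by (subst (asm) proots_split(1)[OF assms(2)]) (simp add: cf.mp_smult)
  then have "(\<Prod>x\<in>#proots p. z - const_func x) = 0" using assms by (simp add: cf.h_eq_0)
  then obtain x where "z = const_func x" by (auto simp: prod_mset_zero_iff)
  then show False using assms by auto
qed

text \<open>Its roots are the abscissae of the points that the isogeny sends to the generic first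
  coordinate \<open>x_func\<close>.\<close>

definition fibre :: "'a::field poly \<Rightarrow> 'a poly \<Rightarrow> 'a func poly" where
  "fibre N D = lift N - smult x_func (lift D)"

lemma degree_fibre: assumes "degree D < degree N"
  shows "degree (fibre N D) = degree N" "lead_coeff (fibre N D) = const_func (lead_coeff N)" "fibre N D \<noteq> 0"
proof -
  have c: "coeff (fibre N D) i = const_func (coeff N i) - x_func * const_func (coeff D i)" for i
    by (simp add: fibre_def cf.coeff_mp)
  have N0: "lead_coeff N \<noteq> 0" using assms by auto
  show d: "degree (fibre N D) = degree N"
  proof (rule antisym)
    show "degree (fibre N D) \<le> degree N" using assms
      by (intro degree_le) (auto simp: c coeff_eq_0 cf.h_0)
    show "degree N \<le> degree (fibre N D)" using assms N0
      by (intro le_degree) (simp add: c coeff_eq_0 cf.h_0 cf.h_eq_0)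
  qed
  show "lead_coeff (fibre N D) = const_func (lead_coeff N)" unfolding d c using assms by (simp add: coeff_eq_0 cf.h_0)
  then show "fibre N D \<noteq> 0" using N0 by (auto simp: cf.h_eq_0)
qed

lemma poly_fibre_const: "poly (fibre N D) (const_func c) = ev [:poly N c, - poly D c:]"
proof -
  have "[:poly N c, - poly D c:] = [:poly N c:] - [:0,1:] * [:poly D c:]" by simp
  then show ?thesis unfolding fibre_def by (simp only: evs) (simp add: cf.poly_mp ev_const x_func_ev)
qed

lemma fibre_root_not_const:
  fixes N D :: "'f::field poly"
  assumes "u * N + v * D = 1" "poly (fibre N D) z = 0"
  shows "z \<notin> range const_func"
proof
  assume "z \<in> range const_func"
  then obtain c where "ev [:poly N c, - poly D c:] = 0" using assms(2) poly_fibre_const[of N D] by auto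
  then have "poly N c = 0" "poly D c = 0" by (auto simp: ev_eq_0)
  moreover have "poly (u * N + v * D) c = 1" using assms(1) by simp
  ultimately show False by simp
qed

text \<open>
  Multiplying the values of the line through \<open>P\<close>, \<open>Q\<close> and \<open>R = - (P + Q)\<close> over the generic fibre gives a
  function on \<open>E'\<close> with divisor \<open>(\<phi> P) + (\<phi> Q) + (\<phi> R) - 3 (O)\<close>.  As \<open>\<phi> P = O\<close>, it is a polynomial in \<open>f\<close>
  alone, so that its norm down to the functions of \<open>f\<close> is a square.
\<close>

lemma translation_by_kernel:
  fixes W W' :: "'f::alg_closed_field weierstrass"
  assumes data: "isogeny_data W W' N D A B H"
    and DP: "poly D xP = 0"
    and line: "cubic W - l^2 - psi W * l = [:-xP, 1:] * [:-x2, 1:] * [:-x3, 1:]"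
  shows "poly N x2 * poly D x3 = poly N x3 * poly D x2"
proof -
  have W': "discriminant W' \<noteq> 0" and B0: "B \<noteq> 0" and H0: "H \<noteq> 0" and D0: "D \<noteq> 0"
    and deg: "degree D < degree N"
    and tr: "D * (2 * A - B * psi W) = - ((smult (a1 W') N + smult (a3 W') D) * H)"
    and nm: "D^3 * (A^2 - A * B * psi W - B^2 * cubic W) =
       - (H^2 * (N^3 + smult (a2 W') (N^2 * D) + smult (a4 W') (N * D^2) + smult (a6 W') (D^3)))"
    using data unfolding isogeny_data_def by blast+
  obtain u v where uv: "u * N + v * D = 1" using data unfolding isogeny_data_def by blast
  define T where "T = (x_func :: 'f func)"
  define ps where "ps = ev (psi W')"
  define cu where "cu = ev (cubic W')"
  have ps_alt: "ps = const_func (a1 W') * T + const_func (a3 W')"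
    unfolding ps_def T_def by (simp add: poly_lift_x[symmetric] psi_def cf.mps)
  have cu_alt: "cu = T^3 + const_func (a2 W') * T^2 + const_func (a4 W') * T + const_func (a6 W')"
    unfolding cu_def T_def
    by (simp add: poly_lift_x[symmetric] cubic_def cf.mps cf.hs algebra_simps power2_eq_square power3_eq_cube)
  \<comment> \<open>The generic point \<open>(T, g)\<close> of the target curve; \<open>gc\<close>
    will be the second coordinate of its negative.\<close>
  obtain g where g: "on_affine (map_weierstrass const_func W') T g"
  proof -
    have "\<exists>g. poly [:- cu, ps, 1:] g = 0" by (rule alg_closed_imp_poly_has_root) simp
    then obtain g where "poly [:- cu, ps, 1:] g = 0" ..
    then have "on_affine (map_weierstrass const_func W') T g"
      by (simp add: on_affine_def cf.mp_psi cf.mp_cubic T_def poly_lift_x ps_def cu_def algebra_simps power2_eq_square)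
    then show ?thesis by (rule that)
  qed
  interpret G: func_curve W' g by unfold_locales (use g in \<open>simp add: T_def\<close>)
  define gc where "gc = G.yc"
  have gc: "gc = - g - ps" by (simp add: gc_def G.yc_def ps_def)
  have geq: "g^2 = cu - ps * g" using G.eq by (simp add: cu_def ps_def)
  define \<chi> where "\<chi> = fibre N D"
  have \<chi>0: "\<chi> \<noteq> 0" and d\<chi>: "degree \<chi> = degree N" and lc: "lead_coeff \<chi> = const_func (lead_coeff N)"
    unfolding \<chi>_def using degree_fibre[OF deg] by auto
  define Z where "Z = proots \<chi>"
  have Zroot: "poly (lift N) z = T * poly (lift D) z" if "z \<in># Z" for z
    using that \<chi>0 by (simp add: Z_def \<chi>_def fibre_def T_def)
  have nz: "poly (lift p) z \<noteq> 0" if "z \<in># Z" "p \<noteq> 0" for z p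
  proof (rule transcendental[OF _ that(2)])
    show "z \<notin> range const_func" using that(1) \<chi>0 fibre_root_not_const[OF uv, of z] by (auto simp: Z_def \<chi>_def)
  qed
  \<comment> \<open>The solution \<open>y\<close> of \<open>(A + B y) / H = g\<close>, so that
    \<open>(z, Y g z)\<close> is the fibre point over \<open>(T, g)\<close> with abscissa
    \<open>z\<close>.\<close>
  define Y where "Y = (\<lambda>g z. (poly (lift H) z * g - poly (lift A) z) / poly (lift B) z)"
  have pt: "Y g z + Y gc z = - poly (lift (psi W)) z \<and> Y g z * Y gc z = - poly (lift (cubic W)) z"
    and integral: "on_affine (map_weierstrass const_func W) z (Y g z)" "on_affine (map_weierstrass const_func W) z (Y gc z)"
    if z: "z \<in># Z" for z
  proof -
    define n d a b h s c where
      "n = poly (lift N) z" and "d = poly (lift D) z" and "a = poly (lift A) z" and "b = poly (lift B) z"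
      and "h = poly (lift H) z" and "s = poly (lift (psi W)) z" and "c = poly (lift (cubic W)) z"
    note ds = n_def d_def a_def b_def h_def s_def c_def
    have d: "d \<noteq> 0" and b: "b \<noteq> 0" using nz[OF z] D0 B0 by (auto simp: ds)
    have n: "n = T * d" using Zroot[OF z] by (simp add: ds)
    have "d * (2 * a - b * s) = - ((const_func (a1 W') * n + const_func (a3 W') * d) * h)"
      using arg_cong[OF tr, of "\<lambda>p. poly (lift p) z"] by (simp add: cf.mps cf.hs ds numeral_poly)
    then have "d * (2 * a - b * s + ps * h) = 0" unfolding n ps_alt by (simp add: algebra_simps)
    then have t1: "2 * a - b * s = - (ps * h)" using d by (simp add: eq_neg_iff_add_eq_0)
    have "d^3 * (a^2 - a * b * s - b^2 * c) = - (h^2 * (n^3 + const_func (a2 W') * (n^2 * d) + const_func (a4 W') * (n * d^2) + const_func (a6 W') * d^3))"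
      using arg_cong[OF nm, of "\<lambda>p. poly (lift p) z"] by (simp add: cf.mps cf.hs ds)
    also have "\<dots> = d^3 * - (h^2 * cu)" unfolding n cu_alt by Groebner_Basis.algebra
    finally have "d^3 * (a^2 - a * b * s - b^2 * c) = d^3 * - (h^2 * cu)" .
    then have t2: "a^2 - a * b * s - b^2 * c = - (h^2 * cu)" using d by (subst (asm) mult_left_cancel) auto
    have "h * (g + gc) - 2 * a = - (b * s)" using t1 unfolding gc by (simp add: algebra_simps)
    then have sum: "Y g z + Y gc z = - s"
      using b unfolding Y_def ds[symmetric] by (simp add: field_simps)
    have "b^2 * (Y g z * Y gc z) = (h * g - a) * (h * gc - a)"
      using b unfolding Y_def ds[symmetric] by (simp add: power2_eq_square)
    also have "\<dots> = h^2 * (g * gc) - h * a * (g + gc) + a^2" by Groebner_Basis.algebra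
    also have "g * gc = - cu" using geq unfolding gc by (simp add: power2_eq_square algebra_simps)
    also have "g + gc = - ps" by (simp add: gc)
    also have "h^2 * - cu - h * a * - ps + a^2 = (a^2 - a * b * s - b^2 * c) - a * (2 * a - b * s) + a^2"
      unfolding t1 t2 by Groebner_Basis.algebra
    also have "\<dots> = b^2 * - c" by Groebner_Basis.algebra
    finally have "b^2 * (Y g z * Y gc z) = b^2 * - c" .
    then have prod: "Y g z * Y gc z = - c" using b by (subst (asm) mult_left_cancel) auto
    show "Y g z + Y gc z = - poly (lift (psi W)) z \<and> Y g z * Y gc z = - poly (lift (cubic W)) z"
      using sum prod by (simp add: ds)
    have "Y gc z = - s - Y g z" "Y g z = - s - Y gc z" using sum by (simp_all add: algebra_simps)
    then have "(Y g z)^2 + s * Y g z = c" "(Y gc z)^2 + s * Y gc z = c"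
      using prod by (simp_all add: power2_eq_square) (simp_all add: algebra_simps)
    then show "on_affine (map_weierstrass const_func W) z (Y g z)" "on_affine (map_weierstrass const_func W) z (Y gc z)"
      by (simp_all add: on_affine_def cf.mp_psi cf.mp_cubic ds)
  qed
  \<comment> \<open>The norm of the function \<open>y - l\<close> from the source to the target of
    the isogeny, as a product over the fibre.\<close>
  define S where "S = (\<lambda>g. \<Prod>z\<in>#Z. Y g z - poly (lift l) z)"
  define R where "R = (\<lambda>g. smult g (lift H) - lift A - lift l * lift B)"
  have RFx: "T \<in> RF" by (simp add: T_def RF_x)
  have FFc: "const_func c \<in> G.FF" for c by (intro G.FF_RF RF_const)
  have lift_in: "coeffs_in G.FF (lift p)" for p by (simp add: coeffs_in_def cf.coeff_mp FFc)
  have lift_conj: "map_poly G.conjg (lift p) = lift p" for p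
    by (rule poly_eqI) (simp add: G.FF.coeff_map cf.coeff_mp G.conjg_RF RF_const)
  have \<chi>c: "coeff \<chi> i = const_func (coeff N i) - T * const_func (coeff D i)" for i
    by (simp add: \<chi>_def fibre_def cf.coeff_mp T_def)
  have \<chi>_RF: "coeff \<chi> i \<in> RF" for i unfolding \<chi>c by (intro RF.closed RF_const RFx)
  have \<chi>_in: "coeffs_in G.FF \<chi>" using \<chi>_RF by (simp add: coeffs_in_def G.FF_RF)
  have \<chi>_conj: "map_poly G.conjg \<chi> = \<chi>"
    by (rule poly_eqI) (simp add: G.FF.coeff_map G.conjg_RF \<chi>_RF)
  have R_in: "coeffs_in G.FF (R g)"
    unfolding R_def by (intro G.FF.coeffs_in_diff G.FF.coeffs_in_smult G.FF.coeffs_in_mult lift_in G.FF_y)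
  have R_coeff: "coeff (R g') i = g' * const_func (coeff H i) - const_func (coeff A i) - const_func (coeff (l * B) i)" for g' i
    by (simp add: R_def cf.coeff_mp flip: cf.mp_mult)
  have R_conj: "map_poly G.conjg (R g) = R gc"
    by (rule poly_eqI) (simp add: G.FF.coeff_map R_coeff G.FF.hom_diff G.FF.hom_mult FFc G.FF_y G.FF.mult_in G.FF.diff_in G.conjg_RF RF_const G.conjg_y gc_def)
  \<comment> \<open>Clearing the denominator \<open>B\<close> makes \<open>S\<close> a quotient of
    two resultants; this yields both its membership in the function field of \<open>W'\<close> and
    its conjugate.\<close>
  have SR: "S g' * rootprod \<chi> (lift B) = rootprod \<chi> (R g')" for g'
  proof -
    have "(Y g' z - poly (lift l) z) * poly (lift B) z = poly (R g') z" if "z \<in># Z" for z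
      using nz[OF that B0] by (simp add: Y_def R_def field_simps)
    then show ?thesis unfolding S_def rootprod_def Z_def[symmetric] prod_mset.distrib[symmetric]
      by (intro arg_cong[of _ _ prod_mset] image_mset_cong) auto
  qed
  have Bnz: "rootprod \<chi> (lift B) \<noteq> 0" unfolding rootprod_def Z_def[symmetric]
    using nz[OF _ B0] by (auto simp: prod_mset_zero_iff)
  have B_in: "rootprod \<chi> (lift B) \<in> G.FF" and B_conj: "G.conjg (rootprod \<chi> (lift B)) = rootprod \<chi> (lift B)"
    using G.FF.rootprod_hom[OF \<chi>0 \<chi>_in lift_in[of B]] unfolding \<chi>_conj lift_conj by auto
  have R_in': "rootprod \<chi> (R g) \<in> G.FF" and RR: "G.conjg (rootprod \<chi> (R g)) = rootprod \<chi> (R gc)"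
    using G.FF.rootprod_hom[OF \<chi>0 \<chi>_in R_in] unfolding \<chi>_conj R_conj by auto
  have Sg: "S g = rootprod \<chi> (R g) * inverse (rootprod \<chi> (lift B))" using SR[of g] Bnz by (simp add: field_simps)
  have S_in: "S g \<in> G.FF" unfolding Sg by (intro G.FF.mult_in R_in' G.FF.inv_in B_in)
  have "G.conjg (S g) * G.conjg (rootprod \<chi> (lift B)) = G.conjg (rootprod \<chi> (R g))"
    using G.FF.hom_mult[OF S_in B_in] SR[of g] by simp
  then have "G.conjg (S g) * rootprod \<chi> (lift B) = S gc * rootprod \<chi> (lift B)"
    unfolding B_conj RR SR[of gc] .
  then have S_conj: "G.conjg (S g) = S gc" using Bnz by simp
  obtain p q where pq: "S g = p + q * g" "p \<in> RF" "q \<in> RF" using S_in unfolding G.FF_def by blast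
  have Sgc: "S gc = p + q * gc" using S_conj pq G.conjg[of p q] by (simp add: gc_def)
  have trace: "S g + S gc = 2 * p - q * ps" unfolding pq(1) Sgc using G.trace by (simp add: gc_def ps_def)
  have norm: "S g * S gc = p^2 - p * q * ps - q^2 * cu"
    unfolding pq(1) Sgc using G.norm by (simp add: gc_def ps_def cu_def)
  \<comment> \<open>The coordinates of the fibre points are integral over the polynomials in
    \<open>T\<close>, hence so is the trace of \<open>S g\<close>.\<close>
  have "2 * p - q * ps \<in> range ev"
  proof (rule RF_integral_imp_poly)
    show "2 * p - q * ps \<in> RF" unfolding ps_def by (intro RF.closed pq RF_ev)
    fix V :: "'f func set" assume V: "valuation_ring_set V" "range ev \<subseteq> V"
    interpret V: valuation_ring_set V by fact
    have cV: "const_func c \<in> V" for c using V(2) by (auto simp flip: ev_const)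
    have TV: "T \<in> V" using V(2) by (auto simp: T_def x_func_ev)
    have liftV: "coeffs_in V (lift p)" for p by (simp add: coeffs_in_def cf.coeff_mp cV)
    have "coeffs_in V \<chi>" unfolding coeffs_in_def \<chi>c by (auto intro!: V.closed cV TV)
    have zV: "z \<in> V" if "z \<in># Z" for z
    proof (rule V.integrally_closed)
      show "coeffs_in V (smult (const_func (inverse (lead_coeff N))) \<chi>)"
        by (intro V.coeffs_in_smult cV) fact
      have "lead_coeff N \<noteq> 0" using deg by auto
      then show "lead_coeff (smult (const_func (inverse (lead_coeff N))) \<chi>) = 1"
        using lc by (simp add: cf.hs cf.h_eq_0)
      show "poly (smult (const_func (inverse (lead_coeff N))) \<chi>) z = 0" using that \<chi>0 by (simp add: Z_def)
    qed
    have yV: "w \<in> V" if z: "z \<in># Z" and w: "on_affine (map_weierstrass const_func W) z w" for z w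
    proof (rule V.integrally_closed)
      show "coeffs_in V [:- poly (lift (cubic W)) z, poly (lift (psi W)) z, 1:]"
        by (auto simp: coeffs_in_def coeff_pCons intro!: V.closed V.poly_in liftV zV[OF z] split: nat.split)
      show "poly [:- poly (lift (cubic W)) z, poly (lift (psi W)) z, 1:] w = 0"
        using w by (simp add: on_affine_def cf.mp_psi cf.mp_cubic algebra_simps power2_eq_square)
    qed simp
    have "S g \<in> V" unfolding S_def
      by (rule V.prod_mset_in) (rule V.diff_in[OF yV[OF _ integral(1)] V.poly_in[OF liftV zV]])
    moreover have "S gc \<in> V" unfolding S_def
      by (rule V.prod_mset_in) (rule V.diff_in[OF yV[OF _ integral(2)] V.poly_in[OF liftV zV]])
    ultimately show "2 * p - q * ps \<in> V" unfolding trace[symmetric] by (rule V.add_in)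
  qed
  then obtain \<tau> where \<tau>: "2 * p - q * ps = ev \<tau>" by auto
  have nP: "poly N xP \<noteq> 0"
  proof
    assume "poly N xP = 0"
    then have "poly (u * N + v * D) xP = 0" using DP by simp
    then show False unfolding uv by simp
  qed
  have lcN: "lead_coeff N \<noteq> 0" using deg by auto
  define c0 where "c0 = poly N xP / lead_coeff N ^ 3"
  have c0: "c0 \<noteq> 0" using nP lcN by (simp add: c0_def)
  define m where "m = [:c0:] * [:poly N x2, - poly D x2:] * [:poly N x3, - poly D x3:]"
  have "S g * S gc = (\<Prod>z\<in>#Z. (Y g z - poly (lift l) z) * (Y gc z - poly (lift l) z))"
    unfolding S_def prod_mset.distrib ..
  also have "\<dots> = (\<Prod>z\<in>#Z. (const_func xP - z) * (const_func x2 - z) * (const_func x3 - z))"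
  proof (intro arg_cong[of _ _ prod_mset] image_mset_cong)
    fix z assume z: "z \<in># Z"
    define L where "L = poly (lift l) z"
    have "(Y g z - L) * (Y gc z - L) = Y g z * Y gc z - L * (Y g z + Y gc z) + L^2" by Groebner_Basis.algebra
    also have "\<dots> = - poly (lift (cubic W - l^2 - psi W * l)) z"
      using pt[OF z] by (simp add: L_def cf.mps power2_eq_square algebra_simps)
    also have "\<dots> = (const_func xP - z) * (const_func x2 - z) * (const_func x3 - z)"
      unfolding line cf.mp_mult cf.mp_pCons cf.h_uminus cf.h_1 cf.mp_0 by simp Groebner_Basis.algebra
    finally show "(Y g z - poly (lift l) z) * (Y gc z - poly (lift l) z) = (const_func xP - z) * (const_func x2 - z) * (const_func x3 - z)"
      unfolding L_def .
  qed
  also have "\<dots> = (\<Prod>z\<in>#Z. const_func xP - z) * (\<Prod>z\<in>#Z. const_func x2 - z) * (\<Prod>z\<in>#Z. const_func x3 - z)"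
    by (simp add: prod_mset.distrib)
  finally have e1: "S g * S gc = (\<Prod>z\<in>#Z. const_func xP - z) * (\<Prod>z\<in>#Z. const_func x2 - z) * (\<Prod>z\<in>#Z. const_func x3 - z)" .
  \<comment> \<open>The product of the differences \<open>t - z\<close> over the fibre is linear in
    \<open>T\<close>; at \<open>t = xP\<close> it is even constant, because \<open>D\<close>
    vanishes there.\<close>
  have e2: "const_func (lead_coeff N) * (\<Prod>z\<in>#Z. const_func t - z) = ev [:poly N t, - poly D t:]" for t
    using poly_split[OF \<chi>0, of "const_func t"] poly_fibre_const[of N D t] unfolding lc Z_def[symmetric] \<chi>_def[symmetric] by simp
  have "const_func (lead_coeff N)^3 * (S g * S gc) =
     (const_func (lead_coeff N) * (\<Prod>z\<in>#Z. const_func xP - z)) * (const_func (lead_coeff N) * (\<Prod>z\<in>#Z. const_func x2 - z)) *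
     (const_func (lead_coeff N) * (\<Prod>z\<in>#Z. const_func x3 - z))"
    unfolding e1 by (simp add: power3_eq_cube)
  also have "\<dots> = ev ([:poly N xP:] * [:poly N x2, - poly D x2:] * [:poly N x3, - poly D x3:])"
    unfolding e2 evs DP by simp
  also have "[:poly N xP:] = [:lead_coeff N:]^3 * [:c0:]"
    using lcN by (simp add: c0_def power3_eq_cube)
  also have "ev ([:lead_coeff N:]^3 * [:c0:] * [:poly N x2, - poly D x2:] * [:poly N x3, - poly D x3:]) = const_func (lead_coeff N)^3 * ev m"
    unfolding evs m_def by (simp add: ev_const mult.assoc)
  finally have SS: "S g * S gc = ev m" using lcN by (simp add: cf.h_eq_0)
  obtain P Q b where b: "b \<noteq> 0" "p = ev P / ev b" "q = ev Q / ev b" using RF_common[OF pq(2,3)] .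
  have PQ: "ev P = p * ev b" "ev Q = q * ev b" using b by (auto simp: ev_eq_0)
  have "ev (2 * P - Q * psi W') = (2 * p - q * ps) * ev b" unfolding evs PQ ps_def by (simp add: algebra_simps)
  also have "\<dots> = ev (b * \<tau>)" unfolding \<tau> evs by simp
  finally have trb: "b dvd 2 * P - Q * psi W'" unfolding ev_eq by simp
  have "ev (P^2 - P * Q * psi W' - Q^2 * cubic W') = (p^2 - p * q * ps - q^2 * cu) * ev b^2"
    unfolding evs PQ ps_def cu_def by Groebner_Basis.algebra
  also have "\<dots> = ev (b^2 * m)" unfolding norm[symmetric] SS evs by simp
  finally have nmb: "P^2 - P * Q * psi W' - Q^2 * cubic W' = b^2 * m" unfolding ev_eq .
  then have "b dvd P \<and> b dvd Q" using normality[OF W' b(1) trb] by simp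
  then obtain P' Q' where P': "P = b * P'" "Q = b * Q'" by (auto elim!: dvdE)
  have "b^2 * (P'^2 - P' * Q' * psi W' - Q'^2 * cubic W') = b^2 * m"
    unfolding nmb[symmetric] P' by (simp add: power2_eq_square algebra_simps)
  then have nm': "P'^2 - P' * Q' * psi W' - Q'^2 * cubic W' = m" using b by simp
  \<comment> \<open>A nonzero \<open>Q'\<close> would contribute degree at least 3 to the norm. So
    \<open>S g\<close> is a polynomial in \<open>T\<close> alone, and its norm is a square.\<close>
  have "degree m \<le> 2"
    unfolding m_def using degree_mult_le[of "[:c0:] * [:poly N x2, - poly D x2:]" "[:poly N x3, - poly D x3:]"]
      degree_mult_le[of "[:c0:]" "[:poly N x2, - poly D x2:]"] by (simp split: if_splits)
  then have "Q' = 0" using norm_degree(1)[of Q' P' W'] nm' by (cases "Q' = 0") auto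
  then have sq: "m = P'^2" using nm' by simp
  \<comment> \<open>The two linear factors of a square have the same root: at the root of the first,
    the derivative of the square vanishes too.\<close>
  have key: "n2 * d3 = n3 * d2" if sq: "[:c0:] * [:n2, - d2:] * [:n3, - d3:] = P'^2" and d: "d2 \<noteq> 0" for n2 d2 n3 d3
  proof -
    define t where "t = n2 / d2"
    have "poly (P'^2) t = 0" unfolding sq[symmetric] using d by (simp add: t_def)
    then have "poly P' t = 0" by simp
    then have "poly (pderiv (P'^2)) t = 0" by (simp add: power2_eq_square pderiv_mult)
    then have "c0 * (- d2) * (n3 - d3 * t) = 0" unfolding sq[symmetric]
      using d by (simp add: pderiv_mult pderiv_pCons t_def algebra_simps)
    then show ?thesis using c0 d by (simp add: t_def field_simps)
  qed
  show ?thesis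
  proof (cases "poly D x2 = 0")
    case False
    show ?thesis using key[OF _ False] sq unfolding m_def by metis
  next
    case True
    show ?thesis
    proof (cases "poly D x3 = 0")
      case f3: False
      have ac: "a * b * c = a * c * b" for a b c :: "'f poly" by (simp add: mult_ac)
      have "[:c0:] * [:poly N x3, - poly D x3:] * [:poly N x2, - poly D x2:] = m" unfolding m_def by (rule ac)
      also note sq
      finally have "poly N x3 * poly D x2 = poly N x2 * poly D x3" by (rule key[OF _ f3])
      then show ?thesis by (rule sym)
    qed (simp add: True)
  qed
qed

section \<open>Chords through a point\<close>

definition neg_pt :: "'a::field weierstrass \<Rightarrow> 'a \<times> 'a \<Rightarrow> 'a \<times> 'a" where
  "neg_pt W Q = (fst Q, - snd Q - poly (psi W) (fst Q))"

definition slope :: "'a::field \<times> 'a \<Rightarrow> 'a \<times> 'a \<Rightarrow> 'a" where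
  "slope P Q = (snd Q - snd P) / (fst Q - fst P)"

definition third_pt :: "'a::field weierstrass \<Rightarrow> 'a \<times> 'a \<Rightarrow> 'a \<times> 'a \<Rightarrow> 'a \<times> 'a" where
  "third_pt W P Q = (let m = slope P Q; x = m^2 + a1 W * m - a2 W - fst P - fst Q in (x, snd P + m * (x - fst P)))"

text \<open>This is \<open>P + Q\<close> when the abscissae differ. Doubling and the origin are not
  provided for, since a constant \<open>P\<close> and a generic \<open>Q\<close> never meet these
  cases.\<close>

definition step :: "'a::field weierstrass \<Rightarrow> 'a \<times> 'a \<Rightarrow> 'a \<times> 'a \<Rightarrow> 'a \<times> 'a" where
  "step W P Q = neg_pt W (third_pt W P Q)"

abbreviation on_pt :: "'a::field weierstrass \<Rightarrow> 'a \<times> 'a \<Rightarrow> bool" where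
  "on_pt W Q \<equiv> on_affine W (fst Q) (snd Q)"

lemma neg_neg: "neg_pt W (neg_pt W Q) = Q" by (simp add: neg_pt_def)

lemma neg_on: assumes "on_pt W Q" shows "on_pt W (neg_pt W Q)"
proof -
  have "(- y - s)^2 + s * (- y - s) = y^2 + s * y" for y s :: 'a by (simp add: power2_eq_square algebra_simps)
  then show ?thesis using assms by (simp add: on_affine_def neg_pt_def)
qed

lemma same_x:
  assumes "on_pt W Q" "on_pt W R" "fst Q = fst R" shows "Q = R \<or> Q = neg_pt W R"
proof -
  have "snd Q ^ 2 + poly (psi W) (fst R) * snd Q = snd R ^ 2 + poly (psi W) (fst R) * snd R"
    using assms by (simp add: on_affine_def)
  moreover have "(q - r) * (q + r + s) = (q^2 + s * q) - (r^2 + s * r)" for q r s :: 'a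
    by Groebner_Basis.algebra
  ultimately have "(snd Q - snd R) * (snd Q + snd R + poly (psi W) (fst R)) = 0" by simp
  then have "snd Q - snd R = 0 \<or> snd Q + snd R + poly (psi W) (fst R) = 0" by simp
  moreover have "snd Q = - snd R - poly (psi W) (fst R)" if "snd Q + snd R + poly (psi W) (fst R) = 0"
    using that by Groebner_Basis.algebra
  ultimately have "snd Q = snd R \<or> snd Q = - snd R - poly (psi W) (fst R)" by auto
  then show ?thesis using assms(3) by (auto simp: neg_pt_def prod_eq_iff)
qed

lemma slope_eq: "fst P \<noteq> fst Q \<Longrightarrow> slope P Q * (fst Q - fst P) = snd Q - snd P"
  by (simp add: slope_def)

text \<open>The abscissa of the third point is chosen so that both sides agree in degrees 2 and 3;
  the remaining linear difference vanishes at two distinct abscissae.\<close>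

lemma third_pt_line:
  fixes W :: "'a::field weierstrass"
  assumes "on_pt W P" "on_pt W Q" "fst P \<noteq> fst Q"
  defines "l \<equiv> [:snd P - slope P Q * fst P, slope P Q:]"
  shows "cubic W - l^2 - psi W * l = [:- fst P, 1:] * [:- fst Q, 1:] * [:- fst (third_pt W P Q), 1:]"
proof -
  define m x x' y y' where "m = slope P Q" and "x = fst P" and "x' = fst Q" and "y = snd P" and "y' = snd Q"
  note ds = m_def x_def x'_def y_def y'_def
  define x3 where "x3 = fst (third_pt W P Q)"
  have x3: "x3 = m^2 + a1 W * m - a2 W - x - x'" by (simp add: x3_def third_pt_def Let_def ds)
  have lx: "poly l x = y" "poly l x' = y'"
    using slope_eq[OF assms(3)] by (simp_all add: l_def ds algebra_simps)
  define p where "p = cubic W - l^2 - psi W * l - [:- x, 1:] * [:- x', 1:] * [:- x3, 1:]"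
  define b where "b = y - m * x"
  define u v where "u = a6 W - b^2 - a3 W * b + x * x' * x3" and
    "v = a4 W - 2 * b * m - a3 W * m - a1 W * b - (x * x' + x * x3 + x' * x3)"
  have p: "p = [:u, v:]"
    unfolding p_def l_def cubic_def psi_def ds[symmetric] b_def[symmetric]
    by (simp add: u_def v_def x3 power2_eq_square algebra_simps)
  have ev: "s^2 + poly (psi W) t * s = poly (cubic W) t \<Longrightarrow> poly l t = s \<Longrightarrow> t = x \<or> t = x' \<Longrightarrow> poly p t = 0" for t s
    unfolding p_def by (auto simp: algebra_simps)
  have "poly p x = 0" "poly p x' = 0"
    using ev[OF assms(1)[unfolded on_affine_def]] ev[OF assms(2)[unfolded on_affine_def]] lx by (simp_all add: ds)
  then have e: "u + x * v = 0" "u + x' * v = 0" by (auto simp: p)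
  have "(x - x') * v = (u + x * v) - (u + x' * v)" by (simp add: algebra_simps)
  then have "(x - x') * v = 0" unfolding e by simp
  then have "v = 0" using assms(3) by (simp add: ds)
  then have "p = 0" using e p by simp
  then show ?thesis by (simp add: p_def x3_def ds)
qed

lemma third_pt_on_line: "snd (third_pt W P Q) = snd P + slope P Q * (fst (third_pt W P Q) - fst P)"
  by (simp add: third_pt_def Let_def)

lemma third_pt_on:
  assumes "on_pt W P" "on_pt W Q" "fst P \<noteq> fst Q"
  shows "on_pt W (third_pt W P Q)"
  using arg_cong[OF third_pt_line[OF assms], of "\<lambda>p. poly p (fst (third_pt W P Q))"]
  by (simp add: on_affine_def third_pt_on_line power2_eq_square algebra_simps)

text \<open>\<open>P\<close> and the third point span the same line, so the construction is an
  involution. This inverts \<open>step\<close> without any associative law.\<close>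

lemma third_third:
  assumes "fst P \<noteq> fst Q" "fst (third_pt W P Q) \<noteq> fst P"
  shows "third_pt W P (third_pt W P Q) = Q"
proof -
  have s: "slope P (third_pt W P Q) = slope P Q"
    using assms(2) by (simp add: slope_def[of P "third_pt W P Q"] third_pt_on_line)
  have x: "fst (third_pt W P (third_pt W P Q)) = fst Q"
    unfolding third_pt_def[of W P "third_pt W P Q"] s by (simp add: Let_def third_pt_def)
  have "snd (third_pt W P (third_pt W P Q)) = snd Q"
    unfolding third_pt_on_line[of W P "third_pt W P Q"] s x using slope_eq[OF assms(1)] by simp
  then show ?thesis using x by (simp add: prod_eq_iff)
qed

section \<open>Translations at generic points\<close>

text \<open>
  \<open>specialization\<close> relates the values of the same element of the function field at two generic points.
\<close>

definition specialization :: "'a::field func \<times> 'a func \<Rightarrow> 'a func \<times> 'a func \<Rightarrow> 'a func \<Rightarrow> 'a func \<Rightarrow> bool" where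
  "specialization Q Q' u u' \<longleftrightarrow>
    (\<exists>a b c. c \<noteq> 0 \<and> u = (poly (lift a) (fst Q) + poly (lift b) (fst Q) * snd Q) / poly (lift c) (fst Q) \<and>
       u' = (poly (lift a) (fst Q') + poly (lift b) (fst Q') * snd Q') / poly (lift c) (fst Q'))"

definition generic_pt :: "'a::field weierstrass \<Rightarrow> 'a func \<times> 'a func \<Rightarrow> bool" where
  "generic_pt W Q \<longleftrightarrow> on_pt (map_weierstrass const_func W) Q \<and> fst Q \<notin> range const_func"

lemma generic_on: "generic_pt W Q \<Longrightarrow> snd Q ^ 2 = poly (lift (cubic W)) (fst Q) - poly (lift (psi W)) (fst Q) * snd Q"
  by (simp add: generic_pt_def on_affine_def cf.mp_psi cf.mp_cubic algebra_simps)

lemma generic_nz: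
  fixes W :: "'f::alg_closed_field weierstrass"
  assumes "generic_pt W Q" "p \<noteq> 0" shows "poly (lift p) (fst Q) \<noteq> 0"
  using transcendental assms by (auto simp: generic_pt_def)

lemma generic_norm:
  assumes "generic_pt W Q"
  shows "(poly (lift a) (fst Q) + poly (lift b) (fst Q) * snd Q) * (poly (lift (a - b * psi W)) (fst Q) - poly (lift b) (fst Q) * snd Q)
     = poly (lift (a^2 - a * b * psi W - b^2 * cubic W)) (fst Q)"
proof -
  define A B S C w where "A = poly (lift a) (fst Q)" and "B = poly (lift b) (fst Q)" and "S = poly (lift (psi W)) (fst Q)"
    and "C = poly (lift (cubic W)) (fst Q)" and "w = snd Q"
  have "(A + B * w) * ((A - B * S) - B * w) = A^2 - A * B * S - B^2 * (w^2 + S * w)" by Groebner_Basis.algebra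
  also have "w^2 + S * w = C" using generic_on[OF assms] by (simp add: w_def S_def C_def)
  finally show ?thesis by (simp add: cf.mps A_def B_def S_def C_def w_def)
qed

text \<open>Multiplying by the conjugate gives a nonzero polynomial in a transcendental
  element.\<close>

lemma generic_linear_nz:
  fixes W :: "'f::alg_closed_field weierstrass"
  assumes "generic_pt W Q" "a \<noteq> 0 \<or> b \<noteq> 0"
  shows "poly (lift a) (fst Q) + poly (lift b) (fst Q) * snd Q \<noteq> 0"
proof
  assume "poly (lift a) (fst Q) + poly (lift b) (fst Q) * snd Q = 0"
  then have "poly (lift (a^2 - a * b * psi W - b^2 * cubic W)) (fst Q) = 0" using generic_norm[OF assms(1), of a b] by simp
  then have "a^2 - a * b * psi W - b^2 * cubic W = 0" using generic_nz[OF assms(1)] by blast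
  then show False using norm_degree(2) assms(2) by blast
qed

text \<open>The relation \<open>sp\<close> is the graph of the isomorphism over the constants
  between the fields generated by \<open>Q\<close> and by \<open>Q'\<close>. Closure under the field
  operations and \<open>sp_0\<close> are all that is needed to carry identities from one point to
  the other.\<close>

locale two_generic =
  fixes W :: "'f::alg_closed_field weierstrass" and Q Q' :: "'f func \<times> 'f func"
  assumes g: "generic_pt W Q" and g': "generic_pt W Q'"
begin

abbreviation "sp \<equiv> specialization Q Q'"

lemma sp_const: "sp (const_func c) (const_func c)"
  unfolding specialization_def by (rule exI[of _ "[:c:]"], rule exI[of _ 0], rule exI[of _ 1]) (simp add: cf.mps cf.hs)

lemma sp_x: "sp (fst Q) (fst Q')"
  unfolding specialization_def by (rule exI[of _ "[:0,1:]"], rule exI[of _ 0], rule exI[of _ 1]) (simp add: cf.mps cf.hs)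

lemma sp_y: "sp (snd Q) (snd Q')"
  unfolding specialization_def by (rule exI[of _ 0], rule exI[of _ 1], rule exI[of _ 1]) (simp add: cf.mps cf.hs)

lemma sp_0: assumes "sp u u'" shows "u = 0 \<longleftrightarrow> u' = 0"
proof -
  obtain a b c where 1: "c \<noteq> 0" "u = (poly (lift a) (fst Q) + poly (lift b) (fst Q) * snd Q) / poly (lift c) (fst Q)"
     "u' = (poly (lift a) (fst Q') + poly (lift b) (fst Q') * snd Q') / poly (lift c) (fst Q')"
    using assms unfolding specialization_def by blast
  have c: "poly (lift c) (fst Q) \<noteq> 0" "poly (lift c) (fst Q') \<noteq> 0" using generic_nz[OF g 1(1)] generic_nz[OF g' 1(1)] by auto
  show ?thesis
  proof (cases "a = 0 \<and> b = 0")
    case True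
    then show ?thesis unfolding 1 by simp
  next
    case False
    then show ?thesis unfolding 1 using c generic_linear_nz[OF g, of a b] generic_linear_nz[OF g', of a b] by simp
  qed
qed

lemma sp_add: assumes "sp u u'" "sp v v'" shows "sp (u + v) (u' + v')"
proof -
  obtain a b c where 1: "c \<noteq> 0" "u = (poly (lift a) (fst Q) + poly (lift b) (fst Q) * snd Q) / poly (lift c) (fst Q)"
     "u' = (poly (lift a) (fst Q') + poly (lift b) (fst Q') * snd Q') / poly (lift c) (fst Q')"
    using assms(1) unfolding specialization_def by blast
  obtain d e f where 2: "f \<noteq> 0" "v = (poly (lift d) (fst Q) + poly (lift e) (fst Q) * snd Q) / poly (lift f) (fst Q)"
     "v' = (poly (lift d) (fst Q') + poly (lift e) (fst Q') * snd Q') / poly (lift f) (fst Q')"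
    using assms(2) unfolding specialization_def by blast
  show ?thesis unfolding specialization_def
    by (rule exI[of _ "a * f + d * c"], rule exI[of _ "b * f + e * c"], rule exI[of _ "c * f"])
       (use 1 2 generic_nz[OF g] generic_nz[OF g'] in \<open>simp add: cf.mps add_frac_eq algebra_simps\<close>)
qed

lemma sp_mult: assumes "sp u u'" "sp v v'" shows "sp (u * v) (u' * v')"
proof -
  obtain a b c where 1: "c \<noteq> 0" "u = (poly (lift a) (fst Q) + poly (lift b) (fst Q) * snd Q) / poly (lift c) (fst Q)"
     "u' = (poly (lift a) (fst Q') + poly (lift b) (fst Q') * snd Q') / poly (lift c) (fst Q')"
    using assms(1) unfolding specialization_def by blast
  obtain d e f where 2: "f \<noteq> 0" "v = (poly (lift d) (fst Q) + poly (lift e) (fst Q) * snd Q) / poly (lift f) (fst Q)"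
     "v' = (poly (lift d) (fst Q') + poly (lift e) (fst Q') * snd Q') / poly (lift f) (fst Q')"
    using assms(2) unfolding specialization_def by blast
  have *: "(poly (lift a) (fst R) + poly (lift b) (fst R) * snd R) * (poly (lift d) (fst R) + poly (lift e) (fst R) * snd R)
     = poly (lift (a * d + b * e * cubic W)) (fst R) + poly (lift (a * e + b * d - b * e * psi W)) (fst R) * snd R"
    if "generic_pt W R" for R
  proof -
    define A B E F S C w where "A = poly (lift a) (fst R)" and "B = poly (lift b) (fst R)" and "E = poly (lift d) (fst R)"
      and "F = poly (lift e) (fst R)" and "S = poly (lift (psi W)) (fst R)" and "C = poly (lift (cubic W)) (fst R)" and "w = snd R"
    have "(A + B * w) * (E + F * w) = A * E + (A * F + B * E) * w + B * F * w^2" by Groebner_Basis.algebra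
    also have "w^2 = C - S * w" using generic_on[OF that] by (simp add: w_def S_def C_def)
    finally show ?thesis by (simp add: cf.mps A_def B_def E_def F_def S_def C_def w_def algebra_simps)
  qed
  show ?thesis unfolding specialization_def
    by (rule exI[of _ "a * d + b * e * cubic W"], rule exI[of _ "a * e + b * d - b * e * psi W"], rule exI[of _ "c * f"])
       (simp only: 1 2 *[OF g, symmetric] *[OF g', symmetric] cf.mp_mult poly_mult times_divide_times_eq, use 1 2 in simp)
qed

lemma sp_uminus: "sp u u' \<Longrightarrow> sp (- u) (- u')"
  using sp_mult[OF sp_const[of "- 1"]] by (simp add: cf.hs)

lemma sp_diff: "sp u u' \<Longrightarrow> sp v v' \<Longrightarrow> sp (u - v) (u' - v')"
  using sp_add[OF _ sp_uminus] by fastforce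

lemma sp_inverse: assumes "sp u u'" shows "sp (inverse u) (inverse u')"
proof (cases "u = 0")
  case True
  then have "u' = 0" using sp_0[OF assms] by simp
  then show ?thesis using True sp_const[of 0] by (simp add: cf.h_0)
next
  case False
  obtain a b c where 1: "c \<noteq> 0" "u = (poly (lift a) (fst Q) + poly (lift b) (fst Q) * snd Q) / poly (lift c) (fst Q)"
     "u' = (poly (lift a) (fst Q') + poly (lift b) (fst Q') * snd Q') / poly (lift c) (fst Q')"
    using assms(1) unfolding specialization_def by blast
  define n where "n = a^2 - a * b * psi W - b^2 * cubic W"
  have ab: "a \<noteq> 0 \<or> b \<noteq> 0" using 1 False by auto
  then have n: "n \<noteq> 0" using norm_degree(2) unfolding n_def by blast
  have *: "inverse ((poly (lift a) (fst R) + poly (lift b) (fst R) * snd R) / poly (lift c) (fst R)) =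
      (poly (lift (c * (a - b * psi W))) (fst R) + poly (lift (- (c * b))) (fst R) * snd R) / poly (lift n) (fst R)"
    if R: "generic_pt W R" for R
  proof -
    define e where "e = poly (lift a) (fst R) + poly (lift b) (fst R) * snd R"
    define f where "f = poly (lift (a - b * psi W)) (fst R) - poly (lift b) (fst R) * snd R"
    have "e * f = poly (lift n) (fst R)" unfolding e_def f_def n_def by (rule generic_norm[OF R])
    moreover have "e \<noteq> 0" "poly (lift c) (fst R) \<noteq> 0" "poly (lift n) (fst R) \<noteq> 0"
      using generic_linear_nz[OF R ab] generic_nz[OF R] 1 n by (auto simp: e_def)
    ultimately have "inverse (e / poly (lift c) (fst R)) = poly (lift c) (fst R) * f / poly (lift n) (fst R)"
      by (simp add: field_simps)
    then show ?thesis unfolding e_def f_def by (simp add: cf.mps algebra_simps)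
  qed
  show ?thesis unfolding specialization_def 1 *[OF g] *[OF g'] using n by blast
qed

lemma sp_divide: "sp u u' \<Longrightarrow> sp v v' \<Longrightarrow> sp (u / v) (u' / v')"
  unfolding divide_inverse by (intro sp_mult sp_inverse)

lemma sp_power: "sp u u' \<Longrightarrow> sp (u ^ n) (u' ^ n)"
  by (induction n) (use sp_const[of 1] in \<open>auto simp: cf.h_1 sp_mult\<close>)

lemma sp_eq: "sp u u' \<Longrightarrow> sp v v' \<Longrightarrow> u = v \<longleftrightarrow> u' = v'"
  using sp_0[OF sp_diff[of u u' v v']] by simp

definition "spp R R' \<longleftrightarrow> sp (fst R) (fst R') \<and> sp (snd R) (snd R')"

lemma spp_base: "spp Q Q'" using sp_x sp_y by (simp add: spp_def)

lemma spp_eq: "spp R R' \<Longrightarrow> spp S S' \<Longrightarrow> R = S \<longleftrightarrow> R' = S'"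
  using sp_eq by (auto simp: spp_def prod_eq_iff)

lemma spp_neg: assumes "spp R R'"
  shows "spp (neg_pt (map_weierstrass const_func W) R) (neg_pt (map_weierstrass const_func W) R')"
  using assms unfolding spp_def neg_pt_def poly_psi cf.map_weierstrass_sel fst_conv snd_conv
  by (auto intro!: sp_diff sp_uminus sp_add sp_mult sp_const)

lemma spp_third: assumes "spp R R'"
  shows "spp (third_pt (map_weierstrass const_func W) (const_func c, const_func d) R)
             (third_pt (map_weierstrass const_func W) (const_func c, const_func d) R')"
  using assms unfolding spp_def third_pt_def slope_def Let_def cf.map_weierstrass_sel fst_conv snd_conv
  by (intro conjI sp_diff sp_add sp_mult sp_const sp_divide sp_power) simp_all

lemma spp_step: assumes "spp R R'"
  shows "spp ((step (map_weierstrass const_func W) (const_func c, const_func d) ^^ n) R)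
             ((step (map_weierstrass const_func W) (const_func c, const_func d) ^^ n) R')"
  by (induction n) (use assms in \<open>auto simp: step_def intro!: spp_neg spp_third\<close>)

end

section \<open>The order of a kernel point\<close>

text \<open>The hypothesis says that \<open>N / D\<close> has derivative zero; by coprimality
  \<open>N\<close> divides \<open>pderiv N\<close>, which the degrees forbid unless the latter is
  zero.\<close>

lemma dvd_deriv_imp_0:
  fixes N :: "'a::field poly"
  assumes "u * N + v * D = 1" "pderiv N * D = N * pderiv D" shows "pderiv N = 0"
proof (rule ccontr)
  assume n0: "pderiv N \<noteq> 0"
  have *: "n' * (u * N + v * D) = N * (u * n') + v * (n' * D)" "N * (u * n') + v * (N * d') = N * (u * n' + v * d')"
    for n' d' by (simp_all only: algebra_simps)
  have "pderiv N = N * (u * pderiv N + v * pderiv D)"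
    using *(1)[of "pderiv N"] unfolding assms *(2) by simp
  then have "N dvd pderiv N" by (rule dvdI)
  then have "degree N \<le> degree (pderiv N)" using n0 by (rule dvd_imp_degree_le)
  moreover have "degree (pderiv N) < degree N"
  proof -
    have "degree N > 0" using n0 by (auto intro: Nat.gr0I elim!: degree_eq_zeroE simp: pderiv_pCons)
    moreover have "degree (pderiv N) \<le> degree N - 1"
      by (rule degree_le) (auto simp: coeff_pderiv coeff_eq_0)
    ultimately show ?thesis by linarith
  qed
  ultimately show False by simp
qed

lemma pderiv_nz:
  fixes N :: "'a::field poly"
  assumes "of_nat (degree N) \<noteq> (0 :: 'a)" shows "pderiv N \<noteq> 0"
proof
  assume "pderiv N = 0"
  moreover have d: "degree N \<noteq> 0" using assms by (metis of_nat_0)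
  ultimately have "of_nat (Suc (degree N - 1)) * coeff N (Suc (degree N - 1)) = 0"
    by (metis coeff_pderiv coeff_0)
  then have "of_nat (degree N) * lead_coeff N = 0" using d by simp
  then show False using assms d by auto
qed

lemma funpow_split: "i \<le> j \<Longrightarrow> (f ^^ j) x = (f ^^ i) ((f ^^ (j - i)) x)"
  using funpow_add[of i "j - i" f] by simp

lemma funpow_split': "i \<le> j \<Longrightarrow> (f ^^ j) x = (f ^^ (j - i)) ((f ^^ i) x)"
  using funpow_add[of "j - i" i f] by simp

locale kernel_point =
  fixes W W' :: "'f::alg_closed_field weierstrass" and N D A B H :: "'f poly" and xP yP :: 'f
  assumes data: "isogeny_data W W' N D A B H"
    and l_prime: "Factorial_Ring.prime (degree N)" and l_odd: "degree N > 2"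
    and l_nz: "of_nat (degree N) \<noteq> (0 :: 'f)"
    and P_on: "on_affine W xP yP" and P_ker: "poly D xP = 0"
begin

abbreviation "\<chi> \<equiv> fibre N D"
abbreviation "Wc \<equiv> map_weierstrass const_func W"
abbreviation "Pc \<equiv> (const_func xP, const_func yP)"

definition "Z = {z. poly \<chi> z = 0}"
text \<open>Both points above each abscissa belong to it, so it covers the fibres over
  \<open>(x_func, g)\<close> and over its negative and is stable under negation.\<close>

definition "\<Phi> = {Q. fst Q \<in> Z \<and> on_pt Wc Q}"

lemma deg: "degree D < degree N" and uv: "\<exists>u v. u * N + v * D = 1" and D0: "D \<noteq> 0"
  and W0: "discriminant W \<noteq> 0"
  using data unfolding isogeny_data_def by blast+

lemma Z_not_const: "z \<in> Z \<Longrightarrow> z \<notin> range const_func"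
  using uv fibre_root_not_const unfolding Z_def by blast

lemma \<Phi>_generic: "Q \<in> \<Phi> \<Longrightarrow> generic_pt W Q"
  using Z_not_const by (auto simp: \<Phi>_def generic_pt_def)

lemma Z_eq: "z \<in> Z \<longleftrightarrow> poly (lift N) z = x_func * poly (lift D) z"
  by (simp add: Z_def fibre_def)

text \<open>A multiple root would annihilate the numerator of the derivative of \<open>N / D\<close>
  at a transcendental element, so this derivative would be zero, against the degree being
  invertible.\<close>

lemma card_Z: "card Z = degree N" and finite_Z: "finite Z"
proof -
  have \<chi>0: "\<chi> \<noteq> 0" and d\<chi>: "degree \<chi> = degree N" using degree_fibre[OF deg] by auto
  obtain u v where uv: "u * N + v * D = 1" using uv by blast
  have simple: "order z \<chi> = 1" if z: "z \<in> Z" for z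
  proof -
    have z0: "poly \<chi> z = 0" using z by (simp add: Z_def)
    have o: "order z \<chi> > 0" using z0 \<chi>0 by (simp add: order_root)
    have "\<not> order z \<chi> \<ge> 2"
    proof
      assume "order z \<chi> \<ge> 2"
      then have "[:-z, 1:]^2 dvd \<chi>" using order_divides by blast
      then obtain r where r: "\<chi> = [:-z,1:]^2 * r" by (elim dvdE)
      have "pderiv \<chi> = [:-z,1:] * (2 * (pderiv [:-z,1:] * r) + [:-z,1:] * pderiv r)"
        unfolding r power2_eq_square pderiv_mult by (simp only: algebra_simps mult_2)
      then have "poly (pderiv \<chi>) z = 0" by simp
      moreover have "pderiv \<chi> = lift (pderiv N) - smult x_func (lift (pderiv D))"
        by (rule poly_eqI) (simp add: fibre_def coeff_pderiv cf.coeff_mp cf.hs algebra_simps flip: cf.h_of_nat)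
      ultimately have 1: "poly (lift (pderiv N)) z = x_func * poly (lift (pderiv D)) z" by simp
      have "poly (lift (pderiv N * D - N * pderiv D)) z = 0"
        using 1 z[unfolded Z_eq] by (simp add: cf.mps)
      then have "pderiv N * D - N * pderiv D = 0"
        using transcendental[OF Z_not_const[OF z]] by blast
      then have "pderiv N = 0" using dvd_deriv_imp_0[OF uv] by simp
      then show False using pderiv_nz[OF l_nz] by simp
    qed
    then show ?thesis using o by simp
  qed
  have set: "set_mset (proots \<chi>) = Z" using \<chi>0 by (simp add: Z_def)
  then show "finite Z" by (metis finite_set_mset)
  have "size (proots \<chi>) = (\<Sum>z\<in>Z. count (proots \<chi>) z)"
    unfolding size_multiset_overloaded_eq set ..
  also have "\<dots> = (\<Sum>z\<in>Z. 1)" using simple \<chi>0 by (intro sum.cong) auto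
  finally have "size (proots \<chi>) = card (set_mset (proots \<chi>))" by (simp add: set)
  then show "card Z = degree N" using proots_split(2)[OF \<chi>0] d\<chi> set by simp
qed

lemma neg_\<Phi>: "Q \<in> \<Phi> \<Longrightarrow> neg_pt Wc Q \<in> \<Phi>"
  using neg_on by (auto simp: \<Phi>_def neg_pt_def)

lemma P_on_c: "on_pt Wc Pc" using cf.map_on_affine[OF P_on] by simp

lemma \<Phi>_ne: "Q \<in> \<Phi> \<Longrightarrow> fst Pc \<noteq> fst Q"
  using Z_not_const[of "fst Q"] unfolding \<Phi>_def by (metis (no_types, lifting) fst_conv mem_Collect_eq rangeI)

text \<open>The points of the fibre are not defined over \<open>'f\<close>, so the translation lemma
  is applied with the algebraic closure of the function field as its base field.\<close>

lemma third_\<Phi>: assumes Q: "Q \<in> \<Phi>" shows "third_pt Wc Pc Q \<in> \<Phi>"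
proof -
  have on: "on_pt Wc Q" and z: "fst Q \<in> Z" using Q by (auto simp: \<Phi>_def)
  have "poly (lift D) (const_func xP) = 0" using P_ker by (simp add: cf.poly_mp cf.h_0)
  from translation_by_kernel[OF cf.isogeny_data_map[OF data] this third_pt_line[OF P_on_c on \<Phi>_ne[OF Q], unfolded fst_conv]]
  have "poly (lift N) (fst Q) * poly (lift D) (fst (third_pt Wc Pc Q)) = poly (lift N) (fst (third_pt Wc Pc Q)) * poly (lift D) (fst Q)" .
  moreover have "poly (lift D) (fst Q) \<noteq> 0" using transcendental[OF Z_not_const[OF z] D0] .
  ultimately have "fst (third_pt Wc Pc Q) \<in> Z" using z unfolding Z_eq by (simp add: mult_ac)
  then show ?thesis using third_pt_on[OF P_on_c on \<Phi>_ne[OF Q]] by (simp add: \<Phi>_def)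
qed

lemma third_third_\<Phi>: "Q \<in> \<Phi> \<Longrightarrow> third_pt Wc Pc (third_pt Wc Pc Q) = Q"
  by (rule third_third[OF \<Phi>_ne \<Phi>_ne[OF third_\<Phi>, THEN not_sym]])

abbreviation "\<tau> \<equiv> step Wc Pc"

lemma step_\<Phi>: "Q \<in> \<Phi> \<Longrightarrow> \<tau> Q \<in> \<Phi>" by (simp add: step_def neg_\<Phi> third_\<Phi>)

lemma steps_\<Phi>: "Q \<in> \<Phi> \<Longrightarrow> (\<tau> ^^ n) Q \<in> \<Phi>" by (induction n) (auto simp: step_\<Phi>)

lemma step_inj: assumes "Q \<in> \<Phi>" "R \<in> \<Phi>" "\<tau> Q = \<tau> R" shows "Q = R"
proof -
  have "third_pt Wc Pc Q = third_pt Wc Pc R" using assms(3) unfolding step_def by (metis neg_neg)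
  then show ?thesis using third_third_\<Phi> assms by metis
qed

lemma steps_inj: assumes "Q \<in> \<Phi>" "R \<in> \<Phi>" "(\<tau> ^^ n) Q = (\<tau> ^^ n) R" shows "Q = R"
  using assms(3) by (induction n) (use assms steps_\<Phi> step_inj in auto)

lemma finite_\<Phi>: "finite \<Phi>"
proof -
  have "finite {w. on_affine Wc z w}" for z
  proof -
    have "{w. on_affine Wc z w} = {w. poly [:- poly (cubic Wc) z, poly (psi Wc) z, 1:] w = 0}"
      by (auto simp: on_affine_def algebra_simps power2_eq_square)
    moreover have "finite {w. poly [:- poly (cubic Wc) z, poly (psi Wc) z, 1:] w = 0}"
      by (rule poly_roots_finite) simp
    ultimately show ?thesis by (simp only:)
  qed
  moreover have "\<Phi> \<subseteq> (\<Union>z\<in>Z. {z} \<times> {w. on_affine Wc z w})" by (auto simp: \<Phi>_def)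
  ultimately show ?thesis using finite_Z by (meson finite_SigmaI finite_subset finite_UN finite_cartesian_product finite.intros)
qed

lemma above: assumes "z \<in> Z" obtains Q where "Q \<in> \<Phi>" "fst Q = z"
proof -
  obtain w where "poly [:- poly (cubic Wc) z, poly (psi Wc) z, 1:] w = 0"
    using alg_closed_imp_poly_has_root[of "[:- poly (cubic Wc) z, poly (psi Wc) z, 1:]"] by auto
  then have "on_affine Wc z w" by (simp add: on_affine_def algebra_simps power2_eq_square)
  then show ?thesis using that[of "(z, w)"] assms by (simp add: \<Phi>_def)
qed

text \<open>All points of the fibre are generic, hence indistinguishable over the constants; this
  makes all orbits equally long.\<close>

lemma transfer:
  assumes "Q \<in> \<Phi>" "Q' \<in> \<Phi>"
  shows "(\<tau> ^^ n) Q = Q \<longleftrightarrow> (\<tau> ^^ n) Q' = Q'"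
    "(\<tau> ^^ n) Q = neg_pt Wc Q \<longleftrightarrow> (\<tau> ^^ n) Q' = neg_pt Wc Q'"
proof -
  interpret two_generic W Q Q' using assms by unfold_locales (auto intro: \<Phi>_generic)
  show "(\<tau> ^^ n) Q = Q \<longleftrightarrow> (\<tau> ^^ n) Q' = Q'" "(\<tau> ^^ n) Q = neg_pt Wc Q \<longleftrightarrow> (\<tau> ^^ n) Q' = neg_pt Wc Q'"
    by (intro spp_eq spp_step spp_base spp_neg)+
qed

lemma neg_ne: assumes "Q \<in> \<Phi>" shows "neg_pt Wc Q \<noteq> Q"
proof
  assume "neg_pt Wc Q = Q"
  then have a: "- snd Q - poly (psi Wc) (fst Q) = snd Q" by (simp add: neg_pt_def prod_eq_iff)
  have "poly (psi Wc) (fst Q) + 2 * snd Q = snd Q - (- snd Q - poly (psi Wc) (fst Q))" by (simp add: algebra_simps)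
  also have "\<dots> = 0" unfolding a by simp
  finally have "poly (psi Wc) (fst Q) + 2 * snd Q = 0" .
  moreover have "poly (psi Wc) (fst Q) + 2 * snd Q = poly (lift (psi W)) (fst Q) + poly (lift 2) (fst Q) * snd Q"
    by (simp only: cf.mp_psi cf.mp_numeral) simp
  ultimately have "psi W = 0 \<and> (2 :: 'f poly) = 0"
    using generic_linear_nz[OF \<Phi>_generic[OF assms], of "psi W" 2] by metis
  then have z: "a1 W = 0" "a3 W = 0" "(2 :: 'f) = 0" by (auto simp: psi_def numeral_poly)
  have "(4 :: 'f) = 2 * 2" by simp
  then have 4: "(4 :: 'f) = 0" unfolding z(3) by simp
  have b: "b2 W = 0" "b4 W = 0" "b6 W = 0"
    using z 4 by (simp_all add: b2_def b4_def b6_def)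
  have "discriminant W = 0" unfolding discriminant_b b by simp
  then show False using W0 by simp
qed

text \<open>A chord that meets the curve again above \<open>Q\<close> would impose a nontrivial
  relation linear in \<open>y\<close> on the generic point \<open>Q\<close>.\<close>

lemma third_ne: assumes "Q \<in> \<Phi>" shows "fst (third_pt Wc Pc Q) \<noteq> fst Q"
proof
  assume eq: "fst (third_pt Wc Pc Q) = fst Q"
  define z w where "z = fst Q" and "w = snd Q"
  have gen: "generic_pt W Q" by (rule \<Phi>_generic[OF assms])
  define m where "m = slope Pc Q"
  have m: "m * (z - const_func xP) = w - const_func yP" using slope_eq[OF \<Phi>_ne[OF assms]] by (simp add: m_def z_def w_def)
  have "m^2 + const_func (a1 W) * m - const_func (a2 W) - const_func xP - 2 * z = 0"
    using eq by (simp add: third_pt_def Let_def cf.map_weierstrass_sel z_def m_def) Groebner_Basis.algebra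
  then have "(z - const_func xP)^2 * (m^2 + const_func (a1 W) * m - const_func (a2 W) - const_func xP - 2 * z) = 0" by simp
  moreover have "(z - const_func xP)^2 * (m^2 + const_func (a1 W) * m - const_func (a2 W) - const_func xP - 2 * z)
    = (m * (z - const_func xP))^2 + const_func (a1 W) * (m * (z - const_func xP)) * (z - const_func xP)
      - (const_func (a2 W) + const_func xP + 2 * z) * (z - const_func xP)^2" by Groebner_Basis.algebra
  ultimately have e: "(w - const_func yP)^2 + const_func (a1 W) * (w - const_func yP) * (z - const_func xP)
      - (const_func (a2 W) + const_func xP + 2 * z) * (z - const_func xP)^2 = 0" unfolding m by simp
  have w2: "w^2 = poly (lift (cubic W)) z - poly (lift (psi W)) z * w" using generic_on[OF gen] by (simp add: z_def w_def)
  define a b where "a = cubic W + [:yP^2:] - smult (a1 W * yP) [:-xP, 1:] - [:a2 W + xP, 2:] * [:-xP, 1:]^2"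
    and "b = smult (a1 W) [:-xP, 1:] - psi W - [:2 * yP:]"
  have "poly (lift a) z + poly (lift b) z * w = poly (lift (cubic W)) z - poly (lift (psi W)) z * w + (const_func yP^2 - 2 * w * const_func yP)
      + const_func (a1 W) * (w - const_func yP) * (z - const_func xP) - (const_func (a2 W) + const_func xP + 2 * z) * (z - const_func xP)^2"
    unfolding a_def b_def cf.mps cf.hs by (simp add: algebra_simps)
  also have "\<dots> = 0" unfolding w2[symmetric] using e by (simp add: power2_eq_square algebra_simps)
  finally have "a = 0" using generic_linear_nz[OF gen, of a b] by (auto simp: z_def w_def)
  \<comment> \<open>The cubic contributes 1 and the product with \<open>2\<close> contributes - 2;
    the result is nonzero in every characteristic.\<close>
  moreover have "coeff a 3 = - 1"
    by (simp add: a_def cubic_def power2_eq_square numeral_3_eq_3 coeff_pCons)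
  ultimately show False by simp
qed

lemma step_ne: assumes "Q \<in> \<Phi>" shows "\<tau> Q \<noteq> Q" "\<tau> Q \<noteq> neg_pt Wc Q"
  using third_ne[OF assms] by (auto simp: step_def neg_pt_def prod_eq_iff)

definition "base = (SOME Q. Q \<in> \<Phi>)"

lemma base: "base \<in> \<Phi>"
proof -
  have "Z \<noteq> {}" using card_Z l_odd by auto
  then obtain Q where "Q \<in> \<Phi>" using above by blast
  then show ?thesis unfolding base_def by (rule someI)
qed

definition "n = (LEAST n. n > 0 \<and> (\<tau> ^^ n) base = base)"

lemma n: "n > 0" "(\<tau> ^^ n) base = base"
proof -
  have "\<exists>n>0. (\<tau> ^^ n) base = base"
  proof -
    define f where "f = (\<lambda>n. (\<tau> ^^ n) base)"
    have "range f \<subseteq> \<Phi>" using steps_\<Phi>[OF base] by (auto simp: f_def)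
    then have fin: "finite (range f)" using finite_\<Phi> by (rule finite_subset)
    have "\<exists>i j. i < j \<and> f i = f j"
    proof (rule ccontr)
      assume no: "\<not> ?thesis"
      have "inj f" by (rule linorder_injI) (use no in blast)
      then have "finite (UNIV :: nat set)" using fin finite_imageD by blast
      then show False by simp
    qed
    then obtain i j where ij: "i < j" "(\<tau> ^^ i) base = (\<tau> ^^ j) base" unfolding f_def by blast
    have "(\<tau> ^^ j) base = (\<tau> ^^ i) ((\<tau> ^^ (j - i)) base)" using ij(1) by (intro funpow_split) simp
    then have "(\<tau> ^^ i) base = (\<tau> ^^ i) ((\<tau> ^^ (j - i)) base)" using ij(2) by simp
    then have "base = (\<tau> ^^ (j - i)) base" by (rule steps_inj[OF base steps_\<Phi>[OF base]])
    then show ?thesis using ij(1) by (intro exI[of _ "j - i"]) auto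
  qed
  then have "n > 0 \<and> (\<tau> ^^ n) base = base" unfolding n_def
    by (rule LeastI_ex[of "\<lambda>n. n > 0 \<and> (\<tau> ^^ n) base = base"])
  then show "n > 0" "(\<tau> ^^ n) base = base" by auto
qed

lemma n_all: "Q \<in> \<Phi> \<Longrightarrow> (\<tau> ^^ n) Q = Q" using transfer(1)[OF base] n by blast

lemma n_min: "Q \<in> \<Phi> \<Longrightarrow> m > 0 \<Longrightarrow> (\<tau> ^^ m) Q = Q \<Longrightarrow> n \<le> m"
  using transfer(1)[OF base, of Q m] unfolding n_def by (intro Least_le) auto

text \<open>Translation by \<open>P\<close> carried through negation is translation by
  \<open>- P\<close>, which is the inverse of \<open>\<tau>\<close>, that is
  \<open>\<tau> ^^ (n - 1)\<close>.\<close>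

lemma step_neg: assumes "Q \<in> \<Phi>" shows "\<tau> (neg_pt Wc Q) = neg_pt Wc ((\<tau> ^^ (n - 1)) Q)"
proof -
  define R where "R = (\<tau> ^^ (n - 1)) Q"
  have R: "R \<in> \<Phi>" using assms by (simp add: R_def steps_\<Phi>)
  have "\<tau> R = (\<tau> ^^ Suc (n - 1)) Q" by (simp add: R_def)
  also have "\<dots> = Q" using n(1) n_all[OF assms] by simp
  finally have "neg_pt Wc (third_pt Wc Pc R) = Q" by (simp add: step_def)
  then have "third_pt Wc Pc R = neg_pt Wc Q" by (metis neg_neg)
  then have "third_pt Wc Pc (neg_pt Wc Q) = R" using third_third_\<Phi>[OF R] by simp
  then show ?thesis by (simp add: step_def R_def)
qed

lemma steps_neg: assumes "Q \<in> \<Phi>" shows "(\<tau> ^^ i) (neg_pt Wc Q) = neg_pt Wc ((\<tau> ^^ (i * (n - 1))) Q)"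
proof (induction i)
  case (Suc i)
  then show ?case using step_neg[OF steps_\<Phi>[OF assms, of "i * (n - 1)"]] by (simp add: funpow_add)
qed simp

text \<open>
  If negation were a translation, it would commute with the translation by \<open>P\<close>, which it inverts.
\<close>

lemma not_neg: assumes "Q \<in> \<Phi>" shows "(\<tau> ^^ m) Q \<noteq> neg_pt Wc Q"
proof
  assume m: "(\<tau> ^^ m) Q = neg_pt Wc Q"
  have all: "(\<tau> ^^ m) R = neg_pt Wc R" if "R \<in> \<Phi>" for R using transfer(2)[OF assms that] m by blast
  have "\<tau> (neg_pt Wc Q) = (\<tau> ^^ m) (\<tau> Q)" unfolding m[symmetric] by (simp add: funpow_swap1)
  also have "\<dots> = neg_pt Wc (\<tau> Q)" by (rule all[OF step_\<Phi>[OF assms]])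
  finally have "neg_pt Wc ((\<tau> ^^ (n - 1)) Q) = neg_pt Wc (\<tau> Q)" using step_neg[OF assms] by simp
  then have "(\<tau> ^^ (n - 1)) Q = \<tau> Q" by (metis neg_neg)
  then have "\<tau> ((\<tau> ^^ (n - 1)) Q) = \<tau> (\<tau> Q)" by simp
  moreover have "\<tau> ((\<tau> ^^ (n - 1)) Q) = (\<tau> ^^ Suc (n - 1)) Q" by simp
  ultimately have two: "(\<tau> ^^ 2) Q = Q" using n(1) n_all[OF assms] by (simp add: numeral_2_eq_2)
  have "(\<tau> ^^ (2 * k)) Q = Q" for k by (induction k) (use two in \<open>simp_all add: numeral_2_eq_2\<close>)
  \<comment> \<open>Now \<open>\<tau>\<close> is an involution at \<open>Q\<close>, so its powers
    are the identity and \<open>\<tau>\<close>, and neither negates \<open>Q\<close>.\<close>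
  then have "(\<tau> ^^ m) Q = Q \<or> (\<tau> ^^ m) Q = \<tau> Q" by (cases "even m") (auto elim!: evenE oddE)
  then show False using m neg_ne[OF assms] step_ne[OF assms] by auto
qed

lemma orbit_inj: assumes "Q \<in> \<Phi>" shows "inj_on (\<lambda>j. fst ((\<tau> ^^ j) Q)) {..<n}"
proof -
  have "fst ((\<tau> ^^ i) Q) \<noteq> fst ((\<tau> ^^ j) Q)" if "i < j" "j < n" for i j
  proof
    assume eq: "fst ((\<tau> ^^ i) Q) = fst ((\<tau> ^^ j) Q)"
    define R where "R = (\<tau> ^^ i) Q"
    have R: "R \<in> \<Phi>" using assms by (simp add: R_def steps_\<Phi>)
    have j: "(\<tau> ^^ j) Q = (\<tau> ^^ (j - i)) R" unfolding R_def using that(1) by (intro funpow_split') simp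
    have "(\<tau> ^^ (j - i)) R = R \<or> (\<tau> ^^ (j - i)) R = neg_pt Wc R"
      using eq R steps_\<Phi>[OF R, of "j - i"] unfolding j R_def[symmetric] by (intro same_x) (auto simp: \<Phi>_def)
    then have "(\<tau> ^^ (j - i)) R = R" using not_neg[OF R] by blast
    then have "n \<le> j - i" using that by (intro n_min[OF R]) auto
    then show False using that by simp
  qed
  then show ?thesis by (intro inj_onI) (metis lessThan_iff linorder_neqE_nat)
qed

text \<open>The abscissae are partitioned by the orbits of \<open>\<tau>\<close>. Starting from
  \<open>- Q\<close> instead of \<open>Q\<close> runs through the same abscissae backwards, so the
  classes are well defined; by \<open>orbit_inj\<close> each has \<open>n\<close> elements.\<close>

lemma n_dvd: "n dvd degree N"
proof -
  define r where "r = {(z, z'). z \<in> Z \<and> (\<exists>Q j. Q \<in> \<Phi> \<and> fst Q = z \<and> fst ((\<tau> ^^ j) Q) = z')}"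
  have r_def': "(z, z') \<in> r \<longleftrightarrow> z \<in> Z \<and> (\<exists>j. fst ((\<tau> ^^ j) Q) = z')" if "Q \<in> \<Phi>" "fst Q = z" for Q z z'
  proof
    assume "(z, z') \<in> r"
    then obtain R j where R: "z \<in> Z" "R \<in> \<Phi>" "fst R = z" "fst ((\<tau> ^^ j) R) = z'" by (auto simp: r_def)
    have "R = Q \<or> R = neg_pt Wc Q" using R that by (intro same_x) (auto simp: \<Phi>_def)
    then show "z \<in> Z \<and> (\<exists>j. fst ((\<tau> ^^ j) Q) = z')"
    proof
      assume "R = neg_pt Wc Q"
      then have "fst ((\<tau> ^^ (j * (n - 1))) Q) = z'" using R(4) steps_neg[OF that(1), of j] by (simp add: neg_pt_def)
      then show ?thesis using R(1) by blast
    qed (use R in auto)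
  next
    assume "z \<in> Z \<and> (\<exists>j. fst ((\<tau> ^^ j) Q) = z')"
    then show "(z, z') \<in> r" using that unfolding r_def by blast
  qed
  have mod: "(\<tau> ^^ j) Q = (\<tau> ^^ (j mod n)) Q" if "Q \<in> \<Phi>" for Q j
  proof -
    have k: "(\<tau> ^^ (n * k)) Q = Q" for k
      by (induction k) (use n_all[OF that] in \<open>simp_all add: funpow_add\<close>)
    have "(\<tau> ^^ j) Q = (\<tau> ^^ (j mod n + n * (j div n))) Q" by simp
    also have "\<dots> = (\<tau> ^^ (j mod n)) Q" unfolding funpow_add o_apply k ..
    finally show ?thesis .
  qed
  have rZ: "z \<in> Z \<and> z' \<in> Z" if "(z, z') \<in> r" for z z'
    using that steps_\<Phi> by (fastforce simp: r_def \<Phi>_def)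
  have "equiv Z r"
  proof (rule equivI)
    show "r \<subseteq> Z \<times> Z" using rZ by auto
    show "refl_on Z r"
    proof (rule refl_onI)
      fix z assume "z \<in> Z"
      then obtain Q where "Q \<in> \<Phi>" "fst Q = z" using above by blast
      then show "(z, z) \<in> r" using r_def'[of Q z z] \<open>z \<in> Z\<close> by (metis funpow_0)
    qed
    show "sym r"
    proof (rule symI)
      fix z z' assume zz: "(z, z') \<in> r"
      then obtain Q where Q: "Q \<in> \<Phi>" "fst Q = z" using above rZ by metis
      then obtain j where j: "fst ((\<tau> ^^ j) Q) = z'" using zz r_def' by blast
      define i where "i = j mod n"
      have i: "i < n" using n(1) by (simp add: i_def)
      have "(\<tau> ^^ (n - i)) ((\<tau> ^^ i) Q) = (\<tau> ^^ n) Q" using i by (intro funpow_split'[symmetric]) simp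
      then have "fst ((\<tau> ^^ (n - i)) ((\<tau> ^^ j) Q)) = z" using n_all[OF Q(1)] mod[OF Q(1), of j] Q(2) by (simp add: i_def)
      then show "(z', z) \<in> r" using r_def'[OF steps_\<Phi>[OF Q(1)] j] rZ[OF zz] by blast
    qed
    show "trans r"
    proof (rule transI)
      fix x y z assume xy: "(x, y) \<in> r" and yz: "(y, z) \<in> r"
      obtain Q where Q: "Q \<in> \<Phi>" "fst Q = x" using above rZ[OF xy] by metis
      obtain j where j: "fst ((\<tau> ^^ j) Q) = y" using xy r_def'[OF Q] by blast
      obtain i where i: "fst ((\<tau> ^^ i) ((\<tau> ^^ j) Q)) = z" using yz r_def'[OF steps_\<Phi>[OF Q(1)] j] by blast
      then have "fst ((\<tau> ^^ (i + j)) Q) = z" by (simp add: funpow_add)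
      then show "(x, z) \<in> r" using r_def'[OF Q] rZ[OF xy] by blast
    qed
  qed
  moreover have "n dvd card C" if C: "C \<in> Z // r" for C
  proof -
    obtain z where z: "z \<in> Z" "C = r `` {z}" by (rule quotientE[OF C])
    obtain Q where Q: "Q \<in> \<Phi>" "fst Q = z" using above z by metis
    have "C = (\<lambda>j. fst ((\<tau> ^^ j) Q)) ` {..<n}"
    proof
      show "C \<subseteq> (\<lambda>j. fst ((\<tau> ^^ j) Q)) ` {..<n}"
      proof
        fix c assume "c \<in> C"
        then obtain j where "c = fst ((\<tau> ^^ j) Q)" using z r_def'[OF Q] by auto
        then have "c = fst ((\<tau> ^^ (j mod n)) Q)" using mod[OF Q(1), of j] by simp
        then show "c \<in> (\<lambda>j. fst ((\<tau> ^^ j) Q)) ` {..<n}" using n(1) by auto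
      qed
      show "(\<lambda>j. fst ((\<tau> ^^ j) Q)) ` {..<n} \<subseteq> C" using z r_def'[OF Q] by auto
    qed
    then show ?thesis using card_image[OF orbit_inj[OF Q(1)]] by simp
  qed
  ultimately show ?thesis using equiv_imp_dvd_card[OF finite_Z] card_Z by metis
qed

text \<open>\<open>n\<close> divides a prime and differs from 1, because \<open>\<tau>\<close> has
  no fixed point.\<close>

lemma period: "Q \<in> \<Phi> \<Longrightarrow> (\<tau> ^^ degree N) Q = Q"
proof -
  assume Q: "Q \<in> \<Phi>"
  have "n \<noteq> 1" using n_all[OF Q] step_ne[OF Q] by auto
  then have "n = degree N" using n_dvd l_prime by (metis prime_nat_iff)
  then show ?thesis using n_all[OF Q] by simp
qed

end

section \<open>The Gauss extension of a valuation ring\<close>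

context valuation_ring_set
begin

definition "primitive p \<longleftrightarrow> coeffs_in V p \<and> (\<exists>i. coeff p i \<notin> mx)"

text \<open>Gauss's lemma: at the sum of the two least indices with unit coefficients, exactly one
  term of the convolution is a unit.\<close>

lemma primitive_mult: assumes "primitive p" "primitive q" shows "primitive (p * q)"
proof -
  have c: "coeff p i \<in> V" "coeff q i \<in> V" for i using assms by (auto simp: primitive_def coeffs_in_def)
  define i j where "i = (LEAST i. coeff p i \<notin> mx)" and "j = (LEAST i. coeff q i \<notin> mx)"
  have ij: "coeff p i \<notin> mx" "coeff q j \<notin> mx"
    using LeastI_ex[of "\<lambda>i. coeff p i \<notin> mx"] LeastI_ex[of "\<lambda>i. coeff q i \<notin> mx"] assms
    unfolding primitive_def i_def j_def by blast+
  have low: "k < i \<Longrightarrow> coeff p k \<in> mx" "k < j \<Longrightarrow> coeff q k \<in> mx" for k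
    unfolding i_def j_def by (auto dest: not_less_Least)
  have "coeff (p * q) (i + j) = (\<Sum>k\<le>i+j. coeff p k * coeff q (i + j - k))" by (rule coeff_mult)
  also have "\<dots> = coeff p i * coeff q j + (\<Sum>k\<in>{..i+j} - {i}. coeff p k * coeff q (i + j - k))"
    by (subst sum.remove[of _ i]) auto
  finally have e: "coeff (p * q) (i + j) = coeff p i * coeff q j + (\<Sum>k\<in>{..i+j} - {i}. coeff p k * coeff q (i + j - k))" .
  have s: "(\<Sum>k\<in>{..i+j} - {i}. coeff p k * coeff q (i + j - k)) \<in> mx"
  proof (rule mx.I_sum)
    fix k assume k: "k \<in> {..i+j} - {i}"
    show "coeff p k * coeff q (i + j - k) \<in> mx"
    proof (cases "k < i")
      case True then show ?thesis by (intro mx.I_mult' low c)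
    next
      case False
      then have "i + j - k < j" using k by auto
      then show ?thesis by (intro mx.I_mult low c)
    qed
  qed
  have "coeff (p * q) (i + j) \<notin> mx"
  proof
    assume "coeff (p * q) (i + j) \<in> mx"
    then have "coeff p i * coeff q j \<in> mx" using mx.I_diff[OF _ s] unfolding e by fastforce
    then show False using mx_prime c ij by blast
  qed
  moreover have "coeffs_in V (p * q)" using assms coeffs_in_mult by (auto simp: primitive_def)
  ultimately show ?thesis unfolding primitive_def by blast
qed

lemma primitive_nz: "primitive p \<Longrightarrow> p \<noteq> 0"
  using mx.I_zero by (auto simp: primitive_def)

end

text \<open>\<open>U\<close> extends \<open>V\<close> and the residue of \<open>z\<close> is
  transcendental over that of \<open>V\<close>: this is what \<open>primitive_unit\<close>
  expresses.\<close>

locale gauss_extension = V: valuation_ring_set V for V :: "'f::alg_closed_field set" +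
  fixes U :: "'f func set" and z :: "'f func"
  assumes U: "valuation_ring_set U"
    and const_mx: "v \<in> V.mx \<Longrightarrow> const_func v \<in> valuation_ring_set.mx U"
    and const_V: "v \<in> V \<Longrightarrow> const_func v \<in> U"
    and z_in: "z \<in> U"
    and primitive_unit: "V.primitive p \<Longrightarrow> poly (lift p) z \<notin> valuation_ring_set.mx U"

text \<open>Chevalley's theorem for the quotients of polynomials in \<open>z\<close> with primitive
  denominator; Gauss's lemma keeps these denominators closed under products.\<close>

lemma gauss_extension_exists:
  fixes z :: "'f::alg_closed_field func"
  assumes V': "valuation_ring_set V'" and z: "z \<notin> range const_func"
  obtains U where "gauss_extension V' U z"
proof -
  interpret V: valuation_ring_set V' by (rule V')
  define ev where "ev = (\<lambda>p. poly (lift p) z)"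
  have ev: "ev (p * q) = ev p * ev q" "ev (p - q) = ev p - ev q" "ev (p + q) = ev p + ev q" "ev 1 = 1" "ev 0 = 0" for p q
    by (simp_all add: ev_def cf.mps cf.hs)
  have ev0: "ev p \<noteq> 0" if "p \<noteq> 0" for p using transcendental[OF z that] by (simp add: ev_def)
  have ev_eq: "ev p = ev q \<longleftrightarrow> p = q" for p q using ev0[of "p - q"] ev by auto
  have prim1: "V.primitive 1" unfolding V.primitive_def coeffs_in_def
    by (auto simp: coeff_1 V.closed V.mx_one intro!: exI[of _ 0])
  define A where "A = {ev a / ev b | a b. coeffs_in V' a \<and> V.primitive b}"
  define I where "I = {ev a / ev b | a b. coeffs_in V.mx a \<and> V.primitive b}"
  have A_I: "ev a / ev b \<in> A" if "coeffs_in V' a" "V.primitive b" for a b using that by (auto simp: A_def)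
  have I_I: "ev a / ev b \<in> I" if "coeffs_in V.mx a" "V.primitive b" for a b using that by (auto simp: I_def)
  have prim_V: "coeffs_in V' b" if "V.primitive b" for b using that by (simp add: V.primitive_def)
  have mx_coeffs: "coeffs_in V' b" if "coeffs_in V.mx b" for b using that V.mx_sub by (auto simp: coeffs_in_def)
  have "ideal_set A I"
  proof
    show "1 \<in> A" using A_I[OF prim_V[OF prim1] prim1] by (simp add: ev)
    show "0 \<in> I" using I_I[OF _ prim1, of 0] by (simp add: ev coeffs_in_def V.mx.I_zero)
    show "I \<subseteq> A" using mx_coeffs by (auto simp: A_def I_def)
  next
    fix x y assume "x \<in> A" "y \<in> A"
    then obtain a b c d where 1: "x = ev a / ev b" "y = ev c / ev d" "coeffs_in V' a" "coeffs_in V' c" "V.primitive b" "V.primitive d"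
      by (auto simp: A_def)
    have nz: "ev b \<noteq> 0" "ev d \<noteq> 0" using 1 ev0 V.primitive_nz by auto
    have "x - y = ev (a * d - c * b) / ev (b * d)" using nz by (simp add: 1 ev diff_frac_eq)
    also have "\<dots> \<in> A" using 1 by (intro A_I V.coeffs_in_diff V.coeffs_in_mult V.primitive_mult) (use 1 prim_V in auto)
    finally show "x - y \<in> A" .
    have "x * y = ev (a * c) / ev (b * d)" by (simp add: 1 ev)
    also have "\<dots> \<in> A" using 1 by (intro A_I V.coeffs_in_mult V.primitive_mult) (use 1 prim_V in auto)
    finally show "x * y \<in> A" .
  next
    fix x y assume "x \<in> I" "y \<in> I"
    then obtain a b c d where 1: "x = ev a / ev b" "y = ev c / ev d" "coeffs_in V.mx a" "coeffs_in V.mx c" "V.primitive b" "V.primitive d"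
      by (auto simp: I_def)
    have nz: "ev b \<noteq> 0" "ev d \<noteq> 0" using 1 ev0 V.primitive_nz by auto
    have "x + y = ev (d * a + b * c) / ev (b * d)" using nz by (simp add: 1 ev add_frac_eq mult_ac)
    also have "\<dots> \<in> I"
    proof (rule I_I)
      have "coeffs_in V.mx (d * a)" "coeffs_in V.mx (b * c)" using 1 by (auto intro: V.mx.coeffs_in_mult_I prim_V)
      then show "coeffs_in V.mx (d * a + b * c)" by (auto simp: coeffs_in_def intro: V.mx.I_add)
    qed (use 1 V.primitive_mult in auto)
    finally show "x + y \<in> I" .
  next
    fix x y assume "x \<in> A" "y \<in> I"
    then obtain a b c d where 1: "x = ev a / ev b" "y = ev c / ev d" "coeffs_in V' a" "coeffs_in V.mx c" "V.primitive b" "V.primitive d"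
      by (auto simp: A_def I_def)
    have "x * y = ev (a * c) / ev (b * d)" by (simp add: 1 ev)
    also have "\<dots> \<in> I" using 1 by (intro I_I V.mx.coeffs_in_mult_I V.primitive_mult)
    finally show "x * y \<in> I" .
  qed
  moreover have "1 \<notin> I"
  proof
    assume "1 \<in> I"
    then obtain a b where 1: "1 = ev a / ev b" "coeffs_in V.mx a" "V.primitive b" by (auto simp: I_def)
    then have "ev a = ev b" using ev0[OF V.primitive_nz] by (auto simp: field_simps)
    then show False using 1 unfolding ev_eq by (auto simp: V.primitive_def coeffs_in_def)
  qed
  ultimately obtain U where U: "valuation_ring_set U" "A \<subseteq> U" "I \<subseteq> valuation_ring_set.mx U" by (rule chevalley)
  interpret U: valuation_ring_set U by fact
  have c: "coeffs_in S [:v:]" if "v \<in> S" "0 \<in> S" for S and v :: 'f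
    using that by (auto simp: coeffs_in_def coeff_pCons split: nat.split)
  have evc: "ev [:v:] = const_func v" for v by (simp add: ev_def cf.mps)
  have "gauss_extension V' U z"
  proof (intro gauss_extension.intro gauss_extension_axioms.intro)
    show "valuation_ring_set V'" "valuation_ring_set U" by fact+
    show "const_func v \<in> U.mx" if "v \<in> V.mx" for v
      using U(3) I_I[OF c[OF that V.mx.I_zero] prim1] by (auto simp: evc ev)
    show "const_func v \<in> U" if "v \<in> V'" for v
      using U(2) A_I[OF c[OF that V.zero_in] prim1] by (auto simp: evc ev)
    have "coeffs_in V' [:0,1:]" by (auto simp: coeffs_in_def coeff_pCons V.closed split: nat.split)
    then have "ev [:0,1:] / ev 1 \<in> A" by (rule A_I[OF _ prim1])
    then show "z \<in> U" using U(2) by (auto simp: ev_def cf.mps cf.hs)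
    show "poly (lift p) z \<notin> U.mx" if p: "V.primitive p" for p
    proof -
      have "ev 1 / ev p \<in> U" using A_I[OF prim_V[OF prim1] p] U(2) by auto
      then have "inverse (ev p) \<in> U" by (simp add: ev divide_inverse)
      then show ?thesis using ev0[OF V.primitive_nz[OF p]] by (auto simp: U.mx_def ev_def)
    qed
  qed
  then show ?thesis by (rule that)
qed

section \<open>Torsion points on curves with good reduction\<close>

text \<open>
  \<open>Q\<close> is a generic point; its reduction is generic on the reduced curve.  As the translates \<open>Q + j P\<close>
  return to \<open>Q\<close> after \<open>l\<close> steps, the reduction of \<open>P\<close> can be neither a point of order 2 or 3 nor, if \<open>l\<close>
  is a unit, the origin.
\<close>

locale good_torsion = gauss_extension V U z for V :: "'f::alg_closed_field set" and U z +
  fixes W :: "'f weierstrass" and xP yP :: 'f and w :: "'f func" and l :: nat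
  assumes a_in: "a1 W \<in> V" "a2 W \<in> V" "a3 W \<in> V" "a4 W \<in> V" "a6 W \<in> V"
    and disc: "discriminant W \<notin> V.mx"
    and P_on: "on_affine W xP yP"
    and gen: "generic_pt W (z, w)"
    and period: "(step (map_weierstrass const_func W) (const_func xP, const_func yP) ^^ l) (z, w) = (z, w)"
    and avoid: "\<And>j. fst ((step (map_weierstrass const_func W) (const_func xP, const_func yP) ^^ j) (z, w)) \<noteq> const_func xP"
    and l_unit: "of_nat l \<notin> V.mx" and l_odd: "odd l" and l_3: "\<not> 3 dvd l"
begin

sublocale U: valuation_ring_set U by (rule U)

abbreviation "Wc \<equiv> map_weierstrass const_func W"
abbreviation "Pc \<equiv> (const_func xP, const_func yP)"
abbreviation "\<tau> \<equiv> step Wc Pc"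

definition "x j = fst ((\<tau> ^^ j) (z, w))"
definition "y j = snd ((\<tau> ^^ j) (z, w))"
definition "m j = slope Pc (x j, y j)"
definition "xc = const_func xP"
definition "yc = const_func yP"

lemmas xy0 = x_def[of 0, simplified] y_def[of 0, simplified]

lemma c_in: "a1 Wc \<in> U" "a2 Wc \<in> U" "a3 Wc \<in> U" "a4 Wc \<in> U" "a6 Wc \<in> U"
  using a_in const_V by (auto simp: cf.map_weierstrass_sel)

lemma lift_in: "coeffs_in V p \<Longrightarrow> poly (lift p) z \<in> U"
  using const_V by (intro U.poly_in z_in) (auto simp: coeffs_in_def cf.coeff_mp)

lemma W_coeffs: "coeffs_in V (psi W)" "coeffs_in V (cubic W)"
  using a_in by (auto simp: coeffs_in_def psi_def cubic_def coeff_pCons V.closed split: nat.split)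

lemma w_in: "w \<in> U"
proof (rule U.integrally_closed)
  show "coeffs_in U [:- poly (lift (cubic W)) z, poly (lift (psi W)) z, 1:]"
    by (auto simp: coeffs_in_def coeff_pCons intro!: U.closed lift_in W_coeffs split: nat.split)
  show "poly [:- poly (lift (cubic W)) z, poly (lift (psi W)) z, 1:] w = 0"
    using generic_on[OF gen] by (simp add: algebra_simps power2_eq_square)
qed simp

text \<open>The conjugate factor is integral and the product is the norm, so a primitive norm
  excludes that the element lies in the maximal ideal.\<close>

lemma linear_unit:
  assumes "coeffs_in V a" "coeffs_in V b" "V.primitive (a^2 - a * b * psi W - b^2 * cubic W)"
  shows "poly (lift a) z + poly (lift b) z * w \<notin> U.mx"
proof
  assume "poly (lift a) z + poly (lift b) z * w \<in> U.mx"
  then have "(poly (lift a) z + poly (lift b) z * w) * (poly (lift (a - b * psi W)) z - poly (lift b) z * w) \<in> U.mx"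
    using assms(1,2) by (intro U.mx.I_mult' U.closed lift_in V.coeffs_in_diff V.coeffs_in_mult W_coeffs w_in)
  then show False using generic_norm[OF gen, of a b] primitive_unit[OF assms(3)] by simp
qed

lemma on: "(y j)^2 + (a1 Wc * x j + a3 Wc) * y j = (x j)^3 + a2 Wc * (x j)^2 + a4 Wc * x j + a6 Wc"
proof -
  have "on_pt Wc ((\<tau> ^^ j) (z, w))"
  proof (induction j)
    case (Suc j)
    have "on_pt Wc Pc" using cf.map_on_affine[OF P_on] by simp
    moreover have "fst Pc \<noteq> fst ((\<tau> ^^ j) (z, w))" using avoid[of j] by simp
    ultimately have "on_pt Wc (\<tau> ((\<tau> ^^ j) (z, w)))"
      unfolding step_def[of Wc Pc "(\<tau> ^^ j) (z, w)"] using Suc by (intro neg_on third_pt_on)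
    then show ?case by simp
  qed (use gen in \<open>simp add: generic_pt_def\<close>)
  then show ?thesis by (simp add: on_affine_def poly_psi poly_cubic x_def y_def)
qed

lemma onP: "yc^2 + (a1 Wc * xc + a3 Wc) * yc = xc^3 + a2 Wc * xc^2 + a4 Wc * xc + a6 Wc"
  using cf.map_on_affine[OF P_on] by (simp add: on_affine_def poly_psi poly_cubic xc_def yc_def)

lemma x_ne: "x j - xc \<noteq> 0" using avoid[of j] by (simp add: x_def xc_def)

lemma m_eq: "m j * (x j - xc) = y j - yc" using x_ne[of j] by (simp add: m_def slope_def xc_def yc_def)

lemma step_x: "x (Suc j) = m j ^ 2 + a1 Wc * m j - a2 Wc - xc - x j"
  by (simp add: x_def m_def y_def step_def neg_pt_def third_pt_def Let_def xc_def)

lemma step_y: "y (Suc j) = - (yc + m j * (x (Suc j) - xc)) - a1 Wc * x (Suc j) - a3 Wc"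
  by (simp add: x_def m_def y_def step_def neg_pt_def third_pt_def Let_def xc_def yc_def poly_psi)

text \<open>The coefficients of the equation with \<open>P\<close> moved to \<open>(0, 0)\<close>.\<close>

definition "A3 = 2 * yc + a1 Wc * xc + a3 Wc"
definition "A4 = 3 * xc^2 + 2 * a2 Wc * xc + a4 Wc - a1 Wc * yc"
definition "A2 = a2 Wc + 3 * xc"

text \<open>With \<open>P\<close> at the origin, the line of slope \<open>m\<close> meets the curve
  where \<open>x\<close> times a monic quadratic vanishes. Its constant term
  \<open>A4 - A3 m\<close> is the product of the other two abscissae.\<close>

lemma step_xc: "(x (Suc j) - xc) * (x j - xc) = A4 - A3 * m j"
proof -
  define t where "t = x j - xc"
  have xj: "x j = t + xc" and yj: "y j = yc + m j * t" using m_eq[of j] by (simp_all add: t_def algebra_simps)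
  have t: "t \<noteq> 0" using x_ne[of j] by (simp add: t_def)
  have "t * ((x (Suc j) - xc) * t - (A4 - A3 * m j)) =
     ((y j)^2 + (a1 Wc * x j + a3 Wc) * y j - ((x j)^3 + a2 Wc * (x j)^2 + a4 Wc * x j + a6 Wc))
     - (yc^2 + (a1 Wc * xc + a3 Wc) * yc - (xc^3 + a2 Wc * xc^2 + a4 Wc * xc + a6 Wc))"
    unfolding step_x A3_def A4_def yj xj by Groebner_Basis.algebra
  also have "\<dots> = 0" unfolding on onP by simp
  finally show ?thesis using t by (simp add: t_def)
qed

lemma step_m: "m (Suc j) = - m j - a1 Wc - A3 / (x (Suc j) - xc)"
proof -
  have "m (Suc j) * (x (Suc j) - xc) = (- m j - a1 Wc - A3 / (x (Suc j) - xc)) * (x (Suc j) - xc)"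
    unfolding m_eq step_y A3_def using x_ne[of "Suc j"] by (simp add: field_simps)
  then show ?thesis using x_ne[of "Suc j"] by simp
qed

section \<open>Congruences and units modulo the maximal ideal of \<open>U\<close>\<close>

definition "cong u v \<longleftrightarrow> u - v \<in> U.mx"

lemma cong_refl: "cong u u" by (simp add: cong_def U.mx.I_zero)
lemma cong_trans: "cong u v \<Longrightarrow> cong v t \<Longrightarrow> cong u t" using U.mx.I_add[of "u - v" "v - t"] by (simp add: cong_def)
lemma cong_add: "cong u v \<Longrightarrow> cong s t \<Longrightarrow> cong (u + s) (v + t)"
  using U.mx.I_add[of "u - v" "s - t"] by (simp add: cong_def algebra_simps)
lemma cong_uminus: "cong u v \<Longrightarrow> cong (- u) (- v)" using U.mx.I_uminus[of "u - v"] by (simp add: cong_def)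
lemma cong_diff: "cong u v \<Longrightarrow> cong s t \<Longrightarrow> cong (u - s) (v - t)"
  using cong_add[OF _ cong_uminus] by fastforce
lemma cong_mult: assumes "cong u v" "cong s t" "u \<in> U" "t \<in> U" shows "cong (u * s) (v * t)"
proof -
  have "u * (s - t) + (u - v) * t \<in> U.mx" using assms unfolding cong_def by (intro U.mx.I_add U.mx.I_mult U.mx.I_mult')
  then show ?thesis by (simp add: cong_def algebra_simps)
qed
lemma cong_in: "cong u v \<Longrightarrow> v \<in> U \<Longrightarrow> u \<in> U"
  using U.add_in[of "u - v" v] U.mx_sub by (auto simp: cong_def)
lemma cong_mx: "cong u v \<Longrightarrow> u \<in> U.mx \<longleftrightarrow> v \<in> U.mx"
  using U.mx.I_diff[of u "u - v"] U.mx.I_add[of v "u - v"] by (auto simp: cong_def)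

definition "unit u \<longleftrightarrow> u \<in> U \<and> u \<notin> U.mx"

lemma unit_nz: "unit u \<Longrightarrow> u \<noteq> 0" using U.mx.I_zero by (auto simp: unit_def)
lemma unit_inv: "unit u \<Longrightarrow> unit (inverse u)"
  unfolding unit_def by (metis U.unit_iff inverse_inverse_eq inverse_zero)
lemma unit_mult: "unit u \<Longrightarrow> unit v \<Longrightarrow> unit (u * v)"
  using U.mx_prime by (auto simp: unit_def U.mult_in)
lemma unit_uminus: "unit u \<Longrightarrow> unit (- u)"
  using U.mx.I_uminus[of "- u"] by (auto simp: unit_def U.uminus_in)
lemma unit_divide: "unit u \<Longrightarrow> unit v \<Longrightarrow> unit (u / v)"
  by (simp add: divide_inverse unit_mult unit_inv)
lemma unit_cong: "cong u v \<Longrightarrow> unit v \<Longrightarrow> unit u"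
  using cong_mx[of u v] cong_in[of u v] by (auto simp: unit_def)
lemma cong_inverse: assumes "cong u v" "unit v" shows "cong (inverse u) (inverse v)"
proof -
  have u: "unit u" by (rule unit_cong[OF assms])
  have "inverse u - inverse v = (inverse u * inverse v) * - (u - v)"
    using unit_nz[OF u] unit_nz[OF assms(2)] by (simp add: field_simps)
  also have "\<dots> \<in> U.mx" using assms u unit_inv unfolding cong_def
    by (intro U.mx.I_mult U.mult_in U.mx.I_uminus) (auto simp: unit_def)
  finally show ?thesis by (simp add: cong_def)
qed
lemma cong_divide: "cong u v \<Longrightarrow> cong s t \<Longrightarrow> u \<in> U \<Longrightarrow> unit t \<Longrightarrow> cong (u / s) (v / t)"
  unfolding divide_inverse using unit_inv[of t] by (intro cong_mult cong_inverse) (auto simp: unit_def)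

lemma const_unit: assumes "v \<in> V" "v \<notin> V.mx" shows "unit (const_func v)"
proof -
  have "inverse v \<in> V" "v \<noteq> 0" using assms V.unit_iff by auto
  then have "inverse (const_func v) \<in> U" "const_func v \<noteq> 0" using const_V by (auto simp: cf.h_eq_0 simp flip: cf.h_inverse)
  then show ?thesis using assms const_V by (auto simp: unit_def U.mx_def)
qed

lemma const_mx_iff: "v \<in> V \<Longrightarrow> const_func v \<in> U.mx \<longleftrightarrow> v \<in> V.mx"
  using const_unit const_mx by (auto simp: unit_def)

text \<open>The leading coefficient 4 may fail to be a unit. If all coefficients lay in the maximal
  ideal, every term of the discriminant would as well.\<close>

lemma div2_nz: "poly (lift (div2 W)) z \<notin> U.mx"
proof (rule primitive_unit)
  have in_V: "b2 W \<in> V" "b4 W \<in> V" "b6 W \<in> V" "b8 W \<in> V"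
    unfolding b2_def b4_def b6_def b8_def by (auto intro!: V.closed a_in)
  have "\<exists>i. coeff (div2 W) i \<notin> V.mx"
  proof (rule ccontr)
    assume "\<not> ?thesis"
    then have a: "coeff (div2 W) i \<in> V.mx" for i by blast
    have b: "b6 W \<in> V.mx" "2 * b4 W \<in> V.mx" "b2 W \<in> V.mx" "4 \<in> V.mx"
      using a[of 0] a[of 1] a[of 2] a[of 3] by (simp_all add: div2_def numeral_2_eq_2 numeral_3_eq_3)
    have "discriminant W = - ((b2 W * b8 W) * b2 W) - (2 * b4 W * b4 W^2) * 4 - (27 * b6 W) * b6 W + (9 * b2 W * b4 W) * b6 W"
      unfolding discriminant_b by Groebner_Basis.algebra
    also have "\<dots> \<in> V.mx" by (intro V.mx.I_add V.mx.I_diff V.mx.I_uminus V.mx.I_mult V.closed in_V b)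
    finally show False using disc by simp
  qed
  moreover have "coeffs_in V (div2 W)"
    using in_V by (auto simp: coeffs_in_def div2_def coeff_pCons V.closed split: nat.split)
  ultimately show "V.primitive (div2 W)" by (simp add: V.primitive_def)
qed

text \<open>If \<open>P\<close> reduces to the origin, each translation moves \<open>x\<close> to first order by \<open>- (xP / yP) (2 y + a1 x + a3)\<close>.\<close>

lemma xP_integral: "xP \<in> V"
proof (rule ccontr)
  assume nV: "xP \<notin> V"
  have "const_func (inverse xP) \<in> U.mx" using V.not_in_imp[OF nV] const_mx by blast
  then have om: "inverse xc \<in> U.mx" by (simp add: xc_def cf.h_inverse)
  define om where "om = inverse xc"
  have omx: "om \<in> U.mx" "om \<in> U" using om U.mx_sub by (auto simp: om_def)
  have xc0: "xc \<noteq> 0" using nV V.zero_in by (auto simp: xc_def cf.h_eq_0)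
  have xco: "xc * om = 1" using xc0 by (simp add: om_def)
  have xcU: "xc \<notin> U" using om xc0 unfolding U.mx_def by auto
  \<comment> \<open>To leading order the square of \<open>yP / xP\<close> is \<open>xP\<close>, so
    it is not integral either.\<close>
  define eta where "eta = yc / xc"
  have Ye: "yc = eta * xc" using xc0 by (simp add: eta_def)
  have eeq: "eta^2 + a1 Wc * eta + a3 Wc * eta * om = xc + a2 Wc + a4 Wc * om + a6 Wc * om^2"
  proof -
    have "xc^2 * (eta^2 + a1 Wc * eta + a3 Wc * eta * om - (xc + a2 Wc + a4 Wc * om + a6 Wc * om^2))
       = (yc^2 + (a1 Wc * xc + a3 Wc * (xc * om)) * yc) - (xc^3 + a2 Wc * xc^2 + a4 Wc * xc * (xc * om) + a6 Wc * (xc * om)^2)"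
      unfolding Ye by Groebner_Basis.algebra
    also have "\<dots> = 0" unfolding xco using onP by simp
    finally show ?thesis using xc0 by simp
  qed
  have "eta \<notin> U"
  proof
    assume "eta \<in> U"
    then have "eta^2 + a1 Wc * eta + a3 Wc * eta * om - a2 Wc - a4 Wc * om - a6 Wc * om^2 \<in> U"
      by (intro U.closed c_in omx)
    then show False using xcU unfolding eeq by simp
  qed
  \<comment> \<open>\<open>ze = xP / yP\<close> is the local parameter at the origin. The next
    quantity \<open>ep\<close> will be congruent to 1, so \<open>om = 1 / xP\<close> is
    \<open>ze ^ 2\<close> to leading order.\<close>
  define ze where "ze = inverse eta"
  have zmx: "ze \<in> U.mx" "ze \<in> U" using U.not_in_imp[OF \<open>eta \<notin> U\<close>] U.mx_sub by (auto simp: ze_def)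
  have eta0: "eta \<noteq> 0" using \<open>eta \<notin> U\<close> U.zero_in by auto
  have ez: "eta * ze = 1" using eta0 by (simp add: ze_def)
  have ze0: "ze \<noteq> 0" using eta0 by (simp add: ze_def)
  define ep where "ep = om * eta^2"
  have om_ep: "om = ep * ze^2"
  proof -
    have "ep * ze^2 = om * (eta * ze)^2" unfolding ep_def by Groebner_Basis.algebra
    then show ?thesis unfolding ez by simp
  qed
  have epeq: "ep * (1 + a1 Wc * ze + a3 Wc * ze * om) = 1 + a2 Wc * om + a4 Wc * om^2 + a6 Wc * om^3"
  proof -
    have "ep * (1 + a1 Wc * ze + a3 Wc * ze * om) = om * (eta^2 + a1 Wc * eta * (eta * ze) + a3 Wc * eta * om * (eta * ze))"
      unfolding ep_def by Groebner_Basis.algebra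
    also have "\<dots> = om * (xc + a2 Wc + a4 Wc * om + a6 Wc * om^2)" unfolding ez using eeq by simp
    also have "\<dots> = (xc * om) + a2 Wc * om + a4 Wc * om^2 + a6 Wc * om^3" by Groebner_Basis.algebra
    finally show ?thesis unfolding xco .
  qed
  define d where "d = 1 + a1 Wc * ze + a3 Wc * ze * om"
  have one_unit: "unit 1" by (simp add: unit_def U.one_in U.mx_one)
  have d1: "cong d 1"
  proof -
    have "a1 Wc * ze + (a3 Wc * ze) * om \<in> U.mx" by (intro U.mx.I_add U.mx.I_mult U.closed c_in omx zmx)
    then show ?thesis by (simp add: cong_def d_def algebra_simps)
  qed
  have ud: "unit d" by (rule unit_cong[OF d1 one_unit])
  have ep1: "cong ep 1"
  proof -
    have "a2 Wc * om + (a4 Wc * om) * om + (a6 Wc * om^2) * om \<in> U.mx" by (intro U.mx.I_add U.mx.I_mult U.closed c_in omx)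
    then have n: "cong (1 + a2 Wc * om + a4 Wc * om^2 + a6 Wc * om^3) 1"
      by (simp add: cong_def algebra_simps power2_eq_square power3_eq_cube)
    have "cong ((1 + a2 Wc * om + a4 Wc * om^2 + a6 Wc * om^3) / d) (1 / 1)"
      by (rule cong_divide[OF n d1 _ one_unit]) (rule cong_in[OF n U.one_in])
    moreover have "ep = (1 + a2 Wc * om + a4 Wc * om^2 + a6 Wc * om^3) / d"
      using epeq unit_nz[OF ud] by (simp add: d_def field_simps)
    ultimately show ?thesis by simp
  qed
  have epU: "ep \<in> U" by (rule cong_in[OF ep1 U.one_in])
  define ps where "ps = (\<lambda>j. 2 * y j + a1 Wc * x j + a3 Wc)"
  \<comment> \<open>One translation, to first order in \<open>ze\<close>: \<open>y\<close> does not
    change modulo the maximal ideal, and \<open>x\<close> moves by a multiple of \<open>ps\<close>,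
    the derivative of the equation in \<open>y\<close>.\<close>
  have main: "cong (y (Suc j)) (y j) \<and> (\<exists>t. t \<in> U.mx \<and> x (Suc j) = x j - ze * (ps j + t))"
    if xj: "x j \<in> U" and yj: "y j \<in> U" for j
  proof -
    define e where "e = 1 - x j * om"
    have e1: "cong e 1" using U.mx.I_uminus[OF U.mx.I_mult[OF xj omx(1)]] by (simp add: e_def cong_def)
    have ue: "unit e" by (rule unit_cong[OF e1 one_unit])
    have e0: "e \<noteq> 0" by (rule unit_nz[OF ue])
    have xe: "x j - xc = - xc * e" unfolding e_def using xco by (simp add: algebra_simps)
    define rho where "rho = (1 - y j * ze * om) / e"
    have f1: "cong (1 - y j * ze * om) 1"
      using U.mx.I_uminus[OF U.mx.I_mult[OF U.mult_in[OF yj zmx(2)] omx(1)]] by (simp add: cong_def)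
    have "cong rho (1 / 1)" unfolding rho_def by (rule cong_divide[OF f1 e1 cong_in[OF f1 U.one_in] one_unit])
    then have rho1: "cong rho 1" by simp
    have rhoU: "rho \<in> U" by (rule cong_in[OF rho1 U.one_in])
    have mr: "m j = eta * rho"
    proof -
      have "(x j - xc) * (eta * rho) = - (xc * eta * (1 - y j * ze * om))"
        unfolding xe rho_def using e0 by simp
      also have "\<dots> = - yc + y j * (xc * om) * (eta * ze)" unfolding Ye by Groebner_Basis.algebra
      also have "\<dots> = y j - yc" unfolding xco ez by simp
      also have "\<dots> = (x j - xc) * m j" using m_eq[of j] by (simp add: mult.commute)
      finally show ?thesis using x_ne[of j] by simp
    qed
    define k where "k = 3 * (x j)^2 + 2 * a2 Wc * x j + a4 Wc - a1 Wc * y j"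
    have kU: "k \<in> U" unfolding k_def by (intro U.closed c_in xj yj)
    have psU: "ps j \<in> U" unfolding ps_def by (intro U.closed c_in xj yj)
    \<comment> \<open>The derivative at \<open>x j\<close> of the cubic with the three abscissae of
      the chord as its roots, computed in two ways.\<close>
    have A: "(x j - x (Suc j)) * (x j - xc) = k - m j * ps j"
    proof -
      have Yj: "yc = y j - m j * (x j - xc)" using m_eq[of j] by simp
      have "(x j - xc) * ((x j - x (Suc j)) * (x j - xc) - (k - m j * ps j)) =
         ((y j)^2 + (a1 Wc * x j + a3 Wc) * y j - ((x j)^3 + a2 Wc * (x j)^2 + a4 Wc * x j + a6 Wc))
       - (yc^2 + (a1 Wc * xc + a3 Wc) * yc - (xc^3 + a2 Wc * xc^2 + a4 Wc * xc + a6 Wc))"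
        unfolding step_x k_def ps_def Yj by Groebner_Basis.algebra
      also have "\<dots> = 0" unfolding on onP by simp
      finally show ?thesis using x_ne[of j] by simp
    qed
    define t where "t = (rho * ep / e) * ps j - ps j - ep * ze * k / e"
    have "(x j - xc) * (x j - ze * (ps j + t)) = (x j - xc) * x (Suc j)"
    proof -
      have "(ps j + t) * e = rho * ep * ps j - ep * ze * k" unfolding t_def using e0 by (simp add: field_simps)
      then have "(x j - xc) * (ze * (ps j + t)) = - (xc * ze * (rho * ep * ps j - ep * ze * k))"
        unfolding xe by (simp add: mult_ac)
      also have "\<dots> = xc * (ep * ze^2) * k - xc * (ep * ze^2) * (eta * rho) * ps j + xc * ep * ze * rho * ps j * (eta * ze - 1)"
        by Groebner_Basis.algebra
      also have "\<dots> = k - m j * ps j" unfolding om_ep[symmetric] mr[symmetric] xco ez by simp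
      also have "\<dots> = (x j - xc) * x j - (x j - xc) * x (Suc j)" unfolding A[symmetric] by (simp add: algebra_simps)
      finally show ?thesis by (simp add: algebra_simps)
    qed
    then have xs: "x (Suc j) = x j - ze * (ps j + t)" using x_ne[of j] by simp
    have ie: "inverse e \<in> U" using unit_inv[OF ue] by (simp add: unit_def)
    have tmx: "t \<in> U.mx"
    proof -
      have "cong (rho * ep) (1 * 1)" by (rule cong_mult[OF rho1 ep1 rhoU U.one_in])
      then have "cong (rho * ep / e) (1 * 1 / 1)" by (rule cong_divide[OF _ e1 U.mult_in[OF rhoU epU] one_unit])
      then have 1: "rho * ep / e - 1 \<in> U.mx" by (simp add: cong_def)
      have "(rho * ep / e - 1) * ps j - (ep * k * inverse e) * ze \<in> U.mx"
        by (intro U.mx.I_diff U.mx.I_mult'[OF 1] psU U.mx.I_mult U.closed epU kU ie zmx)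
      moreover have "(rho * ep / e - 1) * ps j - (ep * k * inverse e) * ze = t" by (simp add: t_def algebra_simps divide_inverse)
      ultimately show ?thesis by simp
    qed
    have tU: "t \<in> U" using tmx U.mx_sub by auto
    have "y (Suc j) = - (y j + m j * (x (Suc j) - x j)) - a1 Wc * x (Suc j) - a3 Wc"
    proof -
      have Yj: "yc = y j - m j * (x j - xc)" using m_eq[of j] by simp
      show ?thesis unfolding step_y[of j] Yj by Groebner_Basis.algebra
    qed
    also have "m j * (x (Suc j) - x j) = - (eta * ze) * (rho * (ps j + t))" unfolding mr xs by Groebner_Basis.algebra
    also have "- (y j + - (eta * ze) * (rho * (ps j + t))) - a1 Wc * x (Suc j) - a3 Wc
       = y j + (rho * (ps j + t) - ps j) + a1 Wc * ze * (ps j + t)" unfolding ez xs ps_def by Groebner_Basis.algebra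
    finally have "y (Suc j) - y j = ((rho - 1) * ps j + rho * t) + (a1 Wc * (ps j + t)) * ze" by (simp add: algebra_simps)
    also have "\<dots> \<in> U.mx"
      using rho1 unfolding cong_def by (intro U.mx.I_add U.mx.I_mult' psU U.mx.I_mult tmx rhoU zmx U.closed c_in tU)
         (auto intro: U.mx.I_mult' psU)
    finally show ?thesis using xs tmx by (auto simp: cong_def)
  qed
  \<comment> \<open>The first-order shifts add up, because \<open>ps j\<close> stays congruent to
    \<open>ps 0\<close>.\<close>
  have "x j \<in> U \<and> y j \<in> U \<and> cong (y j) w \<and> (\<exists>t. t \<in> U.mx \<and> x j = z - ze * (of_nat j * ps 0 + t))" for j
  proof (induction j)
    case 0
    show ?case using z_in w_in U.mx.I_zero by (auto simp: xy0 cong_refl intro!: exI[of _ 0])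
  next
    case (Suc j)
    then obtain t where t: "t \<in> U.mx" "x j = z - ze * (of_nat j * ps 0 + t)" by auto
    have tU: "t \<in> U" using t U.mx_sub by auto
    have psU: "ps j \<in> U" "ps 0 \<in> U" unfolding ps_def using Suc z_in w_in by (auto simp: xy0 intro!: U.closed c_in)
    obtain t' where t': "t' \<in> U.mx" "x (Suc j) = x j - ze * (ps j + t')" and y': "cong (y (Suc j)) (y j)"
      using main Suc by blast
    have t'U: "t' \<in> U" using t' U.mx_sub by auto
    have "cong (x j) z"
      using U.mx.I_uminus[OF U.mx.I_mult[OF U.add_in[OF U.mult_in[OF U.of_nat_in[of j] psU(2)] tU] zmx(1)]]
      by (simp add: cong_def t(2) mult.commute)
    then have "cong (2 * y j + a1 Wc * x j + a3 Wc) (2 * w + a1 Wc * z + a3 Wc)"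
      using Suc by (intro cong_add cong_mult cong_refl U.closed c_in z_in w_in) auto
    then have pj: "ps j - ps 0 \<in> U.mx" by (simp add: cong_def ps_def xy0)
    have "x (Suc j) = z - ze * (of_nat (Suc j) * ps 0 + (t + t' + (ps j - ps 0)))"
      unfolding t'(2) t(2) by (simp add: algebra_simps)
    moreover have "t + t' + (ps j - ps 0) \<in> U.mx" by (intro U.mx.I_add t t' pj)
    moreover have "x (Suc j) \<in> U" unfolding t'(2) using Suc by (intro U.closed zmx psU t'U) auto
    moreover have "y (Suc j) \<in> U" using cong_in[OF y'] Suc by auto
    moreover have "cong (y (Suc j)) w" using cong_trans[OF y'] Suc by auto
    ultimately show ?case by blast
  qed
  \<comment> \<open>The orbit closes after \<open>l\<close> steps, so \<open>of_nat l * ps 0\<close>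
    lies in the maximal ideal. As \<open>l\<close> is a unit, so does \<open>ps 0\<close>, whose
    square is \<open>div2\<close> at the generic \<open>z\<close>.\<close>
  from this[of l] obtain t where t: "t \<in> U.mx" "x l = z - ze * (of_nat l * ps 0 + t)" by auto
  moreover have "x l = z" using period by (simp add: x_def)
  ultimately have "of_nat l * ps 0 + t = 0" using ze0 by simp
  then have "of_nat l * ps 0 = - t" by (simp add: eq_neg_iff_add_eq_0)
  then have lp: "of_nat l * ps 0 \<in> U.mx" using U.mx.I_uminus[OF t(1)] by simp
  have "ps 0 \<in> U" unfolding ps_def xy0 by (intro U.closed c_in z_in w_in)
  moreover have "of_nat l \<notin> U.mx" using const_mx_iff[OF V.of_nat_in[of l]] l_unit by (simp add: cf.h_of_nat)
  ultimately have "ps 0 \<in> U.mx" using lp U.mx_prime U.of_nat_in by blast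
  then have "ps 0 ^ 2 \<in> U.mx" using U.mx.I_power by simp
  moreover have "ps 0 ^ 2 = poly (lift (div2 W)) z"
    using div2_square[of Wc z w] gen by (simp add: generic_pt_def ps_def xy0 poly_psi cf.mp_div2 add.assoc)
  ultimately show False using div2_nz by simp
qed

end

section \<open>Points of order 2 and 3 in the reduction\<close>

context good_torsion
begin

lemma yP_integral: "yP \<in> V"
proof (rule V.integrally_closed)
  show "coeffs_in V [:- poly (cubic W) xP, poly (psi W) xP, 1:]"
    by (auto simp: coeffs_in_def coeff_pCons intro!: V.closed V.poly_in W_coeffs xP_integral split: nat.split)
  show "poly [:- poly (cubic W) xP, poly (psi W) xP, 1:] yP = 0"
    using P_on by (simp add: on_affine_def algebra_simps power2_eq_square)
qed simp

definition "c3 = 2 * yP + a1 W * xP + a3 W"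
definition "c4 = 3 * xP^2 + 2 * a2 W * xP + a4 W - a1 W * yP"
definition "c2 = a2 W + 3 * xP"

lemma c_V: "c3 \<in> V" "c4 \<in> V" "c2 \<in> V"
  unfolding c3_def c4_def c2_def by (intro V.closed a_in xP_integral yP_integral)+

lemma A_const: "A3 = const_func c3" "A4 = const_func c4" "A2 = const_func c2"
  by (simp_all add: A3_def A4_def A2_def c3_def c4_def c2_def xc_def yc_def cf.hs cf.map_weierstrass_sel)

lemma change_P: "weierstrass_change 1 xP 0 yP W (Weierstrass (a1 W) c2 c3 c4 0)"
proof -
  have "yP^2 + (a1 W * xP + a3 W) * yP = xP^3 + a2 W * xP^2 + a4 W * xP + a6 W"
    using P_on by (simp add: on_affine_def poly_psi poly_cubic)
  then show ?thesis
    by (simp add: weierstrass_change_def c2_def c3_def c4_def algebra_simps power2_eq_square power3_eq_cube)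
qed

text \<open>The value of \<open>div3\<close> at 0 is \<open>b8\<close>, and moving \<open>P\<close>
  to the origin is a change of coordinates with \<open>u = 1\<close>.\<close>

lemma b_P: "b8 (Weierstrass (a1 W) c2 c3 c4 0) = poly (div3 W) xP"
  using change_div3[OF change_P, of 0] by (simp add: poly_div3)

lemma c3_square: "c3^2 = poly (div2 W) xP"
  using div2_square[OF P_on] by (simp add: c3_def poly_psi add.assoc)

definition "D j = x j - xc"

lemma D0: "unit (D 0)" "D 0 = poly (lift [:-xP, 1:]) z"
proof -
  show e: "D 0 = poly (lift [:-xP, 1:]) z" by (simp add: D_def xy0 xc_def cf.mps cf.hs)
  have p: "V.primitive [:-xP, 1:]" unfolding V.primitive_def
    using xP_integral V.mx_one by (auto simp: coeffs_in_def coeff_pCons V.closed split: nat.split intro!: exI[of _ 1])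
  then show "unit (D 0)" unfolding e unit_def using primitive_unit lift_in by (simp add: V.primitive_def)
qed

lemma D_step: "D (Suc j) = (A4 - A3 * m j) / D j"
  using step_xc[of j] x_ne[of j] by (simp add: D_def field_simps)

lemma m_step: "m (Suc j) = - m j - a1 Wc - A3 / D (Suc j)"
  using step_m by (simp add: D_def)

lemma m0: "D 0 * m 0 = w - yc" "m 0 \<in> U"
proof -
  show e: "D 0 * m 0 = w - yc" using m_eq[of 0] by (simp add: D_def xy0 mult.commute)
  have "m 0 = inverse (D 0) * (w - yc)" using e unit_nz[OF D0(1)] by (simp add: field_simps)
  then show "m 0 \<in> U" using unit_inv[OF D0(1)] w_in yP_integral const_V by (simp add: unit_def yc_def U.closed)
qed

lemma D_period: "D l = D 0"
  using period by (simp add: D_def x_def)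

text \<open>A point of order 2 in the reduction: modulo the maximal ideal, \<open>D\<close> takes two values alternately.\<close>

lemma div2_unit: "poly (div2 W) xP \<notin> V.mx"
proof
  assume "poly (div2 W) xP \<in> V.mx"
  then have c3: "c3 \<in> V.mx" using V.mx_power[of c3 2] c_V c3_square by simp
  \<comment> \<open>With \<open>c3\<close> and \<open>c4\<close> both in the maximal ideal,
    \<open>P\<close> would reduce to a singular point.\<close>
  have c4: "c4 \<notin> V.mx"
  proof
    assume c4: "c4 \<in> V.mx"
    let ?W = "Weierstrass (a1 W) c2 c3 c4 0"
    have b4: "b4 ?W \<in> V.mx" unfolding b4_def by (simp, intro V.mx.I_add V.mx.I_mult V.closed a_in c3 c4)
    have b6: "b6 ?W \<in> V.mx" unfolding b6_def using V.mx.I_power[OF c3, of 2] by simp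
    have e8: "b8 ?W = - (a1 W * c3 * c4) + c2 * c3 * c3 - c4 * c4"
      by (simp add: b8_def power2_eq_square)
    have b8: "b8 ?W \<in> V.mx"
      unfolding e8 by (intro V.mx.I_add V.mx.I_diff V.mx.I_uminus V.mx.I_mult V.closed a_in c_V c3 c4)
    have b2: "b2 ?W \<in> V" unfolding b2_def by (simp, intro V.closed a_in c_V)
    have "discriminant ?W \<in> V.mx"
      unfolding discriminant_b using b4 b6 b8 b2 V.mx_sub
      by (intro V.mx.I_add V.mx.I_diff V.mx.I_uminus V.mx.I_mult V.mx.I_power V.closed b4 b6 b8 b2) auto
    then show False using change_discriminant[OF change_P] disc by simp
  qed
  have u4: "unit A4" unfolding A_const by (rule const_unit[OF c_V(2) c4])
  have m3: "A3 \<in> U.mx" "A3 \<in> U" unfolding A_const using const_mx[OF c3] const_V c_V by auto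
  have "unit (D j) \<and> m j \<in> U \<and> cong (D j) (if even j then D 0 else A4 / D 0)" for j
  proof (induction j)
    case 0 then show ?case using D0 m0 cong_refl by simp
  next
    case (Suc j)
    define t where "t = (if even j then D 0 else A4 / D 0)"
    have t: "unit t" using D0 u4 unit_divide by (simp add: t_def)
    have j: "unit (D j)" "m j \<in> U" "cong (D j) t" using Suc by (auto simp: t_def)
    have n: "cong (A4 - A3 * m j) A4"
      using U.mx.I_uminus[OF U.mx.I_mult'[OF m3(1) j(2)]] by (simp add: cong_def)
    have c: "cong (D (Suc j)) (A4 / t)" unfolding D_step
      by (rule cong_divide[OF n j(3) _ t]) (rule cong_in[OF n], use u4 in \<open>simp add: unit_def\<close>)
    then have u: "unit (D (Suc j))" using unit_divide[OF u4 t] unit_cong by blast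
    have "A3 / D (Suc j) \<in> U" unfolding divide_inverse using unit_inv[OF u] m3 by (intro U.mult_in) (auto simp: unit_def)
    then have "m (Suc j) \<in> U" unfolding m_step by (intro U.closed j c_in)
    moreover have "A4 / t = (if even (Suc j) then D 0 else A4 / D 0)"
      using unit_nz[OF u4] unit_nz[OF D0(1)] by (simp add: t_def)
    ultimately show ?case using c u by simp
  qed
  \<comment> \<open>As \<open>l\<close> is odd, the period identifies the two alternating values, so
    \<open>(z - xP)^2\<close> would be congruent to a constant; a monic polynomial is a unit at the
    generic \<open>z\<close>.\<close>
  from this[of l] have c: "cong (D 0) (A4 / D 0)" using l_odd D_period by simp
  have "D 0 * (D 0 - A4 / D 0) \<in> U.mx" using c D0 unfolding cong_def unit_def by (intro U.mx.I_mult) auto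
  then have "D 0 * D 0 - A4 \<in> U.mx" using unit_nz[OF D0(1)] by (simp add: right_diff_distrib)
  moreover have "D 0 * D 0 - A4 = poly (lift ([:-xP, 1:]^2 - [:c4:])) z"
    unfolding D0(2) A_const cf.mp_diff cf.mp_power poly_diff poly_power by (simp add: cf.mps power2_eq_square)
  ultimately have "poly (lift ([:-xP, 1:]^2 - [:c4:])) z \<in> U.mx" by simp
  moreover have "V.primitive ([:-xP, 1:]^2 - [:c4:])" unfolding V.primitive_def
  proof
    have e: "[:-xP, 1:]^2 - [:c4:] = [:xP^2 - c4, - 2 * xP, 1:]" by (simp add: power2_eq_square)
    show "coeffs_in V ([:-xP, 1:]^2 - [:c4:])" unfolding e
      by (auto simp: coeffs_in_def coeff_pCons intro!: V.closed xP_integral c_V split: nat.split)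
    show "\<exists>i. coeff ([:-xP, 1:]^2 - [:c4:]) i \<notin> V.mx" unfolding e
      by (rule exI[of _ 2]) (simp add: V.mx_one numeral_2_eq_2)
  qed
  ultimately show False using primitive_unit by blast
qed

text \<open>
  A point of order 3 in the reduction: after the tangent at \<open>P\<close> has been made horizontal, the map
  \<open>(D, v) \<mapsto> (- A3 v / D, A3 / D)\<close> on coordinates and slopes has order 3.
\<close>

lemma div3_unit: "poly (div3 W) xP \<notin> V.mx"
proof
  assume d3: "poly (div3 W) xP \<in> V.mx"
  have c3: "c3 \<notin> V.mx"
  proof
    assume "c3 \<in> V.mx"
    then have "c3^2 \<in> V.mx" by (rule V.mx.I_power) simp
    then show False using div2_unit c3_square by simp
  qed
  have u3: "unit A3" unfolding A_const by (rule const_unit[OF c_V(1) c3])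
  have c30: "c3 \<noteq> 0" "inverse c3 \<in> V" using c3 c_V V.unit_iff by auto
  \<comment> \<open>The slope of the tangent at \<open>P\<close>.\<close>
  define s where "s = c4 * inverse c3"
  have sV: "s \<in> V" unfolding s_def by (intro V.closed c_V c30)
  have sc: "c4 = c3 * s" using c30 by (simp add: s_def)
  \<comment> \<open>The coefficient \<open>a2\<close> once the tangent is horizontal. It equals
    \<open>div3\<close> at \<open>xP\<close> up to the unit \<open>c3^2\<close>; that it is small
    says that \<open>P\<close> reduces to a flex.\<close>
  define e2 where "e2 = c2 - a1 W * s - s^2"
  have "c3^2 * e2 = poly (div3 W) xP"
    unfolding b_P[symmetric] b8_def e2_def sc by simp Groebner_Basis.algebra
  then have "e2 = inverse c3 * inverse c3 * poly (div3 W) xP" using c30 by (simp add: field_simps power2_eq_square)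
  then have e2: "e2 \<in> V.mx" using d3 c30 by (simp only:) (intro V.mx.I_mult V.closed)
  define S E2 where "S = const_func s" and "E2 = const_func e2"
  have S: "S \<in> U" using sV const_V by (simp add: S_def)
  have E2: "E2 \<in> U.mx" using const_mx[OF e2] by (simp add: E2_def)
  have A4: "A4 = A3 * S" unfolding A_const S_def sc by (simp add: cf.hs)
  have A2: "A2 = E2 + a1 Wc * S + S^2" unfolding A_const E2_def S_def e2_def by (simp add: cf.hs cf.map_weierstrass_sel)
  define v where "v j = m j - S" for j
  have Dnz: "D j \<noteq> 0" for j using x_ne by (simp add: D_def)
  have D1: "D (Suc j) = - (A3 * v j) / D j" for j unfolding D_step v_def A4 by (simp add: algebra_simps)
  have vnz: "v j \<noteq> 0" for j using D1[of j] Dnz[of "Suc j"] by auto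
  have A30: "A3 \<noteq> 0" by (rule unit_nz[OF u3])
  have v1: "v (Suc j) = A3 / D j - E2 / v j" for j
  proof -
    have "D j + D (Suc j) = m j ^ 2 + a1 Wc * m j - A2" unfolding D_def step_x A2_def by simp
    also have "\<dots> = v j ^ 2 + (a1 Wc + 2 * S) * v j - E2" unfolding v_def A2 by Groebner_Basis.algebra
    finally have 1: "D j = v j ^ 2 + (a1 Wc + 2 * S) * v j - E2 - D (Suc j)" by (simp add: algebra_simps)
    have "v (Suc j) = - v j - (a1 Wc + 2 * S) - A3 / D (Suc j)" unfolding v_def m_step by simp
    also have "A3 / D (Suc j) = - (D j / v j)" unfolding D1 using A30 Dnz[of j] vnz[of j] by (simp add: field_simps)
    also have "D j / v j = v j + (a1 Wc + 2 * S) - E2 / v j - D (Suc j) / v j"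
      by (subst 1) (use vnz[of j] in \<open>simp add: field_simps power2_eq_square\<close>)
    also have "D (Suc j) / v j = - (A3 / D j)" unfolding D1 using vnz[of j] by simp
    finally show ?thesis by simp
  qed
  have A3U: "A3 \<in> U" using u3 by (simp add: unit_def)
  have step: "unit (- (A3 * r) / d) \<and> unit (A3 / d) \<and> cong (D (Suc j)) (- (A3 * r) / d) \<and> cong (v (Suc j)) (A3 / d)"
    if c: "cong (D j) d" "cong (v j) r" and u: "unit d" "unit r" for j d r
  proof -
    have uD: "unit (D j)" "unit (v j)" using c u unit_cong by auto
    have vU: "v j \<in> U" "r \<in> U" using uD u by (auto simp: unit_def)
    have "cong (- (A3 * v j)) (- (A3 * r))" by (intro cong_uminus cong_mult cong_refl c A3U vU)
    then have "cong (D (Suc j)) (- (A3 * r) / d)" unfolding D1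
      by (rule cong_divide[OF _ c(1) _ u(1)]) (intro U.closed A3U vU)
    moreover have "cong (A3 / D j - E2 / v j) (A3 / d - 0)"
    proof (rule cong_diff)
      show "cong (A3 / D j) (A3 / d)" by (rule cong_divide[OF cong_refl c(1) A3U u(1)])
      have "inverse (v j) \<in> U" using unit_inv[OF uD(2)] by (simp add: unit_def)
      then show "cong (E2 / v j) 0" unfolding cong_def divide_inverse using U.mx.I_mult'[OF E2] by simp
    qed
    ultimately show ?thesis unfolding v1 using u u3 by (simp add: unit_divide unit_mult unit_uminus)
  qed
  have lin: "w - yc - S * D 0 - const_func c = poly (lift (- [:yP + c:] - smult s [:-xP, 1:])) z + poly (lift 1) z * w" for c
    unfolding D0(2) by (simp add: cf.mps cf.hs yc_def S_def algebra_simps)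
  \<comment> \<open>The function is \<open>y\<close> minus a linear polynomial in \<open>x\<close>;
    its norm has the coefficient \<open>- 1\<close> in degree 3 and is therefore primitive.\<close>
  have lin_unit: "w - yc - S * D 0 - const_func c \<notin> U.mx" if "c \<in> V" for c
    unfolding lin
  proof (rule linear_unit)
    define q where "q = - [:yP + c:] - smult s [:-xP, 1:]"
    have q: "q = [:s * xP - (yP + c), - s:]" by (simp add: q_def)
    show qV: "coeffs_in V q" "coeffs_in V 1"
      unfolding q using that by (auto simp: coeffs_in_def coeff_pCons coeff_1 intro!: V.closed xP_integral yP_integral sV split: nat.split)
    have "coeffs_in V (q^2 - q * 1 * psi W - 1^2 * cubic W)"
      unfolding power2_eq_square by (intro V.coeffs_in_diff V.coeffs_in_mult qV W_coeffs)
    moreover have "coeff (q^2 - q * 1 * psi W - 1^2 * cubic W) 3 = - 1"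
      by (simp add: q psi_def cubic_def power2_eq_square numeral_3_eq_3 coeff_pCons)
    then have "coeff (q^2 - q * 1 * psi W - 1^2 * cubic W) 3 \<notin> V.mx" using V.mx.I_uminus[of "- 1"] V.mx_one by auto
    ultimately show "V.primitive (q^2 - q * 1 * psi W - 1^2 * cubic W)" unfolding V.primitive_def by blast
  qed
  have Dv: "D 0 * v 0 = w - yc - S * D 0" unfolding v_def using m0(1) by (simp add: algebra_simps)
  have v0: "unit (v 0)"
  proof -
    have "v 0 \<in> U" unfolding v_def by (intro U.closed m0 S)
    moreover have "D 0 * v 0 \<notin> U.mx" unfolding Dv using lin_unit[of 0] V.zero_in by (simp add: cf.h_0)
    ultimately show ?thesis unfolding unit_def using U.mx.I_mult[of "D 0" "v 0"] D0(1) by (auto simp: unit_def)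
  qed
  have d0: "D 0 \<noteq> 0" "v 0 \<noteq> 0" using Dnz vnz by auto
  have s1: "unit (- (A3 * v 0) / D 0) \<and> unit (A3 / D 0) \<and> cong (D (Suc j)) (- (A3 * v 0) / D 0) \<and> cong (v (Suc j)) (A3 / D 0)"
    if "cong (D j) (D 0)" "cong (v j) (v 0)" for j
    using step[OF that D0(1) v0] .
  have s2: "cong (D (Suc (Suc j))) (A3 / v 0) \<and> cong (v (Suc (Suc j))) (- D 0 / v 0)"
    if "cong (D j) (D 0)" "cong (v j) (v 0)" for j
  proof -
    have "- (A3 * (A3 / D 0)) / (- (A3 * v 0) / D 0) = A3 / v 0" "A3 / (- (A3 * v 0) / D 0) = - D 0 / v 0"
      using d0 A30 by (simp_all add: field_simps)
    then show ?thesis using step[of "Suc j" "- (A3 * v 0) / D 0" "A3 / D 0"] s1[OF that] by simp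
  qed
  have s3: "cong (D (Suc (Suc (Suc j)))) (D 0) \<and> cong (v (Suc (Suc (Suc j)))) (v 0)"
    if "cong (D j) (D 0)" "cong (v j) (v 0)" for j
  proof -
    have "- (A3 * (- D 0 / v 0)) / (A3 / v 0) = D 0" "A3 / (A3 / v 0) = v 0"
      using d0 A30 by (simp_all add: field_simps)
    moreover have "unit (A3 / v 0)" "unit (- D 0 / v 0)" using u3 v0 D0(1) by (auto intro!: unit_divide unit_uminus)
    ultimately show ?thesis using step[of "Suc (Suc j)" "A3 / v 0" "- D 0 / v 0"] s2[OF that] by simp
  qed
  have cyc: "cong (D (3 * k)) (D 0) \<and> cong (v (3 * k)) (v 0)" for k
  proof (induction k)
    case (Suc k)
    have "3 * Suc k = Suc (Suc (Suc (3 * k)))" by simp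
    then show ?case using s3[of "3 * k"] Suc by (simp only:)
  qed (simp add: cong_refl)
  have "l mod 3 = 1 \<or> l mod 3 = 2" using l_3 by (auto simp: dvd_eq_mod_eq_0)
  then show False
  proof
    assume "l mod 3 = 1"
    \<comment> \<open>After one step beyond full cycles the period makes
      \<open>D 0 ^ 3 + A3 * (D 0 * v 0)\<close> small, which is again a function linear in
      \<open>y\<close>.\<close>
    then have l: "l = Suc (3 * (l div 3))" by presburger
    have "cong (D l) (- (A3 * v 0) / D 0)" using s1[of "3 * (l div 3)"] cyc[of "l div 3"] l by metis
    then have "cong (D 0) (- (A3 * v 0) / D 0)" unfolding D_period .
    then have "(D 0 * D 0) * (D 0 - - (A3 * v 0) / D 0) \<in> U.mx"
      using D0 unfolding cong_def unit_def by (intro U.mx.I_mult U.mult_in) auto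
    moreover have "(d * d) * (d - - a / d) = d^3 + a * d" if "d \<noteq> 0" for d a :: "'f func"
      using that by (simp add: power3_eq_cube distrib_left)
    from this[OF d0(1), of "A3 * v 0"]
    have "(D 0 * D 0) * (D 0 - - (A3 * v 0) / D 0) = D 0^3 + A3 * (D 0 * v 0)" by (simp only: mult_ac)
    moreover have "\<dots> = poly (lift ([:-xP, 1:]^3 - [:c3 * yP:] - smult (c3 * s) [:-xP, 1:])) z + poly (lift [:c3:]) z * w"
    proof -
      have "D 0^3 + A3 * (D 0 * v 0) = D 0^3 - const_func (c3 * yP) - const_func (c3 * s) * D 0 + const_func c3 * w"
        unfolding Dv A_const by (simp add: cf.hs yc_def S_def algebra_simps)
      moreover have "const_func (c3 * yP) = poly (lift [:c3 * yP:]) z" "const_func c3 = poly (lift [:c3:]) z"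
        by (simp_all add: cf.mps)
      ultimately show ?thesis
        unfolding cf.mp_diff cf.mp_power cf.mp_smult poly_diff poly_power poly_smult D0(2) by (simp only:)
    qed
    ultimately have "poly (lift ([:-xP, 1:]^3 - [:c3 * yP:] - smult (c3 * s) [:-xP, 1:])) z + poly (lift [:c3:]) z * w \<in> U.mx" by (simp only:)
    moreover have "poly (lift ([:-xP, 1:]^3 - [:c3 * yP:] - smult (c3 * s) [:-xP, 1:])) z + poly (lift [:c3:]) z * w \<notin> U.mx"
    proof (rule linear_unit)
      define q where "q = [:-xP, 1:]^3 - [:c3 * yP:] - smult (c3 * s) [:-xP, 1:]"
      have "[:-xP, 1:]^3 = [:- (xP^3), 3 * xP^2, - 3 * xP, 1:]"
        by (simp add: power3_eq_cube power2_eq_square algebra_simps)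
      then have q: "q = [:- (xP^3) - c3 * yP + c3 * s * xP, 3 * xP^2 - c3 * s, - 3 * xP, 1:]"
        by (simp add: q_def)
      show qV: "coeffs_in V q" "coeffs_in V [:c3:]"
        unfolding q by (auto simp: coeffs_in_def coeff_pCons intro!: V.closed xP_integral yP_integral sV c_V split: nat.split)
      have "coeffs_in V (q^2 - q * [:c3:] * psi W - [:c3:]^2 * cubic W)"
        unfolding power2_eq_square by (intro V.coeffs_in_diff V.coeffs_in_mult qV W_coeffs)
      \<comment> \<open>Only \<open>q^2\<close>, with \<open>q\<close> monic of degree 3, reaches
        degree 6; so the norm is primitive.\<close>
      moreover have "coeff (q^2 - q * [:c3:] * psi W - [:c3:]^2 * cubic W) 6 = 1"
      proof -
        have q3: "degree q = 3" "coeff q 3 = 1" by (simp_all add: q numeral_3_eq_3)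
        have "coeff (q * q) (degree q + degree q) = coeff q (degree q) * coeff q (degree q)" by (rule coeff_mult_degree_sum)
        then have 1: "coeff (q^2) 6 = 1" by (simp add: q3 power2_eq_square)
        have "degree (q * [:c3:] * psi W) \<le> degree q + degree [:c3:] + degree (psi W)"
          using degree_mult_le[of "q * [:c3:]" "psi W"] degree_mult_le[of q "[:c3:]"] by linarith
        then have 2: "coeff (q * [:c3:] * psi W) 6 = 0"
          using degree_psi[of W] q3 by (intro coeff_eq_0) simp
        have "degree ([:c3:]^2 * cubic W) \<le> degree ([:c3:]^2) + degree (cubic W)" by (rule degree_mult_le)
        then have 3: "coeff ([:c3:]^2 * cubic W) 6 = 0"
          using degree_cubic(1)[of W] by (intro coeff_eq_0) (simp add: power2_eq_square)
        show ?thesis unfolding coeff_diff 1 2 3 by simp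
      qed
      then have "coeff (q^2 - q * [:c3:] * psi W - [:c3:]^2 * cubic W) 6 \<notin> V.mx" using V.mx_one by auto
      ultimately show "V.primitive (q^2 - q * [:c3:] * psi W - [:c3:]^2 * cubic W)" unfolding V.primitive_def by blast
    qed
    ultimately show False by blast
  next
    assume "l mod 3 = 2"
    \<comment> \<open>After two steps beyond full cycles \<open>D 0 * v 0\<close> would be congruent
      to \<open>A3\<close>, which \<open>lin_unit\<close> excludes.\<close>
    then have l: "l = Suc (Suc (3 * (l div 3)))" by presburger
    have "cong (D l) (A3 / v 0)" using s2[of "3 * (l div 3)"] cyc[of "l div 3"] l by metis
    then have "cong (D 0) (A3 / v 0)" unfolding D_period .
    then have "v 0 * (D 0 - A3 / v 0) \<in> U.mx"
      using v0 unfolding cong_def unit_def by (intro U.mx.I_mult) auto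
    also have "v 0 * (D 0 - A3 / v 0) = w - yc - S * D 0 - const_func c3"
      unfolding Dv[symmetric] A_const[symmetric] using d0 by (simp add: field_simps)
    finally show False using lin_unit[OF c_V(1)] by blast
  qed
qed

end

section \<open>The kernel of an isogeny from a curve with good reduction\<close>

text \<open>The closed orbit of one generic fibre point supplies all that is needed about
  \<open>P\<close>; it avoids the abscissa of \<open>P\<close> because fibre points are not
  constant.\<close>

lemma kernel_units:
  fixes W W' :: "'f::alg_closed_field weierstrass" and V :: "'f set"
  assumes V: "valuation_ring_set V"
    and W: "a1 W \<in> V" "a2 W \<in> V" "a3 W \<in> V" "a4 W \<in> V" "a6 W \<in> V"
    and disc: "discriminant W \<notin> valuation_ring_set.mx V"
    and data: "isogeny_data W W' N D A B H"
    and l: "Factorial_Ring.prime (degree N)" "degree N > 3" "of_nat (degree N) \<notin> valuation_ring_set.mx V"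
    and x: "poly D x = 0"
  shows "x \<in> V" "poly (div2 W) x \<notin> valuation_ring_set.mx V" "poly (div3 W) x \<notin> valuation_ring_set.mx V"
proof -
  interpret V: valuation_ring_set V by fact
  obtain y where "poly [:- poly (cubic W) x, poly (psi W) x, 1:] y = 0"
    using alg_closed_imp_poly_has_root[of "[:- poly (cubic W) x, poly (psi W) x, 1:]"] by auto
  then have on: "on_affine W x y" by (simp add: on_affine_def algebra_simps power2_eq_square)
  interpret K: kernel_point W W' N D A B H x y
  proof
    show "of_nat (degree N) \<noteq> (0 :: 'f)" using l(3) V.mx.I_zero by metis
  qed (use data l on x in auto)
  obtain z w where Q: "(z, w) \<in> K.\<Phi>" using K.base by (metis surj_pair)
  have gen: "generic_pt W (z, w)" by (rule K.\<Phi>_generic[OF Q])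
  obtain U where U: "gauss_extension V U z"
    using gauss_extension_exists[OF V, of z] gen by (auto simp: generic_pt_def)
  have odd: "odd (degree N)" by (rule prime_odd_nat[OF l(1)]) (use l(2) in linarith)
  have not3: "\<not> 3 dvd degree N"
  proof
    assume "3 dvd degree N"
    then have "(3 :: nat) = 1 \<or> 3 = degree N" using l(1) unfolding prime_nat_iff by blast
    then show False using l(2) by simp
  qed
  interpret G: good_torsion V U z W x y w "degree N"
  proof (intro good_torsion.intro[OF U] good_torsion_axioms.intro)
    show "(K.\<tau> ^^ degree N) (z, w) = (z, w)" by (rule K.period[OF Q])
    show "fst ((K.\<tau> ^^ j) (z, w)) \<noteq> const_func x" for j
      using K.\<Phi>_ne[OF K.steps_\<Phi>[OF Q, of j]] by simp
  qed (fact W disc on gen l(3) odd not3)+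
  show "x \<in> V" "poly (div2 W) x \<notin> V.mx" "poly (div3 W) x \<notin> V.mx"
    by (rule G.xP_integral G.div2_unit G.div3_unit)+
qed

text \<open>\<open>E\<close> need not have good reduction itself, so the kernel is examined on
  \<open>W\<close>. Substituting \<open>y = u^3 y' + u^2 s x' + t\<close> moves the linear part into
  the new \<open>A\<close> and the factor \<open>u^3\<close> into the new \<open>B\<close>.\<close>

lemma isogeny_data_change:
  fixes E W :: "'f::field weierstrass"
  assumes data: "isogeny_data E E' N D A B H" and ch: "weierstrass_change u r s t E W"
  defines "c \<equiv> \<lambda>p. pcompose p [:r, u^2:]"
  shows "isogeny_data W E' (c N) (c D) (c A + c B * [:t, u^2 * s:]) (smult (u^3) (c B)) (c H)"
proof -
  have u: "u \<noteq> 0" using ch by (simp add: weierstrass_change_def)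
  have nz: "c p = 0 \<longleftrightarrow> p = 0" and dg: "degree (c p) = degree p" for p
    using u by (simp_all add: c_def pcompose_eq_0_iff degree_pcompose)
  define L where "L = [:t, u^2 * s:]"
  have U: "smult (u^3) p = [:u:]^3 * p" for p by (simp add: power3_eq_cube mult.assoc)
  note w = ch[unfolded weierstrass_change_def]
  have ps: "[:u:]^3 * psi W = c (psi E) + 2 * L"
  proof -
    have "[:u:]^3 * psi W = [:u^3 * a3 W, u^2 * (u * a1 W):]"
      by (simp add: psi_def power3_eq_cube power2_eq_square mult_ac)
    also have "\<dots> = c (psi E) + 2 * L"
      using w by (simp add: c_def psi_def L_def pcompose_pCons numeral_poly algebra_simps)
    finally show ?thesis .
  qed
  have cu: "([:u:]^3)^2 * cubic W = c (cubic E) - L^2 - c (psi E) * L"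
  proof -
    have "([:u:]^3)^2 * cubic W = [:u^6 * a6 W, u^2 * (u^4 * a4 W), u^4 * (u^2 * a2 W), u^6:]"
      by (simp add: cubic_def eval_nat_numeral mult_ac)
    also have "\<dots> = c (cubic E) - L^2 - c (psi E) * L"
      using w by (simp add: c_def cubic_def psi_def L_def pcompose_pCons) (simp add: eval_nat_numeral algebra_simps)
    finally show ?thesis .
  qed
  have cs: "c (p + q) = c p + c q" "c (p - q) = c p - c q" "c (p * q) = c p * c q" "c (- p) = - c p" "c (smult k p) = smult k (c p)" for p q k
    by (simp_all add: c_def pcompose_add pcompose_diff pcompose_mult pcompose_uminus pcompose_smult)
  have c1: "c 1 = 1" by (simp add: c_def pcompose_const flip: pCons_one)
  have cp: "c (p ^ n) = c p ^ n" "c 1 = 1" for p n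
    by (induction n) (simp_all add: c1 cs)
  have c2: "c 2 = 2" using cs(1)[of 1 1] c1 by simp
  obtain a b where ab: "a * N + b * D = 1" using data unfolding isogeny_data_def by blast
  have bz: "c a * c N + c b * c D = 1" using arg_cong[OF ab, of c] by (simp only: cs cp)
  have 1: "D * (2 * A - B * psi E) = - ((smult (a1 E') N + smult (a3 E') D) * H)"
    and 2: "D^3 * (A^2 - A * B * psi E - B^2 * cubic E) =
       - (H^2 * (N^3 + smult (a2 E') (N^2 * D) + smult (a4 E') (N * D^2) + smult (a6 E') (D^3)))"
    using data unfolding isogeny_data_def by blast+
  have i1: "2 * (c A + c B * L) - [:u:]^3 * c B * psi W = 2 * c A - c B * c (psi E)"
  proof -
    have "2 * (c A + c B * L) - [:u:]^3 * c B * psi W = 2 * (c A + c B * L) - c B * ([:u:]^3 * psi W)" by (simp only: mult_ac)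
    also have "\<dots> = 2 * c A - c B * c (psi E)" unfolding ps by Groebner_Basis.algebra
    finally show ?thesis .
  qed
  have i2: "(c A + c B * L)^2 - (c A + c B * L) * ([:u:]^3 * c B) * psi W - ([:u:]^3 * c B)^2 * cubic W
     = (c A)^2 - c A * c B * c (psi E) - (c B)^2 * c (cubic E)"
  proof -
    have "(c A + c B * L)^2 - (c A + c B * L) * ([:u:]^3 * c B) * psi W - ([:u:]^3 * c B)^2 * cubic W =
       (c A + c B * L)^2 - (c A + c B * L) * c B * ([:u:]^3 * psi W) - (c B)^2 * (([:u:]^3)^2 * cubic W)"
      by (simp only: power_mult_distrib mult_ac)
    also have "\<dots> = (c A)^2 - c A * c B * c (psi E) - (c B)^2 * c (cubic E)"
      unfolding ps cu by Groebner_Basis.algebra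
    finally show ?thesis .
  qed
  have "discriminant W \<noteq> 0"
    using change_discriminant[OF ch] data u by (auto simp: isogeny_data_def)
  then show ?thesis
    using data u bz arg_cong[OF 1, of c] arg_cong[OF 2, of c]
    unfolding isogeny_data_def nz dg U L_def[symmetric] i1 i2 cs cp c2
    by (auto simp: nz)
qed

section \<open>Denominators of an isogeny\<close>

lemma bezout_mult:
  fixes p q r :: "'a::field poly"
  assumes "\<exists>u v. u * p + v * q = 1" "\<exists>u v. u * p + v * r = 1" shows "\<exists>u v. u * p + v * (q * r) = 1"
proof -
  obtain u v u' v' where 1: "u * p + v * q = 1" "u' * p + v' * r = 1" using assms by blast
  have "1 = (u * p + v * q) * (u' * p + v' * r)" unfolding 1 by simp
  also have "\<dots> = (u * u' * p + u * v' * r + v * q * u') * p + (v * v') * (q * r)" by (simp only: algebra_simps)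
  finally show ?thesis by metis
qed

lemma bezout_no_common_root:
  assumes "u * p + v * q = 1" "poly p x = 0" "poly q x = (0 :: 'a::field)" shows False
  using arg_cong[OF assms(1), of "\<lambda>p. poly p x"] assms(2,3) by simp

text \<open>Divisibility over an algebraically closed field is inclusion of the multisets of
  roots.\<close>

lemma order_dvd:
  fixes p q :: "'f::alg_closed_field poly"
  assumes "p \<noteq> 0" "q \<noteq> 0" "\<And>x. order x p \<le> order x q" shows "p dvd q"
proof -
  have "proots p \<subseteq># proots q" using assms by (intro mset_subset_eqI) simp
  then obtain M where "proots q = proots p + M" by (metis subset_mset.le_iff_add)
  then have e: "(\<Prod>x\<in>#proots q. [:-x, 1:]) = (\<Prod>x\<in>#proots p. [:-x, 1:]) * (\<Prod>x\<in>#M. [:-x, 1:])" by simp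
  have "p dvd (\<Prod>x\<in>#proots p. [:-x, 1:])"
    by (subst proots_split(1)[OF assms(1)]) (simp add: smult_dvd_iff assms(1))
  also have "\<dots> dvd (\<Prod>x\<in>#proots q. [:-x, 1:])" unfolding e by simp
  also have "\<dots> dvd q"
    by (subst (2) proots_split(1)[OF assms(2)]) (rule dvd_smult, simp)
  finally show ?thesis .
qed

text \<open>Coprimality and normality give \<open>j^2 = smult c D\<close> and
  \<open>H = D * j\<close>. The degree comes from the invariant differential: its pullback has no
  poles, so \<open>b\<close> divides the numerator \<open>G\<close> of the derivative of
  \<open>f\<close>; as the norm fixes \<open>degree b\<close>, this bounds \<open>degree j\<close>
  from below.\<close>

lemma isogeny_denominators:
  fixes W W' :: "'f::alg_closed_field weierstrass"
  assumes data: "isogeny_data W W' N D A B H"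
    and cop: "\<exists>u v t. u * A + v * B + t * H = 1"
    and ram: "\<And>x. poly D x = 0 \<Longrightarrow> poly (div2 W) x \<noteq> 0"
    and odd: "odd (degree N)" and big: "degree N > 1" and l_nz: "of_nat (degree N) \<noteq> (0 :: 'f)"
  shows "degree D = degree N - 1" "2 * degree H = 3 * (degree N - 1)" "poly H x = 0 \<longleftrightarrow> poly D x = 0"
proof -
  have W: "discriminant W \<noteq> 0" and W': "discriminant W' \<noteq> 0" and B0: "B \<noteq> 0" and H0: "H \<noteq> 0" and D0: "D \<noteq> 0"
    and deg: "degree D < degree N"
    and tr: "D * (2 * A - B * psi W) = - ((smult (a1 W') N + smult (a3 W') D) * H)"
    and nm: "D^3 * (A^2 - A * B * psi W - B^2 * cubic W) =
       - (H^2 * (N^3 + smult (a2 W') (N^2 * D) + smult (a4 W') (N * D^2) + smult (a6 W') (D^3)))"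
    and bz: "\<exists>u v. u * N + v * D = 1"
    using data unfolding isogeny_data_def by blast+
  define F where "F = N^3 + smult (a2 W') (N^2 * D) + smult (a4 W') (N * D^2) + smult (a6 W') (D^3)"
  define k where "k = smult (a2 W') (N^2) + smult (a4 W') (N * D) + smult (a6 W') (D^2)"
  have Fk: "F = N^3 + k * D" by (simp add: F_def k_def algebra_simps power2_eq_square power3_eq_cube)
  have "\<exists>u v. u * D + v * N = 1" using bz by (metis add.commute)
  then have "\<exists>u v. u * D + v * (N * N * N) = 1" by (intro bezout_mult)
  then obtain u v where uv: "u * D + v * N^3 = 1" by (auto simp: power3_eq_cube)
  have "(u - v * k) * D + v * F = 1" unfolding Fk uv[symmetric] by (simp add: algebra_simps)
  then have "\<exists>u v. u * F + v * D = 1" by (metis add.commute)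
  then have "\<exists>u v. u * F + v * (D * D * D) = 1" by (intro bezout_mult)
  then obtain p q where pq: "p * F + q * D^3 = 1" by (auto simp: power3_eq_cube)
  define n where "n = A^2 - A * B * psi W - B^2 * cubic W"
  have nm': "D^3 * n = - (H^2 * F)" using nm by (simp add: n_def F_def)
  have "H^2 = H^2 * (p * F + q * D^3)" unfolding pq by simp
  also have "\<dots> = p * (H^2 * F) + D^3 * (q * H^2)" by (simp only: algebra_simps)
  also have "H^2 * F = - (D^3 * n)" using nm' by simp
  also have "p * - (D^3 * n) + D^3 * (q * H^2) = D^3 * (q * H^2 - p * n)" by (simp add: algebra_simps)
  finally obtain \<kappa> where \<kappa>: "H^2 = D^3 * \<kappa>" by blast
  have \<kappa>0: "\<kappa> \<noteq> 0" using \<kappa> H0 by auto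
  have "D^3 * n = D^3 * - (\<kappa> * F)" unfolding nm' \<kappa> by simp
  then have n\<kappa>: "n = - (\<kappa> * F)" using D0 by (subst (asm) mult_left_cancel) auto
  have "D dvd H"
  proof (rule order_dvd[OF D0 H0])
    fix x
    have "order x (H * H) = order x (D * D * D * \<kappa>)" using \<kappa> by (simp add: power2_eq_square power3_eq_cube)
    then have "2 * order x H = 3 * order x D + order x \<kappa>" using H0 D0 \<kappa>0 by (simp add: order_mult)
    then show "order x D \<le> order x H" by linarith
  qed
  then obtain j where j: "H = D * j" by (elim dvdE)
  have j0: "j \<noteq> 0" using j H0 by auto
  have "D^2 * j^2 = D^2 * (D * \<kappa>)" using \<kappa> unfolding j by (simp add: power2_eq_square power3_eq_cube mult_ac)
  then have j2: "j^2 = D * \<kappa>" using D0 by (subst (asm) mult_left_cancel) auto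
  have "D * (2 * A - B * psi W) = D * - ((smult (a1 W') N + smult (a3 W') D) * j)" unfolding tr j by (simp add: mult_ac)
  then have tr': "2 * A - B * psi W = - ((smult (a1 W') N + smult (a3 W') D) * j)"
    using D0 by (subst (asm) mult_left_cancel) auto
  obtain u1 u2 u3 where ABH: "u1 * A + u2 * B + u3 * H = 1" using cop by blast
  have no_ABH: False if "poly A x = 0" "poly B x = 0" "poly H x = 0" for x
    using arg_cong[OF ABH, of "\<lambda>p. poly p x"] that by simp
  \<comment> \<open>A root of \<open>\<kappa>\<close> would be common to \<open>A\<close>,
    \<open>B\<close> and \<open>H\<close>. At a root of \<open>D\<close> this follows from
    \<open>B^2 * div2 W\<close> being the squared trace minus four times the norm; elsewhere
    \<open>\<kappa>\<close> vanishes doubly and normality applies.\<close>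
  have "poly \<kappa> x \<noteq> 0" for x
  proof
    assume k: "poly \<kappa> x = 0"
    have jx: "poly j x = 0" using arg_cong[OF j2, of "\<lambda>p. poly p x"] k by simp
    then have Hx: "poly H x = 0" by (simp add: j)
    have t0: "poly (2 * A - B * psi W) x = 0" unfolding tr' by (simp add: jx)
    have n0: "poly n x = 0" unfolding n\<kappa> by (simp add: k)
    show False
    proof (cases "poly D x = 0")
      case True
      have "B^2 * div2 W = (2 * A - B * psi W)^2 - 4 * n" unfolding div2_psi n_def by Groebner_Basis.algebra
      then have "poly (B^2 * div2 W) x = 0" using t0 n0 by simp
      then have Bx: "poly B x = 0" using ram[OF True] by simp
      then have "poly A x = 0" using n0 by (simp add: n_def)
      then show False using Bx Hx no_ABH by blast
    next
      case False
      have "2 * order x j = order x \<kappa>"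
      proof -
        have "order x (j * j) = order x (D * \<kappa>)" using j2 by (simp add: power2_eq_square)
        then show ?thesis using j0 D0 \<kappa>0 False by (simp add: order_mult order_0I)
      qed
      moreover have "order x j > 0" using jx j0 by (simp add: order_root)
      ultimately have "order x \<kappa> \<ge> 2" by linarith
      then have "[:-x, 1:]^2 dvd \<kappa>" using order_divides by blast
      then have "[:-x, 1:]^2 dvd n" unfolding n\<kappa> by simp
      moreover have "[:-x, 1:] dvd 2 * A - B * psi W" using t0 by (simp only: poly_eq_0_iff_dvd)
      ultimately have "[:-x, 1:] dvd A \<and> [:-x, 1:] dvd B" unfolding n_def by (intro normality[OF W]) auto
      then have "poly A x = 0" "poly B x = 0" by (simp_all only: poly_eq_0_iff_dvd)
      then show False using Hx no_ABH by blast
    qed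
  qed
  then have "degree \<kappa> = 0" using alg_closed_imp_poly_has_root by blast
  then obtain c where c: "\<kappa> = [:c:]" by (elim degree_eq_zeroE)
  have c0: "c \<noteq> 0" using \<kappa>0 c by auto
  have j2': "j^2 = smult c D" using j2 c by simp
  have dj: "degree D = 2 * degree j"
  proof -
    have "degree (j^2) = degree (smult c D)" unfolding j2' ..
    then show ?thesis using c0 by (simp add: degree_power_eq j0)
  qed
  have dH: "degree H = degree D + degree j" unfolding j using D0 j0 by (rule degree_mult_eq)
  have roots: "poly j x = 0 \<longleftrightarrow> poly D x = 0" for x
    using arg_cong[OF j2', of "\<lambda>p. poly p x"] c0 by auto
  show "poly H x = 0 \<longleftrightarrow> poly D x = 0" using roots by (simp add: j)
  \<comment> \<open>In these terms \<open>f = N1 / j^2\<close> and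
    \<open>g = (a + b y) / j^3\<close>, the denominators of weighted coordinates.\<close>
  define N1 a b where "N1 = smult c N" and "a = smult c A" and "b = smult c B"
  have N1: "N1 = [:c:] * N" "a = [:c:] * A" "b = [:c:] * B" by (simp_all add: N1_def a_def b_def)
  have jD: "j^2 = [:c:] * D" using j2' by simp
  define S where "S = smult (a1 W') N1 + smult (a3 W') (j^2)"
  have cC: "[:k:] * p = smult k p" for k :: 'f and p by simp
  have e1: "2 * a + j * S = b * psi W"
  proof -
    have "b * psi W = 2 * a - [:c:] * (2 * A - B * psi W)" unfolding N1 by (simp only: algebra_simps)
    also have "\<dots> = 2 * a + j * S" unfolding tr' S_def N1(1) jD by (simp add: algebra_simps)
    finally show ?thesis by simp
  qed
  define C1 C2 C3 C4 C6 where "C1 = [:a1 W':]" and "C2 = [:a2 W':]" and "C3 = [:a3 W':]" and "C4 = [:a4 W':]" and "C6 = [:a6 W':]"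
  have S': "S = C1 * N1 + C3 * j^2" by (simp add: S_def C1_def C3_def)
  define F1 where "F1 = N1^3 + C2 * N1^2 * j^2 + C4 * N1 * j^4 + C6 * j^6"
  have F1: "F1 = [:c:]^3 * F"
  proof -
    have "j^4 = (j^2)^2" "j^6 = (j^2)^3" by (simp_all flip: power_mult)
    then have "j^4 = ([:c:] * D)^2" "j^6 = ([:c:] * D)^3" unfolding jD by simp_all
    then show ?thesis unfolding F1_def F_def jD N1(1) C2_def C4_def C6_def cC[symmetric] by Groebner_Basis.algebra
  qed
  define Q where "Q = a^2 + j * S * a - F1"
  have e2: "Q = - (b^2 * cubic W)"
  proof -
    have "a^2 - a * b * psi W - b^2 * cubic W = [:c:]^2 * n" unfolding N1 n_def by Groebner_Basis.algebra
    also have "\<dots> = - ([:c:]^3 * F)" unfolding n\<kappa> c by (simp add: power2_eq_square power3_eq_cube)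
    also have "\<dots> = - F1" unfolding F1 ..
    finally have "a^2 - a * (b * psi W) - b^2 * cubic W = - F1" by (simp add: mult.assoc)
    then have "a^2 - a * (2 * a + j * S) - b^2 * cubic W = - F1" unfolding e1 .
    then show ?thesis unfolding Q_def by Groebner_Basis.algebra
  qed
  \<comment> \<open>\<open>G / j^3\<close> is the derivative of \<open>N1 / j^2\<close>;
    \<open>v\<close> below is the derivative in \<open>x\<close> of the equation of
    \<open>W'\<close> in weighted coordinates.\<close>
  define G where "G = pderiv N1 * j - 2 * N1 * pderiv j"
  define v where "v = C1 * a * j - 3 * N1^2 - 2 * C2 * N1 * j^2 - C4 * j^4"
  have dC: "pderiv C1 = 0" "pderiv C2 = 0" "pderiv C3 = 0" "pderiv C4 = 0" "pderiv C6 = 0"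
    by (simp_all add: C1_def C2_def C3_def C4_def C6_def pderiv_pCons)
  have dpow: "pderiv (p^2) = 2 * p * pderiv p" "pderiv (p^3) = 3 * p^2 * pderiv p"
     "pderiv (p^4) = 4 * p^3 * pderiv p" "pderiv (p^6) = 6 * p^5 * pderiv p" for p :: "'f poly"
    by (simp_all add: pderiv_power eval_nat_numeral algebra_simps pderiv_mult)
  \<comment> \<open>The weighted equation, differentiated. By \<open>e1\<close> and
    \<open>e2\<close> every term but \<open>v * G\<close> is divisible by \<open>b\<close>, and at
    the roots of \<open>b\<close> nonsingularity keeps \<open>v\<close> away from 0.\<close>
  have key: "j * pderiv Q = v * G + (2 * a + j * S) * (pderiv a * j - 3 * a * pderiv j) + 6 * Q * pderiv j"
    unfolding Q_def F1_def S' v_def G_def pderiv_diff pderiv_add pderiv_mult dpow dC by Groebner_Basis.algebra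
  have "v * G = j * pderiv Q - b * psi W * (pderiv a * j - 3 * a * pderiv j) - 6 * Q * pderiv j"
    using key unfolding e1 by (simp add: algebra_simps)
  also have "\<dots> = b * (- j * (2 * pderiv b * cubic W + b * pderiv (cubic W)) - psi W * (pderiv a * j - 3 * a * pderiv j) + 6 * b * cubic W * pderiv j)"
    unfolding e2 pderiv_minus pderiv_mult dpow by Groebner_Basis.algebra
  finally have b_dvd: "b dvd v * G" by simp
  have b0: "b \<noteq> 0" using B0 c0 by (simp add: b_def)
  have N1z: "poly N1 x = 0 \<Longrightarrow> poly j x = 0 \<Longrightarrow> False" for x
    using bz bezout_no_common_root roots c0 by (auto simp: N1_def)
  have v_nz: "poly v x \<noteq> 0" if bx: "poly b x = 0" for x
  proof
    assume vx: "poly v x = 0"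
    have ee: "poly (2 * a + j * S) x = 0" "poly Q x = 0" unfolding e1 e2 using bx by simp_all
    have "poly N1 x = 0" "poly j x = 0"
      using singular_imp_discriminant_0_homogeneous[OF W', of "poly a x" "poly j x" "poly N1 x"] ee vx
      by (simp_all add: Q_def F1_def S' v_def C1_def C2_def C3_def C4_def C6_def algebra_simps power2_eq_square power3_eq_cube eval_nat_numeral)
    then show False by (rule N1z)
  qed
  have dn: "max (2 * degree A) (2 * degree B + 3) = 3 * degree N"
  proof -
    have "degree F = degree (N^3)"
    proof -
      have "degree (k * D) < degree (N^3)"
      proof (cases "k = 0")
        case True
        have "N \<noteq> 0" using big by auto
        then show ?thesis using True big by (simp add: degree_power_eq)
      next
        case False
        have "degree k \<le> 2 * degree N" unfolding k_def
        proof (intro degree_add_le)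
          show "degree (smult (a2 W') (N^2)) \<le> 2 * degree N" using degree_power_le[of N 2] degree_smult_le[of "a2 W'" "N^2"] by linarith
          show "degree (smult (a4 W') (N * D)) \<le> 2 * degree N" using degree_mult_le[of N D] deg degree_smult_le[of "a4 W'" "N * D"] by linarith
          show "degree (smult (a6 W') (D^2)) \<le> 2 * degree N" using degree_power_le[of D 2] deg degree_smult_le[of "a6 W'" "D^2"] by linarith
        qed
        moreover have "degree (N^3) = 3 * degree N" using big by (subst degree_power_eq) auto
        ultimately show ?thesis using degree_mult_le[of k D] deg by linarith
      qed
      then show ?thesis unfolding Fk by (rule degree_add_eq_left)
    qed
    moreover have "degree (N^3) = 3 * degree N" using big by (subst degree_power_eq) auto
    ultimately have "degree n = 3 * degree N" unfolding n\<kappa> c using c0 by simp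
    then show ?thesis using norm_degree(1)[OF B0, of A W] by (simp add: n_def)
  qed
  \<comment> \<open>\<open>3 * degree N\<close> is odd, so the maximum is its odd member.\<close>
  then have dB: "2 * degree B + 3 = 3 * degree N" using odd by (simp add: max_def split: if_splits) presburger
  have db: "degree b = degree B" using c0 by (simp add: b_def)
  have "degree b > 0" using db dB big by linarith
  then obtain x0 where "poly b x0 = 0" using alg_closed_imp_poly_has_root by blast
  then have v0: "v \<noteq> 0" using v_nz by fastforce
  have l1: "of_nat (degree N1) \<noteq> (0 :: 'f)" using l_nz c0 by (simp add: N1_def)
  have G0: "G \<noteq> 0"
  proof
    assume "G = 0"
    then have "pderiv N1 * j^2 = N1 * pderiv (j^2)" unfolding G_def dpow by (simp add: power2_eq_square algebra_simps)
    moreover obtain u v where "u * N + v * D = 1" using bz by blast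
    then have "smult (inverse c) u * N1 + smult (inverse c) v * j^2 = 1" using c0 unfolding N1_def j2' by simp
    ultimately have "pderiv N1 = 0" using dvd_deriv_imp_0 by blast
    then show False using pderiv_nz[OF l1] by simp
  qed
  have "b dvd G"
  proof (rule order_dvd[OF b0 G0])
    fix x
    show "order x b \<le> order x G"
    proof (cases "poly b x = 0")
      case True
      have "order x b \<le> order x (v * G)" using b_dvd v0 G0 by (intro dvd_imp_order_le) auto
      then show ?thesis using v_nz[OF True] v0 G0 by (simp add: order_mult order_0I)
    qed (simp add: order_0I)
  qed
  then have "degree b \<le> degree G" using G0 by (rule dvd_imp_degree_le)
  moreover have "degree G \<le> degree N + degree j - 1"
  proof -
    have d: "degree (pderiv p) \<le> degree p - 1" for p :: "'f poly"
      by (rule degree_le) (auto simp: coeff_pderiv coeff_eq_0)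
    have dN: "degree N1 = degree N" using c0 by (simp add: N1_def)
    have "degree (pderiv N1 * j) \<le> degree N + degree j - 1"
      using degree_mult_le[of "pderiv N1" j] d[of N1] dN big by linarith
    moreover have "degree (2 * N1 * pderiv j) \<le> degree N + degree j - 1"
    proof (cases "degree j = 0")
      case True
      then obtain k where k: "j = [:k:]" by (rule degree_eq_zeroE)
      have "pderiv j = 0" unfolding k by (simp add: pderiv_pCons)
      then show ?thesis by simp
    next
      case False
      have "degree (2 * N1 * pderiv j) \<le> degree (2 * N1) + degree (pderiv j)" by (rule degree_mult_le)
      moreover have "degree (2 * N1) \<le> degree N" unfolding mult_2 by (rule degree_add_le) (simp_all add: dN)
      ultimately show ?thesis using d[of j] False by linarith
    qed
    ultimately show ?thesis unfolding G_def by (rule degree_diff_le)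
  qed
  ultimately show dD: "degree D = degree N - 1" using db dB dj deg by linarith
  show "2 * degree H = 3 * (degree N - 1)" using dH dj dD by linarith
qed

section \<open>Rational points over a rational function field\<close>

text \<open>A point over \<open>K(x)\<close> in projective form, or a map from the line to the
  curve.\<close>

definition hom_eq :: "'a::field weierstrass \<Rightarrow> 'a poly \<Rightarrow> 'a poly \<Rightarrow> 'a poly \<Rightarrow> bool" where
  "hom_eq W p q r \<longleftrightarrow> q^2 * r + [:a1 W:] * p * q * r + [:a3 W:] * q * r^2 =
     p^3 + [:a2 W:] * p^2 * r + [:a4 W:] * p * r^2 + [:a6 W:] * r^3"

lemma coeff_mult_le:
  fixes p q :: "'a::comm_ring_1 poly"
  assumes "degree p \<le> m" "degree q \<le> n" shows "coeff (p * q) (m + n) = coeff p m * coeff q n"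
proof (cases "degree p = m \<and> degree q = n")
  case True then show ?thesis using coeff_mult_degree_sum[of p q] by simp
next
  case False
  then have "degree p + degree q < m + n" using assms by auto
  then have "degree (p * q) < m + n" using degree_mult_le[of p q] by linarith
  moreover have "coeff p m * coeff q n = 0" using False assms by (auto simp: coeff_eq_0)
  ultimately show ?thesis by (simp add: coeff_eq_0)
qed

text \<open>Locally at \<open>x\<close> the factor \<open>q\<close> is a unit, so \<open>p\<close>
  divides \<open>s\<close> there.\<close>

lemma order_le_by_cross:
  fixes p q r s :: "'f::alg_closed_field poly"
  assumes "p * r = q * s" "poly q x \<noteq> 0" "s \<noteq> 0"
  shows "order x p \<le> order x s"
proof -
  have "q \<noteq> 0" using assms by auto
  then have nz: "p * r \<noteq> 0" using assms by simp
  then have "order x p \<le> order x (q * s)" unfolding assms(1)[symmetric] by (simp add: order_mult)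
  then show ?thesis using assms \<open>q \<noteq> 0\<close> by (simp add: order_mult order_0I)
qed

text \<open>At a root of \<open>p\<close> one of \<open>q\<close>, \<open>r\<close> is nonzero, and
  the cross relation makes \<open>p\<close> divide its own derivative there.\<close>

lemma pderiv_0_if_parallel:
  fixes p q r :: "'f::alg_closed_field poly"
  assumes "p * pderiv q = q * pderiv p" "p * pderiv r = r * pderiv p"
    and "\<And>x. \<not> (poly p x = 0 \<and> poly q x = 0 \<and> poly r x = 0)"
  shows "pderiv p = 0"
proof (rule ccontr)
  assume d: "pderiv p \<noteq> 0"
  then have p: "p \<noteq> 0" by auto
  have "p dvd pderiv p"
  proof (rule order_dvd[OF p d])
    fix x
    show "order x p \<le> order x (pderiv p)"
    proof (cases "poly p x = 0")
      case True
      then have "poly q x \<noteq> 0 \<or> poly r x \<noteq> 0" using assms(3) by blast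
      then show ?thesis using order_le_by_cross[OF assms(1) _ d] order_le_by_cross[OF assms(2) _ d] by blast
    qed (simp add: order_0I)
  qed
  then have "degree p \<le> degree (pderiv p)" using d by (rule dvd_imp_degree_le)
  moreover have "degree (pderiv p) \<le> degree p - 1"
    by (rule degree_le) (auto simp: coeff_pderiv coeff_eq_0)
  moreover have "degree p \<noteq> 0"
  proof
    assume "degree p = 0"
    then obtain c where c: "p = [:c:]" by (rule degree_eq_zeroE)
    show False using d unfolding c by (simp add: pderiv_pCons)
  qed
  ultimately show False by linarith
qed

text \<open>The pullback of the invariant differential is a regular differential on the line, hence zero.\<close>

lemma hom_eq_pderiv_0:
  fixes W :: "'f::alg_closed_field weierstrass"
  assumes W: "discriminant W \<noteq> 0" and eq: "hom_eq W p q r"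
    and no_common: "\<And>x. \<not> (poly p x = 0 \<and> poly q x = 0 \<and> poly r x = 0)"
  shows "pderiv p = 0 \<and> pderiv q = 0 \<and> pderiv r = 0"
proof -
  define C1 C2 C3 C4 C6 where "C1 = [:a1 W:]" and "C2 = [:a2 W:]" and "C3 = [:a3 W:]" and "C4 = [:a4 W:]" and "C6 = [:a6 W:]"
  note Cs = C1_def C2_def C3_def C4_def C6_def
  have dC: "pderiv C1 = 0" "pderiv C2 = 0" "pderiv C3 = 0" "pderiv C4 = 0" "pderiv C6 = 0"
    by (simp_all add: Cs pderiv_pCons)
  have dpow: "pderiv (p^2) = 2 * p * pderiv p" "pderiv (p^3) = 3 * p^2 * pderiv p" for p :: "'f poly"
    by (simp_all add: eval_nat_numeral algebra_simps pderiv_mult)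
  define F where "F = q^2 * r + C1 * p * q * r + C3 * q * r^2 - (p^3 + C2 * p^2 * r + C4 * p * r^2 + C6 * r^3)"
  have F0: "F = 0" using eq by (simp add: hom_eq_def F_def Cs)
  \<comment> \<open>The gradient of the homogeneous equation along the map, up to one common sign
    convention; by nonsingularity its components have no common root.\<close>
  define fx fy fz where "fx = C1 * q * r - 3 * p^2 - 2 * C2 * p * r - C4 * r^2"
    and "fy = 2 * q * r + C1 * p * r + C3 * r^2"
    and "fz = q^2 + C1 * p * q + 2 * C3 * q * r - C2 * p^2 - 2 * C4 * p * r - 3 * C6 * r^2"
  have sing: "x = 0 \<and> y = 0 \<and> z = 0"
    if "y^2 * z + a1 W * x * y * z + a3 W * y * z^2 - (x^3 + a2 W * x^2 * z + a4 W * x * z^2 + a6 W * z^3) = 0"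
      and dx: "a1 W * y * z - 3 * x^2 - 2 * a2 W * x * z - a4 W * z^2 = 0" and dy: "2 * y * z + a1 W * x * z + a3 W * z^2 = 0"
      and dz: "y^2 + a1 W * x * y + 2 * a3 W * y * z - a2 W * x^2 - 2 * a4 W * x * z - 3 * a6 W * z^2 = 0" for x y z
  proof (cases "z = 0")
    case True
    then show ?thesis using that by simp
  next
    case False
    define s t where "s = x / z" and "t = y / z"
    have st: "x = s * z" "y = t * z" using False by (simp_all add: s_def t_def)
    have "z^3 * (t^2 + (a1 W * s + a3 W) * t - (s^3 + a2 W * s^2 + a4 W * s + a6 W)) = 0"
      using that(1) unfolding st by Groebner_Basis.algebra
    then have 1: "on_affine W s t" using False by (simp add: on_affine_def poly_psi poly_cubic)
    have "z^2 * (2 * t + (a1 W * s + a3 W)) = 0" using dy unfolding st by Groebner_Basis.algebra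
    then have 2: "2 * t + poly (psi W) s = 0" using False by (simp add: poly_psi)
    have "z^2 * (a1 W * t - 3 * s^2 - 2 * a2 W * s - a4 W) = 0" using dx unfolding st by Groebner_Basis.algebra
    then have 3: "a1 W * t - 3 * s^2 - 2 * a2 W * s - a4 W = 0" using False by simp
    show ?thesis using singular_imp_discriminant_0[OF 1 2 3] W by simp
  qed
  have no_common': "\<not> (poly fx x = 0 \<and> poly fy x = 0 \<and> poly fz x = 0)" for x
  proof
    assume "poly fx x = 0 \<and> poly fy x = 0 \<and> poly fz x = 0"
    moreover have "poly F x = 0" using F0 by simp
    ultimately have "poly p x = 0 \<and> poly q x = 0 \<and> poly r x = 0"
      by (intro sing) (simp_all add: fx_def fy_def fz_def F_def Cs mult_ac)
    then show False using no_common by blast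
  qed
  have euler: "fx * p + fy * q + fz * r = 0"
  proof -
    have "fx * p + fy * q + fz * r = 3 * F" unfolding F_def fx_def fy_def fz_def by Groebner_Basis.algebra
    then show ?thesis by (simp add: F0)
  qed
  have dF: "fx * pderiv p + fy * pderiv q + fz * pderiv r = 0"
  proof -
    have "fx * pderiv p + fy * pderiv q + fz * pderiv r = pderiv F"
      unfolding F_def fx_def fy_def fz_def pderiv_diff pderiv_add pderiv_mult dpow dC by Groebner_Basis.algebra
    then show ?thesis by (simp add: F0)
  qed
  \<comment> \<open>The cross product of the point with its derivative. The gradient is orthogonal
    to both, by Euler's formula and by differentiation, so the two are proportional; the factor is
    the pulled back differential.\<close>
  define c1 c2 c3 where "c1 = q * pderiv r - r * pderiv q" and "c2 = r * pderiv p - p * pderiv r" and "c3 = p * pderiv q - q * pderiv p"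
  have cross: "c1 * fy = c2 * fx" "c2 * fz = c3 * fy" "c3 * fx = c1 * fz"
  proof -
    have "c1 * fy - c2 * fx = pderiv r * (fx * p + fy * q + fz * r) - r * (fx * pderiv p + fy * pderiv q + fz * pderiv r)"
      "c2 * fz - c3 * fy = pderiv p * (fx * p + fy * q + fz * r) - p * (fx * pderiv p + fy * pderiv q + fz * pderiv r)"
      "c3 * fx - c1 * fz = pderiv q * (fx * p + fy * q + fz * r) - q * (fx * pderiv p + fy * pderiv q + fz * pderiv r)"
      unfolding c1_def c2_def c3_def by Groebner_Basis.algebra+
    then show "c1 * fy = c2 * fx" "c2 * fz = c3 * fy" "c3 * fx = c1 * fz" unfolding euler dF by simp_all
  qed
  define k where "k = max (degree p) (max (degree q) (degree r))"
  have dk: "degree p \<le> k" "degree q \<le> k" "degree r \<le> k" by (auto simp: k_def)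
  have pos: "pderiv s = 0 \<or> k > 0" if "degree s \<le> k" for s :: "'f poly"
  proof (cases "k = 0")
    case True
    then have "degree s = 0" using that by simp
    then obtain c where "s = [:c:]" by (rule degree_eq_zeroE)
    then show ?thesis by (simp add: pderiv_pCons)
  qed simp
  show ?thesis
  proof (cases "k = 0")
    case True then show ?thesis using pos dk by blast
  next
    case k0: False
    have c_deg: "degree (s * pderiv t - t * pderiv s) < 2 * k" if "degree s \<le> k" "degree t \<le> k" for s t :: "'f poly"
    proof -
      have d: "degree (pderiv p) \<le> degree p - 1" for p :: "'f poly"
        by (rule degree_le) (auto simp: coeff_pderiv coeff_eq_0)
      have "degree (s * pderiv t) \<le> 2 * k - 1" "degree (t * pderiv s) \<le> 2 * k - 1"
        using degree_mult_le[of s "pderiv t"] degree_mult_le[of t "pderiv s"] d[of s] d[of t] that k0 by linarith+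
      then have "degree (s * pderiv t - t * pderiv s) \<le> 2 * k - 1" by (rule degree_diff_le)
      then show ?thesis using k0 by linarith
    qed
    \<comment> \<open>The image of the point at infinity of the line. Its coordinates satisfy the
      equation too, so some component of the gradient really has degree \<open>2 * k\<close>,
      whereas the cross product stays below.\<close>
    define x y z where "x = coeff p k" and "y = coeff q k" and "z = coeff r k"
    have xyz: "\<not> (x = 0 \<and> y = 0 \<and> z = 0)"
      using k0 unfolding x_def y_def z_def k_def max_def by (auto split: if_splits)
    have co2: "coeff (s * t) (2 * k) = coeff s k * coeff t k" if "degree s \<le> k" "degree t \<le> k" for s t :: "'f poly"
      using coeff_mult_le[OF that] by (simp add: mult_2)
    have d2: "degree (s * t) \<le> 2 * k" if "degree s \<le> k" "degree t \<le> k" for s t :: "'f poly"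
      using degree_mult_le[of s t] that by linarith
    have co3: "coeff (s * t * u) (3 * k) = coeff s k * coeff t k * coeff u k" if "degree s \<le> k" "degree t \<le> k" "degree u \<le> k" for s t u :: "'f poly"
      using coeff_mult_le[OF d2[OF that(1,2)] that(3)] co2[OF that(1,2)] by (simp add: algebra_simps)
    have F': "F = q * q * r + smult (a1 W) (p * q * r) + smult (a3 W) (q * r * r) - (p * p * p + smult (a2 W) (p * p * r) + smult (a4 W) (p * r * r) + smult (a6 W) (r * r * r))"
      by (simp add: F_def Cs power2_eq_square power3_eq_cube mult_ac)
    have nn: "numeral n * s = smult (numeral n) s" for n and s :: "'f poly" by (simp add: numeral_poly)
    have num: "2 * C2 = [:2 * a2 W:]" "2 * C3 = [:2 * a3 W:]" "2 * C4 = [:2 * a4 W:]" "3 * C6 = [:3 * a6 W:]"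
      by (simp_all add: Cs numeral_poly)
    have fs: "fx = smult (a1 W) (q * r) - smult 3 (p * p) - smult (2 * a2 W) (p * r) - smult (a4 W) (r * r)"
      "fy = smult 2 (q * r) + smult (a1 W) (p * r) + smult (a3 W) (r * r)"
      "fz = q * q + smult (a1 W) (p * q) + smult (2 * a3 W) (q * r) - smult (a2 W) (p * p) - smult (2 * a4 W) (p * r) - smult (3 * a6 W) (r * r)"
      unfolding fx_def fy_def fz_def num by (simp_all add: Cs(1,2,3,4) power2_eq_square mult.assoc nn)
    have "coeff F (3 * k) = 0" by (simp add: F0)
    then have "coeff fx (2 * k) \<noteq> 0 \<or> coeff fy (2 * k) \<noteq> 0 \<or> coeff fz (2 * k) \<noteq> 0"
      using sing[of y z x] xyz unfolding F' fs coeff_add coeff_diff coeff_smult co2[OF dk(1) dk(1)] co2[OF dk(1) dk(2)] co2[OF dk(1) dk(3)]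
        co2[OF dk(2) dk(2)] co2[OF dk(2) dk(3)] co2[OF dk(3) dk(3)] co3[OF dk(2) dk(2) dk(3)] co3[OF dk(1) dk(2) dk(3)]
        co3[OF dk(2) dk(3) dk(3)] co3[OF dk(1) dk(1) dk(1)] co3[OF dk(1) dk(1) dk(3)] co3[OF dk(1) dk(3) dk(3)] co3[OF dk(3) dk(3) dk(3)]
        x_def[symmetric] y_def[symmetric] z_def[symmetric]
      by (simp only: power2_eq_square power3_eq_cube mult.assoc) blast
    moreover have main: "e1 = 0 \<and> e2 = 0 \<and> e3 = 0"
      if lead: "coeff g1 (2 * k) \<noteq> 0" and cr: "e1 * g2 = e2 * g1" "e1 * g3 = e3 * g1" and dg: "degree e1 < 2 * k"
        and nc: "\<And>x. \<not> (poly g1 x = 0 \<and> poly g2 x = 0 \<and> poly g3 x = 0)" for e1 e2 e3 g1 g2 g3 :: "'f poly"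
    proof -
      have g1: "g1 \<noteq> 0" and dg1: "degree g1 \<ge> 2 * k" using lead by (auto intro: le_degree)
      have "e1 = 0"
      proof (rule ccontr)
        assume e1: "e1 \<noteq> 0"
        have "g1 dvd e1"
        proof (rule order_dvd[OF g1 e1])
          fix x
          show "order x g1 \<le> order x e1"
          proof (cases "poly g1 x = 0")
            case True
            then have "poly g2 x \<noteq> 0 \<or> poly g3 x \<noteq> 0" using nc by blast
            moreover have "g1 * e2 = g2 * e1" "g1 * e3 = g3 * e1" using cr by (simp_all add: mult.commute)
            ultimately show ?thesis using order_le_by_cross e1 by blast
          qed (simp add: order_0I)
        qed
        then have "degree g1 \<le> degree e1" using e1 by (rule dvd_imp_degree_le)
        then show False using dg1 dg by linarith
      qed
      then show ?thesis using cr g1 by simp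
    qed
    ultimately have c0: "c1 = 0 \<and> c2 = 0 \<and> c3 = 0"
    proof (elim disjE)
      assume "coeff fx (2 * k) \<noteq> 0"
      then show ?thesis using main[of fx c1 fy c2 fz c3] cross no_common' c_deg[OF dk(2) dk(3)] by (auto simp: c1_def)
    next
      assume "coeff fy (2 * k) \<noteq> 0"
      then show ?thesis using main[of fy c2 fx c1 fz c3] cross no_common' c_deg[OF dk(3) dk(1)] by (auto simp: c2_def)
    next
      assume "coeff fz (2 * k) \<noteq> 0"
      then show ?thesis using main[of fz c3 fx c1 fy c2] cross no_common' c_deg[OF dk(1) dk(2)] by (auto simp: c3_def)
    qed
    have "q * pderiv r = r * pderiv q" "r * pderiv p = p * pderiv r" "p * pderiv q = q * pderiv p"
      using c0 by (simp_all add: c1_def c2_def c3_def)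
    then show ?thesis
      using pderiv_0_if_parallel[of p q r] pderiv_0_if_parallel[of q r p] pderiv_0_if_parallel[of r p q] no_common by metis
  qed
qed


section \<open>Descent along Frobenius\<close>

lemma power_CHAR_inj:
  fixes x y :: "'r::idom"
  assumes "Factorial_Ring.prime CHAR('r)" "x ^ CHAR('r) = y ^ CHAR('r)" shows "x = y"
proof -
  have "x ^ CHAR('r) = (x - y) ^ CHAR('r) + y ^ CHAR('r)"
    using freshmans_dream[OF assms(1) refl, of "x - y" y] by simp
  then have "(x - y) ^ CHAR('r) = 0" using assms(2) by simp
  then show ?thesis by simp
qed

text \<open>Only exponents divisible by the characteristic occur, and the coefficients have roots in
  an algebraically closed field.\<close>

lemma poly_CHAR_root:
  fixes p :: "'f::alg_closed_field poly"
  assumes c: "Factorial_Ring.prime CHAR('f)" and d: "pderiv p = 0"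
  obtains P where "p = P ^ CHAR('f)" "degree p = CHAR('f) * degree P"
proof -
  define c where "c = CHAR('f)"
  have c0: "c > 0" using assms(1) prime_gt_0_nat by (simp add: c_def)
  have "\<exists>b. b ^ c = a" for a :: 'f using nth_root_exists[OF c0, of a] by blast
  then obtain b :: "'f \<Rightarrow> 'f" where b: "b a ^ c = a" for a by metis
  have nz: "coeff p i = 0" if "\<not> c dvd i" for i
  proof (cases i)
    case (Suc j)
    have "of_nat (Suc j) * coeff p (Suc j) = 0" using d by (metis coeff_0 coeff_pderiv)
    moreover have "of_nat (Suc j) \<noteq> (0 :: 'f)" using that Suc of_nat_eq_0_iff_char_dvd unfolding c_def by blast
    ultimately show ?thesis using Suc by simp
  qed (use that in simp)
  define P where "P = (\<Sum>i\<le>degree p. monom (b (coeff p (c * i))) i)"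
  have "P ^ c = (\<Sum>i\<le>degree p. monom (b (coeff p (c * i))) i ^ c)"
    using freshmans_dream_sum[where f = "\<lambda>i. monom (b (coeff p (c * i))) i" and A = "{..degree p}" and n = c] c
    by (simp add: P_def c_def)
  also have "\<dots> = (\<Sum>i\<le>degree p. monom (coeff p (c * i)) (c * i))"
    by (simp add: monom_power b mult.commute)
  finally have P: "P ^ c = (\<Sum>i\<le>degree p. monom (coeff p (c * i)) (c * i))" .
  have "p = P ^ c"
  proof (rule poly_eqI)
    fix n
    show "coeff p n = coeff (P ^ c) n"
    proof (cases "c dvd n")
      case True
      then obtain m where m: "n = c * m" by auto
      have "coeff (P ^ c) n = (\<Sum>i\<le>degree p. if i = m then coeff p (c * m) else 0)"
        unfolding P coeff_sum using c0 by (intro sum.cong) (auto simp: m)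
      also have "\<dots> = (if m \<le> degree p then coeff p n else 0)" by (simp add: m)
      also have "\<dots> = coeff p n"
      proof -
        have "m \<le> n" using m c0 by simp
        then show ?thesis by (auto simp: coeff_eq_0)
      qed
      finally show ?thesis by simp
    next
      case False
      have "coeff (P ^ c) n = 0" unfolding P coeff_sum using False by (intro sum.neutral) auto
      then show ?thesis using nz[OF False] by simp
    qed
  qed
  moreover from this have "degree p = c * degree P"
    by (cases "P = 0") (use c0 in \<open>auto simp: degree_power_eq power_0_left\<close>)
  ultimately show ?thesis using that unfolding c_def by blast
qed

lemma pderiv_0_char_0:
  fixes p :: "'f::field poly"
  assumes "CHAR('f) = 0" "pderiv p = 0" shows "degree p = 0"
proof (rule ccontr)
  assume "degree p \<noteq> 0"
  then obtain j where j: "degree p = Suc j" using not0_implies_Suc by blast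
  have "of_nat (Suc j) * coeff p (Suc j) = 0" using assms(2) by (metis coeff_0 coeff_pderiv)
  moreover have "of_nat (Suc j) \<noteq> (0 :: 'f)" using assms(1) of_nat_eq_0_iff_char_dvd[where ?'a = 'f, of "Suc j"] by simp
  ultimately have "coeff p (Suc j) = 0" by simp
  then show False using j by (metis leading_coeff_0_iff degree_0 nat.distinct(1))
qed

text \<open>In positive characteristic the point is inseparable, and one descends along Frobenius.\<close>

lemma hom_eq_const:
  fixes W :: "'f::alg_closed_field weierstrass"
  assumes "discriminant W \<noteq> 0" "hom_eq W p q r"
    and "\<And>x. \<not> (poly p x = 0 \<and> poly q x = 0 \<and> poly r x = 0)"
  shows "degree p = 0 \<and> degree q = 0 \<and> degree r = 0"
  using assms
proof (induction "degree p + degree q + degree r" arbitrary: W p q r rule: less_induct)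
  case less
  note d = hom_eq_pderiv_0[OF less.prems]
  show ?case
  proof (cases "CHAR('f) = 0")
    case True
    then show ?thesis using d pderiv_0_char_0 by blast
  next
    case False
    then have c: "Factorial_Ring.prime CHAR('f)" using prime_CHAR_semidom by auto
    define c where "c = CHAR('f)"
    have c2: "c \<ge> 2" using c prime_ge_2_nat by (simp add: c_def)
    obtain P where P: "p = P ^ c" "degree p = c * degree P" using poly_CHAR_root[OF c] d unfolding c_def by blast
    obtain Q where Q: "q = Q ^ c" "degree q = c * degree Q" using poly_CHAR_root[OF c] d unfolding c_def by blast
    obtain R where R: "r = R ^ c" "degree r = c * degree R" using poly_CHAR_root[OF c] d unfolding c_def by blast
    have "\<exists>b. b ^ c = a" for a :: 'f using nth_root_exists[of c a] c2 by auto
    then obtain b :: "'f \<Rightarrow> 'f" where b: "b a ^ c = a" for a by metis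
    interpret Fr: field_hom_map "\<lambda>x :: 'f. x ^ c"
      by unfold_locales (use freshmans_dream[OF c refl] in \<open>auto simp: power_mult_distrib c_def\<close>)
    \<comment> \<open>The curve whose Frobenius twist is \<open>W\<close>: the roots
      \<open>P\<close>, \<open>Q\<close>, \<open>R\<close> of the coordinates satisfy its equation
      and have smaller total degree.\<close>
    define V where "V = map_weierstrass b W"
    have W: "W = map_weierstrass (\<lambda>x. x ^ c) V" by (cases W) (simp add: V_def b)
    have V: "discriminant V \<noteq> 0" using less.prems(1) using c2 unfolding W Fr.mp_discriminant by auto
    have fd: "(s + t) ^ c = s ^ c + t ^ c" for s t :: "'f poly"
      using freshmans_dream[where x = s and y = t and n = c] c by (simp add: c_def)
    have k: "[:x ^ c:] = [:x:] ^ c" for x :: 'f by (simp add: poly_const_pow)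
    have pw: "(s ^ c) ^ n = (s ^ n) ^ c" for s :: "'f poly" and n by (simp add: mult.commute flip: power_mult)
    have "(Q^2 * R + [:a1 V:] * P * Q * R + [:a3 V:] * Q * R^2) ^ c =
      (P^3 + [:a2 V:] * P^2 * R + [:a4 V:] * P * R^2 + [:a6 V:] * R^3) ^ c"
      using less.prems(2) unfolding hom_eq_def P(1) Q(1) R(1) W Fr.map_weierstrass_sel fd power_mult_distrib k pw .
    then have "hom_eq V P Q R" unfolding hom_eq_def c_def using power_CHAR_inj[where ?'r = "'f poly"] c by simp
    moreover have "\<not> (poly P x = 0 \<and> poly Q x = 0 \<and> poly R x = 0)" for x
      using less.prems(3)[of x] c2 unfolding P(1) Q(1) R(1) poly_power by auto
    moreover have "degree P + degree Q + degree R < degree p + degree q + degree r"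
      if "degree P + degree Q + degree R > 0"
    proof -
      have "degree p + degree q + degree r = c * (degree P + degree Q + degree R)"
        by (simp add: P(2) Q(2) R(2) algebra_simps)
      also have "\<dots> \<ge> 2 * (degree P + degree Q + degree R)" using c2 by (rule mult_le_mono1)
      finally show ?thesis using that by (metis add_gr_0 less_le_trans mult_2 less_add_same_cancel2)
    qed
    ultimately have "degree P = 0 \<and> degree Q = 0 \<and> degree R = 0" using less.hyps[of P Q R V] V by fastforce
    then show ?thesis using P(2) Q(2) R(2) by simp
  qed
qed

lemma remove_common_roots:
  fixes p q r :: "'f::alg_closed_field poly"
  assumes "r \<noteq> 0"
  obtains g p' q' r' where "g \<noteq> 0" "p = g * p'" "q = g * q'" "r = g * r'"
    "\<And>x. \<not> (poly p' x = 0 \<and> poly q' x = 0 \<and> poly r' x = 0)"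
proof -
  have "\<exists>g p' q' r'. g \<noteq> 0 \<and> p = g * p' \<and> q = g * q' \<and> r = g * r' \<and>
    (\<forall>x. \<not> (poly p' x = 0 \<and> poly q' x = 0 \<and> poly r' x = 0))" using assms
  proof (induction "degree r" arbitrary: p q r rule: less_induct)
    case less
    show ?case
    proof (cases "\<exists>x. poly p x = 0 \<and> poly q x = 0 \<and> poly r x = 0")
      case False
      then show ?thesis by (intro exI[of _ 1] exI[of _ p] exI[of _ q] exI[of _ r]) auto
    next
      case True
      then obtain x p1 q1 r1 where 1: "p = [:-x,1:] * p1" "q = [:-x,1:] * q1" "r = [:-x,1:] * r1"
        by (metis poly_eq_0_iff_dvd dvdE)
      have r1: "r1 \<noteq> 0" using less.prems 1 by auto
      then have "degree r1 < degree r" unfolding 1 by (subst degree_mult_eq) auto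
      then obtain g p' q' r' where *: "g \<noteq> 0" "p1 = g * p'" "q1 = g * q'" "r1 = g * r'"
        "\<forall>x. \<not> (poly p' x = 0 \<and> poly q' x = 0 \<and> poly r' x = 0)"
        using less.hyps r1 by blast
      show ?thesis
        by (rule exI[of _ "[:-x,1:] * g"], rule exI[of _ p'], rule exI[of _ q'], rule exI[of _ r'])
          (use * in \<open>simp add: 1 mult.assoc del: mult_pCons_left\<close>)
    qed
  qed
  then show ?thesis using that by blast
qed

lemma (in field_hom_map) hom_eq_map:
  "hom_eq W p q r \<Longrightarrow> hom_eq (map_weierstrass h W) (map_poly h p) (map_poly h q) (map_poly h r)"
  unfolding hom_eq_def map_weierstrass_sel by (drule arg_cong[of _ _ "map_poly h"]) (simp add: mps del: mult_pCons_left)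

text \<open>The result on maps from the line needs algebraically closed constants. A ratio that is
  constant there already lies in the original field, being a quotient of coefficients.\<close>

lemma RF_point_const:
  fixes W :: "'a::field weierstrass"
  assumes W: "discriminant W \<noteq> 0" and on: "on_affine (map_weierstrass const_func W) u v" and uv: "u \<in> RF" "v \<in> RF"
  shows "u \<in> range const_func \<and> v \<in> range const_func"
proof -
  obtain p q r where r: "r \<noteq> 0" and pq: "u = ev p / ev r" "v = ev q / ev r" using RF_common[OF uv] .
  have er: "ev r \<noteq> 0" using r by (simp add: ev_eq_0)
  have P: "ev p = u * ev r" "ev q = v * ev r" using pq er by auto
  have on': "v^2 + (const_func (a1 W) * u + const_func (a3 W)) * v = u^3 + const_func (a2 W) * u^2 + const_func (a4 W) * u + const_func (a6 W)"
    using on by (simp add: on_affine_def poly_psi poly_cubic cf.map_weierstrass_sel)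
  have "ev (q^2 * r + [:a1 W:] * p * q * r + [:a3 W:] * q * r^2) =
     ev (p^3 + [:a2 W:] * p^2 * r + [:a4 W:] * p * r^2 + [:a6 W:] * r^3)"
    unfolding evs ev_const P using on' by Groebner_Basis.algebra
  then have eq: "hom_eq W p q r" unfolding hom_eq_def ev_eq .
  define m where "m = (map_poly to_ac :: 'a poly \<Rightarrow> 'a alg_closure poly)"
  have "m r \<noteq> 0" using r by (simp add: m_def ac.mp_eq_0)
  then obtain g p' q' r' where g: "g \<noteq> 0" "m p = g * p'" "m q = g * q'" "m r = g * r'"
    and nc: "\<And>x. \<not> (poly p' x = 0 \<and> poly q' x = 0 \<and> poly r' x = 0)"
    by (rule remove_common_roots[of "m r" "m p" "m q"]) blast
  define W' where "W' = map_weierstrass to_ac W"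
  have "hom_eq W' (g * p') (g * q') (g * r')" using ac.hom_eq_map[OF eq] g unfolding m_def W'_def by simp
  then have "g^3 * (q'^2 * r' + [:a1 W':] * p' * q' * r' + [:a3 W':] * q' * r'^2) =
     g^3 * (p'^3 + [:a2 W':] * p'^2 * r' + [:a4 W':] * p' * r'^2 + [:a6 W':] * r'^3)"
    unfolding hom_eq_def by Groebner_Basis.algebra
  then have "hom_eq W' p' q' r'" unfolding hom_eq_def using g(1) by (subst (asm) mult_left_cancel) auto
  moreover have "discriminant W' \<noteq> 0" using W by (simp add: W'_def ac.mp_discriminant)
  ultimately have "degree p' = 0 \<and> degree q' = 0 \<and> degree r' = 0" using hom_eq_const nc by blast
  then obtain x y z where xyz: "p' = [:x:]" "q' = [:y:]" "r' = [:z:]" by (metis degree_eq_zeroE)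
  have z: "z \<noteq> 0" using \<open>m r \<noteq> 0\<close> g xyz by auto
  have *: "ev s / ev r \<in> range const_func" if "m s = g * [:w:]" for s w
  proof -
    define k where "k = coeff s (degree r) / lead_coeff r"
    have s: "m s = smult (w / z) (m r)" using that g(4) z xyz by (simp add: mult.commute)
    have "to_ac (coeff s (degree r)) = (w / z) * to_ac (lead_coeff r)"
      using arg_cong[OF s, of "\<lambda>p. coeff p (degree r)"] by (simp add: m_def ac.coeff_mp)
    then have "to_ac k = w / z" using r by (simp add: k_def)
    then have "m s = m (smult k r)" unfolding s unfolding m_def ac.mp_smult by simp
    then have "s = [:k:] * r" unfolding m_def ac.mp_eq by simp
    then have "ev s / ev r = const_func k" using er by (simp only: evs ev_const) simp
    then show ?thesis by simp
  qed
  show ?thesis unfolding pq using *[of p x] *[of q y] g xyz by auto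
qed

section \<open>Field extensions\<close>

context subfield_hom
begin

lemma division_in:
  assumes "coeffs_in K a" "coeffs_in K b" "b \<noteq> 0"
  obtains q r where "coeffs_in K q" "coeffs_in K r" "a = q * b + r" "r = 0 \<or> degree r < degree b"
proof -
  have "\<exists>q r. coeffs_in K q \<and> coeffs_in K r \<and> a = q * b + r \<and> (r = 0 \<or> degree r < degree b)"
    using assms(1)
  proof (induction "degree a" arbitrary: a rule: less_induct)
    case less
    show ?case
    proof (cases "a = 0 \<or> degree a < degree b")
      case True
      then show ?thesis using less.prems by (intro exI[of _ 0] exI[of _ a]) (auto simp: coeffs_in_def zero_in)
    next
      case False
      define k where "k = degree a - degree b"
      define c where "c = lead_coeff a * inverse (lead_coeff b)"
      define a' where "a' = a - monom c k * b"
      have cK: "c \<in> K" using less.prems assms(2) by (auto simp: c_def coeffs_in_def intro: mult_in inv_in)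
      have mK: "coeffs_in K (monom c k)" using cK by (auto simp: coeffs_in_def zero_in)
      have a': "coeffs_in K a'" unfolding a'_def by (intro coeffs_in_diff coeffs_in_mult less.prems mK assms(2))
      have ca': "coeff a' i = coeff a i - (if k \<le> i then c * coeff b (i - k) else 0)" for i
        by (auto simp: a'_def coeff_monom_mult)
      have z: "coeff a' i = 0" if "i \<ge> degree a" for i
      proof (cases "i = degree a")
        case True
        have "i - k = degree b" "k \<le> i" using True False by (auto simp: k_def)
        then show ?thesis using assms(3) by (simp add: ca' c_def True)
      next
        case ne: False
        then have "i - k > degree b" using that False by (auto simp: k_def)
        then show ?thesis using ne that by (simp add: ca' coeff_eq_0)
      qed
      have IH: "\<exists>q r. coeffs_in K q \<and> coeffs_in K r \<and> a' = q * b + r \<and> (r = 0 \<or> degree r < degree b)"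
      proof (cases "a' = 0")
        case True
        then show ?thesis by (intro exI[of _ 0]) (auto simp: coeffs_in_def zero_in)
      next
        case ne: False
        then have "degree a' < degree a" using z[of "degree a'"] by (metis leading_coeff_0_iff not_less)
        then show ?thesis using less.hyps a' by blast
      qed
      then obtain q r where *: "coeffs_in K q" "coeffs_in K r" "a' = q * b + r" "r = 0 \<or> degree r < degree b" by blast
      have "a = (q + monom c k) * b + r" using *(3) by (simp add: a'_def algebra_simps)
      then show ?thesis using * mK coeffs_in_add by blast
    qed
  qed
  then show ?thesis using that by blast
qed

text \<open>The Euclidean algorithm on \<open>p\<close> and any polynomial \<open>m\<close> that
  annihilates \<open>x\<close>. Irreducibility of \<open>m\<close> is not assumed: a zero remainder
  exposes a factor of smaller degree that still annihilates \<open>x\<close>.\<close>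

lemma inverse_in_adjoin:
  assumes "m \<noteq> 0" "coeffs_in K m" "poly m x = 0" "coeffs_in K p" "poly p x \<noteq> 0"
  shows "\<exists>q. coeffs_in K q \<and> poly q x = inverse (poly p x)"
  using assms
proof (induction "degree p + degree m" arbitrary: p m rule: less_induct)
  case less
  have p0: "p \<noteq> 0" using less.prems by auto
  show ?case
  proof (cases "degree p = 0")
    case True
    then obtain c where c: "p = [:c:]" by (rule degree_eq_zeroE)
    then have "c \<in> K" using less.prems(4) unfolding coeffs_in_def by (metis coeff_pCons_0)
    then show ?thesis by (intro exI[of _ "[:inverse c:]"]) (auto simp: c intro: coeffs_in_const inv_in)
  next
    case dp: False
    show ?thesis
    proof (cases "degree p < degree m")
      case False
      obtain q r where *: "coeffs_in K q" "coeffs_in K r" "p = q * m + r" "r = 0 \<or> degree r < degree m"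
        by (rule division_in[OF less.prems(4,2,1)])
      have "poly r x = poly p x" using *(3) less.prems(3) by simp
      moreover have "degree r < degree p" using * False dp by auto
      ultimately show ?thesis using less.hyps[of r m] less.prems * by auto
    next
      case True
      obtain q r where *: "coeffs_in K q" "coeffs_in K r" "m = q * p + r" "r = 0 \<or> degree r < degree p"
        by (rule division_in[OF less.prems(2,4) p0])
      have dr: "degree r < degree p" using * dp by auto
      have v: "poly q x * poly p x + poly r x = 0" using *(3) less.prems(3) by simp
      show ?thesis
      proof (cases "poly r x = 0")
        case False
        then obtain s where s: "coeffs_in K s" "poly s x = inverse (poly r x)"
          using less.hyps[of r m] less.prems * dr by auto
        have "poly r x = - (poly q x * poly p x)" using v by (simp add: eq_neg_iff_add_eq_0 add.commute)
        then have "poly (- (q * s)) x = inverse (poly p x)" using False less.prems(5) by (simp add: s field_simps)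
        moreover have "coeffs_in K (- (q * s))"
          using coeffs_in_mult[OF *(1) s(1)] by (auto simp: coeffs_in_def uminus_in)
        ultimately show ?thesis by blast
      next
        case r: True
        show ?thesis
        proof (cases "r = 0")
          case False
          then show ?thesis using less.hyps[of p r] less.prems * r dr True by auto
        next
          case r0: True
          have q0: "q \<noteq> 0" using * r0 less.prems by auto
          have "poly q x = 0" using v r less.prems(5) by simp
          moreover have "degree q < degree m" unfolding *(3) r0 using q0 p0 dp by (simp add: degree_mult_eq)
          ultimately show ?thesis using less.hyps[of p q] less.prems * q0 by auto
        qed
      qed
    qed
  qed
qed

end

text \<open>A nonzero combination of least degree divides all three polynomials.\<close>

lemma poly_bezout:
  fixes A B H :: "'a::field poly"
  assumes "H \<noteq> 0"
  obtains d A' B' H' u v t where "d \<noteq> 0" "A = d * A'" "B = d * B'" "H = d * H'" "u * A' + v * B' + t * H' = 1"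
proof -
  define I where "I = (\<lambda>d. d \<noteq> 0 \<and> (\<exists>u v t. d = u * A + v * B + t * H))"
  have "H = 0 * A + 0 * B + 1 * H" by simp
  then have "I H" using assms unfolding I_def by blast
  define d where "d = arg_min degree I"
  have "I d" unfolding d_def using \<open>I H\<close> by (rule arg_min_natI)
  have min: "degree d \<le> degree e" if "I e" for e unfolding d_def using that by (rule arg_min_nat_le)
  obtain u v t where d: "d \<noteq> 0" "d = u * A + v * B + t * H" using \<open>I d\<close> unfolding I_def by blast
  have div: "d dvd s" if s: "s = u' * A + v' * B + t' * H" for s u' v' t'
  proof -
    have "s mod d = s - (s div d) * d" by (simp add: minus_div_mult_eq_mod)
    also have "\<dots> = (u' - s div d * u) * A + (v' - s div d * v) * B + (t' - s div d * t) * H"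
      by (subst (2) d(2), subst s) Groebner_Basis.algebra
    finally have "s mod d \<noteq> 0 \<Longrightarrow> I (s mod d)" unfolding I_def by blast
    then have "s mod d = 0" using min degree_mod_less[OF d(1), of s] by fastforce
    then show ?thesis by auto
  qed
  have "d dvd A" "d dvd B" "d dvd H"
    by (rule div[of _ 1 0 0], simp) (rule div[of _ 0 1 0], simp, rule div[of _ 0 0 1], simp)
  then obtain A' B' H' where *: "A = d * A'" "B = d * B'" "H = d * H'" by (auto elim!: dvdE)
  have "d * (u * A' + v * B' + t * H') = d * 1" using d(2) unfolding * by (simp add: algebra_simps)
  then have "u * A' + v * B' + t * H' = 1" using d(1) by (subst (asm) mult_left_cancel) auto
  then show ?thesis using that d(1) * by blast
qed

section \<open>Subfields, spans and dimensions in the ring attached to a field type\<close>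

abbreviation rta :: "'f::field ring" where "rta \<equiv> ring_of_type_algebra"

lemma rta_simps:
  "carrier rta = UNIV" "\<one>\<^bsub>rta\<^esub> = 1" "\<zero>\<^bsub>rta\<^esub> = 0" "x \<oplus>\<^bsub>rta\<^esub> y = x + y" "x \<otimes>\<^bsub>rta\<^esub> y = x * (y :: 'f::field)"
  by (simp_all add: ring_of_type_algebra_def)

lemma rta_uminus: "\<ominus>\<^bsub>rta\<^esub> x = - (x :: 'f::field)"
proof -
  interpret F: field "rta :: 'f ring" by (rule field_from_type_algebra)
  show ?thesis by (rule F.minus_equality) (simp_all add: rta_simps)
qed

lemma rta_inv: "x \<noteq> 0 \<Longrightarrow> inv\<^bsub>rta\<^esub> x = inverse (x :: 'f::field)"
proof -
  assume x: "x \<noteq> 0"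
  interpret F: field "rta :: 'f ring" by (rule field_from_type_algebra)
  show ?thesis by (rule F.inv_char) (use x in \<open>simp_all add: rta_simps\<close>)
qed

lemma subfield_rta:
  assumes "subfield K (rta :: 'f::field ring)"
  shows "subring_set K" "x \<in> K \<Longrightarrow> inverse x \<in> K"
proof -
  interpret F: field "rta :: 'f ring" by (rule field_from_type_algebra)
  note E = subringE[OF subfieldE(1)[OF assms]]
  have u: "- a \<in> K" if "a \<in> K" for a using E(5)[OF that] by (simp add: rta_uminus)
  show "subring_set K"
  proof
    fix a b assume ab: "a \<in> K" "b \<in> K"
    show "a * b \<in> K" using E(6)[OF ab] by (simp add: rta_simps)
    show "a - b \<in> K" using E(7)[OF ab(1) u[OF ab(2)]] by (simp add: rta_simps)
  qed (use E(3) in \<open>simp add: rta_simps\<close>)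
  show "x \<in> K \<Longrightarrow> inverse x \<in> K"
    using F.subfield_m_inv(1)[OF assms, of x] E(2) by (cases "x = 0") (simp_all add: rta_simps rta_inv)
qed

lemma adjoin_consts_subfield: "subfield (adjoin_consts S) rta"
proof -
  interpret F: field "rta :: 'a func ring" by (rule field_from_type_algebra)
  show ?thesis unfolding adjoin_consts_def by (rule F.generate_field_is_subfield) (simp add: rta_simps)
qed

lemma adjoin_consts_incl: "range const_func \<subseteq> adjoin_consts S" "S \<subseteq> adjoin_consts S"
  unfolding adjoin_consts_def by (auto intro: generate_field.incl)

lemma adjoin_consts_least:
  assumes F: "subring_set F" "\<And>x. x \<in> F \<Longrightarrow> inverse x \<in> F" and S: "range const_func \<subseteq> F" "S \<subseteq> F"
  shows "adjoin_consts S \<subseteq> F"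
proof
  interpret subring_set F by (rule F)
  fix x assume "x \<in> adjoin_consts S"
  then show "x \<in> F" unfolding adjoin_consts_def
    by (induction rule: generate_field.induct) (use S F(2) in \<open>auto simp: rta_simps rta_uminus rta_inv intro: closed\<close>)
qed


lemma rta_combine: "ring.combine rta Ks Us = (\<Sum>i<min (length Ks) (length Us). Ks ! i * (Us ! i :: 'f::field))"
proof -
  interpret F: field "rta :: 'f ring" by (rule field_from_type_algebra)
  show ?thesis
  proof (induction Ks Us rule: F.combine.induct)
    case (1 k Ks u Us)
    then show ?case by (simp add: rta_simps sum.lessThan_Suc_shift del: sum.lessThan_Suc)
  qed (simp_all add: rta_simps)
qed

lemma rta_dimension:
  fixes b :: "nat \<Rightarrow> 'f::field"
  assumes K: "subfield K rta"
    and ind: "\<And>k. (\<And>i. i < n \<Longrightarrow> k i \<in> K) \<Longrightarrow> (\<Sum>i<n. k i * b i) = 0 \<Longrightarrow> (\<forall>i<n. k i = 0)"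
  shows "ring.dimension rta n K {\<Sum>i<n. k i * b i | k. \<forall>i<n. k i \<in> K}"
proof -
  interpret F: field "rta :: 'f ring" by (rule field_from_type_algebra)
  interpret K: subring_set K by (rule subfield_rta[OF K])
  define Us where "Us = map b [0..<n]"
  have len: "length Us = n" and nth: "\<And>i. i < n \<Longrightarrow> Us ! i = b i" by (simp_all add: Us_def)
  have Us: "set Us \<subseteq> carrier rta" by (simp add: rta_simps)
  have comb: "F.combine Ks Us = (\<Sum>i<n. (if i < length Ks then Ks ! i else 0) * b i)" for Ks
  proof -
    have "F.combine Ks Us = (\<Sum>i<min (length Ks) n. Ks ! i * b i)"
      unfolding rta_combine len by (rule sum.cong) (auto simp: nth)
    also have "\<dots> = (\<Sum>i<n. (if i < length Ks then Ks ! i else 0) * b i)"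
      by (rule sum.mono_neutral_cong_left) auto
    finally show ?thesis .
  qed
  have "F.independent K Us"
  proof (rule F.trivial_combine_imp_independent[OF K Us])
    fix Ks assume Ks: "set Ks \<subseteq> K" "F.combine Ks Us = \<zero>\<^bsub>rta\<^esub>"
    have "\<forall>i<n. (if i < length Ks then Ks ! i else 0) = 0"
      by (rule ind) (use Ks K.zero_in in \<open>auto simp: comb[symmetric] rta_simps\<close>)
    then show "set (take (length Us) Ks) \<subseteq> {\<zero>\<^bsub>rta\<^esub>}" by (fastforce simp: in_set_conv_nth rta_simps len)
  qed
  moreover have "F.Span K Us = {\<Sum>i<n. k i * b i | k. \<forall>i<n. k i \<in> K}"
    unfolding F.Span_eq_combine_set[OF K Us]
  proof (intro equalityI subsetI; elim CollectE exE conjE)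
    fix u Ks assume "u = F.combine Ks Us" "set Ks \<subseteq> K"
    then show "u \<in> {\<Sum>i<n. k i * b i | k. \<forall>i<n. k i \<in> K}" unfolding comb
      by (intro CollectI exI[of _ "\<lambda>i. if i < length Ks then Ks ! i else 0"]) (auto simp: K.zero_in)
  next
    fix u k assume "u = (\<Sum>i<n. k i * b i)" "\<forall>i<n. k i \<in> K"
    then show "u \<in> {F.combine Ks Us | Ks. set Ks \<subseteq> K}"
      by (intro CollectI exI[of _ "map k [0..<n]"]) (auto simp: comb intro!: sum.cong)
  qed
  ultimately show ?thesis using F.dimensionI[OF K, of Us] len by simp
qed

lemma rta_dimension_unique:
  assumes "subfield K (rta :: 'f::field ring)" "ring.dimension rta m K M" "ring.dimension rta n K M"
  shows "m = n"
proof -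
  interpret F: field "rta :: 'f ring" by (rule field_from_type_algebra)
  show ?thesis by (rule F.dimension_is_inj[OF assms])
qed

section \<open>Evenness of the first coordinate\<close>

text \<open>Chevalley's theorem for \<open>K[1 / x]\<close> and its elements without constant term.
  The place lives on the whole algebraic closure, so it can be used for a function and for its
  conjugate.\<close>

lemma place_at_infinity:
  obtains V :: "'a::field func set" where "valuation_ring_set V" "range const_func \<subseteq> V"
    "inverse x_func \<in> valuation_ring_set.mx V"
proof -
  define z where "z = inverse (x_func :: 'a func)"
  have x0: "(x_func :: 'a func) \<noteq> 0" unfolding x_func_ev by (simp add: ev_eq_0)
  define A where "A = range (\<lambda>p :: 'a poly. poly (lift p) z)"
  define I where "I = {poly (lift p) z | p :: 'a poly. coeff p 0 = 0}"
  have "ideal_set A I"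
  proof
    show "1 \<in> A" unfolding A_def by (rule image_eqI[of _ _ 1]) (simp_all add: cf.h_1)
    show "I \<subseteq> A" by (auto simp: I_def A_def)
    show "0 \<in> I" unfolding I_def by (rule CollectI, rule exI[of _ 0]) simp
  next
    fix a b assume "a \<in> A" "b \<in> A"
    then obtain p q where *: "a = poly (lift p) z" "b = poly (lift q) z" by (auto simp: A_def)
    show "a - b \<in> A" unfolding A_def by (rule image_eqI[of _ _ "p - q"]) (simp_all add: * cf.mps)
    show "a * b \<in> A" unfolding A_def by (rule image_eqI[of _ _ "p * q"]) (simp_all add: * cf.mps)
  next
    fix a b assume "a \<in> I" "b \<in> I"
    then obtain p q where *: "a = poly (lift p) z" "b = poly (lift q) z" "coeff p 0 = 0" "coeff q 0 = 0" by (auto simp: I_def)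
    show "a + b \<in> I" unfolding I_def by (rule CollectI, rule exI[of _ "p + q"]) (simp add: * cf.mps)
  next
    fix a b assume "a \<in> A" "b \<in> I"
    then obtain p q where *: "a = poly (lift p) z" "b = poly (lift q) z" "coeff q 0 = 0" by (auto simp: A_def I_def)
    show "a * b \<in> I" unfolding I_def by (rule CollectI, rule exI[of _ "p * q"]) (simp add: * cf.mps coeff_mult)
  qed
  moreover have "1 \<notin> I"
  proof
    assume "1 \<in> I"
    then obtain p where p: "poly (lift p) z = 1" "coeff p 0 = 0" by (auto simp: I_def)
    define n where "n = degree p"
    \<comment> \<open>The relation multiplied by a power of \<open>x\<close>; its coefficient in
      degree \<open>n\<close> is \<open>- 1\<close>, although \<open>q\<close> should be
      zero.\<close>
    define q where "q = (\<Sum>i\<le>n. monom (coeff p i) (n - i)) - monom 1 n"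
    have evm: "ev (monom c i) = const_func c * x_func ^ i" for c :: 'a and i
      using poly_lift_x[of "monom c i"] by (simp add: map_poly_monom cf.h_0 poly_monom)
    have evs': "ev (sum s S) = (\<Sum>i\<in>S. ev (s i))" for s :: "nat \<Rightarrow> 'a poly" and S
      by (induction S rule: infinite_finite_induct) (auto simp: evs)
    have "(\<Sum>i\<le>n. const_func (coeff p i) * z ^ i) * x_func ^ n = x_func ^ n"
      using p(1) by (simp add: cf.poly_mp' n_def)
    moreover have "(\<Sum>i\<le>n. const_func (coeff p i) * z ^ i) * x_func ^ n = (\<Sum>i\<le>n. const_func (coeff p i) * x_func ^ (n - i))"
      unfolding sum_distrib_right by (rule sum.cong) (use x0 in \<open>auto simp: z_def power_diff field_simps\<close>)
    ultimately have "ev q = 0" by (simp add: q_def ev_diff evs' evm cf.h_1)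
    then have q0: "q = 0" by (simp add: ev_eq_0)
    have "coeff q n = (\<Sum>i\<le>n. if i = 0 then coeff p 0 else 0) - 1"
      unfolding q_def coeff_diff coeff_sum coeff_monom by (intro arg_cong2[of _ _ _ _ minus] sum.cong) auto
    then show False using q0 p(2) by simp
  qed
  ultimately obtain V where V: "valuation_ring_set V" "A \<subseteq> V" "I \<subseteq> valuation_ring_set.mx V" by (rule chevalley)
  moreover have "const_func c \<in> A" for c :: 'a
    unfolding A_def by (rule image_eqI[of _ _ "[:c:]"]) (simp_all add: cf.mps)
  moreover have "z \<in> I"
    unfolding I_def by (rule CollectI, rule exI[of _ "[:0,1:]"]) (simp add: cf.mps cf.h_0 cf.h_1)
  ultimately show ?thesis using that[of V] unfolding z_def by blast
qed

section \<open>Values of forms and slopes of lines near the origin of a curve\<close>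

lemma form_value_scale:
  "form_value h d c (s * x, s * y, s * z) = s ^ d * form_value h d c (x, y, z)"
proof -
  have "h (c i j) * (s * x) ^ i * (s * y) ^ j * (s * z) ^ (d - i - j) = s ^ d * (h (c i j) * x ^ i * y ^ j * z ^ (d - i - j))"
    if "i \<le> d" "j \<le> d - i" for i j
  proof -
    have "s ^ d = s ^ (i + (j + (d - i - j)))" using that by simp
    also have "\<dots> = s ^ i * (s ^ j * s ^ (d - i - j))" by (simp only: power_add)
    finally show ?thesis by (simp add: power_mult_distrib mult_ac)
  qed
  then show ?thesis unfolding form_value_def prod.case sum_distrib_left by (intro sum.cong refl) auto
qed

lemma form_value_top:
  "(\<Sum>i\<le>d. \<Sum>j\<le>d - i. if i = 0 \<and> j = d then k i j else 0) = ((k :: nat \<Rightarrow> nat \<Rightarrow> 'b::field) 0 d)"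
proof -
  have "(\<Sum>i\<le>d. \<Sum>j\<le>d - i. if i = 0 \<and> j = d then k i j else 0) = (\<Sum>i\<le>d. if i = 0 then k 0 d else 0)"
  proof (intro sum.cong refl)
    fix i
    show "(\<Sum>j\<le>d - i. if i = 0 \<and> j = d then k i j else 0) = (if i = 0 then k 0 d else 0)"
      by (cases "i = 0") simp_all
  qed
  then show ?thesis by simp
qed

lemma form_value_origin: "form_value h d c (0, 1, 0) = (h (c 0 d) :: 'b::field)"
proof -
  have "form_value h d c (0, 1, 0) = (\<Sum>i\<le>d. \<Sum>j\<le>d - i. if i = 0 \<and> j = d then h (c i j) else 0)"
    unfolding form_value_def prod.case by (intro sum.cong refl) (auto simp: power_0_left)
  then show ?thesis by (simp add: form_value_top)
qed

context valuation_ring_set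
begin

definition "one_unit a \<longleftrightarrow> a - 1 \<in> mx"

lemma one_unitD: assumes "one_unit a" shows "a \<in> V" "a \<notin> mx" "a \<noteq> 0" "inverse a \<in> V"
proof -
  have a: "a - 1 \<in> mx" using assms by (simp add: one_unit_def)
  then have "a - 1 \<in> V" using mx_sub by blast
  from add_in[OF this one_in] show V: "a \<in> V" by simp
  show m: "a \<notin> mx" using mx.I_diff[OF _ a, of a] mx_one by auto
  show "a \<noteq> 0" "inverse a \<in> V" using unit_iff[OF V] m by auto
qed

lemma one_unit_mult: assumes "one_unit a" "one_unit b" shows "one_unit (a * b)"
proof -
  have "a * (b - 1) + (a - 1) \<in> mx"
    using assms one_unitD(1)[OF assms(1)] unfolding one_unit_def by (intro mx.I_add mx.I_mult)
  then show ?thesis by (simp add: one_unit_def algebra_simps)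
qed

lemma one_unit_inverse: assumes "one_unit a" shows "one_unit (inverse a)"
proof -
  have "inverse a - 1 = - (inverse a * (a - 1))" using one_unitD(3)[OF assms] by (simp add: algebra_simps)
  then show ?thesis unfolding one_unit_def
    using assms one_unitD(4)[OF assms] by (auto simp: one_unit_def intro!: mx.I_uminus mx.I_mult)
qed

text \<open>Divided by \<open>x^2\<close>, the equation expresses \<open>x\<close> as a polynomial
  in \<open>y / x\<close> with integral coefficients, so \<open>y / x\<close> cannot be
  integral.\<close>

lemma pole_coordinates:
  assumes W: "a1 W \<in> V" "a2 W \<in> V" "a3 W \<in> V" "a4 W \<in> V" "a6 W \<in> V"
    and on: "on_affine W x y" and x: "x \<noteq> 0" "inverse x \<in> mx"
  shows "y \<noteq> 0" "x / y \<in> mx" "inverse y \<in> mx"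
proof -
  define s z where "s = y / x" and "z = inverse x"
  have zV: "z \<in> V" using x mx_sub by (auto simp: z_def)
  have y: "y = s * x" and zx: "z * x = 1" using x by (simp_all add: s_def z_def)
  have "y^2 + (a1 W * x + a3 W) * y = x^3 + a2 W * x^2 + a4 W * x + a6 W"
    using on by (simp add: on_affine_def poly_psi poly_cubic)
  then have "x = s^2 + a1 W * s + a3 W * s * z - a2 W - a4 W * z - a6 W * z^2"
    using zx unfolding y by Groebner_Basis.algebra
  then have sV: "s \<notin> V"
    using x mx_mult[of x "inverse x"] mx_one
    by (metis W zV mult_in add_in diff_in power_in right_inverse)
  then have "s \<noteq> 0" "inverse s \<in> mx" using zero_in not_in_imp by auto
  then show y0: "y \<noteq> 0" and m: "x / y \<in> mx" using x by (auto simp: s_def)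
  have "inverse y = z * (x / y)" using x by (simp add: z_def field_simps)
  then show "inverse y \<in> mx" using m zV mx_mult by metis
qed

lemma form_value_pole:
  assumes "y \<noteq> 0" "x / y \<in> mx" "inverse y \<in> mx" "\<And>i j. h (c i j) \<in> V"
  shows "form_value h d c (x, y, 1) / y ^ d - h (c 0 d) \<in> mx"
proof -
  define t u where "t = x / y" and "u = inverse y"
  have tu: "t \<in> mx" "u \<in> mx" using assms by (simp_all add: t_def u_def)
  then have tuV: "t \<in> V" "u \<in> V" using mx_sub by auto
  have "form_value h d c (x, y, 1) = form_value h d c (y * t, y * 1, y * u)" using assms(1) by (simp add: t_def u_def)
  then have 1: "form_value h d c (x, y, 1) / y ^ d = form_value h d c (t, 1, u)"
    unfolding form_value_scale using assms(1) by simp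
  have "form_value h d c (t, 1, u) - h (c 0 d) =
    (\<Sum>i\<le>d. \<Sum>j\<le>d - i. h (c i j) * t ^ i * u ^ (d - i - j) - (if i = 0 \<and> j = d then h (c i j) else 0))"
    unfolding sum_subtractf form_value_top by (simp add: form_value_def)
  also have "\<dots> \<in> mx"
  proof (intro mx.I_sum)
    fix i j assume ij: "i \<in> {..d}" "j \<in> {..d - i}"
    show "h (c i j) * t ^ i * u ^ (d - i - j) - (if i = 0 \<and> j = d then h (c i j) else 0) \<in> mx"
    proof (cases "i = 0 \<and> j = d")
      case True then show ?thesis by (simp add: mx.I_zero)
    next
      case False
      have "h (c i j) * t ^ i * u ^ (d - i - j) \<in> mx"
      proof (cases "i = 0")
        case True
        then have "d - i - j > 0" using False ij by auto
        then show ?thesis by (intro mx.I_mult mult_in power_in tuV assms(4) mx.I_power tu)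
      next
        case False
        then have "t ^ i \<in> mx" by (intro mx.I_power tu) auto
        then show ?thesis by (intro mx.I_mult' mx.I_mult power_in tuV assms(4))
      qed
      then show ?thesis using False by auto
    qed
  qed
  finally show ?thesis unfolding 1 .
qed

text \<open>Divided by \<open>y ^ d\<close>, the three forms reduce to their values at the origin,
  of which only the middle one is nonzero: the isogeny sends points near the origin close to the
  origin.\<close>

lemma regular_pole:
  assumes y: "y \<noteq> 0" "x / y \<in> mx" "inverse y \<in> mx" and h: "\<And>c. h c \<in> V" "h 0 = 0" "\<And>c. c \<noteq> 0 \<Longrightarrow> inverse (h c) \<in> V" "\<And>c. c \<noteq> 0 \<Longrightarrow> h c \<noteq> 0"
    and F: "form_value h d F2 (x, y, 1) \<noteq> 0" "form_value h d F0 (x, y, 1) = form_value h d F2 (x, y, 1) * f"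
      "form_value h d F1 (x, y, 1) = form_value h d F2 (x, y, 1) * g"
    and c: "F0 0 d = 0" "F1 0 d \<noteq> 0" "F2 0 d = 0"
  shows "g \<noteq> 0 \<and> inverse g \<in> mx \<and> f / g \<in> mx"
proof -
  define G where "G = (\<lambda>F. form_value h d F (x, y, 1) / y ^ d)"
  have G: "G F - h (F 0 d) \<in> mx" for F unfolding G_def by (rule form_value_pole[OF y]) (rule h(1))
  have m: "G F0 \<in> mx" "G F2 \<in> mx" using G[of F0] G[of F2] c h(2) by simp_all
  have "G F1 - h (F1 0 d) \<in> V" using G mx_sub by blast
  from add_in[OF this h(1)[of "F1 0 d"]] have V: "G F1 \<in> V" by simp
  have "G F1 \<notin> mx"
  proof
    assume "G F1 \<in> mx"
    from mx.I_diff[OF this G[of F1]] have "h (F1 0 d) \<in> mx" by simp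
    then show False using h(3,4)[OF c(2)] by (simp add: mx_def)
  qed
  then have u: "G F1 \<noteq> 0" "inverse (G F1) \<in> V" using unit_iff[OF V] by auto
  have e: "G F0 = G F2 * f" "G F1 = G F2 * g" using F by (simp_all add: G_def)
  have G2: "G F2 \<noteq> 0" using u e by auto
  have "g \<noteq> 0" "inverse g = G F2 * inverse (G F1)" "f / g = G F0 * inverse (G F1)"
    using u(1) G2 unfolding e by (auto simp: field_simps)
  then show ?thesis using mx.I_mult'[OF m(1) u(2)] mx.I_mult'[OF m(2) u(2)] by simp
qed

text \<open>With \<open>t = f / g\<close> the equation makes \<open>f * t^2\<close> congruent to 1,
  and for a line through the integral point \<open>(c, e)\<close> also \<open>m * t\<close> is
  congruent to 1.\<close>

lemma pole_slope:
  assumes W: "a1 W \<in> V" "a2 W \<in> V" "a3 W \<in> V" "a4 W \<in> V" "a6 W \<in> V"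
    and on: "on_affine W f g" and g: "g \<noteq> 0" "inverse g \<in> mx" "f / g \<in> mx"
    and c: "c \<in> V" "e \<in> V" "m * (f - c) = g - e"
  shows "f \<notin> V" "m \<noteq> 0" "inverse m \<in> mx" "one_unit (f / m^2)"
proof -
  define t u where "t = f / g" and "u = inverse g"
  have tu: "t \<in> mx" "u \<in> mx" using g by (simp_all add: t_def u_def)
  then have tuV: "t \<in> V" "u \<in> V" using mx_sub by auto
  have gu: "g * u = 1" and t: "t = f * u" using g by (simp_all add: t_def u_def field_simps)
  have "g^2 + (a1 W * f + a3 W) * g = f^3 + a2 W * f^2 + a4 W * f + a6 W"
    using on by (simp add: on_affine_def poly_psi poly_cubic)
  then have "f * t^2 - 1 = t * (a1 W - a2 W * t - a4 W * u) + u * (a3 W - a6 W * u)"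
    using gu unfolding t by Groebner_Basis.algebra
  also have "\<dots> \<in> mx" by (intro mx.I_add mx.I_mult' tu diff_in mult_in W tuV)
  finally have ft: "one_unit (f * t^2)" by (simp add: one_unit_def)
  then have nz: "f \<noteq> 0" "t \<noteq> 0" using one_unitD(3) by fastforce+
  have fie: "inverse f = t^2 * inverse (f * t^2)" using nz by (simp add: field_simps)
  have fi: "inverse f \<in> mx" unfolding fie by (intro mx.I_mult' mx.I_power tu one_unitD(4)[OF ft]) simp
  then show "f \<notin> V" using nz mx_mult[of f "inverse f"] mx_one by auto
  define a where "a = 1 - c * inverse f"
  have a: "one_unit a" unfolding one_unit_def a_def using mx.I_uminus[OF mx_mult[OF c(1) fi]] by simp
  have ff: "f * inverse f = 1" using nz by simp
  have "m * t * a = 1 - e * u"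
  proof -
    have "m * t * a = m * (f - c) * u" unfolding a_def t using ff by Groebner_Basis.algebra
    also have "\<dots> = 1 - e * u" unfolding c(3) using gu by (simp add: algebra_simps)
    finally show ?thesis .
  qed
  then have "one_unit (m * t * a)" unfolding one_unit_def using mx.I_uminus[OF mx_mult[OF c(2) tu(2)]] by simp
  from one_unit_mult[OF this one_unit_inverse[OF a]] have mt: "one_unit (m * t)" using one_unitD(3)[OF a] by (simp add: mult.assoc)
  then show m0: "m \<noteq> 0" using one_unitD(3) by fastforce
  have mi: "inverse m = t * inverse (m * t)" using nz m0 by (simp add: field_simps)
  show "inverse m \<in> mx" unfolding mi by (rule mx.I_mult'[OF tu(1) one_unitD(4)[OF mt]])
  have "f / m^2 = (f * t^2) * (inverse (m * t) * inverse (m * t))" using nz m0 by (simp add: field_simps power2_eq_square)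
  then show "one_unit (f / m^2)" using one_unit_mult[OF ft one_unit_mult[OF one_unit_inverse[OF mt] one_unit_inverse[OF mt]]] by simp
qed

end

context subfield_hom
begin

lemma hom_add: "x \<in> K \<Longrightarrow> y \<in> K \<Longrightarrow> \<theta> (x + y) = \<theta> x + \<theta> y"
  using hom_diff[OF _ uminus_in, of x y] by (simp add: hom_uminus)

lemma hom_sum: "(\<And>i. i \<in> S \<Longrightarrow> s i \<in> K) \<Longrightarrow> \<theta> (sum s S) = (\<Sum>i\<in>S. \<theta> (s i))"
  by (induction S rule: infinite_finite_induct) (auto simp: hom_zero hom_add sum_in)

end

context func_curve
begin

lemma FF_x: "x_func \<in> FF" by (rule FF_RF[OF RF_x])

lemma FF_const: "const_func c \<in> FF" by (rule FF_RF[OF RF_const])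

lemma conjg_form: "conjg (form_value const_func d c (x_func, y, 1)) = form_value const_func d c (x_func, yc, 1)"
proof -
  have t: "const_func (c i j) * x_func ^ i * y ^ j * 1 ^ k \<in> FF" for i j k
    by (intro FF.mult_in FF.power_in FF_x FF_y FF_const FF.one_in)
  have "conjg (const_func (c i j) * x_func ^ i * y ^ j * 1 ^ k) = const_func (c i j) * x_func ^ i * yc ^ j * 1 ^ k" for i j k
    by (simp add: FF.hom_mult FF.hom_power FF.mult_in FF.power_in FF_x FF_y FF_const conjg_RF[OF RF_x] conjg_RF[OF RF_const] conjg_y)
  note c = this
  define T where "T = (\<lambda>i j. const_func (c i j) * x_func ^ i * y ^ j * 1 ^ (d - i - j))"
  have "conjg (\<Sum>i\<le>d. \<Sum>j\<le>d - i. T i j) = (\<Sum>i\<le>d. conjg (\<Sum>j\<le>d - i. T i j))"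
    unfolding T_def by (rule FF.hom_sum) (intro FF.sum_in t)
  also have "\<dots> = (\<Sum>i\<le>d. \<Sum>j\<le>d - i. conjg (T i j))"
    unfolding T_def by (intro sum.cong refl FF.hom_sum t)
  finally show ?thesis unfolding form_value_def prod.case T_def c .
qed

lemma form_in: "form_value const_func d c (x_func, y, 1) \<in> FF"
  unfolding form_value_def prod.case
  by (intro FF.sum_in FF.mult_in FF.power_in FF_x FF_y FF_const FF.one_in)

lemma conjg_on:
  assumes "u \<in> FF" "v \<in> FF" "on_affine (map_weierstrass const_func V) u v"
  shows "on_affine (map_weierstrass const_func V) (conjg u) (conjg v)"
proof -
  have "v^2 + (const_func (a1 V) * u + const_func (a3 V)) * v = u^3 + const_func (a2 V) * u^2 + const_func (a4 V) * u + const_func (a6 V)"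
    using assms(3) by (simp add: on_affine_def poly_psi poly_cubic cf.map_weierstrass_sel)
  from arg_cong[OF this, of conjg] show ?thesis
    by (simp add: on_affine_def poly_psi poly_cubic cf.map_weierstrass_sel FF.hom_add FF.hom_mult FF.hom_power
        FF.closed assms FF_const conjg_RF[OF RF_const])
qed

text \<open>Equality would force characteristic 2 and \<open>psi W = 0\<close>, where
  \<open>b2\<close>, \<open>b4\<close> and \<open>b6\<close> all vanish.\<close>

lemma y_ne_yc: assumes "discriminant W \<noteq> 0" shows "y \<noteq> yc"
proof
  assume "y = yc"
  then have "ev (psi W) + 2 * y = 0" by (simp add: yc_def)
  then have "ev (psi W) = 0 \<and> (2 :: 'a func) = 0" using unique0[of "ev (psi W)" 2] RF_ev RF.numeral_in by blast
  then have 1: "psi W = 0" and "ev (2 :: 'a poly) = 0" by (simp_all add: ev_eq_0 ev_numeral)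
  then have "(2 :: 'a poly) = 0" by (simp add: ev_eq_0)
  then have two: "(2 :: 'a) = 0" by (simp add: numeral_poly)
  then have "(4 :: 'a) = 0" by (metis mult_2 numeral_Bit0 add_0 mult_zero_left)
  then have "b2 W = 0" "b4 W = 0" "b6 W = 0" using 1 two by (simp_all add: b2_def b4_def b6_def psi_def)
  then show False using assms by (simp add: discriminant_b)
qed

lemma poles:
  assumes F: "form_value const_func d F2 (x_func, y, 1) \<noteq> 0"
      "form_value const_func d F0 (x_func, y, 1) = form_value const_func d F2 (x_func, y, 1) * f"
      "form_value const_func d F1 (x_func, y, 1) = form_value const_func d F2 (x_func, y, 1) * g"
    and c: "F0 0 d = 0" "F1 0 d \<noteq> 0" "F2 0 d = 0" and fg: "f \<in> FF" "g \<in> FF"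
    and V: "valuation_ring_set V" "range const_func \<subseteq> V" "inverse x_func \<in> valuation_ring_set.mx V"
  shows "g \<noteq> 0 \<and> inverse g \<in> valuation_ring_set.mx V \<and> f / g \<in> valuation_ring_set.mx V"
    "conjg g \<noteq> 0 \<and> inverse (conjg g) \<in> valuation_ring_set.mx V \<and> conjg f / conjg g \<in> valuation_ring_set.mx V"
proof -
  interpret V: valuation_ring_set V by fact
  have cV: "const_func c \<in> V" for c using V(2) by auto
  have ci: "inverse (const_func c) \<in> V" for c using cV[of "inverse c"] by (simp add: cf.h_inverse)
  have x0: "(x_func :: 'a func) \<noteq> 0" unfolding x_func_ev by (simp add: ev_eq_0)
  note P = V.pole_coordinates[of "map_weierstrass const_func W" x_func, unfolded cf.map_weierstrass_sel, OF cV cV cV cV cV _ x0 V(3)]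
  show "g \<noteq> 0 \<and> inverse g \<in> V.mx \<and> f / g \<in> V.mx"
    by (rule V.regular_pole[OF P[OF on] _ _ _ _ F c]) (simp_all add: cV ci cf.h_0 cf.h_eq_0)
  have yc: "on_affine (map_weierstrass const_func W) x_func yc"
    using conjg_on[OF FF_x FF_y on] by (simp add: conjg_y conjg_RF[OF RF_x])
  have Fc: "form_value const_func d F2 (x_func, yc, 1) \<noteq> 0"
    using F(1) FF.hom_eq_0[OF form_in] by (metis conjg_form)
  have Fc': "form_value const_func d F0 (x_func, yc, 1) = form_value const_func d F2 (x_func, yc, 1) * conjg f"
    using arg_cong[OF F(2), of conjg] by (simp add: conjg_form FF.hom_mult form_in fg)
  have Fc'': "form_value const_func d F1 (x_func, yc, 1) = form_value const_func d F2 (x_func, yc, 1) * conjg g"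
    using arg_cong[OF F(3), of conjg] by (simp add: conjg_form FF.hom_mult form_in fg)
  show "conjg g \<noteq> 0 \<and> inverse (conjg g) \<in> V.mx \<and> conjg f / conjg g \<in> V.mx"
    by (rule V.regular_pole[OF P[OF yc] _ _ _ _ Fc Fc' Fc'' c]) (simp_all add: cV ci cf.h_0 cf.h_eq_0)
qed

text \<open>
  \<open>\<phi> P + \<phi> (- P)\<close> is a rational point over \<open>K(x)\<close>, hence constant; if \<open>f\<close> were not even it would be an affine
  point, which the behaviour at the origin forbids.
\<close>

lemma first_coordinate_even:
  assumes W: "discriminant W \<noteq> 0" and W': "discriminant W' \<noteq> 0"
    and fg: "f \<in> FF" "g \<in> FF" and on': "on_affine (map_weierstrass const_func W') f g"
    and V: "valuation_ring_set V" "range const_func \<subseteq> V"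
    and p1: "g \<noteq> 0 \<and> inverse g \<in> valuation_ring_set.mx V \<and> f / g \<in> valuation_ring_set.mx V"
    and p2: "conjg g \<noteq> 0 \<and> inverse (conjg g) \<in> valuation_ring_set.mx V \<and> conjg f / conjg g \<in> valuation_ring_set.mx V"
  shows "f \<in> RF"
proof -
  interpret V: valuation_ring_set V by fact
  have cV: "const_func c \<in> V" for c using V(2) by auto
  define C where "C = map_weierstrass const_func W'"
  note Cs = cf.map_weierstrass_sel[of W', folded C_def]
  obtain f0 f1 where f: "f = f0 + f1 * y" "f0 \<in> RF" "f1 \<in> RF" using fg(1) by (auto simp: FF_def)
  obtain g0 g1 where g: "g = g0 + g1 * y" "g0 \<in> RF" "g1 \<in> RF" using fg(2) by (auto simp: FF_def)
  have fc: "conjg f = f0 + f1 * yc" and gc: "conjg g = g0 + g1 * yc" using f g conjg by auto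
  have "f1 = 0"
  proof (rule ccontr)
    assume f1: "f1 \<noteq> 0"
    have yy: "y - yc \<noteq> 0" using y_ne_yc[OF W] by simp
    have df: "f - conjg f = f1 * (y - yc)" "g - conjg g = g1 * (y - yc)"
      unfolding fc gc unfolding f(1) g(1) by (simp_all add: algebra_simps)
    then have ne: "f \<noteq> conjg f" using f1 yy by auto
    \<comment> \<open>The chord through \<open>(f, g)\<close> and its conjugate is stable under
      conjugation, so its slope and its third intersection are defined over
      \<open>K(x)\<close>.\<close>
    define m where "m = g1 / f1"
    have mR: "m \<in> RF" unfolding m_def by (intro RF_divide f g)
    have mg: "m * (f - conjg f) = g - conjg g" unfolding df m_def using f1 by simp
    have sl: "slope (f, g) (conjg f, conjg g) = m"
      using slope_eq[of "(f, g)" "(conjg f, conjg g)"] ne mg by (simp add: slope_def field_simps)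
    obtain c e where ce: "third_pt C (f, g) (conjg f, conjg g) = (c, e)" by force
    have c: "c = m^2 + a1 C * m - a2 C - f - conjg f" and e: "e = g + m * (c - f)"
      using ce by (simp_all add: third_pt_def sl Let_def) auto
    have "on_pt C (third_pt C (f, g) (conjg f, conjg g))"
      by (rule third_pt_on) (use on' conjg_on[OF fg on'] ne in \<open>simp_all add: C_def\<close>)
    then have ceC: "on_affine C c e" by (simp add: ce)
    have tr: "f + conjg f = 2 * f0 - f1 * ev (psi W)" unfolding fc unfolding f(1) by (rule trace)
    have "c = m^2 + a1 C * m - a2 C - (f + conjg f)" using c by simp
    also have "\<dots> = m^2 + a1 C * m - a2 C - (2 * f0 - f1 * ev (psi W))" unfolding tr ..
    also have "\<dots> \<in> RF" unfolding Cs by (intro RF.closed RF_const RF_ev f mR)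
    finally have cR: "c \<in> RF" .
    have "m * f1 = g1" using f1 by (simp add: m_def)
    then have "e = g0 + m * (c - f0)" unfolding e f(1) g(1) by (simp add: algebra_simps)
    also have "\<dots> \<in> RF" by (intro RF.closed cR mR f g)
    finally have eR: "e \<in> RF" .
    have "c \<in> range const_func \<and> e \<in> range const_func"
      using RF_point_const[OF W' ceC[unfolded C_def] cR eR] .
    then have ceV: "c \<in> V" "e \<in> V" using V(2) by auto
    have l: "m * (f - c) = g - e" "m * (conjg f - c) = conjg g - e"
      using mg unfolding e by (simp_all add: algebra_simps)
    have CV: "a1 C \<in> V" "a2 C \<in> V" "a3 C \<in> V" "a4 C \<in> V" "a6 C \<in> V" unfolding Cs by (rule cV)+
    have onC: "on_affine C f g" "on_affine C (conjg f) (conjg g)" using on' conjg_on[OF fg on'] by (simp_all add: C_def)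
    note p1' = p1[THEN conjunct1] p1[THEN conjunct2, THEN conjunct1] p1[THEN conjunct2, THEN conjunct2]
    note p2' = p2[THEN conjunct1] p2[THEN conjunct2, THEN conjunct1] p2[THEN conjunct2, THEN conjunct2]
    note s1 = V.pole_slope[OF CV onC(1) p1' ceV l(1)]
    note s2 = V.pole_slope[OF CV onC(2) p2' ceV l(2)]
    define w where "w = inverse m"
    have w: "w \<in> V.mx" "m * w = 1" using s1(2,3) by (simp_all add: w_def)
    then have wV: "w \<in> V" using V.mx_sub by auto
    have ou: "f * w^2 - 1 \<in> V.mx" "conjg f * w^2 - 1 \<in> V.mx"
      using s1(4) s2(4) by (simp_all add: V.one_unit_def w_def divide_inverse power_inverse)
    \<comment> \<open>The formula for \<open>c\<close> divided by \<open>m^2\<close>. Both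
      \<open>f\<close> and its conjugate are \<open>m^2\<close> to leading order, and so is their
      sum: a contradiction in every residue characteristic.\<close>
    have "w * (a1 C - (a2 C + c) * w) - (f * w^2 - 1) - (conjg f * w^2 - 1) = 1"
      using w(2) c by Groebner_Basis.algebra
    moreover have "w * (a1 C - (a2 C + c) * w) - (f * w^2 - 1) - (conjg f * w^2 - 1) \<in> V.mx"
      by (intro V.mx.I_diff ou V.mx.I_mult' w V.closed CV ceV wV)
    ultimately have "1 \<in> V.mx" by (simp only:)
    then show False using V.mx_one by simp
  qed
  then show ?thesis using f by simp
qed

end

section \<open>From isogenies to polynomial data\<close>

context func_curve
begin

text \<open>With \<open>f\<close> and \<open>g\<close> in lowest terms, the coefficients of 1 and
  \<open>y\<close> in the equation of \<open>W'\<close> vanish separately. The second has the factor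
  \<open>g1\<close>, nonzero because \<open>(f, g)\<close> would otherwise be a point over
  \<open>K(x)\<close> and hence constant.\<close>

lemma isogeny_data_exists:
  assumes W: "discriminant W \<noteq> 0" and W': "discriminant W' \<noteq> 0"
    and f: "f \<in> RF" and g: "g \<in> FF" and on': "on_affine (map_weierstrass const_func W') f g"
    and nconst: "\<not> (f \<in> range const_func \<and> g \<in> range const_func)"
    and V: "valuation_ring_set V" "range const_func \<subseteq> V" "inverse x_func \<in> valuation_ring_set.mx V" "f \<notin> V"
  obtains N D A B H u v t where "isogeny_data W W' N D A B H" "f = ev N / ev D" "g = (ev A + ev B * y) / ev H"
    "u * A + v * B + t * H = 1"
proof -
  interpret V: valuation_ring_set V by fact
  obtain N0 D0 where f0: "D0 \<noteq> 0" "f = ev N0 / ev D0" using RF_cases[OF f] .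
  obtain d1 N Z D u v t where 1: "d1 \<noteq> 0" "N0 = d1 * N" "0 = d1 * Z" "D0 = d1 * D" "u * N + v * Z + t * D = 1"
    using poly_bezout[OF f0(1), of N0 0] .
  have D0: "D \<noteq> 0" and cop: "u * N + t * D = 1" using 1 f0(1) by auto
  have eD: "ev D \<noteq> 0" "ev d1 \<noteq> 0" using D0 1(1) by (simp_all add: ev_eq_0)
  have fND: "f = ev N / ev D" unfolding f0(2) 1(2,4) evs using eD by simp
  obtain g0 g1 where gg: "g = g0 + g1 * y" "g0 \<in> RF" "g1 \<in> RF" using g by (auto simp: FF_def)
  obtain A0 B0 H0 where g0: "H0 \<noteq> 0" "g0 = ev A0 / ev H0" "g1 = ev B0 / ev H0" using RF_common[OF gg(2,3)] .
  obtain d2 A B H u' v' t' where 2: "d2 \<noteq> 0" "A0 = d2 * A" "B0 = d2 * B" "H0 = d2 * H" "u' * A + v' * B + t' * H = 1"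
    using poly_bezout[OF g0(1), of A0 B0] .
  have H0: "H \<noteq> 0" using 2 g0(1) by auto
  have eH: "ev H \<noteq> 0" "ev d2 \<noteq> 0" using H0 2(1) by (simp_all add: ev_eq_0)
  have gAB: "g0 = ev A / ev H" "g1 = ev B / ev H" unfolding g0(2,3) 2(2-4) evs using eH by simp_all
  have gABy: "g = (ev A + ev B * y) / ev H" unfolding gg gAB by (simp add: add_divide_distrib)
  have on2: "g^2 + (const_func (a1 W') * f + const_func (a3 W')) * g =
      f^3 + const_func (a2 W') * f^2 + const_func (a4 W') * f + const_func (a6 W')"
    using on' by (simp add: on_affine_def poly_psi poly_cubic cf.map_weierstrass_sel)
  have g1: "g1 \<noteq> 0"
  proof
    assume "g1 = 0"
    then have "g \<in> RF" using gg by simp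
    then show False using RF_point_const[OF W' on' f] nconst by blast
  qed
  then have B0: "B \<noteq> 0" using gAB by (auto simp: ev_0)
  define h where "h = const_func (a1 W') * f + const_func (a3 W')"
  have hR: "h \<in> RF" unfolding h_def by (intro RF.closed RF_const f)
  define r where "r = f^3 + const_func (a2 W') * f^2 + const_func (a4 W') * f + const_func (a6 W')"
  have rR: "r \<in> RF" unfolding r_def by (intro RF.closed RF_const f)
  have "(g0^2 + g1^2 * ev (cubic W) + h * g0 - r) + (2 * g0 * g1 - g1^2 * ev (psi W) + h * g1) * y = 0"
  proof -
    have "(g0^2 + g1^2 * ev (cubic W) + h * g0 - r) + (2 * g0 * g1 - g1^2 * ev (psi W) + h * g1) * y =
        ((g0 + g1 * y)^2 + h * (g0 + g1 * y) - r) - g1^2 * (y^2 - (ev (cubic W) - ev (psi W) * y))"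
      by Groebner_Basis.algebra
    also have "\<dots> = 0" using on2[folded h_def r_def] unfolding eq gg(1) by simp
    finally show ?thesis .
  qed
  moreover have "g0^2 + g1^2 * ev (cubic W) + h * g0 - r \<in> RF" "2 * g0 * g1 - g1^2 * ev (psi W) + h * g1 \<in> RF"
    by (intro RF.closed gg hR rR RF_ev)+
  ultimately have z: "g0^2 + g1^2 * ev (cubic W) + h * g0 - r = 0" "2 * g0 * g1 - g1^2 * ev (psi W) + h * g1 = 0"
    using unique0 by blast+
  have "2 * g0 * g1 - g1^2 * ev (psi W) + h * g1 = g1 * (2 * g0 - g1 * ev (psi W) + h)" by Groebner_Basis.algebra
  then have tr: "2 * g0 - g1 * ev (psi W) + h = 0" using g1 z(2) by simp
  have "g0^2 - g0 * g1 * ev (psi W) - g1^2 * ev (cubic W) + r =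
      g0 * (2 * g0 - g1 * ev (psi W) + h) - (g0^2 + g1^2 * ev (cubic W) + h * g0 - r)"
    by Groebner_Basis.algebra
  then have nm: "g0^2 - g0 * g1 * ev (psi W) - g1^2 * ev (cubic W) + r = 0" using z(1) tr by simp
  have P: "ev N = f * ev D" "ev A = g0 * ev H" "ev B = g1 * ev H"
    by (simp only: fND nonzero_eq_divide_eq[OF eD(1)] nonzero_divide_eq_eq times_divide_eq_left nonzero_mult_div_cancel_right[OF eD(1)])
      (simp_all only: gAB times_divide_eq_left nonzero_mult_div_cancel_right[OF eH(1)])
  have sm: "smult c p = [:c:] * p" for c and p :: "'a poly" by simp
  have l1: "ev (D * (2 * A - B * psi W)) = ev D * ev H * (2 * g0 - g1 * ev (psi W))"
    unfolding evs P by Groebner_Basis.algebra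
  have r1: "ev (- ((smult (a1 W') N + smult (a3 W') D) * H)) = ev D * ev H * (- h)"
    unfolding sm evs ev_const P h_def by Groebner_Basis.algebra
  have "2 * g0 - g1 * ev (psi W) = - h" using tr by (simp add: eq_neg_iff_add_eq_0)
  then have "ev (D * (2 * A - B * psi W)) = ev (- ((smult (a1 W') N + smult (a3 W') D) * H))"
    unfolding l1 r1 by simp
  then have i1: "D * (2 * A - B * psi W) = - ((smult (a1 W') N + smult (a3 W') D) * H)" by (simp only: ev_eq)
  have l2: "ev (D^3 * (A^2 - A * B * psi W - B^2 * cubic W)) =
      ev D ^ 3 * ev H ^ 2 * (g0^2 - g0 * g1 * ev (psi W) - g1^2 * ev (cubic W))"
    unfolding evs P by Groebner_Basis.algebra
  have r2: "ev (- (H^2 * (N^3 + smult (a2 W') (N^2 * D) + smult (a4 W') (N * D^2) + smult (a6 W') (D^3)))) =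
      ev D ^ 3 * ev H ^ 2 * (- r)"
    unfolding sm evs ev_const P r_def by Groebner_Basis.algebra
  have "g0^2 - g0 * g1 * ev (psi W) - g1^2 * ev (cubic W) = - r" using nm by (simp add: eq_neg_iff_add_eq_0)
  then have "ev (D^3 * (A^2 - A * B * psi W - B^2 * cubic W)) =
       ev (- (H^2 * (N^3 + smult (a2 W') (N^2 * D) + smult (a4 W') (N * D^2) + smult (a6 W') (D^3))))"
    unfolding l2 r2 by simp
  then have i2: "D^3 * (A^2 - A * B * psi W - B^2 * cubic W) =
       - (H^2 * (N^3 + smult (a2 W') (N^2 * D) + smult (a4 W') (N * D^2) + smult (a6 W') (D^3)))" by (simp only: ev_eq)
  have x0: "(x_func :: 'a func) \<noteq> 0" unfolding x_func_ev by (simp add: ev_eq_0)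
  \<comment> \<open>Otherwise \<open>N / D\<close> would be finite at the place at infinity.\<close>
  have deg: "degree D < degree N"
  proof (rule ccontr)
    assume le: "\<not> degree D < degree N"
    define w where "w = inverse (x_func :: 'a func)"
    have w: "w \<in> V.mx" "w \<in> V" using V(3) V.mx_sub by (auto simp: w_def)
    have cV: "const_func c \<in> V" for c using V(2) by auto
    have lead: "ev p * w ^ n - const_func (coeff p n) \<in> V.mx" if "degree p \<le> n" for p n
      using that
    proof (induction p arbitrary: n)
      case 0
      then show ?case by (simp add: ev_0 cf.h_0 V.mx.I_zero)
    next
      case (pCons a p)
      have e: "ev (pCons a p) = const_func a + x_func * ev p"
      proof -
        have "pCons a p = [:a:] + [:0, 1:] * p" by simp
        then show ?thesis by (simp only: evs ev_const x_func_ev)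
      qed
      show ?case
      proof (cases n)
        case 0
        then have "p = 0" using pCons by (auto split: if_splits)
        then show ?thesis by (simp add: 0 ev_const V.mx.I_zero)
      next
        case (Suc m)
        have "ev (pCons a p) * w ^ n - const_func (coeff (pCons a p) n) =
          const_func a * w ^ n + (ev p * w ^ m - const_func (coeff p m))"
          unfolding e Suc using x0 by (simp add: w_def algebra_simps)
        moreover have "const_func a * w ^ n \<in> V.mx" using Suc by (intro V.mx.I_mult cV V.mx.I_power w) auto
        moreover have "degree p \<le> m" using pCons Suc by (auto split: if_splits)
        ultimately show ?thesis using pCons.IH V.mx.I_add by metis
      qed
    qed
    define n where "n = degree D"
    define a b where "a = ev N * w ^ n" and "b = ev D * w ^ n"
    have ab: "a - const_func (coeff N n) \<in> V.mx" "b - const_func (lead_coeff D) \<in> V.mx"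
      using lead[of N n] lead[of D n] le by (simp_all add: a_def b_def n_def)
    have aV: "a \<in> V" "b \<in> V"
      using V.add_in[OF subsetD[OF V.mx_sub ab(1)] cV[of "coeff N n"]] V.add_in[OF subsetD[OF V.mx_sub ab(2)] cV[of "lead_coeff D"]] by simp_all
    have "b \<notin> V.mx"
    proof
      assume "b \<in> V.mx"
      from V.mx.I_diff[OF this ab(2)] have "const_func (lead_coeff D) \<in> V.mx" by simp
      moreover have "inverse (const_func (lead_coeff D)) \<in> V" using cV[of "inverse (lead_coeff D)"] by (simp add: cf.h_inverse)
      ultimately show False using D0 by (auto simp: V.mx_def cf.h_eq_0)
    qed
    then have "inverse b \<in> V" using V.unit_iff[OF aV(2)] by simp
    from V.mult_in[OF aV(1) this] have "a * inverse b \<in> V" .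
    moreover have "a * inverse b = f" unfolding a_def b_def fND using x0 eD by (simp add: w_def field_simps)
    ultimately show False using V(4) by simp
  qed
  have "isogeny_data W W' N D A B H"
    unfolding isogeny_data_def using W W' B0 H0 D0 deg cop i1 i2 by blast
  then show ?thesis using that fND gABy 2(5) by blast
qed

end

section \<open>The degree of an isogeny\<close>

text \<open>Modulo \<open>N\<close> only the term with \<open>P 0\<close> survives; since
  \<open>D\<close> is coprime to \<open>N\<close> and \<open>P 0\<close> has smaller degree,
  \<open>P 0\<close> is zero and a factor \<open>N\<close> can be cancelled.\<close>

lemma power_combination_0:
  fixes N D :: "'a::field poly"
  assumes cop: "u * N + v * D = 1" and N: "degree N > 0"
    and P: "\<And>j. j \<le> m \<Longrightarrow> P j = 0 \<or> degree (P j) < degree N"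
    and sum: "(\<Sum>j\<le>m. P j * N ^ j * D ^ (m - j)) = 0"
  shows "\<forall>j\<le>m. P j = 0"
  using P sum
proof (induction m arbitrary: P)
  case (Suc m)
  have e: "(\<Sum>j\<le>Suc m. P j * N ^ j * D ^ (Suc m - j)) =
    P 0 * D ^ Suc m + N * (\<Sum>j\<le>m. P (Suc j) * N ^ j * D ^ (m - j))"
    unfolding sum.atMost_Suc_shift sum_distrib_left by (simp add: mult_ac)
  define S where "S = (\<Sum>j\<le>m. P (Suc j) * N ^ j * D ^ (m - j))"
  have PS: "P 0 * D ^ Suc m + N * S = 0" using e Suc.prems(2) unfolding S_def by (simp only:)
  then have "P 0 * D ^ Suc m = N * (- S)" by (simp add: eq_neg_iff_add_eq_0)
  then have dv: "N dvd P 0 * D ^ Suc m" by (rule dvdI)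
  have "\<exists>u v. u * N + v * (D ^ k) = 1" for k
  proof (induction k)
    case 0 then show ?case by (intro exI[of _ 0] exI[of _ 1]) simp
  next
    case (Suc k) then show ?case using bezout_mult[of N D "D ^ k"] cop by auto
  qed
  then obtain u' v' where uv: "u' * N + v' * D ^ Suc m = 1" by blast
  have "P 0 = P 0 * (u' * N + v' * D ^ Suc m)" unfolding uv by simp
  also have "\<dots> = (P 0 * u') * N + v' * (P 0 * D ^ Suc m)"
    by (simp only: distrib_left mult.assoc mult.left_commute[of "P 0" v'])
  also have "N dvd (P 0 * u') * N + v' * (P 0 * D ^ Suc m)" by (rule dvd_add[OF dvd_triv_right dvd_mult[OF dv]])
  finally have "N dvd P 0" .
  then have P0: "P 0 = 0" using Suc.prems(1)[of 0] dvd_imp_degree_le[of N "P 0"] by (cases "P 0 = 0") auto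
  have "N \<noteq> 0" using N by auto
  then have "S = 0" using PS unfolding P0 by simp
  have "\<forall>j\<le>m. P (Suc j) = 0"
  proof (rule Suc.IH)
    show "P (Suc j) = 0 \<or> degree (P (Suc j)) < degree N" if "j \<le> m" for j
      by (rule Suc.prems(1)) (use that in simp)
  qed (rule \<open>S = 0\<close>[unfolded S_def])
  then have "P j = 0" if "j \<le> Suc m" for j using P0 that by (cases j) simp_all
  then show ?case by blast
qed simp

text \<open>Once \<open>D ^ m\<close> has been multiplied through, sorting by powers of
  \<open>f\<close> instead of powers of \<open>x\<close> yields coefficients of degree below
  \<open>degree N\<close>.\<close>

lemma powers_of_x_independent:
  fixes N D :: "'a::field poly"
  assumes cop: "u * N + v * D = 1" and deg: "degree D < degree N" "D \<noteq> 0" and f: "f = ev N / ev D"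
    and sum: "(\<Sum>i<degree N. poly (lift (C i)) f * x_func ^ i) = 0"
  shows "\<forall>i<degree N. C i = 0"
proof -
  define n where "n = degree N"
  define m where "m = Max (insert 0 ((\<lambda>i. degree (C i)) ` {..<n}))"
  have m: "degree (C i) \<le> m" if "i < n" for i unfolding m_def using that by (intro Max_ge) auto
  have evs': "ev (sum s S) = (\<Sum>i\<in>S. ev (s i))" for s :: "nat \<Rightarrow> 'a poly" and S
    by (induction S rule: infinite_finite_induct) (auto simp: evs)
  have evm: "ev (monom c i) = const_func c * x_func ^ i" for c :: 'a and i
    using poly_lift_x[of "monom c i"] by (simp add: map_poly_monom cf.h_0 poly_monom)
  have eD: "ev D \<noteq> 0" using deg(2) by (simp add: ev_eq_0)
  define P where "P = (\<lambda>j. \<Sum>i<n. monom (coeff (C i) j) i)"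
  have "ev (\<Sum>j\<le>m. P j * N ^ j * D ^ (m - j)) = (\<Sum>j\<le>m. \<Sum>i<n. const_func (coeff (C i) j) * x_func ^ i * (ev N ^ j * ev D ^ (m - j)))"
    unfolding evs' P_def evs evm sum_distrib_right by (simp add: mult.assoc)
  also have "\<dots> = (\<Sum>i<n. \<Sum>j\<le>m. const_func (coeff (C i) j) * x_func ^ i * (ev N ^ j * ev D ^ (m - j)))"
    by (rule sum.swap)
  also have "\<dots> = (\<Sum>i<n. ev D ^ m * (poly (lift (C i)) f * x_func ^ i))"
  proof (intro sum.cong refl)
    fix i assume "i \<in> {..<n}"
    then have d: "degree (C i) \<le> m" using m by simp
    have "poly (lift (C i)) f = (\<Sum>j\<le>m. const_func (coeff (C i) j) * f ^ j)"
      unfolding cf.poly_mp' by (rule sum.mono_neutral_left) (use d in \<open>auto simp: coeff_eq_0 cf.h_0\<close>)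
    moreover have "ev D ^ m * f ^ j = ev N ^ j * ev D ^ (m - j)" if "j \<le> m" for j
      using that eD by (simp add: f power_divide power_diff)
    ultimately show "(\<Sum>j\<le>m. const_func (coeff (C i) j) * x_func ^ i * (ev N ^ j * ev D ^ (m - j))) =
        ev D ^ m * (poly (lift (C i)) f * x_func ^ i)"
      by (auto simp: sum_distrib_left sum_distrib_right mult_ac intro!: sum.cong)
  qed
  also have "\<dots> = 0" using sum by (simp add: n_def flip: sum_distrib_left)
  finally have 0: "(\<Sum>j\<le>m. P j * N ^ j * D ^ (m - j)) = 0" by (simp only: ev_eq_0)
  have cP: "coeff (P j) i = (if i < n then coeff (C i) j else 0)" for i j
    unfolding P_def coeff_sum by simp
  have dP: "P j = 0 \<or> degree (P j) < degree N" for j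
    by (cases "P j = 0") (auto simp: cP n_def[symmetric] simp flip: leading_coeff_0_iff split: if_splits)
  have "\<forall>j\<le>m. P j = 0" by (rule power_combination_0[OF cop _ dP 0]) (use deg in simp)
  then have "coeff (C i) j = 0" if "i < n" for i j
    using cP[of j i] that m[OF that] by (cases "j \<le> m") (auto simp: coeff_eq_0)
  then show ?thesis by (auto simp: n_def poly_eq_iff)
qed

lemma fractions_subfield:
  fixes P :: "'f::field set"
  assumes "subring_set P"
  defines "Q \<equiv> {u / w | u w. u \<in> P \<and> w \<in> P \<and> w \<noteq> 0}"
  shows "subring_set Q" "x \<in> Q \<Longrightarrow> inverse x \<in> Q" "P \<subseteq> Q"
proof -
  interpret subring_set P by fact
  have I: "u \<in> P \<Longrightarrow> w \<in> P \<Longrightarrow> w \<noteq> 0 \<Longrightarrow> u / w \<in> Q" for u w unfolding Q_def by blast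
  show "P \<subseteq> Q" using I[OF _ one_in] by auto
  show "subring_set Q"
  proof
    show "1 \<in> Q" using I[OF one_in one_in] by simp
    fix a b assume "a \<in> Q" "b \<in> Q"
    then obtain u w u' w' where *: "a = u / w" "b = u' / w'" "u \<in> P" "w \<in> P" "u' \<in> P" "w' \<in> P" "w \<noteq> 0" "w' \<noteq> 0"
      unfolding Q_def by blast
    have "(u * w' - u' * w) / (w * w') \<in> Q" by (intro I diff_in mult_in *) (simp add: *)
    then show "a - b \<in> Q" using * by (simp add: diff_frac_eq)
    have "(u * u') / (w * w') \<in> Q" by (intro I mult_in *) (simp add: *)
    then show "a * b \<in> Q" using * by simp
  qed
  show "inverse x \<in> Q" if x: "x \<in> Q"
  proof -
    obtain u w where *: "x = u / w" "u \<in> P" "w \<in> P" "w \<noteq> 0" using x unfolding Q_def by blast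
    then show ?thesis using I[of w u] I[of 0 1] zero_in one_in by (cases "u = 0") auto
  qed
qed

lemma common_denominator:
  fixes P :: "'f::field set" and k :: "nat \<Rightarrow> 'f"
  assumes "subring_set P" "\<And>i. i < n \<Longrightarrow> k i \<in> {u / w | u w. u \<in> P \<and> w \<in> P \<and> w \<noteq> 0}"
  shows "\<exists>w\<in>P. w \<noteq> 0 \<and> (\<forall>i<n. w * k i \<in> P)"
  using assms(2)
proof (induction n)
  interpret subring_set P by fact
  case 0
  then show ?case using one_in by (intro bexI[of _ 1]) auto
next
  interpret subring_set P by fact
  case (Suc n)
  then obtain w where w: "w \<in> P" "w \<noteq> 0" "\<forall>i<n. w * k i \<in> P" by auto
  obtain u z where u: "k n = u / z" "u \<in> P" "z \<in> P" "z \<noteq> 0" using Suc.prems[of n] by blast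
  have "z * w * k i \<in> P" if "i < Suc n" for i
  proof (cases "i = n")
    case True
    then have "z * w * k i = u * w" using u by simp
    then show ?thesis using mult_in[OF u(2) w(1)] by (simp only:)
  next
    case False
    then have "w * k i \<in> P" using that w by simp
    then show ?thesis using mult_in[OF u(3)] by (simp add: mult.assoc)
  qed
  then show ?case using u w mult_in by (intro bexI[of _ "z * w"]) auto
qed

context func_curve
begin

lemma adjoin_generic: "adjoin_consts {x_func, y} = FF"
proof
  show "adjoin_consts {x_func, y} \<subseteq> FF"
    by (rule adjoin_consts_least[OF FF.subring_set_axioms FF.inv_in]) (auto simp: FF_x FF_y FF_const)
  note M = subfield_rta[OF adjoin_consts_subfield[of "{x_func, y}"]]
  interpret M: subring_set "adjoin_consts {x_func, y}" by (rule M)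
  note inc = adjoin_consts_incl[of "{x_func, y}"]
  have e: "ev p \<in> adjoin_consts {x_func, y}" for p
    unfolding poly_lift_x[symmetric] using inc by (intro M.poly_in) (auto simp: coeffs_in_def cf.coeff_mp)
  have "RF \<subseteq> adjoin_consts {x_func, y}"
  proof
    fix u :: "'a func" assume "u \<in> RF"
    then obtain p q where "u = ev p / ev q" using RF_cases by blast
    then show "u \<in> adjoin_consts {x_func, y}" using M.mult_in[OF e M(2)[OF e]] by (simp add: divide_inverse)
  qed
  then show "FF \<subseteq> adjoin_consts {x_func, y}"
    unfolding FF_def using inc by (auto intro!: M.add_in M.mult_in)
qed

text \<open>The powers of \<open>x\<close> below \<open>degree N\<close> are a basis of
  \<open>K(E)\<close> over \<open>K(f, g)\<close>: \<open>x\<close> is a root of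
  \<open>N - f D\<close>, and uniqueness of dimension identifies \<open>degree N\<close> with
  \<open>l\<close>.\<close>

lemma isogeny_degree:
  assumes data: "isogeny_data W W' N D A B H" and f: "f = ev N / ev D" and g: "g = (ev A + ev B * y) / ev H"
    and on': "on_affine (map_weierstrass const_func W') f g"
    and dim: "ring.dimension rta l (adjoin_consts {f, g}) (adjoin_consts {x_func, y})"
  shows "degree N = l"
proof -
  define n where "n = degree N"
  have nz: "B \<noteq> 0" "H \<noteq> 0" "D \<noteq> 0" and deg: "degree D < n" using data by (auto simp: isogeny_data_def n_def)
  obtain u v where cop: "u * N + v * D = 1" using data unfolding isogeny_data_def by blast
  have enz: "ev B \<noteq> 0" "ev H \<noteq> 0" "ev D \<noteq> 0" using nz by (simp_all add: ev_eq_0)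
  have fR: "f \<in> RF" unfolding f by (rule RF_quot)
  have gF: "g \<in> FF" unfolding g divide_inverse
    by (intro FF.mult_in FF.add_in FF.inv_in FF_y FF_RF RF_ev)
  define M where "M = adjoin_consts {f, g}"
  have Msub: "subfield M rta" unfolding M_def by (rule adjoin_consts_subfield)
  interpret M: subring_set M by (rule subfield_rta[OF Msub])
  interpret M: subfield_hom M id
    by unfold_locales (auto intro: subfield_rta(2)[OF Msub])
  have Mf: "f \<in> M" and Mg: "g \<in> M" and Mc: "\<And>c. const_func c \<in> M"
    unfolding M_def using adjoin_consts_incl by blast+
  have MF: "M \<subseteq> FF" unfolding M_def
    by (rule adjoin_consts_least[OF FF.subring_set_axioms FF.inv_in]) (use FF_RF[OF fR] gF FF_const in auto)
  define F where "F = lift N - smult f (lift D)"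
  have cF: "coeff F i = const_func (coeff N i) - f * const_func (coeff D i)" for i by (simp add: F_def cf.coeff_mp)
  have FM: "coeffs_in M F" unfolding coeffs_in_def cF by (intro allI M.closed Mc Mf)
  have "coeff F n = const_func (lead_coeff N)" unfolding cF using deg by (simp add: coeff_eq_0 cf.h_0 n_def)
  then have Fn: "coeff F n \<noteq> 0" using deg by (auto simp: cf.h_eq_0 n_def)
  then have F0: "F \<noteq> 0" by auto
  have "degree F \<le> n" using deg by (intro degree_le) (auto simp: cF coeff_eq_0 cf.h_0 n_def)
  then have dF: "degree F = n" using le_degree[OF Fn] by simp
  have Fx: "poly F x_func = 0" using enz by (simp add: F_def poly_lift_x f)
  define S where "S = {poly p x_func | p. coeffs_in M p}"
  have SI: "coeffs_in M p \<Longrightarrow> poly p x_func \<in> S" for p by (auto simp: S_def)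
  have Sring: "subring_set S"
  proof
    show "1 \<in> S" using SI[of 1] M.coeffs_in_const[OF M.one_in] by (simp add: one_pCons)
    fix a b assume "a \<in> S" "b \<in> S"
    then obtain p q where "a = poly p x_func" "b = poly q x_func" "coeffs_in M p" "coeffs_in M q" by (auto simp: S_def)
    then show "a - b \<in> S" "a * b \<in> S"
      using SI[of "p - q"] SI[of "p * q"] M.coeffs_in_diff M.coeffs_in_mult by auto
  qed
  interpret S: subring_set S by (rule Sring)
  have MS: "M \<subseteq> S" using SI[OF M.coeffs_in_const] by auto
  have Sinv: "inverse a \<in> S" if aS: "a \<in> S" for a
  proof (cases "a = 0")
    case False
    obtain p where p: "a = poly p x_func" "coeffs_in M p" using aS by (auto simp: S_def)
    then obtain q where "coeffs_in M q" "poly q x_func = inverse a"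
      using M.inverse_in_adjoin[OF F0 FM Fx p(2)] False by auto
    then show ?thesis using SI by metis
  qed (simp add: S.zero_in)
  have "lift p \<in> Collect (coeffs_in M)" for p by (simp add: coeffs_in_def cf.coeff_mp Mc)
  then have evS: "ev p \<in> S" for p unfolding poly_lift_x[symmetric] by (intro SI) simp
  \<comment> \<open>As \<open>B\<close> is nonzero, \<open>y\<close> is obtained from
    \<open>g\<close> and rational functions of \<open>x\<close>, so \<open>x\<close> alone generates
    the extension.\<close>
  have "y = (g * ev H - ev A) * inverse (ev B)" using enz by (simp add: g)
  also have "\<dots> \<in> S" by (intro S.mult_in S.diff_in Sinv evS subsetD[OF MS Mg])
  finally have yS: "y \<in> S" .
  have "FF \<subseteq> S"
  proof
    fix a assume "a \<in> FF"
    then obtain p q where *: "a = p + q * y" "p \<in> RF" "q \<in> RF" by (auto simp: FF_def)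
    have RS: "r \<in> S" if rR: "r \<in> RF" for r
    proof -
      obtain p q where "r = ev p / ev q" using RF_cases[OF rR] by blast
      then show ?thesis using S.mult_in[OF evS Sinv[OF evS]] by (simp add: divide_inverse)
    qed
    then show "a \<in> S" unfolding *(1) by (intro S.add_in S.mult_in yS RS *(2,3))
  qed
  moreover have "S \<subseteq> {\<Sum>i<n. k i * x_func ^ i | k. \<forall>i<n. k i \<in> M}"
  proof
    fix a assume "a \<in> S"
    then obtain p where p: "a = poly p x_func" "coeffs_in M p" by (auto simp: S_def)
    obtain q r where *: "coeffs_in M q" "coeffs_in M r" "p = q * F + r" "r = 0 \<or> degree r < degree F"
      by (rule M.division_in[OF p(2) FM F0])
    have "a = poly r x_func" using p *(3) Fx by simp
    also have "\<dots> = (\<Sum>i<n. coeff r i * x_func ^ i)"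
      unfolding poly_altdef by (rule sum.mono_neutral_cong) (use *(4) dF deg in \<open>auto simp: coeff_eq_0\<close>)
    finally show "a \<in> {\<Sum>i<n. k i * x_func ^ i | k. \<forall>i<n. k i \<in> M}" using *(2) by (auto simp: coeffs_in_def)
  qed
  moreover have "{\<Sum>i<n. k i * x_func ^ i | k. \<forall>i<n. k i \<in> M} \<subseteq> FF"
    using MF by (auto intro!: FF.sum_in FF.mult_in FF.power_in FF_x)
  ultimately have span: "{\<Sum>i<n. k i * x_func ^ i | k. \<forall>i<n. k i \<in> M} = FF" by blast
  \<comment> \<open>The ring \<open>K[f] + K[f] g\<close>, whose fractions contain \<open>M\<close>.
    After clearing denominators, comparing coefficients of 1 and \<open>y\<close> splits a relation
    into two over \<open>K[f]\<close>.\<close>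
  define P where "P = {poly (lift C) f + poly (lift E) f * g | C E. True}"
  have PI: "poly (lift C) f + poly (lift E) f * g \<in> P" for C E by (auto simp: P_def)
  have g2: "g^2 = poly (lift (cubic W')) f - poly (lift (psi W')) f * g"
    using on' by (simp add: on_affine_def cf.mp_psi cf.mp_cubic eq_diff_eq)
  have Pring: "subring_set P"
  proof
    show "1 \<in> P" using PI[of 1 0] by (simp add: cf.h_1)
    fix a b assume "a \<in> P" "b \<in> P"
    then obtain C E C' E' where *: "a = poly (lift C) f + poly (lift E) f * g" "b = poly (lift C') f + poly (lift E') f * g"
      by (auto simp: P_def)
    show "a - b \<in> P" using PI[of "C - C'" "E - E'"] by (simp add: * cf.mps algebra_simps)
    have "a * b = poly (lift C) f * poly (lift C') f + (poly (lift C) f * poly (lift E') f + poly (lift E) f * poly (lift C') f) * g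
        + poly (lift E) f * poly (lift E') f * g^2"
      unfolding * by Groebner_Basis.algebra
    also have "\<dots> = poly (lift (C * C' + E * E' * cubic W')) f + poly (lift (C * E' + E * C' - E * E' * psi W')) f * g"
      unfolding g2 by (simp add: cf.mps algebra_simps)
    finally show "a * b \<in> P" using PI by simp
  qed
  define Q where "Q = {u / w | u w. u \<in> P \<and> w \<in> P \<and> w \<noteq> 0}"
  have "M \<subseteq> Q" unfolding M_def
  proof (rule adjoin_consts_least)
    note fr = fractions_subfield[OF Pring, folded Q_def]
    show "subring_set Q" "\<And>x. x \<in> Q \<Longrightarrow> inverse x \<in> Q" by (rule fr(1), erule fr(2))
    have "const_func c \<in> P" for c using PI[of "[:c:]" 0] by (simp add: cf.mps)
    moreover have "f \<in> P" using PI[of "[:0, 1:]" 0] by (simp add: cf.mps cf.h_0 cf.h_1)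
    moreover have "g \<in> P" using PI[of 0 1] by (simp add: cf.h_1)
    ultimately show "range const_func \<subseteq> Q" "{f, g} \<subseteq> Q" using fr(3) by auto
  qed
  have ind: "\<forall>i<n. k i = 0" if k: "\<And>i. i < n \<Longrightarrow> k i \<in> M" and 0: "(\<Sum>i<n. k i * x_func ^ i) = 0" for k
  proof -
    have "\<And>i. i < n \<Longrightarrow> k i \<in> Q" using k \<open>M \<subseteq> Q\<close> by auto
    then obtain w where w: "w \<in> P" "w \<noteq> 0" "\<forall>i<n. w * k i \<in> P"
      using common_denominator[OF Pring, of n k] unfolding Q_def by blast
    then have "\<forall>i. \<exists>C E. i < n \<longrightarrow> w * k i = poly (lift C) f + poly (lift E) f * g" unfolding P_def by blast
    then obtain C E where CE: "\<And>i. i < n \<Longrightarrow> w * k i = poly (lift (C i)) f + poly (lift (E i)) f * g" by metis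
    define a b where "a = (\<Sum>i<n. poly (lift (C i)) f * x_func ^ i)" and "b = (\<Sum>i<n. poly (lift (E i)) f * x_func ^ i)"
    have "0 = (\<Sum>i<n. w * k i * x_func ^ i)" using 0 by (simp add: mult.assoc flip: sum_distrib_left)
    also have "\<dots> = (\<Sum>i<n. poly (lift (C i)) f * x_func ^ i + (poly (lift (E i)) f * x_func ^ i) * g)"
      by (intro sum.cong refl) (simp add: CE algebra_simps)
    also have "\<dots> = a + b * g" unfolding a_def b_def by (simp add: sum.distrib sum_distrib_right)
    finally have ab: "a + b * g = 0" by simp
    have pR: "poly (lift p) f \<in> RF" for p by (rule RF.poly_in) (simp_all add: coeffs_in_def cf.coeff_mp RF_const fR)
    have abR: "a \<in> RF" "b \<in> RF" unfolding a_def b_def by (intro RF.sum_in RF.mult_in RF.power_in RF_x pR)+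
    have r: "a + b * (ev A / ev H) \<in> RF" "b * (ev B / ev H) \<in> RF"
      by (intro RF.add_in RF.mult_in abR RF_quot)+
    have "(a + b * (ev A / ev H)) + (b * (ev B / ev H)) * y = a + b * g" unfolding g by (simp add: add_divide_distrib algebra_simps)
    then have "a + b * (ev A / ev H) = 0 \<and> b * (ev B / ev H) = 0"
      using ab by (intro unique0 r) (simp only:)
    then have "b = 0" "a = 0" using enz by auto
    then have "(\<forall>i<n. C i = 0) \<and> (\<forall>i<n. E i = 0)"
      using powers_of_x_independent[OF cop _ nz(3) f] deg unfolding a_def b_def n_def by blast
    then show ?thesis using CE w(2) by fastforce
  qed
  have "ring.dimension rta n M {\<Sum>i<n. k i * x_func ^ i | k. \<forall>i<n. k i \<in> M}"
    by (rule rta_dimension[OF Msub]) (rule ind)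
  then have "ring.dimension rta n M FF" unfolding span .
  moreover have "ring.dimension rta l M FF" using dim by (simp add: M_def adjoin_generic)
  ultimately show ?thesis using rta_dimension_unique[OF Msub] by (simp add: n_def)
qed

end

lemma rational_isogeny_data:
  assumes "has_rational_isogeny (E :: 'a::field weierstrass) l"
  obtains E' N D A B H u v t where "isogeny_data E E' N D A B H" "degree N = l" "u * A + v * B + t * H = 1"
proof -
  obtain E' y f g where i: "isogeny E E' y f g"
    and dim: "ring.dimension rta l (adjoin_consts {f, g}) (adjoin_consts {x_func, y})"
    using assms unfolding has_rational_isogeny_def by blast
  have on: "on_curve W (a, b, 1) \<longleftrightarrow> on_affine W a b" for W :: "'a func weierstrass" and a b
    by (simp add: on_curve_def on_affine_def poly_psi poly_cubic algebra_simps)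
  have E: "discriminant E \<noteq> 0" "discriminant E' \<noteq> 0" and y: "on_affine (map_weierstrass const_func E) x_func y"
    and fg: "f \<in> adjoin_consts {x_func, y}" "g \<in> adjoin_consts {x_func, y}"
    and on': "on_affine (map_weierstrass const_func E') f g"
    and nc: "\<not> (f \<in> range const_func \<and> g \<in> range const_func)"
    using i unfolding isogeny_def elliptic_curve_def generic_y_def on by blast+
  obtain q where rv: "regular_value y f g (0, 1, 0) (0, q, 0)" using i unfolding isogeny_def by blast
  interpret func_curve E y by unfold_locales (rule y)
  have fgF: "f \<in> FF" "g \<in> FF" using fg by (simp_all add: adjoin_generic)
  obtain d F0 F1 F2 where F: "form_value const_func d F2 (x_func, y, 1) \<noteq> 0"
      "form_value const_func d F0 (x_func, y, 1) = form_value const_func d F2 (x_func, y, 1) * f"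
      "form_value const_func d F1 (x_func, y, 1) = form_value const_func d F2 (x_func, y, 1) * g"
    and Q: "(0, q, 0) = (to_ac (F0 0 d), to_ac (F1 0 d), to_ac (F2 0 d))"
    using rv unfolding regular_value_def form_value_origin by (elim exE conjE) (rule that)
  have "q \<noteq> 0" using rv unfolding regular_value_def by auto
  then have c: "F0 0 d = 0" "F1 0 d \<noteq> 0" "F2 0 d = 0" using Q by auto
  obtain V :: "'a func set" where V: "valuation_ring_set V" "range const_func \<subseteq> V"
    "inverse x_func \<in> valuation_ring_set.mx V" by (rule place_at_infinity)
  note p = poles[OF F c fgF V]
  have fR: "f \<in> RF" by (rule first_coordinate_even[OF E fgF on' V(1,2) p])
  interpret V: valuation_ring_set V by fact
  have cV: "const_func c \<in> V" for c using V(2) by auto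
  \<comment> \<open>Any integral \<open>c\<close> with \<open>f - c\<close> nonzero will do for the
    slope lemma; the case distinction avoids a division by zero.\<close>
  define c where "c = (if f = 0 then 1 else 0 :: 'a func)"
  have c: "c \<in> V" "g / (f - c) * (f - c) = g - 0" using V.closed by (auto simp: c_def)
  have "f \<notin> V"
    by (rule V.pole_slope(1)[OF _ _ _ _ _ on' _ _ _ c(1) V.zero_in c(2)])
      (use p(1) in \<open>simp_all add: cf.map_weierstrass_sel cV\<close>)
  then obtain N D A B H u v t where *: "isogeny_data E E' N D A B H" "f = ev N / ev D" "g = (ev A + ev B * y) / ev H"
    "u * A + v * B + t * H = 1"
    by (rule isogeny_data_exists[OF E fR fgF(2) on' nc V])
  have "degree N = l" by (rule isogeny_degree[OF *(1,2,3) on' dim])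
  then show ?thesis using that * by blast
qed

section \<open>Discrete valuations\<close>

lemma discrete_valuation_simps:
  assumes "discrete_valuation F w"
  shows "subring_set F" "x \<in> F \<Longrightarrow> inverse x \<in> F" "x \<in> F \<Longrightarrow> y \<in> F \<Longrightarrow> x \<noteq> 0 \<Longrightarrow> y \<noteq> 0 \<Longrightarrow> w (x * y) = w x + w y"
    "w 1 = 0" "x \<in> F \<Longrightarrow> x \<noteq> 0 \<Longrightarrow> w (inverse x) = - w x" "x \<in> F \<Longrightarrow> x \<noteq> 0 \<Longrightarrow> w (x ^ n) = int n * w x"
    "x \<in> F \<Longrightarrow> x \<noteq> 0 \<Longrightarrow> w (- x) = w x"
proof -
  have sf: "subfield F rta" using assms by (simp add: discrete_valuation_def)
  show "subring_set F" and inv: "\<And>x. x \<in> F \<Longrightarrow> inverse x \<in> F" using subfield_rta[OF sf] by blast+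
  interpret subring_set F by fact
  show m: "w (x * y) = w x + w y" if "x \<in> F" "y \<in> F" "x \<noteq> 0" "y \<noteq> 0" for x y
    using assms that by (simp add: discrete_valuation_def)
  show 1: "w 1 = 0" using m[of 1 1] one_in by simp
  show "w (inverse x) = - w x" if "x \<in> F" "x \<noteq> 0" using m[of x "inverse x"] that inv 1 by simp
  show "w (x ^ n) = int n * w x" if "x \<in> F" "x \<noteq> 0"
    by (induction n) (use that in \<open>auto simp: 1 m power_in algebra_simps\<close>)
  have "w (- 1) + w (- 1) = 0" using m[of "- 1" "- 1"] one_in uminus_in 1 by simp
  then show "w (- x) = w x" if "x \<in> F" "x \<noteq> 0" using m[of "- 1" x] that one_in uminus_in by simp
qed

lemma discrete_valuation_ideal:
  assumes "discrete_valuation F w"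
  shows "ideal_set (valuation_ring F w) (valuation_ideal F w)" "1 \<notin> valuation_ideal F w"
proof -
  note dv = discrete_valuation_simps[OF assms]
  interpret subring_set F by (rule dv)
  have ult: "min (w x) (w y) \<le> w (x + y)" if "x \<in> F" "y \<in> F" "x \<noteq> 0" "y \<noteq> 0" "x + y \<noteq> 0" for x y
    using assms that by (simp add: discrete_valuation_def)
  show "1 \<notin> valuation_ideal F w" by (simp add: valuation_ideal_def dv)
  have add: "x + y \<in> S" if "x \<in> S" "y \<in> S" "S = valuation_ring F w \<or> S = valuation_ideal F w" for x y S
    using that ult[of x y]
    by (cases "x = 0 \<or> y = 0 \<or> x + y = 0") (auto simp: valuation_ring_def valuation_ideal_def min_le_iff_disj zero_in intro: add_in)
  show "ideal_set (valuation_ring F w) (valuation_ideal F w)"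
  proof
    show "1 \<in> valuation_ring F w" by (simp add: valuation_ring_def dv one_in)
    show "0 \<in> valuation_ideal F w" by (simp add: valuation_ideal_def zero_in)
    show "valuation_ideal F w \<subseteq> valuation_ring F w" by (auto simp: valuation_ring_def valuation_ideal_def)
  next
    fix x y assume xy: "x \<in> valuation_ring F w" "y \<in> valuation_ring F w"
    have "- y \<in> valuation_ring F w" using xy dv(7)[of y] by (cases "y = 0") (auto simp: valuation_ring_def uminus_in)
    from add[OF xy(1) this] show "x - y \<in> valuation_ring F w" by simp
    show "x * y \<in> valuation_ring F w" using xy dv(3)[of x y]
      by (cases "x = 0 \<or> y = 0") (auto simp: valuation_ring_def mult_in zero_in)
  next
    fix x y assume "x \<in> valuation_ideal F w" "y \<in> valuation_ideal F w"
    then show "x + y \<in> valuation_ideal F w" using add by blast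
  next
    fix x y assume "x \<in> valuation_ring F w" "y \<in> valuation_ideal F w"
    then show "x * y \<in> valuation_ideal F w"
      using dv(3)[of x y]
      by (cases "x = 0 \<or> y = 0") (auto simp: valuation_ring_def valuation_ideal_def mult_in zero_in)
  qed
qed

text \<open>No comparison of value groups is needed: a nonzero valuation would put \<open>x\<close>
  or its inverse into the maximal ideal.\<close>

lemma discrete_valuation_unit:
  assumes w: "discrete_valuation F w" and V: "valuation_ring_set V" "valuation_ideal F w \<subseteq> valuation_ring_set.mx V"
    and x: "x \<in> F" "x \<noteq> 0" "x \<in> V" "x \<notin> valuation_ring_set.mx V"
  shows "w x = 0"
proof (rule ccontr)
  interpret V: valuation_ring_set V by fact
  note dv = discrete_valuation_simps[OF w]
  have u: "inverse x \<in> V" using V.unit_iff[OF x(3)] x(4) by simp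
  assume "w x \<noteq> 0"
  then consider "w x > 0" | "w (inverse x) > 0" using dv(5)[OF x(1,2)] by linarith
  then have "x \<in> V.mx \<or> inverse x \<in> V.mx"
    using V(2) x(1) dv(2)[OF x(1)] by cases (auto simp: valuation_ideal_def)
  then show False using x V.mx_mult[of x "inverse x"] V.mx_one by auto
qed

text \<open>The multiples of 1 in the quotient are the cosets of \<open>of_nat n\<close>; this turns
  the residue characteristic into a statement inside the field.\<close>

lemma residue_field_of_nat:
  assumes v: "discrete_valuation F v" and R: "R = valuation_ring F v"
  shows "add_pow (residue_field R v) n \<one>\<^bsub>residue_field R v\<^esub> = \<zero>\<^bsub>residue_field R v\<^esub> \<longleftrightarrow> of_nat n \<in> valuation_ideal F v"
proof -
  interpret I: ideal_set R "valuation_ideal F v" unfolding R by (rule discrete_valuation_ideal[OF v])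
  define J where "J = valuation_ideal R v"
  have J: "J = valuation_ideal F v" unfolding J_def R by (auto simp: valuation_ideal_def valuation_ring_def)
  note Ia = I.I_add[folded J] and Id = I.I_diff[folded J] and I0 = I.I_zero[folded J]
  have co: "J +>\<^bsub>rta\<lparr>carrier := R\<rparr>\<^esub> x = {a + x | a. a \<in> J}" for x
    by (auto simp: a_r_coset_def' rta_simps)
  have "add_pow (residue_field R v) m \<one>\<^bsub>residue_field R v\<^esub> = {a + of_nat m | a. a \<in> J}" for m
  proof (induction m)
    case 0
    then show ?case by (simp add: add_pow_def nat_pow_def residue_field_def FactRing_def J_def)
  next
    case (Suc m)
    have "add_pow (residue_field R v) (Suc m) \<one>\<^bsub>residue_field R v\<^esub> =
       {a + b | a b. a \<in> {a + of_nat m | a. a \<in> J} \<and> b \<in> {a + 1 | a. a \<in> J}}"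
      using Suc unfolding add_pow_def nat_pow_def
      by (simp add: residue_field_def FactRing_def set_add_def' co[unfolded J_def] rta_simps J_def) blast
    also have "\<dots> = {a + of_nat (Suc m) | a. a \<in> J}"
    proof (intro equalityI subsetI; elim CollectE exE conjE)
      fix x a b a' b' assume "x = a + b" "a = a' + of_nat m" "a' \<in> J" "b = b' + 1" "b' \<in> J"
      then show "x \<in> {a + of_nat (Suc m) | a. a \<in> J}" using Ia by (auto intro!: exI[of _ "a' + b'"])
    next
      fix x a assume "x = a + of_nat (Suc m)" "a \<in> J"
      then have "x = (a + of_nat m) + (0 + 1)" by simp
      then show "x \<in> {a + b | a b. a \<in> {a + of_nat m | a. a \<in> J} \<and> b \<in> {a + 1 | a. a \<in> J}}"
        using \<open>a \<in> J\<close> I0 by blast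
    qed
    finally show ?case .
  qed
  moreover have "{a + of_nat n | a. a \<in> J} = J \<longleftrightarrow> of_nat n \<in> J"
  proof
    assume "{a + of_nat n | a. a \<in> J} = J"
    moreover have "0 + of_nat n \<in> {a + of_nat n | a. a \<in> J}" using I0 by blast
    ultimately show "of_nat n \<in> J" by simp
  next
    assume n: "of_nat n \<in> J"
    show "{a + of_nat n | a. a \<in> J} = J"
    proof (intro equalityI subsetI)
      fix x assume "x \<in> J"
      then have "x - of_nat n \<in> J" using n Id by simp
      then show "x \<in> {a + of_nat n | a. a \<in> J}" by (intro CollectI exI[of _ "x - of_nat n"]) simp
    qed (use n Ia in auto)
  qed
  moreover have "\<zero>\<^bsub>residue_field R v\<^esub> = J" by (simp add: residue_field_def FactRing_def J_def)
  ultimately show ?thesis by (simp add: J)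
qed

section \<open>The divisibility\<close>

lemma rootprod_unit:
  fixes p R :: "'f::alg_closed_field poly"
  assumes "valuation_ring_set V" "p \<noteq> 0"
    and root: "\<And>z. poly p z = 0 \<Longrightarrow> \<exists>e. poly R z = c * e \<and> e \<in> V \<and> e \<notin> valuation_ring_set.mx V"
  shows "\<exists>e. rootprod p R = c ^ degree p * e \<and> e \<in> V \<and> e \<notin> valuation_ring_set.mx V"
proof -
  interpret V: valuation_ring_set V by fact
  have "\<exists>e. (\<Prod>z\<in>#A. poly R z) = c ^ size A * e \<and> e \<in> V \<and> e \<notin> V.mx" if "\<And>z. z \<in># A \<Longrightarrow> poly p z = 0" for A
    using that
  proof (induction A)
    case empty
    then show ?case using V.one_in V.mx_one by (intro exI[of _ 1]) simp
  next
    case (add z A)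
    obtain e where e: "(\<Prod>z\<in>#A. poly R z) = c ^ size A * e" "e \<in> V" "e \<notin> V.mx" using add by auto
    obtain e' where e': "poly R z = c * e'" "e' \<in> V" "e' \<notin> V.mx" using root[of z] add.prems by auto
    have "(\<Prod>z\<in>#add_mset z A. poly R z) = c ^ size (add_mset z A) * (e' * e)" using e e' by (simp add: mult_ac)
    then show ?case using V.mult_in[OF e'(2) e(2)] V.mx_prime[OF e'(2) e(2)] e'(3) e(3) by blast
  qed
  from this[of "proots p"] show ?thesis
    using proots_split(2)[OF assms(2)] assms(2) unfolding rootprod_def by simp
qed

lemma twelve_dvd_discriminant:
  fixes E :: "'a::field weierstrass"
  assumes v: "discrete_valuation UNIV v" and E: "discriminant E \<noteq> 0" and pg: "potentially_good_reduction v E"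
    and iso: "has_rational_isogeny E l" and l: "Factorial_Ring.prime l" "l > 3" and lv: "of_nat l \<noteq> (0 :: 'a)" "v (of_nat l) = 0"
  shows "12 dvd (int l - 1) * v (discriminant E)"
proof -
  obtain E' N D A B H a b c where data: "isogeny_data E E' N D A B H" and N: "degree N = l" and cop: "a * A + b * B + c * H = 1"
    by (rule rational_isogeny_data[OF iso])
  obtain L :: "'a alg_closure set" and w e where L: "range to_ac \<subseteq> L" and w: "discrete_valuation L w" and e: "0 < e"
    and we: "\<And>x. x \<noteq> 0 \<Longrightarrow> w (to_ac x) = e * v x" and good: "good_reduction L w (map_weierstrass to_ac E)"
    using pg unfolding potentially_good_reduction_def by blast
  obtain W where iso_W: "isomorphic_over L (map_weierstrass to_ac E) W" and WL: "set_weierstrass W \<subseteq> valuation_ring L w"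
    and dW: "discriminant W \<notin> valuation_ideal L w"
    using good unfolding good_reduction_def minimal_equation_def integral_equation_def by blast
  define m where "m = (map_poly to_ac :: 'a poly \<Rightarrow> 'a alg_closure poly)"
  define mE where "mE = map_weierstrass to_ac E"
  obtain u r s t where u: "u \<in> L" and ch: "weierstrass_change u r s t mE W"
    using iso_W unfolding isomorphic_over_def mE_def by blast
  have u0: "u \<noteq> 0" using ch by (simp add: weierstrass_change_def)
  note dv = discrete_valuation_simps[OF w]
  interpret L: subring_set L by (rule dv)
  have AI: "ideal_set (valuation_ring L w) (valuation_ideal L w)" "1 \<notin> valuation_ideal L w"
    by (rule discrete_valuation_ideal[OF w])+
  interpret O: ideal_set "valuation_ring L w" "valuation_ideal L w" by (rule AI)
  \<comment> \<open>A valuation ring of the whole algebraic closure above that of \<open>w\<close>,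
    because the abscissae of the kernel need not lie in \<open>L\<close>.\<close>
  obtain V where V: "valuation_ring_set V" "valuation_ring L w \<subseteq> V" "valuation_ideal L w \<subseteq> valuation_ring_set.mx V"
    by (rule chevalley[OF AI])
  interpret V: valuation_ring_set V by fact
  have unit0: "w x = 0" if "x \<in> L" "x \<in> V" "x \<notin> V.mx" for x
    using discrete_valuation_unit[OF w V(1,3) that(1) _ that(2,3)] that(3) V.mx.I_zero by blast
  have unit: "x \<in> V \<and> x \<notin> V.mx" if x: "x \<in> L" "x \<noteq> 0" "w x = 0" for x
  proof -
    have "x \<in> valuation_ring L w" "inverse x \<in> valuation_ring L w"
      using x dv(2)[OF x(1)] dv(5)[OF x(1,2)] by (simp_all add: valuation_ring_def)
    then show ?thesis using V(2) V.unit_iff[of x] x(2) by blast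
  qed
  have Wa: "a1 W \<in> valuation_ring L w" "a2 W \<in> valuation_ring L w" "a3 W \<in> valuation_ring L w" "a4 W \<in> valuation_ring L w" "a6 W \<in> valuation_ring L w"
    using WL by (cases W; simp)+
  then have WV: "a1 W \<in> V" "a2 W \<in> V" "a3 W \<in> V" "a4 W \<in> V" "a6 W \<in> V" using V(2) by auto
  have "discriminant W \<in> valuation_ring L w"
    unfolding discriminant_b b2_def b4_def b6_def b8_def by (intro O.closed Wa)
  then have dW': "discriminant W \<in> L" "discriminant W \<noteq> 0" "w (discriminant W) = 0"
    using dW by (auto simp: valuation_ring_def valuation_ideal_def)
  have disc: "discriminant W \<notin> V.mx" using unit[OF dW'] by blast
  have lmx: "of_nat l \<notin> V.mx"
  proof -
    have "w (of_nat l) = 0" using we[OF lv(1)] lv(2) by (simp add: ac.h_of_nat)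
    moreover have "(of_nat l :: 'a alg_closure) \<noteq> 0" using lv(1) ac.h_eq_0[of "of_nat l :: 'a"] by (simp add: ac.h_of_nat)
    ultimately show ?thesis using unit[OF L.of_nat_in] by blast
  qed
  have data1: "isogeny_data mE (map_weierstrass to_ac E') (m N) (m D) (m A) (m B) (m H)"
    unfolding m_def mE_def by (rule ac.isogeny_data_map[OF data])
  define f where "f = (\<lambda>p :: 'a alg_closure poly. pcompose p [:r, u^2:])"
  have data2: "isogeny_data W (map_weierstrass to_ac E') (f (m N)) (f (m D)) (f (m A) + f (m B) * [:t, u^2 * s:]) (smult (u^3) (f (m B))) (f (m H))"
    unfolding f_def by (rule isogeny_data_change[OF data1 ch])
  have mN: "degree (m N) = l" "degree (f (m N)) = l"
    using u0 N by (simp_all add: f_def m_def ac.mp_degree degree_pcompose)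
  have roots: "\<exists>x. z = u^2 * x + r \<and> x \<in> V \<and> poly (div2 W) x \<notin> V.mx \<and> poly (div3 W) x \<notin> V.mx"
    if z: "poly (m D) z = 0" for z
  proof -
    define x where "x = (z - r) / u^2"
    have zx: "z = u^2 * x + r" using u0 by (simp add: x_def)
    have fx: "poly (f (m D)) x = 0" using z by (simp add: f_def poly_pcompose zx add.commute mult.commute)
    show ?thesis using kernel_units[OF V(1) WV disc data2 _ _ _ fx] l lmx zx unfolding mN by blast
  qed
  have dV: "poly (div2 W) x \<in> V" "poly (div3 W) x \<in> V" if "x \<in> V" for x
    unfolding poly_div2 poly_div3 b2_def b4_def b6_def b8_def by (intro V.closed WV that)+
  \<comment> \<open>There is no kernel point of order 2, since \<open>div2\<close> takes unit values
    up to powers of \<open>u\<close>.\<close>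
  have ram: "poly (div2 mE) z \<noteq> 0" if z: "poly (m D) z = 0" for z
  proof -
    obtain x where x: "z = u^2 * x + r" "poly (div2 W) x \<notin> V.mx" using roots[OF z] by blast
    then have "poly (div2 W) x \<noteq> 0" using V.mx.I_zero by auto
    then show ?thesis unfolding x(1) change_div2[OF ch] using u0 by simp
  qed
  have cop1: "m a * m A + m b * m B + m c * m H = 1"
    using arg_cong[OF cop, of m] by (simp add: m_def ac.mps)
  have cop2: "\<exists>a b c. a * m A + b * m B + c * m H = 1" using cop1 by blast
  have oddl: "odd (degree (m N))" "degree (m N) > 1" using prime_odd_nat[OF l(1)] l(2) by (simp_all add: mN)
  have l0: "of_nat (degree (m N)) \<noteq> (0 :: 'a alg_closure)" using lmx V.mx.I_zero unfolding mN by auto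
  note den = isogeny_denominators[OF data1 cop2 ram oddl l0, unfolded mN(1)]
  have nz: "m D \<noteq> 0" "m H \<noteq> 0" using data1 by (auto simp: isogeny_data_def)
  interpret K: subring_set "range (to_ac :: 'a \<Rightarrow> 'a alg_closure)"
    by unfold_locales (auto simp flip: to_ac_diff to_ac_mult to_ac_1)
  interpret K: subfield_hom "range (to_ac :: 'a \<Rightarrow> 'a alg_closure)" id
    by unfold_locales (auto simp flip: to_ac_inverse)
  have mK: "coeffs_in (range to_ac) (m p)" for p by (simp add: coeffs_in_def m_def ac.coeff_mp)
  \<comment> \<open>If an element of \<open>K\<close> is \<open>u ^ k\<close> times a unit of
    \<open>V\<close>, this unit lies in \<open>L\<close> and has \<open>w\<close>-value 0, so
    \<open>v\<close> is determined by \<open>w u\<close>.\<close>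
  have val: "e * v d = int k * w u + int 0 \<and> d \<noteq> 0" if "to_ac d = u ^ k * q" "q \<in> V" "q \<notin> V.mx" for d k q
  proof -
    have q0: "q \<noteq> 0" using that(3) V.mx.I_zero by auto
    have "q = to_ac d * inverse (u ^ k)" using that(1) u0 by simp
    also have "\<dots> \<in> L" using L u by (intro L.mult_in dv(2) L.power_in) auto
    finally have qL: "q \<in> L" .
    have "to_ac d \<noteq> 0" using that(1) q0 u0 by simp
    then have d0: "d \<noteq> 0" by auto
    have "e * v d = w (u ^ k * q)" using we[OF d0] that(1) by simp
    also have "\<dots> = w (u ^ k) + w q" using u u0 qL q0 by (intro dv(3)) (auto intro: L.power_in)
    also have "\<dots> = int k * w u" using dv(6)[OF u u0] unit0[OF qL that(2,3)] by simp
    finally show ?thesis using d0 by simp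
  qed
  have d1: "e * v (discriminant E) = 12 * w u"
    using val[of "discriminant E" 12 "discriminant W"] change_discriminant[OF ch] unit[OF dW'] by (simp add: mE_def ac.mp_discriminant)
  have e3: "\<exists>q. poly (div3 mE) z = u ^ 8 * q \<and> q \<in> V \<and> q \<notin> V.mx" if "poly (m D) z = 0" for z
    using roots[OF that] dV(2) change_div3[OF ch] by blast
  have e2: "\<exists>q. poly (div2 mE) z = u ^ 6 * q \<and> q \<in> V \<and> q \<notin> V.mx" if "poly (m H) z = 0" for z
    using roots[of z] den(3) that dV(1) change_div2[OF ch] by blast
  obtain q3 where q3: "rootprod (m D) (div3 mE) = (u ^ 8) ^ (l - 1) * q3" "q3 \<in> V" "q3 \<notin> V.mx"
    using rootprod_unit[OF V(1) nz(1) e3] den(1) by auto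
  obtain q2 where q2: "rootprod (m H) (div2 mE) = (u ^ 6) ^ degree (m H) * q2" "q2 \<in> V" "q2 \<notin> V.mx"
    using rootprod_unit[OF V(1) nz(2) e2] by auto
  \<comment> \<open>With the identity as homomorphism, \<open>rootprod_hom\<close> brings the
    product from the algebraic closure down to the base field.\<close>
  obtain r3 where r3: "to_ac r3 = rootprod (m D) (div3 mE)"
    using K.rootprod_hom[OF nz(1) mK, of "div3 mE"] mK[of "div3 E"] unfolding mE_def ac.mp_div3 m_def by (metis imageE)
  obtain r2 where r2: "to_ac r2 = rootprod (m H) (div2 mE)"
    using K.rootprod_hom[OF nz(2) mK, of "div2 mE"] mK[of "div2 E"] unfolding mE_def ac.mp_div2 m_def by (metis imageE)
  have v3: "e * v r3 = int (8 * (l - 1)) * w u"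
    using val[of r3 "8 * (l - 1)" q3] q3 r3 by (simp add: power_mult)
  have v2: "e * v r2 = int (6 * degree (m H)) * w u"
    using val[of r2 "6 * degree (m H)" q2] q2 r2 by (simp add: power_mult)
  define x where "x = (int l - 1) * v (discriminant E)"
  have l1: "int (l - 1) = int l - 1" using l(2) by simp
  have "e * (3 * v r3) = 2 * (int l - 1) * (12 * w u)" using v3 l1 by simp
  also have "\<dots> = e * (2 * x)" unfolding d1[symmetric] x_def by simp
  finally have 3: "3 * v r3 = 2 * x" using e by simp
  have "2 * int (degree (m H)) = 3 * int (l - 1)"
    using arg_cong[OF den(2), of int] by (simp only: of_nat_mult of_nat_numeral)
  then have dH: "int (degree (m H)) * 2 = 3 * (int l - 1)" unfolding l1 by simp
  have "e * (4 * v r2) = (int (degree (m H)) * 2) * (12 * w u)" using v2 by simp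
  also have "\<dots> = e * (3 * x)" unfolding dH d1[symmetric] x_def by simp
  finally have 4: "4 * v r2 = 3 * x" using e by simp
  \<comment> \<open>The equation from \<open>div3\<close> gives divisibility by 3, the one from
    \<open>div2\<close> divisibility by 4.\<close>
  show ?thesis unfolding x_def[symmetric] using 3 4 by presburger
qed

theorem theorem2p3:
  fixes R :: "'a::field set" and v :: "'a \<Rightarrow> int"
    and E Emin :: "'a weierstrass" and p l :: nat
  assumes "is_dvr UNIV R v"
    and "is_complete R v"
    and "perfect_field (residue_field R v)"
    and "has_characteristic (residue_field R v) p"
    and "p > 0"
    and "elliptic_curve E"
    and "potentially_good_reduction v E"
    and "Factorial_Ring.prime l" and "l > 3" and "l \<noteq> p"
    and "has_rational_isogeny E l"
    and "minimal_equation UNIV v E Emin"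
  shows "12 dvd (int l - 1) * v (discriminant Emin)"
proof -
  have v: "discrete_valuation UNIV v" and R: "R = valuation_ring UNIV v" using assms(1) by (simp_all add: is_dvr_def)
  note dv = discrete_valuation_simps[OF v]
  have char: "of_nat n \<in> valuation_ideal UNIV v \<longleftrightarrow> p dvd n" for n
    using residue_field_of_nat[OF v R, of n] assms(4) by (simp add: has_characteristic_def)
  have "p \<noteq> 1" using char[of 1] discrete_valuation_ideal(2)[OF v] by auto
  then have "\<not> p dvd l" using assms(8,10) prime_nat_iff by blast
  then have nI: "of_nat l \<notin> valuation_ideal UNIV v" by (simp add: char)
  interpret I: ideal_set "valuation_ring UNIV v" "valuation_ideal UNIV v" by (rule discrete_valuation_ideal(1)[OF v])
  have l0: "of_nat l \<noteq> (0 :: 'a)" "v (of_nat l) = 0"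
    using nI I.of_nat_in[of l] by (auto simp: valuation_ring_def valuation_ideal_def)
  obtain u r s t where ch: "weierstrass_change u r s t E Emin"
    using assms(12) unfolding minimal_equation_def integral_equation_def isomorphic_over_def by blast
  have u: "u \<noteq> 0" using ch by (simp add: weierstrass_change_def)
  have E: "discriminant E \<noteq> 0" using assms(6) by (simp add: elliptic_curve_def)
  \<comment> \<open>The two discriminants differ by a twelfth power, so divisibility by 12 passes
    from \<open>E\<close> to the minimal equation.\<close>
  have d: "u ^ 12 * discriminant Emin = discriminant E" by (rule change_discriminant[OF ch])
  then have m: "discriminant Emin \<noteq> 0" using E by auto
  have "v (discriminant E) = v (u ^ 12) + v (discriminant Emin)"
    unfolding d[symmetric] using u m by (intro dv(3)) auto
  then have "v (discriminant E) = 12 * v u + v (discriminant Emin)" using dv(6)[of u 12] u by simp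
  moreover have "12 dvd (int l - 1) * v (discriminant E)"
    by (rule twelve_dvd_discriminant[OF v E assms(7,11,8,9) l0])
  ultimately have "12 dvd 12 * ((int l - 1) * v u) + (int l - 1) * v (discriminant Emin)"
    by (simp add: algebra_simps)
  then show ?thesis by (simp only: dvd_add_times_triv_left_iff dvd_add_right_iff[OF dvd_triv_left])
qed


end
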